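(* Let $s\in(\tfrac12,1)$ and $\alpha,\sigma\in(0,s)$. Let $\Omega\subset\mathbb R^n$ be a bounded $C^{1,\alpha}$ domain, let $K$ be an elliptic kernel with constants $\lambda,\Lambda$, and let $L$ be the operator with kernel $K$. Assume that $K$ is $\sigma$-Hölder on some set $\mathcal A\Supset\Omega$. Let $G$ be the Green function associated with $L$ and $\Omega$. Then $$|\nabla_xG(x,y)|\le c\,\max\{|x-y|^{-1},d_\Omega(x)^{-1}\}\,G(x,y)\qquad\text{for all }x,y\in\Omega,\ x\ne y,$$ where $c>0$ depends only on $n,s,\lambda,\Lambda,\alpha,\sigma$ and $\Omega$.
   Context: Standing assumptions: $n>2s$, $\Lambda\ge\lambda>0$. $B_r(x)$ is the ball of radius $r$ centred at $x$, $B_r=B_r(0)$, $d_\Omega(x)=\operatorname{dist}(x,\mathbb R^n\setminus\Omega)$. Elliptic kernel with constants $\lambda,\Lambda$: a measurable $K:\mathbb R^n\times\mathbb R^n\to[0,\infty]$ with $\lambda|x-y|^{-n-2s}\le K(x,y)=K(y,x)\le\Lambda|x-y|^{-n-2s}$ for all $x,y$. The operator with kernel $K$ is $Lu(x)=2\,\mathrm{p.v.}\int_{\mathbb R^n}(u(x)-u(y))K(x,y)\,dy$, understood weakly as below. $K$ is $\sigma$-Hölder on a set $\mathcal A\subset\mathbb R^n$ if $|K(x+h,y+h)-K(x,y)|\le\Lambda|h|^\sigma|x-y|^{-n-2s}$ for all $x,y\in\mathcal A$ and $h\in B_1$. Weak solutions: $\mathcal E^K(u,\varphi)=\int_{\mathbb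 R^n}\int_{\mathbb R^n}(u(x)-u(y))(\varphi(x)-\varphi(y))K(x,y)\,dy\,dx$. $H^s_\Omega(\mathbb R^n)=\{u\in H^s(\mathbb R^n):u=0\text{ in }\mathbb R^n\setminus\Omega\}$. A function $\varphi$ is the weak solution to $L\varphi=\psi$ in $\Omega$, $\varphi=0$ in $\mathbb R^n\setminus\Omega$ (with $\psi\in L^\infty(\Omega)$), if $\varphi\in H^s_\Omega(\mathbb R^n)$ and $\mathcal E^K(\varphi,\eta)=\int_\Omega\psi\eta\,dx$ for all $\eta\in H^s_\Omega(\mathbb R^n)$. Green function: a measurable $G:\mathbb R^n\times\mathbb R^n\to[0,\infty]$ is a Green function associated with $\Omega$ and $L$ if $G(\cdot,y)\in L^1(\Omega)$ for each $y\in\Omega$, $G=0$ a.e. on $(\mathbb R^n\times\mathbb R^n)\setminus(\Omega\times\Omega)$, and $\int_{\mathbb R^n}G(x,y)\psi(x)\,dx=\varphi(y)$ for every $y\in\Omega$ and every $\psi\in L^\infty(\Omega)$, where $\varphi$ is the (continuous representative of the) weak solution to $L\varphi=\psi$ in $\Omega$, $\varphi=0$ in $\mathbb R^n\setminus\Omega$. The Green function exists, is unique, and is symmetric; pointwise statements refer to its representative that is continuous in $\Omega\times\Omega$ off the diagonal. *)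

theory Defs
  imports "HOL-Analysis.Analysis"
begin

(* |x - y|^(-n-2s) with values in [0,\<infinity>]: inverse (0::ennreal) = \<infinity>, so the value at x = y is \<infinity>. *)
definition riesz :: "real \<Rightarrow> real^'n \<Rightarrow> real^'n \<Rightarrow> ennreal" where
  "riesz s x y = inverse (ennreal (norm (x - y) powr (real CARD('n) + 2 * s)))"

definition elliptic_kernel ::
    "real \<Rightarrow> real \<Rightarrow> real \<Rightarrow> (real^'n \<Rightarrow> real^'n \<Rightarrow> ennreal) \<Rightarrow> bool" where
  "elliptic_kernel s lam Lam K \<longleftrightarrow>
     (\<lambda>(x, y). K x y) \<in> borel_measurable lebesgue \<and>
     (\<forall>x y. ennreal lam * riesz s x y \<le> K x y \<and> K x y = K y x
          \<and> K x y \<le> ennreal Lam * riesz s x y)"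

(* The point x + h need not lie in A.  An elliptic kernel is finite off the diagonal, so enn2real
   loses nothing; on the diagonal the difference is \<infinity> - \<infinity> and carries no condition. *)
definition kernel_holder_on ::
    "real \<Rightarrow> real \<Rightarrow> real \<Rightarrow> (real^'n \<Rightarrow> real^'n \<Rightarrow> ennreal) \<Rightarrow> (real^'n) set \<Rightarrow> bool" where
  "kernel_holder_on s Lam \<sigma> K A \<longleftrightarrow>
     (\<forall>x\<in>A. \<forall>y\<in>A. \<forall>h\<in>ball 0 1. x \<noteq> y \<longrightarrow>
        \<bar>enn2real (K (x + h) (y + h)) - enn2real (K x y)\<bar>
          \<le> Lam * norm h powr \<sigma> * norm (x - y) powr (- real CARD('n) - 2 * s))"

definition sobolev_H :: "real \<Rightarrow> (real^'n \<Rightarrow> real) set" where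
  "sobolev_H s = {u. u \<in> borel_measurable lebesgue \<and>
     integrable lebesgue (\<lambda>x. (u x)\<^sup>2) \<and>
     integrable lebesgue
       (\<lambda>(x, y). (u x - u y)\<^sup>2 / norm (x - y) powr (real CARD('n) + 2 * s))}"

definition sobolev_H0 :: "real \<Rightarrow> (real^'n) set \<Rightarrow> (real^'n \<Rightarrow> real) set" where
  "sobolev_H0 s \<Omega> = {u \<in> sobolev_H s. AE x in lebesgue. x \<notin> \<Omega> \<longrightarrow> u x = 0}"

(* Here lebesgue is Lebesgue measure on the product space.  For an elliptic kernel and u, v in
   sobolev_H s the integrand is integrable, so this is also the iterated integral. *)
definition energy ::
    "(real^'n \<Rightarrow> real^'n \<Rightarrow> ennreal) \<Rightarrow> (real^'n \<Rightarrow> real) \<Rightarrow> (real^'n \<Rightarrow> real) \<Rightarrow> real" where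
  "energy K u v =
     integral\<^sup>L lebesgue (\<lambda>(x, y). (u x - u y) * (v x - v y) * enn2real (K x y))"

definition Linfty_on :: "(real^'n) set \<Rightarrow> (real^'n \<Rightarrow> real) set" where
  "Linfty_on \<Omega> = {\<psi>. \<psi> \<in> borel_measurable (lebesgue_on \<Omega>) \<and>
     (\<exists>M. AE x in lebesgue_on \<Omega>. \<bar>\<psi> x\<bar> \<le> M)}"

definition weak_solution ::
    "real \<Rightarrow> (real^'n \<Rightarrow> real^'n \<Rightarrow> ennreal) \<Rightarrow> (real^'n) set
      \<Rightarrow> (real^'n \<Rightarrow> real) \<Rightarrow> (real^'n \<Rightarrow> real) \<Rightarrow> bool" where
  "weak_solution s K \<Omega> \<psi> \<phi> \<longleftrightarrow>
     \<phi> \<in> sobolev_H0 s \<Omega> \<and>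
     (\<forall>\<eta>\<in>sobolev_H0 s \<Omega>. energy K \<phi> \<eta> = (LINT x:\<Omega>|lebesgue. \<psi> x * \<eta> x))"

(* In the last clause \<psi> is given on \<Omega> only and extended by zero, so the integral over the whole
   space is the one over \<Omega>.  The weak solution is unique up to null sets; requiring continuity on
   \<Omega> selects the continuous representative there, so that its value at y is determined. *)
definition green_function ::
    "real \<Rightarrow> (real^'n \<Rightarrow> real^'n \<Rightarrow> ennreal) \<Rightarrow> (real^'n) set
      \<Rightarrow> (real^'n \<Rightarrow> real^'n \<Rightarrow> ennreal) \<Rightarrow> bool" where
  "green_function s K \<Omega> G \<longleftrightarrow>
     (\<lambda>(x, y). G x y) \<in> borel_measurable lebesgue \<and>
     (\<forall>y\<in>\<Omega>. (\<lambda>x. G x y) \<in> borel_measurable (lebesgue_on \<Omega>) \<and>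
            (\<integral>\<^sup>+x. G x y \<partial>lebesgue_on \<Omega>) < \<infinity>) \<and>
     (AE (x, y) in lebesgue. (x, y) \<notin> \<Omega> \<times> \<Omega> \<longrightarrow> G x y = 0) \<and>
     (\<forall>\<psi>\<in>Linfty_on \<Omega>. \<forall>\<phi>. weak_solution s K \<Omega> \<psi> \<phi> \<longrightarrow> continuous_on \<Omega> \<phi> \<longrightarrow>
        (\<forall>y\<in>\<Omega>. (LINT x:\<Omega>|lebesgue. enn2real (G x y) * \<psi> x) = \<phi> y))"

definition C1_holder :: "real \<Rightarrow> (real^'n \<Rightarrow> real) \<Rightarrow> bool" where
  "C1_holder \<alpha> g \<longleftrightarrow>
     (\<exists>Dg C. \<forall>x y. GDERIV g x :> Dg x \<and> norm (Dg x - Dg y) \<le> C * norm (x - y) powr \<alpha>)"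

(* Near each boundary point, \<Omega> is the strict epigraph, in the direction of a unit vector e, of a
   C^{1,\<alpha>} function on the hyperplane orthogonal to e.  x - (x \<bullet> e) e is the projection of x to that
   hyperplane; g enters only through its restriction to the hyperplane, and every C^{1,\<alpha>} function
   there extends to the whole space, being constant in the direction e. *)
definition C1_holder_domain :: "real \<Rightarrow> (real^'n) set \<Rightarrow> bool" where
  "C1_holder_domain \<alpha> \<Omega> \<longleftrightarrow>
     open \<Omega> \<and> connected \<Omega> \<and> \<Omega> \<noteq> {} \<and>
     (\<forall>z\<in>frontier \<Omega>. \<exists>r>0. \<exists>e g. norm e = 1 \<and> C1_holder \<alpha> g \<and>
        \<Omega> \<inter> ball z r = {x \<in> ball z r. x \<bullet> e > g (x - (x \<bullet> e) *\<^sub>R e)})"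

end

theory Submission
 imports Defs "HOL-Library.Diagonal_Subsequence"
begin

text \<open>The kernel is truncated at a distance \<open>tau\<close>, and all estimates are uniform in \<open>tau\<close>. For a translation
 invariant truncated kernel the operator is a multiple of \<open>I - P\<close>, where \<open>P\<close> is the transition operator of a random
 walk. The first \<open>i\<close> steps of the walk smooth bounded functions to Lipschitz functions with constant of order
 \<open>i powr (- 1 / (2 * s))\<close> (in the unit of space in which a step has size one); summing over \<open>i\<close> in the resolvent gives Hoelder estimates
 of every order \<open>\<gamma> < 1\<close>, also for right-hand sides in divergence form. Freezing the kernel at a point and
 absorbing the difference carries them over to Hoelder continuous kernels, first for solutions \<open>u\<close> and then for
 the differences \<open>u (x + h) - u x\<close>; thus second differences of \<open>u\<close> are of order \<open>\<gamma> + \<sigma> > 1\<close>, and \<open>u\<close> has a gradient.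
 A barrier gives a weak Harnack inequality, and with the Hoelder estimate a full one, so that on a ball of radius \<open>R\<close>
 without sources everything is bounded by the value of \<open>u\<close> at the centre. As \<open>tau\<close> tends to 0 one obtains weak solutions
 with the same bounds. With sources concentrating at a point they converge to the Green function, and \<open>R\<close>
 may be taken comparable to the smaller of \<open>norm (x - y)\<close> and the distance of \<open>x\<close> to the complement.\<close>

text \<open>Freezing only makes the kernel translation invariant: as a function of the jump it stays
  merely measurable and comparable to \<open>norm z powr (- n - 2 * s)\<close>, so neither Fourier
  nor heat kernel regularity is at hand, and all smoothing has to come from the lower bound. The
  bound of order \<open>t powr (- 1 / (2 * s))\<close> is integrable at time 0 exactly because
  \<open>s > 1 / 2\<close>. Freezing and cutting off produce errors of order
  \<open>norm (x - y) powr (\<gamma> - n - 2 * s)\<close>; since \<open>\<gamma> < 1 < 2 * s\<close>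
  they are not absolutely integrable uniformly in \<open>tau\<close>, and only their antisymmetry
  makes them harmless. The truncation makes the operators bounded: solutions come from Neumann
  series and satisfy their equations at every point, the maximum principle needs no regularity, and
  the seminorms to be absorbed are finite beforehand. The price is that increments shorter than
  \<open>tau\<close> are out of control, and that Harnack's inequality carries an additive error
  which vanishes only in the limit.\<close>

abbreviation "Borel \<equiv> borel_measurable borel"
abbreviation "borel2 \<equiv> borel \<Otimes>\<^sub>M borel"
abbreviation "lborel2 \<equiv> lborel \<Otimes>\<^sub>M lborel"
abbreviation rpow :: "real => real => 'a::real_normed_vector => real" where "rpow n s z \<equiv> norm z powr (- n - 2 * s)"
lemmas bochner_integrable_add = Bochner_Integration.integrable_add
 and bochner_bound = Bochner_Integration.integrable_bound
 and bochner_integrable_diff = Bochner_Integration.integrable_diff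
 and bochner_add = Bochner_Integration.integral_add
 and bochner_cong = Bochner_Integration.integral_cong
 and bochner_diff = Bochner_Integration.integral_diff
 and bochner_integral_sum = Bochner_Integration.integral_sum

section \<open>Changes of variables and integrals of powers of the norm\<close>

lemma affine_integral:
 fixes f :: "'a::euclidean_space => real"
 assumes c: "c \<noteq> 0" and [measurable]: "f \<in> Borel"
 shows "(LBINT z. f (t + c *\<^sub>R z)) = (LBINT z. f z) / \<bar>c\<bar> ^ DIM('a)" (is ?A)
  and "integrable lborel (\<lambda>z. f (t + c *\<^sub>R z)) \<longleftrightarrow> integrable lborel f" (is ?B)
proof -
 let ?D = "density (distr lborel borel (\<lambda>x. t + c *\<^sub>R x)) (\<lambda>_. ennreal (\<bar>c\<bar> ^ DIM('a)))"
 have E: "lborel = ?D" using lborel_affine[OF c, of t] by simp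
 have "integral\<^sup>L lborel f = integral\<^sup>L ?D f" using E by (rule arg_cong)
 also have "\<dots> = (\<integral>x. \<bar>c\<bar> ^ DIM('a) *\<^sub>R f x \<partial>distr lborel borel (\<lambda>x. t + c *\<^sub>R x))"
  by (rule integral_density) auto
 also have "\<dots> = (LBINT x. \<bar>c\<bar> ^ DIM('a) *\<^sub>R f (t + c *\<^sub>R x))"
  by (rule integral_distr) auto
 finally show ?A using c by (simp add: field_simps)
 have "integrable lborel f \<longleftrightarrow> integrable ?D f" using E by (rule arg_cong)
 also have "\<dots> \<longleftrightarrow> integrable (distr lborel borel (\<lambda>x. t + c *\<^sub>R x)) (\<lambda>x. \<bar>c\<bar> ^ DIM('a) *\<^sub>R f x)"
  by (rule integrable_density) auto
 also have "\<dots> \<longleftrightarrow> integrable lborel (\<lambda>x. \<bar>c\<bar> ^ DIM('a) *\<^sub>R f (t + c *\<^sub>R x))"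
  by (rule integrable_distr_eq) auto
 finally show ?B using c by simp
qed

lemma shift_integral:
 fixes f :: "'a::euclidean_space => real"
 assumes "f \<in> Borel"
 shows "(LBINT z. f (t + z)) = (LBINT z. f z)"
  and "integrable lborel (\<lambda>z. f (t + z)) \<longleftrightarrow> integrable lborel f"
 using affine_integral[of 1 f t, OF _ assms] by simp_all

lemma reflect_integral:
 fixes f :: "'a::euclidean_space => real"
 assumes "f \<in> Borel"
 shows "(LBINT z. f (- z)) = (LBINT z. f z)"
  and "integrable lborel (\<lambda>z. f (- z)) \<longleftrightarrow> integrable lborel f"
 using affine_integral[of "-1" f 0, OF _ assms] by simp_all

text \<open>A substitute for polar coordinates: the integrand is dominated by a sum of constants
  times indicators of centred balls, so that only volumes of balls enter. Overlaps merely add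
  nonnegative terms.\<close>

lemma dyadic_nn_integral_le:
 fixes f :: "'a::euclidean_space => real"
 assumes S: "!!z. z \<in> S ==> \<exists>j. norm z < \<rho> j \<and> f z \<le> a j"
  and a: "!!j::nat. 0 \<le> a j" and r: "!!j. 0 \<le> \<rho> j"
 shows "(\<integral>\<^sup>+z. ennreal (f z) * indicator S z \<partial>lborel)
    \<le> (\<Sum>j. ennreal (a j * (unit_ball_vol (DIM('a)) * \<rho> j ^ DIM('a))))"
proof -
 have "ennreal (f z) * indicator S z \<le> (\<Sum>j. ennreal (a j) * indicator (ball 0 (\<rho> j)) z)" for z
 proof (cases "z \<in> S")
  case True
  then obtain j where j: "norm z < \<rho> j" "f z \<le> a j" using S by blast
  have "ennreal (f z) * indicator S z \<le> ennreal (a j) * indicator (ball 0 (\<rho> j)) z"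
   using True j by (simp add: ennreal_leI)
  also have "\<dots> \<le> (\<Sum>j. ennreal (a j) * indicator (ball 0 (\<rho> j)) z)"
  proof -
   have "(\<Sum>i\<in>{j}. X i) \<le> (\<Sum>i. X i)" for X :: "nat => ennreal" by (intro sum_le_suminf) auto
   from this[of "\<lambda>j. ennreal (a j) * indicator (ball 0 (\<rho> j)) z"] show ?thesis
    by (simp only: sum.insert sum.empty finite.emptyI empty_iff not_False_eq_True add_0_right)
  qed
  finally show ?thesis .
 qed simp
 then have "(\<integral>\<^sup>+z. ennreal (f z) * indicator S z \<partial>lborel)
   \<le> (\<integral>\<^sup>+z. (\<Sum>j. ennreal (a j) * indicator (ball 0 (\<rho> j)) (z::'a)) \<partial>lborel)"
  by (intro nn_integral_mono)
 also have "\<dots> = (\<Sum>j. \<integral>\<^sup>+z. ennreal (a j) * indicator (ball 0 (\<rho> j)) (z::'a) \<partial>lborel)"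
  by (rule nn_integral_suminf) (auto intro!: borel_measurable_times_ennreal borel_measurable_indicator)
 also have "\<dots> = (\<Sum>j. ennreal (a j * (unit_ball_vol (DIM('a)) * \<rho> j ^ DIM('a))))"
  using a r by (subst nn_integral_cmult_indicator) (auto simp: emeasure_ball ennreal_mult)
 finally show ?thesis .
qed

text \<open>Up to the power of the radius, a bound for the integral of
  \<open>norm z powr (e - n)\<close> over a ball and of \<open>norm z powr (- e - n)\<close> over
  its complement. The geometric series over dyadic rings stands in for the exact
  \<open>1 / e\<close>; it blows up as \<open>e\<close> tends to 0, which is why the exponents below
  have to satisfy strict inequalities.\<close>

definition radial_const :: "real => real => real" where
 "radial_const n e = 2 powr n * unit_ball_vol n / (1 - 2 powr (- e))"

lemma radial_const_pos: "0 < e ==> 0 \<le> n ==> 0 < radial_const n e"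
 by (simp add: radial_const_def powr_minus inverse_less_1_iff)

lemma dyadic_sum:
 assumes e: "0 < e" and n: "0 \<le> n" and B: "0 \<le> B"
  and b: "!!j. b j = 2 powr n * unit_ball_vol n * B * 2 powr (- e * real j)"
 shows "(\<Sum>j. ennreal (b j)) = ennreal (B * radial_const n e)"
proof -
 have "2 powr (- e) < 1" using e by (simp add: powr_minus inverse_less_1_iff)
 then have "(\<lambda>j. (2 powr (- e)) ^ j) sums (1 / (1 - 2 powr (- e)))"
  by (intro geometric_sums) simp
 moreover have "(2 powr (- e)) ^ j = 2 powr (- e * real j)" for j
  by (simp add: powr_realpow[symmetric] powr_powr)
 ultimately have "b sums (2 powr n * unit_ball_vol n * B * (1 / (1 - 2 powr (- e))))"
  unfolding b by (intro sums_mult) simp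
 moreover have "0 \<le> b j" for j using n B by (simp add: b)
 ultimately show ?thesis
  by (subst suminf_ennreal_eq) (auto simp: radial_const_def mult_ac)
qed

lemma near_nn_integral:
 assumes e: "0 < e" "e \<le> real DIM('a)" and R: "0 < R"
 shows "(\<integral>\<^sup>+(z::'a::euclidean_space). ennreal (norm z powr (e - real DIM('a))) * indicator {z. norm z < R} z \<partial>lborel)
   \<le> ennreal (R powr e * radial_const (real DIM('a)) e)"
proof -
 let ?n = "real DIM('a)"
 let ?\<rho> = "\<lambda>j::nat. R * 2 powr (- real j)"
 have "(\<integral>\<^sup>+(z::'a). ennreal (norm z powr (e - ?n)) * indicator {z. norm z < R} z \<partial>lborel)
  \<le> (\<Sum>j. ennreal (2 powr ?n * ?\<rho> j powr (e - ?n) * (unit_ball_vol (DIM('a)) * ?\<rho> j ^ DIM('a))))"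
 proof (rule dyadic_nn_integral_le)
  fix z :: 'a assume "z \<in> {z. norm z < R}"
  then have z: "norm z < R" by simp
  show "\<exists>j. norm z < ?\<rho> j \<and> norm z powr (e - ?n) \<le> 2 powr ?n * ?\<rho> j powr (e - ?n)"
  proof (cases "z = 0")
   \<comment> \<open>\<open>0 powr (e - n)\<close> is 0, so the origin needs no ring of its
     own.\<close>
   case True
   then show ?thesis using R by (intro exI[of _ 0]) simp
  next
   case False
   define L where "L = log 2 (R / norm z)"
   have L: "2 powr L = R / norm z" "L > 0" using False R z by (auto simp: L_def)
   \<comment> \<open>The largest integer strictly below \<open>L\<close>, because
     \<open>norm z < R * 2 powr (- j)\<close> has to be strict.\<close>
   define j where "j = nat (\<lceil>L\<rceil> - 1)"
   have j: "real j < L" "L \<le> real j + 1" using L(2) unfolding j_def by linarith+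
   have "2 powr real j < R / norm z" using j(1) L(1) by (metis one_less_numeral_iff powr_less_cancel_iff semiring_norm(76))
   then have 1: "norm z < ?\<rho> j" using False by (simp add: powr_minus field_simps)
   have "R / norm z \<le> 2 powr (real j + 1)" using j(2) L(1)
    by (metis one_less_numeral_iff powr_le_cancel_iff semiring_norm(76))
   then have 2: "?\<rho> j / 2 \<le> norm z" using False by (simp add: powr_minus powr_add field_simps)
   have "norm z powr (e - ?n) \<le> (?\<rho> j / 2) powr (e - ?n)"
    using 2 R e by (intro powr_mono2') auto
   also have "\<dots> = ?\<rho> j powr (e - ?n) * 2 powr (?n - e)"
    using R by (simp add: powr_divide powr_diff field_simps powr_mult)
   also have "\<dots> \<le> ?\<rho> j powr (e - ?n) * 2 powr ?n"
    using e by (intro mult_left_mono) auto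
   finally show ?thesis using 1 by (auto simp: mult_ac)
  qed
 qed (use R in auto)
 also have "\<dots> = ennreal (R powr e * radial_const ?n e)"
 proof (rule dyadic_sum)
  fix j
  have "?\<rho> j ^ DIM('a) = ?\<rho> j powr ?n" using R by (simp add: powr_realpow)
  then have "?\<rho> j powr (e - ?n) * ?\<rho> j ^ DIM('a) = ?\<rho> j powr e" using R by (simp add: powr_add[symmetric])
  also have "\<dots> = R powr e * 2 powr (- e * real j)"
   using R by (simp add: powr_mult powr_powr mult_ac)
  finally have *: "?\<rho> j powr (e - ?n) * ?\<rho> j ^ DIM('a) = R powr e * 2 powr (- e * real j)" .
  have "2 powr ?n * ?\<rho> j powr (e - ?n) * (unit_ball_vol ?n * ?\<rho> j ^ DIM('a))
    = 2 powr ?n * unit_ball_vol ?n * (?\<rho> j powr (e - ?n) * ?\<rho> j ^ DIM('a))" by (simp add: mult_ac)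
  also have "\<dots> = 2 powr ?n * unit_ball_vol ?n * (R powr e * 2 powr (- e * real j))" unfolding * ..
  finally show "2 powr ?n * ?\<rho> j powr (e - ?n) * (unit_ball_vol ?n * ?\<rho> j ^ DIM('a))
    = 2 powr ?n * unit_ball_vol ?n * R powr e * 2 powr (- e * real j)" by (simp add: mult_ac)
 qed (use e in auto)
 finally show ?thesis .
qed

lemma far_nn_integral:
 assumes e: "0 < e" and R: "0 < R"
 shows "(\<integral>\<^sup>+(z::'a::euclidean_space). ennreal (norm z powr (- e - real DIM('a))) * indicator {z. R \<le> norm z} z \<partial>lborel)
   \<le> ennreal (R powr (- e) * radial_const (real DIM('a)) e)"
proof -
 let ?n = "real DIM('a)"
 let ?r = "\<lambda>j::nat. R * 2 powr (real j)"
 have "(\<integral>\<^sup>+(z::'a). ennreal (norm z powr (- e - ?n)) * indicator {z. R \<le> norm z} z \<partial>lborel)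
  \<le> (\<Sum>j. ennreal (?r j powr (- e - ?n) * (unit_ball_vol (DIM('a)) * (2 * ?r j) ^ DIM('a))))"
 proof (rule dyadic_nn_integral_le)
  fix z :: 'a assume "z \<in> {z. R \<le> norm z}"
  then have z: "R \<le> norm z" "0 < norm z" using R by auto
  define L where "L = log 2 (norm z / R)"
  have L: "2 powr L = norm z / R" "L \<ge> 0" using R z by (auto simp: L_def)
  define j where "j = nat \<lfloor>L\<rfloor>"
  have j: "real j \<le> L" "L < real j + 1" using L(2) unfolding j_def by linarith+
  have "2 powr real j \<le> norm z / R" using j(1) L(1)
   by (metis one_less_numeral_iff powr_le_cancel_iff semiring_norm(76))
  then have 1: "?r j \<le> norm z" using R by (simp add: field_simps)
  have "norm z / R < 2 powr (real j + 1)" using j(2) L(1)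
   by (metis one_less_numeral_iff powr_less_cancel_iff semiring_norm(76))
  then have 2: "norm z < 2 * ?r j" using R by (simp add: powr_add field_simps)
  have "norm z powr (- e - ?n) \<le> ?r j powr (- e - ?n)"
   using 1 R e by (intro powr_mono2') auto
  then show "\<exists>j. norm z < 2 * ?r j \<and> norm z powr (- e - ?n) \<le> ?r j powr (- e - ?n)"
   using 2 by auto
 qed (use R in auto)
 also have "\<dots> = ennreal (R powr (- e) * radial_const ?n e)"
 proof (rule dyadic_sum)
  fix j
  have "(2 * ?r j) ^ DIM('a) = 2 powr ?n * ?r j powr ?n"
   using R by (simp add: powr_realpow power_mult_distrib)
  then have "?r j powr (- e - ?n) * (2 * ?r j) ^ DIM('a) = 2 powr ?n * (?r j powr (- e - ?n) * ?r j powr ?n)"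
   by (simp add: mult_ac)
  also have "?r j powr (- e - ?n) * ?r j powr ?n = ?r j powr (- e)" using R by (simp add: powr_add[symmetric])
  also have "\<dots> = R powr (- e) * 2 powr (- e * real j)"
   using R by (simp add: powr_mult powr_powr mult_ac)
  finally have *: "?r j powr (- e - ?n) * (2 * ?r j) ^ DIM('a) = 2 powr ?n * (R powr (- e) * 2 powr (- e * real j))" .
  have "?r j powr (- e - ?n) * (unit_ball_vol ?n * (2 * ?r j) ^ DIM('a))
    = unit_ball_vol ?n * (?r j powr (- e - ?n) * (2 * ?r j) ^ DIM('a))" by (simp add: mult_ac)
  also have "\<dots> = unit_ball_vol ?n * (2 powr ?n * (R powr (- e) * 2 powr (- e * real j)))" unfolding * ..
  finally show "?r j powr (- e - ?n) * (unit_ball_vol ?n * (2 * ?r j) ^ DIM('a))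
    = 2 powr ?n * unit_ball_vol ?n * R powr (- e) * 2 powr (- e * real j)" by (simp add: mult_ac)
 qed (use e in auto)
 finally show ?thesis .
qed

lemma integral_bound_of_nn:
 fixes f g :: "'a => real"
 assumes f: "f \<in> borel_measurable M" and fg: "!!z. z \<in> space M ==> \<bar>f z\<bar> \<le> A * g z"
  and g: "(\<integral>\<^sup>+z. ennreal (g z) \<partial>M) \<le> ennreal B" "g \<in> borel_measurable M" and A: "0 \<le> A"
  and B: "0 \<le> B"
 shows "integrable M f" "(\<integral>z. \<bar>f z\<bar> \<partial>M) \<le> A * B" "\<bar>\<integral>z. f z \<partial>M\<bar> \<le> A * B"
proof -
 have "(\<integral>\<^sup>+z. ennreal \<bar>f z\<bar> \<partial>M) \<le> (\<integral>\<^sup>+z. ennreal A * ennreal (g z) \<partial>M)"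
  using fg A by (intro nn_integral_mono) (auto simp: ennreal_mult'[symmetric] intro: ennreal_leI)
 also have "\<dots> = ennreal A * (\<integral>\<^sup>+z. ennreal (g z) \<partial>M)" using g by (intro nn_integral_cmult) auto
 also have "\<dots> \<le> ennreal A * ennreal B" using g by (intro mult_left_mono) auto
 finally have *: "(\<integral>\<^sup>+z. ennreal \<bar>f z\<bar> \<partial>M) \<le> ennreal (A * B)" using A by (simp add: ennreal_mult')
 show i: "integrable M f"
  using f * by (intro integrableI_bounded) (auto intro: le_less_trans)
 have "ennreal (\<integral>z. \<bar>f z\<bar> \<partial>M) \<le> ennreal (A * B)"
  using * i by (subst nn_integral_eq_integral[symmetric]) auto
 then show "(\<integral>z. \<bar>f z\<bar> \<partial>M) \<le> A * B" using A B by (simp add: ennreal_le_iff)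
 then show "\<bar>\<integral>z. f z \<partial>M\<bar> \<le> A * B" using integral_abs_bound[of M f] by linarith
qed

lemma near_integral_bound:
 fixes f :: "'a::euclidean_space => real"
 assumes f: "f \<in> Borel"
  and b: "!!z. \<bar>f z\<bar> \<le> (if norm z < R then A * norm z powr (e - real DIM('a)) else 0)"
  and e: "0 < e" "e \<le> real DIM('a)" and R: "0 < R" and A: "0 \<le> A"
 shows "integrable lborel f" "(LBINT z. \<bar>f z\<bar>) \<le> A * (R powr e * radial_const (real DIM('a)) e)"
  "\<bar>\<integral>z. f z \<partial>lborel\<bar> \<le> A * (R powr e * radial_const (real DIM('a)) e)"
proof -
 define g where "g = (\<lambda>z::'a. norm z powr (e - real DIM('a)) * indicator {z. norm z < R} z)"
 have g: "\<bar>f z\<bar> \<le> A * g z" for z using b[of z] by (simp add: g_def indicator_def split: if_splits)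
 have m: "f \<in> borel_measurable lborel" "g \<in> borel_measurable lborel"
  using f by (auto simp: g_def)
 have "(\<integral>\<^sup>+z. ennreal (g z) \<partial>lborel) \<le> ennreal (R powr e * radial_const (real DIM('a)) e)"
  using near_nn_integral[OF e R] by (simp add: g_def ennreal_mult'' ennreal_indicator)
 from integral_bound_of_nn[OF m(1) g this m(2) A]
 show "integrable lborel f" "(LBINT z. \<bar>f z\<bar>) \<le> A * (R powr e * radial_const (real DIM('a)) e)"
  "\<bar>\<integral>z. f z \<partial>lborel\<bar> \<le> A * (R powr e * radial_const (real DIM('a)) e)"
  using radial_const_pos[OF e(1), of "real DIM('a)"] by auto
qed

lemma far_integral_bound:
 fixes f :: "'a::euclidean_space => real"
 assumes f: "f \<in> Borel"
  and b: "!!z. \<bar>f z\<bar> \<le> (if R \<le> norm z then A * norm z powr (- e - real DIM('a)) else 0)"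
  and e: "0 < e" and R: "0 < R" and A: "0 \<le> A"
 shows "integrable lborel f" "(LBINT z. \<bar>f z\<bar>) \<le> A * (R powr (- e) * radial_const (real DIM('a)) e)"
  "\<bar>\<integral>z. f z \<partial>lborel\<bar> \<le> A * (R powr (- e) * radial_const (real DIM('a)) e)"
proof -
 define g where "g = (\<lambda>z::'a. norm z powr (- e - real DIM('a)) * indicator {z. R \<le> norm z} z)"
 have g: "\<bar>f z\<bar> \<le> A * g z" for z using b[of z] by (simp add: g_def indicator_def split: if_splits)
 have m: "f \<in> borel_measurable lborel" "g \<in> borel_measurable lborel"
  using f by (auto simp: g_def)
 have "(\<integral>\<^sup>+z. ennreal (g z) \<partial>lborel) \<le> ennreal (R powr (- e) * radial_const (real DIM('a)) e)"
  using far_nn_integral[OF e R, where 'a='a] by (simp add: g_def ennreal_mult'' ennreal_indicator)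
 from integral_bound_of_nn[OF m(1) g this m(2) A]
 show "integrable lborel f" "(LBINT z. \<bar>f z\<bar>) \<le> A * (R powr (- e) * radial_const (real DIM('a)) e)"
  "\<bar>\<integral>z. f z \<partial>lborel\<bar> \<le> A * (R powr (- e) * radial_const (real DIM('a)) e)"
  using radial_const_pos[OF e(1), of "real DIM('a)"] by auto
qed

section \<open>Smoothing by random walks\<close>

text \<open>The bound holds at every point and not just almost everywhere: the equations below are
  pointwise, and suprema and limits are taken point by point.\<close>

definition bbd :: "real => ('a::euclidean_space => real) => bool" where
 "bbd B f \<longleftrightarrow> f \<in> Borel \<and> (\<forall>x. \<bar>f x\<bar> \<le> B)"

lemma bbdI: "f \<in> Borel ==> (!!x. \<bar>f x\<bar> \<le> B) ==> bbd B f"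
 by (simp add: bbd_def)

lemma bbd_measurable [measurable_dest]: "bbd B f ==> f \<in> Borel"
 by (simp add: bbd_def)

lemma bbd_le: "bbd B f ==> \<bar>f x\<bar> \<le> B"
 by (simp add: bbd_def)

lemma bbd_nonneg: "bbd B f ==> 0 \<le> B"
 using bbd_le[of B f undefined] by linarith

lemma bbd_add: "bbd A f ==> bbd B g ==> bbd (A + B) (\<lambda>x. f x + g x)"
 by (auto simp: bbd_def intro!: order_trans[OF abs_triangle_ineq] add_mono)

lemma bbd_diff: "bbd A f ==> bbd B g ==> bbd (A + B) (\<lambda>x. f x - g x)"
 by (auto simp: bbd_def intro!: order_trans[OF abs_triangle_ineq4] add_mono)

lemma bbd_scale: "bbd B f ==> bbd (\<bar>c\<bar> * B) (\<lambda>x. c * f x)"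
 by (auto simp: bbd_def abs_mult intro!: mult_left_mono)

lemma bbd_shift: "bbd B f ==> bbd B (\<lambda>x. f (x + h))"
 by (auto simp: bbd_def)

lemma bbd_integrable:
 assumes q: "integrable lborel q" and f: "bbd B f"
 shows "integrable lborel (\<lambda>z. q z * f (x + z))" "\<bar>\<integral>z. q z * f (x + z) \<partial>lborel\<bar> \<le> (LBINT z. \<bar>q z\<bar>) * B"
proof -
 note [measurable] = bbd_measurable[OF f] borel_measurable_integrable[OF q]
 have qB: "integrable lborel (\<lambda>z. \<bar>q z\<bar> * B)" using q by auto
 have le: "norm (q z * f (x + z)) \<le> \<bar>q z\<bar> * B" for z
  using bbd_le[OF f] by (auto simp: abs_mult intro: mult_left_mono)
 show i: "integrable lborel (\<lambda>z. q z * f (x + z))"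
 proof (rule bochner_bound[OF qB], measurable, rule AE_I2)
  fix z show "norm (q z * f (x + z)) \<le> norm (\<bar>q z\<bar> * B)"
   using le[of z] abs_ge_self[of "\<bar>q z\<bar> * B"] unfolding real_norm_def by linarith
 qed
 have "\<bar>\<integral>z. q z * f (x + z) \<partial>lborel\<bar> \<le> (LBINT z. \<bar>q z\<bar> * B)"
  using le by (intro order_trans[OF integral_abs_bound integral_mono[OF integrable_abs[OF i] qB]]) auto
 then show "\<bar>\<integral>z. q z * f (x + z) \<partial>lborel\<bar> \<le> (LBINT z. \<bar>q z\<bar>) * B" by simp
qed

text \<open>The expectation of \<open>f\<close> after a jump from \<open>x\<close> with density
  \<open>q\<close>; hence \<open>x + z\<close> in place of the \<open>x - z\<close> of a
  convolution.\<close>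

definition cv :: "('a::euclidean_space => real) => ('a => real) => 'a => real" where
 "cv q f x = (LBINT z. q z * f (x + z))"

lemma cv_shift: "cv q (\<lambda>x. f (x + h)) x = cv q f (x + h)"
 by (simp add: cv_def ac_simps)

lemma cv_measurable:
 assumes [measurable]: "q \<in> Borel" "f \<in> Borel"
 shows "cv q f \<in> Borel"
proof -
 have "(\<lambda>x. \<integral>z. q z * f (x + z) \<partial>lborel) \<in> Borel"
  by (rule lborel.borel_measurable_lebesgue_integral) measurable
 then show ?thesis by (simp add: cv_def[abs_def])
qed

lemma cv_bbd:
 assumes q: "integrable lborel q" and f: "bbd B f"
 shows "bbd ((LBINT z. \<bar>q z\<bar>) * B) (cv q f)"
 using bbd_integrable(2)[OF q f] cv_measurable[of q f] bbd_measurable[OF f] borel_measurable_integrable[OF q]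
 by (auto simp: bbd_def cv_def)

lemma cv_add:
 assumes "integrable lborel q" "bbd A f" "bbd B g"
 shows "cv q (\<lambda>x. f x + g x) x = cv q f x + cv q g x"
 using assms by (simp add: cv_def distrib_left bbd_integrable)

lemma cv_diff:
 assumes "integrable lborel q" "bbd A f" "bbd B g"
 shows "cv q (\<lambda>x. f x - g x) x = cv q f x - cv q g x"
 using assms by (simp add: cv_def right_diff_distrib bbd_integrable)

lemma cv_scale: "cv q (\<lambda>x. c * f x) x = c * cv q f x"
 by (simp add: cv_def mult.left_commute)

lemma cv_split:
 assumes "integrable lborel q" "integrable lborel r" "bbd B f"
 shows "cv (\<lambda>z. a * q z + r z) f x = a * cv q f x + cv r f x"
 using assms by (simp add: cv_def distrib_right mult.assoc bbd_integrable)

text \<open>The shift is moved from \<open>f\<close> to \<open>q\<close>, so that nothing but a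
  bound for \<open>f\<close> is used; the gain is the continuity of translations of \<open>q\<close>
  in the mean.\<close>

lemma cv_increment:
 assumes q: "integrable lborel q" and f: "bbd B f"
 shows "\<bar>cv q f (x + h) - cv q f x\<bar> \<le> (LBINT z. \<bar>q (z - h) - q z\<bar>) * B"
proof -
 note [measurable] = bbd_measurable[OF f] borel_measurable_integrable[OF q]
 have qh: "integrable lborel (\<lambda>z. q (z - h))"
  using shift_integral(2)[of q "- h"] q by simp
 have "cv q f (x + h) = (LBINT z. q (z - h) * f (x + z))"
  using shift_integral(1)[of "\<lambda>z. q (z - h) * f (x + z)" h] by (simp add: cv_def ac_simps)
 then have "cv q f (x + h) - cv q f x = (LBINT z. (q (z - h) - q z) * f (x + z))"
  using bbd_integrable(1)[OF qh f] bbd_integrable(1)[OF q f] by (simp add: cv_def left_diff_distrib)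
 then show ?thesis using bbd_integrable(2)[of "\<lambda>z. q (z - h) - q z", OF _ f] qh q by simp
qed

text \<open>A tent in \<open>norm z / \<rho>\<close> on the annulus between \<open>\<rho>\<close>
  and \<open>3 * \<rho>\<close>. It is the Lipschitz part that can be split off from a rough kernel
  knowing only its lower bound; it avoids the origin, where the truncated kernel vanishes.\<close>

definition annulus_bump :: "real => 'a::euclidean_space => real" where
 "annulus_bump \<rho> z = max 0 (1 - \<bar>norm z / \<rho> - 2\<bar>)"

lemma annulus_bump_measurable [measurable]: "annulus_bump \<rho> \<in> Borel"
 unfolding annulus_bump_def by measurable

lemma annulus_bump_range: "0 \<le> annulus_bump \<rho> z" "annulus_bump \<rho> z \<le> 1"
 by (auto simp: annulus_bump_def)

lemma annulus_bump_support: "0 < \<rho> ==> annulus_bump \<rho> z \<noteq> 0 ==> \<rho> < norm z \<and> norm z < 3 * \<rho>"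
 by (auto simp: annulus_bump_def max_def abs_if field_simps split: if_splits)

lemma annulus_bump_lipschitz:
 assumes "0 < \<rho>" shows "\<bar>annulus_bump \<rho> x - annulus_bump \<rho> y\<bar> \<le> norm (x - y) / \<rho>"
proof -
 have "\<bar>norm x / \<rho> - norm y / \<rho>\<bar> \<le> norm (x - y) / \<rho>"
  using norm_triangle_ineq3[of x y] assms
  by (simp add: diff_divide_distrib[symmetric] abs_divide divide_right_mono)
 then show ?thesis unfolding annulus_bump_def by linarith
qed

lemma integrable_ball_indicator: "integrable lborel (indicator (ball c r) :: 'a::euclidean_space => real)"
 by (rule integrable_real_indicator) (simp, rule emeasure_lborel_ball_finite)

lemma integral_ball_indicator:
 "0 \<le> r ==> (LBINT z. indicator (ball c r) z) = unit_ball_vol (DIM('a)) * r ^ DIM('a)" for c :: "'a::euclidean_space"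
 by (simp add: content_ball)

lemma annulus_bump_integrable:
 assumes "0 < \<rho>" shows "integrable lborel (annulus_bump \<rho> :: 'a::euclidean_space => real)"
proof (rule bochner_bound[OF integrable_ball_indicator[of 0 "3 * \<rho>"]])
 show "AE z in lborel. norm (annulus_bump \<rho> (z::'a)) \<le> norm (indicator (ball 0 (3 * \<rho>)) z :: real)"
 proof (rule AE_I2)
  fix z :: 'a
  show "norm (annulus_bump \<rho> z) \<le> norm (indicator (ball 0 (3 * \<rho>)) z :: real)"
   using annulus_bump_support[OF assms, of z] annulus_bump_range[of \<rho> z]
   by (cases "annulus_bump \<rho> z = 0") auto
 qed
qed auto

lemma annulus_bump_mass:
 assumes r: "0 < \<rho>"
 shows "unit_ball_vol (DIM('a)) * (\<rho> / 2) ^ DIM('a) / 2 \<le> (LBINT (z::'a::euclidean_space). annulus_bump \<rho> z)"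
proof -
 obtain e :: 'a where e: "norm e = 1" by (meson norm_Basis nonempty_Basis ex_in_conv)
 have "(LBINT (z::'a). (1/2) * indicator (ball ((2 * \<rho>) *\<^sub>R e) (\<rho> / 2)) z) \<le> (LBINT (z::'a). annulus_bump \<rho> z)"
 proof (rule integral_mono)
  fix z :: 'a
  show "(1/2) * indicator (ball ((2 * \<rho>) *\<^sub>R e) (\<rho> / 2)) z \<le> annulus_bump \<rho> z"
  proof (cases "z \<in> ball ((2 * \<rho>) *\<^sub>R e) (\<rho> / 2)")
   case True
   then have "norm ((2 * \<rho>) *\<^sub>R e - z) < \<rho> / 2" by (simp add: dist_norm)
   moreover have "\<bar>norm ((2 * \<rho>) *\<^sub>R e) - norm z\<bar> \<le> norm ((2 * \<rho>) *\<^sub>R e - z)"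
    by (rule norm_triangle_ineq3)
   ultimately have "\<bar>2 * \<rho> - norm z\<bar> < \<rho> / 2" using r e by simp
   then have "\<bar>norm z / \<rho> - 2\<bar> \<le> 1/2" using r by (auto simp: abs_if field_simps split: if_splits)
   then show ?thesis using True by (auto simp: annulus_bump_def)
  qed (use annulus_bump_range in auto)
 qed (use r annulus_bump_integrable integrable_ball_indicator in auto)
 then show ?thesis using integral_ball_indicator[of "\<rho> / 2" "(2 * \<rho>) *\<^sub>R e"] r by simp
qed

lemma annulus_bump_increment:
 assumes r: "0 < \<rho>"
 shows "(LBINT (z::'a::euclidean_space). \<bar>annulus_bump \<rho> (z - h) - annulus_bump \<rho> z\<bar>)
   \<le> norm h / \<rho> * (2 * (unit_ball_vol (DIM('a)) * (3 * \<rho>) ^ DIM('a)))"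
proof -
 let ?I = "\<lambda>c z. indicator (ball c (3 * \<rho>)) (z::'a) :: real"
 have "(LBINT z. \<bar>annulus_bump \<rho> (z - h) - annulus_bump \<rho> (z::'a)\<bar>)
   \<le> (LBINT z. norm h / \<rho> * (?I h z + ?I 0 z))"
 proof (rule integral_mono)
  show "integrable lborel (\<lambda>z. \<bar>annulus_bump \<rho> (z - h) - annulus_bump \<rho> (z::'a)\<bar>)"
   using shift_integral(2)[of "annulus_bump \<rho>" "- h"] annulus_bump_integrable[OF r, where 'a='a]
   by (intro integrable_abs bochner_integrable_diff) auto
  fix z :: 'a
  show "\<bar>annulus_bump \<rho> (z - h) - annulus_bump \<rho> z\<bar> \<le> norm h / \<rho> * (?I h z + ?I 0 z)"
  proof (cases "z \<in> ball h (3 * \<rho>) \<or> z \<in> ball 0 (3 * \<rho>)")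
   case True
   have "\<bar>annulus_bump \<rho> (z - h) - annulus_bump \<rho> z\<bar> \<le> norm h / \<rho> * 1"
    using annulus_bump_lipschitz[OF r, of "z - h" z] by simp
   also have "\<dots> \<le> norm h / \<rho> * (?I h z + ?I 0 z)"
    using True r by (intro mult_left_mono) (auto simp: indicator_def)
   finally show ?thesis .
  next
   case False
   then have "annulus_bump \<rho> (z - h) = 0" "annulus_bump \<rho> z = 0"
    using annulus_bump_support[OF r, of "z - h"] annulus_bump_support[OF r, of z]
    by (auto simp: dist_norm norm_minus_commute)
   then show ?thesis using r by simp
  qed
  show "integrable lborel (\<lambda>z. norm h / \<rho> * (?I h z + ?I 0 z))"
   by (intro integrable_mult_right bochner_integrable_add integrable_ball_indicator)
 qed
 also have "\<dots> = norm h / \<rho> * (2 * (unit_ball_vol (DIM('a)) * (3 * \<rho>) ^ DIM('a)))"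
  using integral_ball_indicator[of "3 * \<rho>" h] integral_ball_indicator[of "3 * \<rho>" "0::'a"] r
   by (simp add: bochner_add[OF integrable_ball_indicator integrable_ball_indicator] content_ball)
 finally show ?thesis .
qed

text \<open>For the operator, which carries a factor 2, the jumps from the tent part at radius
  \<open>\<rho>\<close> occur at a rate of at least
  \<open>bump_constant n s lam * \<rho> powr (- 2 * s)\<close>.\<close>

definition bump_constant :: "real => real => real => real" where
 "bump_constant n s lam = lam * unit_ball_vol n * 3 powr (- n - 2 * s) / 2 powr n"

text \<open>The tent used at time \<open>t\<close> has radius
  \<open>bump_scale n s lam * t powr (1 / (2 * s))\<close>. The second argument of the minimum makes
  its jump rate at least \<open>12 / t\<close>, so that three such jumps are expected during a
  quarter of the time and \<open>exp (- 3) \<le> 1 / 4\<close> applies; the first keeps the tent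
  inside the unit ball as long as \<open>t \<le> 4\<close>.\<close>

definition bump_scale :: "real => real => real => real" where
 "bump_scale n s lam = min (1 / 12) ((bump_constant n s lam / 12) powr (1 / (2 * s)))"

text \<open>One entry for each case of the smoothing lemma: the Lipschitz part, which may use up
  half of the bound; tent radii below the truncation; and the start at time
  \<open>theta\<close>.\<close>

definition smoothing_constant :: "real => real => real => real" where
 "smoothing_constant n s lam = max (8 * 6 powr n / bump_scale n s lam)
   (max (2 / bump_scale n s lam) (2 / bump_constant n s lam powr (1 / (2 * s))))"

locale near_kernel =
 fixes n s lam Lam tau :: real and k :: "'a::euclidean_space => real"
 assumes n [simp]: "real DIM('a) = n"
  and s: "1 / 2 < s" "s < 1" "2 * s < n"
  and lam: "0 < lam" "lam \<le> Lam"
  and tau: "0 < tau" "3 * tau \<le> 1"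
  and k_measurable [measurable]: "k \<in> Borel"
  and k_even: "!!z. k (- z) = k z"
  and k_lower: "!!z. tau < norm z ==> norm z < 1 ==> lam * rpow n s z \<le> k z"
  and k_upper: "!!z. tau < norm z ==> norm z < 1 ==> k z \<le> Lam * rpow n s z"
  and k_zero: "!!z. \<not> (tau < norm z \<and> norm z < 1) ==> k z = 0"
begin

abbreviation "bump_rate \<equiv> bump_constant n s lam"
abbreviation "mu \<equiv> bump_scale n s lam"
abbreviation "csm \<equiv> smoothing_constant n s lam"

lemma k_nonneg: "0 \<le> k z"
 using k_lower[of z] k_zero[of z] lam by (smt (verit) mult_nonneg_nonneg powr_ge_zero)

lemma k_integrable: "integrable lborel k"
proof (rule far_integral_bound(1)[of k tau Lam "2 * s", unfolded n])
 fix z :: 'a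
 show "\<bar>k z\<bar> \<le> (if tau \<le> norm z then Lam * norm z powr (- (2 * s) - n) else 0)"
 proof -
  have e: "- n - 2 * s = - (2 * s) - n" by simp
  show ?thesis using k_upper[of z, unfolded e] k_zero[of z] k_nonneg[of z] lam
   by (cases "tau < norm z \<and> norm z < 1") auto
 qed
qed (use s lam tau in auto)

text \<open>With \<open>P\<close> the convolution with \<open>k / kap\<close>, the operator \<open>2 * (LBINT z. (f x - f (x + z)) * k z)\<close> is \<open>(f x - P f x) / theta\<close>.\<close>

definition kap where "kap = (LBINT z. k z)"
definition theta where "theta = 1 / (2 * kap)"

lemma n_pos: "0 < n" using s by simp

lemma pow_DIM: "0 < x ==> x ^ DIM('a) = x powr n"
 by (metis n powr_realpow)

lemma bump_rate_pos: "0 < bump_rate"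
 using lam n_pos by (simp add: bump_constant_def)

lemma k_ge_bump:
 assumes "tau \<le> \<rho>" "3 * \<rho> \<le> 1"
 shows "lam * (3 * \<rho>) powr (- n - 2 * s) * annulus_bump \<rho> z \<le> k z"
proof (cases "annulus_bump \<rho> z = 0")
 case False
 have r: "0 < \<rho>" using assms tau by simp
 note z = annulus_bump_support[OF r False]
 have "lam * (3 * \<rho>) powr (- n - 2 * s) * annulus_bump \<rho> z \<le> lam * (3 * \<rho>) powr (- n - 2 * s) * 1"
  using annulus_bump_range[of \<rho> z] lam by (intro mult_left_mono) auto
 also have "\<dots> \<le> lam * rpow n s z"
 proof -
  have "(3 * \<rho>) powr (- n - 2 * s) \<le> rpow n s z"
   using z r s by (intro powr_mono2') auto
  then show ?thesis using lam by simp
 qed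
 also have "\<dots> \<le> k z" using z assms by (intro k_lower) auto
 finally show ?thesis .
qed (simp add: k_nonneg)

lemma bump_mass_rate:
 assumes "tau \<le> \<rho>"
 shows "bump_rate * \<rho> powr (- 2 * s) \<le> lam * (3 * \<rho>) powr (- n - 2 * s) * (2 * (LBINT (z::'a). annulus_bump \<rho> z))"
proof -
 have r: "0 < \<rho>" using assms tau by simp
 have "bump_rate * \<rho> powr (- 2 * s) = lam * (3 powr (- n - 2 * s) * (\<rho> powr (- n - 2 * s) * \<rho> powr n)) * (unit_ball_vol n / 2 powr n)"
  using r by (simp add: bump_constant_def powr_add[symmetric])
 also have "\<dots> = lam * (3 * \<rho>) powr (- n - 2 * s) * (2 * (unit_ball_vol n * (\<rho> / 2) ^ DIM('a) / 2))"
  using r by (simp add: powr_mult pow_DIM powr_divide)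
 also have "\<dots> \<le> lam * (3 * \<rho>) powr (- n - 2 * s) * (2 * (LBINT (z::'a). annulus_bump \<rho> z))"
  using annulus_bump_mass[OF r, where 'a='a] lam by (intro mult_left_mono) auto
 finally show ?thesis .
qed

lemma bump_le_kap:
 assumes "tau \<le> \<rho>" "3 * \<rho> \<le> 1"
 shows "lam * (3 * \<rho>) powr (- n - 2 * s) * (LBINT (z::'a). annulus_bump \<rho> z) \<le> kap"
proof -
 have "(LBINT (z::'a). lam * (3 * \<rho>) powr (- n - 2 * s) * annulus_bump \<rho> z) \<le> kap"
  unfolding kap_def using assms tau
  by (intro integral_mono k_ge_bump k_integrable integrable_mult_right annulus_bump_integrable) auto
 then show ?thesis by simp
qed

lemma kap_ge: "bump_rate * tau powr (- 2 * s) / 2 \<le> kap"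
 using bump_mass_rate[of tau] bump_le_kap[of tau] tau by simp

lemma kap_pos: "0 < kap"
proof -
 have "0 < bump_rate * tau powr (- 2 * s) / 2" using bump_rate_pos tau by simp
 then show ?thesis using kap_ge by linarith
qed

lemma theta_pos: "0 < theta" by (simp add: theta_def kap_pos)

lemma theta_le: "theta \<le> tau powr (2 * s) / bump_rate"
proof -
 have "bump_rate * tau powr (- (2 * s)) \<le> 2 * kap" using kap_ge by simp
 then have "1 / (2 * kap) \<le> 1 / (bump_rate * tau powr (- (2 * s)))"
  using bump_rate_pos tau by (intro divide_left_mono) (auto simp: kap_pos)
 then show ?thesis using tau by (simp add: theta_def powr_minus field_simps)
qed

definition P :: "('a => real) => 'a => real" where "P = cv (\<lambda>z. k z / kap)"

lemma kk: "integrable lborel (\<lambda>z. k z / kap)" "(LBINT z. \<bar>k z / kap\<bar>) = 1"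
 using k_integrable kap_pos by (auto simp: k_nonneg kap_def[symmetric])

lemma P_bbd: "bbd B f ==> bbd B (P f)"
 using cv_bbd[OF kk(1), of B f] unfolding kk(2) P_def by simp

lemma Pi_bbd: "bbd B f ==> bbd B ((P ^^ i) f)"
 by (induction i) (auto intro: P_bbd)

lemma P_diff: "bbd A f ==> bbd B g ==> P (\<lambda>x. f x - g x) = (\<lambda>x. P f x - P g x)"
 unfolding P_def by (rule ext, rule cv_diff[OF kk(1)])

lemma P_add: "bbd A f ==> bbd B g ==> P (\<lambda>x. f x + g x) = (\<lambda>x. P f x + P g x)"
 unfolding P_def by (rule ext, rule cv_add[OF kk(1)])

lemma P_scale: "P (\<lambda>x. c * f x) = (\<lambda>x. c * P f x)"
 unfolding P_def by (rule ext, rule cv_scale)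

lemma P_shift: "P (\<lambda>x. f (x + h)) = (\<lambda>x. P f (x + h))"
 unfolding P_def by (rule ext, rule cv_shift)

lemma Pi_diff: "bbd A f ==> bbd B g ==> (P ^^ i) (\<lambda>x. f x - g x) = (\<lambda>x. (P ^^ i) f x - (P ^^ i) g x)"
 by (induction i) (auto intro: P_diff Pi_bbd)

lemma Pi_add: "bbd A f ==> bbd B g ==> (P ^^ i) (\<lambda>x. f x + g x) = (\<lambda>x. (P ^^ i) f x + (P ^^ i) g x)"
 by (induction i) (auto intro: P_add Pi_bbd)

lemma Pi_scale: "(P ^^ i) (\<lambda>x. c * f x) = (\<lambda>x. c * (P ^^ i) f x)"
 by (induction i) (auto simp: P_scale)

lemma Pi_shift: "(P ^^ i) (\<lambda>x. f (x + h)) = (\<lambda>x. (P ^^ i) f (x + h))"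
 by (induction i) (auto simp: P_shift)

text \<open>By duality with bounded functions, a bound for the total variation of the difference
  between the laws of the walk after \<open>i\<close> steps from \<open>x + h\<close> and from
  \<open>x\<close>, uniformly in \<open>x\<close>.\<close>

definition sm :: "nat => 'a => real => bool" where
 "sm i h c \<longleftrightarrow> (\<forall>f B. bbd B f --> (\<forall>x. \<bar>(P ^^ i) f (x + h) - (P ^^ i) f x\<bar> \<le> c * B))"

lemma smD: "sm i h c ==> bbd B f ==> \<bar>(P ^^ i) f (x + h) - (P ^^ i) f x\<bar> \<le> c * B"
 by (auto simp: sm_def)

lemma sm_mono: "sm i h c ==> c \<le> c' ==> sm i h c'"
 unfolding sm_def by (meson bbd_nonneg mult_right_mono order_trans)

lemma sm_2: "sm i h 2"
 unfolding sm_def using Pi_bbd bbd_le by (smt (verit, ccfv_threshold))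

text \<open>A jump of the walk splits into a Lipschitz part of probability \<open>p\<close> and a remainder; after
 \<open>N\<close> jumps the remainder alone has been used with probability at most \<open>(1 - p) ^ N\<close>.\<close>

lemma sm_step:
 assumes \<rho>: "tau \<le> \<rho>" "3 * \<rho> \<le> 1" and M: "sm M h a" and a: "0 \<le> a"
 shows "sm (N + M) h (exp (- bump_rate * theta * \<rho> powr (- 2 * s) * real N) * a + 4 * 6 powr n * norm h / \<rho>)"
proof -
 have r: "0 < \<rho>" using \<rho> tau by simp
 define m where "m = (LBINT (z::'a). annulus_bump \<rho> z)"
 define c where "c = lam * (3 * \<rho>) powr (- n - 2 * s)"
 define p where "p = c * m / kap"
 define b where "b = (\<lambda>z::'a. annulus_bump \<rho> z / m)"
 define q where "q = (\<lambda>z::'a. k z / kap - p * b z)"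
 define L where "L = 4 * 6 powr n * norm h / \<rho>"
 have "0 < unit_ball_vol n * (\<rho> / 2) ^ DIM('a) / 2" using r n_pos by simp
 then have m: "0 < m" "unit_ball_vol n * (\<rho> / 2) ^ DIM('a) / 2 \<le> m"
  using annulus_bump_mass[OF r, where 'a='a] by (auto simp: m_def)
 have c: "0 \<le> c" using lam by (simp add: c_def)
 have p: "0 \<le> p" "p \<le> 1" using bump_le_kap[OF \<rho>] kap_pos c m by (auto simp: p_def c_def m_def)
 have b0: "0 \<le> b z" for z using m annulus_bump_range(1)[of \<rho> z] by (simp add: b_def)
 have b_int: "integrable lborel b" "(LBINT z. \<bar>b z\<bar>) = 1"
  using annulus_bump_integrable[OF r, where 'a='a] m
  by (simp_all only: abs_of_nonneg[OF b0]) (simp_all add: b_def m_def[symmetric])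
 have q0: "0 \<le> q z" for z
  using k_ge_bump[OF \<rho>, of z] kap_pos m by (simp add: q_def p_def b_def c_def divide_right_mono)
 have q_int: "integrable lborel q" using kk(1) b_int by (auto simp: q_def)
 have "(LBINT z. \<bar>q z\<bar>) = (LBINT z. \<bar>k z / kap\<bar>) - p * (LBINT z. \<bar>b z\<bar>)"
 proof -
  have "\<bar>q z\<bar> = \<bar>k z / kap\<bar> - p * \<bar>b z\<bar>" for z
   using q0[of z] b0[of z] k_nonneg[of z] kap_pos by (simp add: q_def)
  then have "(LBINT z. \<bar>q z\<bar>) = (LBINT z. \<bar>k z / kap\<bar> - p * \<bar>b z\<bar>)" by simp
  also have "\<dots> = (LBINT z. \<bar>k z / kap\<bar>) - (LBINT z. p * \<bar>b z\<bar>)"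
   using kk(1) b_int(1) by (intro bochner_diff integrable_abs integrable_mult_right)
  finally show ?thesis by simp
 qed
 then have q_mass: "(LBINT z. \<bar>q z\<bar>) = 1 - p" unfolding kk(2) b_int(2) by simp
 have P: "P f x = p * cv b f x + cv q f x" if "bbd B f" for B f x
  using cv_split[OF b_int(1) q_int that, of p x] by (simp add: P_def q_def)
 have bump: "\<bar>cv b f (x + h) - cv b f x\<bar> \<le> L * B" if f: "bbd B f" for B f x
 proof -
  have "(LBINT z. \<bar>b (z - h) - b z\<bar>) = (LBINT z. \<bar>annulus_bump \<rho> (z - h) - annulus_bump \<rho> z\<bar>) / m"
   using m by (simp add: b_def diff_divide_distrib[symmetric] abs_divide)
  also have "\<dots> \<le> (norm h / \<rho> * (2 * (unit_ball_vol n * (3 * \<rho>) ^ DIM('a)))) / m"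
   using annulus_bump_increment[OF r, of h] m by (intro divide_right_mono) auto
  also have "\<dots> \<le> (norm h / \<rho> * (2 * (unit_ball_vol n * (3 * \<rho>) ^ DIM('a)))) / (unit_ball_vol n * (\<rho> / 2) ^ DIM('a) / 2)"
   using m r n_pos by (intro divide_left_mono) auto
  also have "\<dots> = L"
  proof -
   define w where "w = unit_ball_vol n * (\<rho> / 2) ^ DIM('a)"
   have w: "w > 0" using r n_pos by (simp add: w_def)
   have "(3 * \<rho>) powr n = 6 powr n * (\<rho> / 2) powr n" using r by (simp add: powr_mult[symmetric])
   then have "unit_ball_vol n * (3 * \<rho>) ^ DIM('a) = 6 powr n * w"
    using pow_DIM[of "3 * \<rho>"] pow_DIM[of "\<rho> / 2"] r unfolding w_def by simp
   then show ?thesis using w unfolding w_def[symmetric] L_def by (simp add: field_simps)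
  qed
  finally have "(LBINT z. \<bar>b (z - h) - b z\<bar>) \<le> L" .
  then show ?thesis using cv_increment[OF b_int(1) f, of x h] bbd_nonneg[OF f]
   by (meson mult_right_mono order_trans)
 qed
 have L: "0 \<le> L" using r by (simp add: L_def)
 have main: "sm (N + M) h ((1 - p) ^ N * a + L)"
 proof (induction N)
  case 0
  show ?case using L by (auto intro: sm_mono[OF M])
 next
  case (Suc N)
  show ?case unfolding sm_def
  proof (intro allI impI)
   fix f :: "'a => real" and B x assume f: "bbd B f"
   note B = bbd_nonneg[OF f]
   have fb: "bbd B (cv b f)" using cv_bbd[OF b_int(1) f] b_int by simp
   have fq: "bbd ((1 - p) * B) (cv q f)" using cv_bbd[OF q_int f] q_mass by simp
   have Pf: "P f = (\<lambda>x. p * cv b f x + cv q f x)" by (rule ext) (rule P[OF f])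
   have "(P ^^ (Suc N + M)) f = (P ^^ (N + M)) (P f)" by (simp add: funpow_swap1)
   also have "\<dots> = (\<lambda>x. p * (P ^^ (N + M)) (cv b f) x + (P ^^ (N + M)) (cv q f) x)"
    unfolding Pf using Pi_add[OF bbd_scale[OF fb] fq] by (simp add: Pi_scale)
   finally have E: "(P ^^ (Suc N + M)) f = (\<lambda>x. p * (P ^^ (N + M)) (cv b f) x + (P ^^ (N + M)) (cv q f) x)" .
   have 1: "\<bar>(P ^^ (N + M)) (cv b f) (x + h) - (P ^^ (N + M)) (cv b f) x\<bar> \<le> L * B"
   proof -
    have d: "bbd (L * B) (\<lambda>x. cv b f (x + h) - cv b f x)"
     using bump[OF f] bbd_measurable[OF fb] by (intro bbdI) auto
    have "(P ^^ (N + M)) (\<lambda>x. cv b f (x + h) - cv b f x) = (\<lambda>x. (P ^^ (N + M)) (cv b f) (x + h) - (P ^^ (N + M)) (cv b f) x)"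
     using Pi_diff[OF bbd_shift[OF fb] fb] by (simp add: Pi_shift)
    then show ?thesis using bbd_le[OF Pi_bbd[OF d]] by metis
   qed
   have 2: "\<bar>(P ^^ (N + M)) (cv q f) (x + h) - (P ^^ (N + M)) (cv q f) x\<bar> \<le> ((1 - p) ^ N * a + L) * ((1 - p) * B)"
    using smD[OF Suc fq] .
   have "\<bar>(P ^^ (Suc N + M)) f (x + h) - (P ^^ (Suc N + M)) f x\<bar>
     = \<bar>p * ((P ^^ (N + M)) (cv b f) (x + h) - (P ^^ (N + M)) (cv b f) x) + ((P ^^ (N + M)) (cv q f) (x + h) - (P ^^ (N + M)) (cv q f) x)\<bar>"
    unfolding E by (simp add: algebra_simps)
   also have "\<dots> \<le> p * (L * B) + ((1 - p) ^ N * a + L) * ((1 - p) * B)"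
    using mult_left_mono[OF 1 p(1)] 2 p(1) by (intro order_trans[OF abs_triangle_ineq] add_mono) (auto simp: abs_mult)
   also have "\<dots> = ((1 - p) ^ Suc N * a + L) * B" by (simp add: algebra_simps)
   finally show "\<bar>(P ^^ (Suc N + M)) f (x + h) - (P ^^ (Suc N + M)) f x\<bar> \<le> ((1 - p) ^ Suc N * a + L) * B" .
  qed
 qed
 have "bump_rate * theta * \<rho> powr (- 2 * s) \<le> p"
  using mult_right_mono[OF bump_mass_rate[OF \<rho>(1)], of theta] theta_pos kap_pos
  by (simp add: p_def c_def m_def theta_def mult_ac)
 then have "1 - p \<le> exp (- bump_rate * theta * \<rho> powr (- 2 * s))"
  using exp_ge_add_one_self[of "- bump_rate * theta * \<rho> powr (- 2 * s)"] by linarith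
 then have "(1 - p) ^ N \<le> exp (- bump_rate * theta * \<rho> powr (- 2 * s)) ^ N"
  using p by (intro power_mono) auto
 also have "\<dots> = exp (- bump_rate * theta * \<rho> powr (- 2 * s) * real N)"
  by (simp add: exp_of_nat_mult[symmetric] mult_ac)
 finally have "(1 - p) ^ N * a + L \<le> exp (- bump_rate * theta * \<rho> powr (- 2 * s) * real N) * a + L"
  using a by (intro add_mono mult_right_mono) auto
 then show ?thesis using sm_mono[OF main] by (simp add: L_def)
qed

lemma mu_pos: "0 < mu" using bump_rate_pos by (simp add: bump_scale_def)
lemma csm_pos: "0 < csm" using mu_pos by (auto simp: smoothing_constant_def less_max_iff_disj)

lemma mu_powr: "mu powr (2 * s) \<le> bump_rate / 12"
proof -
 have "mu powr (2 * s) \<le> ((bump_rate / 12) powr (1 / (2 * s))) powr (2 * s)"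
  using mu_pos s by (intro powr_mono2) (auto simp: bump_scale_def)
 then show ?thesis using s bump_rate_pos by (simp add: powr_powr)
qed

text \<open>Induction by halving. With \<open>t = (i + 1) * theta\<close>, one half of the steps is
  used to meet a Lipschitz jump. If none occurs, which has probability at most \<open>1 / 4\<close>,
  the induction hypothesis for the other half costs a factor of at most 2. Hence at most half of the
  bound comes from there, and the Lipschitz part takes up the other half.\<close>

lemma smoothing:
 assumes "tau \<le> norm h" "real (Suc i) * theta \<le> 4"
 shows "sm i h (csm * norm h * (real (Suc i) * theta) powr (- 1 / (2 * s)))"
 using assms(2)
proof (induction i rule: less_induct)
 case (less i)
 define a where "a = 1 / (2 * s)"
 define t where "t = real (Suc i) * theta"
 have a: "0 < a" "a < 1" "2 * s * a = 1" using s by (auto simp: a_def)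
 have t: "0 < t" "t \<le> 4" using theta_pos less.prems by (auto simp: t_def)
 have h: "0 < norm h" using assms(1) tau by linarith
 have "sm i h (csm * norm h * t powr (- a))"
 proof (cases "i = 0 \<or> mu * t powr a < tau")
  \<comment> \<open>Here there is no step to spare, or the tent would reach below the truncation. In
    both cases \<open>norm h \<ge> tau\<close> is so large in comparison with the time that the
    trivial bound 2 suffices.\<close>
  case True
  have "2 \<le> csm * norm h * t powr (- a)"
  proof (cases "mu * t powr a < tau")
   case True
   then have "mu * t powr a \<le> norm h" using assms by simp
   then have "mu \<le> norm h * t powr (- a)" using t by (simp add: powr_minus field_simps)
   then have "2 / mu * mu \<le> csm * (norm h * t powr (- a))"
    using mu_pos csm_pos by (intro mult_mono) (auto simp: smoothing_constant_def)
   then show ?thesis using mu_pos by (simp add: mult_ac)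
  next
   case False
   then have "t = theta" using \<open>i = 0 \<or> mu * t powr a < tau\<close> by (simp add: t_def)
   then have "t powr a \<le> (tau powr (2 * s) / bump_rate) powr a"
    using theta_le t a by (intro powr_mono2) auto
   also have "\<dots> = tau / bump_rate powr a" using tau bump_rate_pos a by (simp add: powr_divide powr_powr)
   also have "\<dots> \<le> norm h / bump_rate powr a" using assms bump_rate_pos by (intro divide_right_mono) auto
   finally have "bump_rate powr a \<le> norm h * t powr (- a)" using t bump_rate_pos by (simp add: powr_minus field_simps)
   then have "2 / bump_rate powr a * bump_rate powr a \<le> csm * (norm h * t powr (- a))"
    using bump_rate_pos csm_pos by (intro mult_mono) (auto simp: smoothing_constant_def a_def)
   then show ?thesis using bump_rate_pos by (simp add: mult_ac)
  qed
  then show ?thesis by (rule sm_mono[OF sm_2])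
 next
  case False
  define \<rho> where "\<rho> = mu * t powr a"
  have i: "0 < i" using False by simp
  have "t powr a \<le> 4 powr 1" using t a
   by (intro order_trans[OF powr_mono2[of a t 4] powr_mono]) auto
  then have "mu * t powr a \<le> 1 / 12 * 4" using mu_pos by (intro mult_mono) (auto simp: bump_scale_def)
  then have \<rho>: "tau \<le> \<rho>" "3 * \<rho> \<le> 1" using False by (auto simp: \<rho>_def)
  have r: "0 < \<rho>" using mu_pos t by (simp add: \<rho>_def)
  define M where "M = i div 2"
  define N where "N = i - M"
  have iM: "M < i" "N + M = i" using i by (auto simp: M_def N_def)
  have "2 * Suc M \<ge> Suc i" by (simp add: M_def)
  then have "2 * real (Suc M) \<ge> real (Suc i)" by linarith
  then have tM: "t / 2 \<le> real (Suc M) * theta" using theta_pos by (simp add: t_def)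
  have "real (Suc M) * theta \<le> t" using iM theta_pos by (simp add: t_def)
  then have "sm M h (csm * norm h * (real (Suc M) * theta) powr (- a))"
   using less.IH[OF iM(1)] t by (simp add: a_def)
  moreover have "(real (Suc M) * theta) powr (- a) \<le> 2 * t powr (- a)"
  proof -
   have "(real (Suc M) * theta) powr (- a) \<le> (t / 2) powr (- a)" using tM t a by (intro powr_mono2') auto
   also have "\<dots> = 2 powr a * t powr (- a)" using t by (simp add: powr_divide powr_minus field_simps)
   also have "\<dots> \<le> 2 powr 1 * t powr (- a)" using a by (intro mult_right_mono powr_mono) auto
   finally show ?thesis by simp
  qed
  then have "csm * norm h * (real (Suc M) * theta) powr (- a) \<le> csm * norm h * (2 * t powr (- a))"
   using csm_pos by (intro mult_left_mono) auto
  ultimately have smM: "sm M h (csm * norm h * (2 * t powr (- a)))" by (rule sm_mono)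
  have "4 * N \<ge> Suc i" using i by (simp add: N_def M_def)
  then have "4 * real N \<ge> real (Suc i)" by linarith
  then have tN: "t \<le> 4 * (theta * real N)" using theta_pos by (simp add: t_def)
  have "\<rho> powr (- 2 * s) = mu powr (- 2 * s) * t powr (- (2 * s * a))"
   using mu_pos t by (simp add: \<rho>_def powr_mult powr_powr mult_ac)
  then have e: "\<rho> powr (- 2 * s) = mu powr (- 2 * s) / t" unfolding a using t by (simp add: powr_minus field_simps)
  have "12 / bump_rate \<le> mu powr (- 2 * s)"
   using mu_powr mu_pos bump_rate_pos by (simp add: powr_minus field_simps)
  then have "12 / bump_rate / t \<le> \<rho> powr (- 2 * s)"
   unfolding e using t by (intro divide_right_mono) auto
  then have "12 / bump_rate / t * (bump_rate * (theta * real N)) \<le> \<rho> powr (- 2 * s) * (bump_rate * (theta * real N))"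
   using bump_rate_pos theta_pos by (intro mult_right_mono) auto
  then have "12 * (theta * real N) / t \<le> bump_rate * theta * \<rho> powr (- 2 * s) * real N"
   using bump_rate_pos by (simp add: mult_ac)
  moreover have "3 \<le> 12 * (theta * real N) / t" using tN t by (simp add: field_simps)
  ultimately have "exp (- (bump_rate * theta * \<rho> powr (- 2 * s) * real N)) \<le> exp (- 3)" by simp
  also have "exp (- 3 :: real) \<le> 1 / 4"
   using exp_ge_add_one_self[of "3::real"] by (simp add: exp_minus field_simps)
  finally have ex: "exp (- bump_rate * theta * \<rho> powr (- 2 * s) * real N) \<le> 1 / 4" by simp
  have "sm (N + M) h (exp (- bump_rate * theta * \<rho> powr (- 2 * s) * real N) * (csm * norm h * (2 * t powr (- a))) + 4 * 6 powr n * norm h / \<rho>)"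
   using csm_pos by (intro sm_step[OF \<rho> smM]) auto
  moreover have "exp (- bump_rate * theta * \<rho> powr (- 2 * s) * real N) * (csm * norm h * (2 * t powr (- a))) \<le> 1 / 4 * (csm * norm h * (2 * t powr (- a)))"
   using ex csm_pos by (intro mult_right_mono) auto
  moreover have "4 * 6 powr n * norm h / \<rho> \<le> csm / 2 * norm h * t powr (- a)"
  proof -
   have "4 * 6 powr n * norm h / \<rho> = (8 * 6 powr n / mu) / 2 * (norm h * t powr (- a))"
    using mu_pos t by (simp add: \<rho>_def powr_minus field_simps)
   also have "\<dots> \<le> csm / 2 * (norm h * t powr (- a))"
    by (intro mult_right_mono divide_right_mono) (auto simp: smoothing_constant_def)
   finally show ?thesis by (simp add: mult_ac)
  qed
  ultimately show ?thesis unfolding iM(2) by (elim sm_mono) linarith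
 qed
 then show ?case by (simp add: t_def a_def)
qed

end

section \<open>Summation over time and the resolvent\<close>

lemma measurable_case_prod_compose:
 assumes F: "case_prod F \<in> borel_measurable borel2"
  and [measurable]: "f \<in> M \<rightarrow>\<^sub>M borel" "g \<in> M \<rightarrow>\<^sub>M borel"
 shows "(\<lambda>x. F (f x) (g x)) \<in> borel_measurable M"
proof -
 have "(\<lambda>x. case_prod F (f x, g x)) \<in> borel_measurable M"
  by (rule measurable_compose[OF _ F]) measurable
 then show ?thesis by simp
qed

lemma powr_step_le:
 fixes x p :: real
 assumes x: "0 < x" and p: "p < 1" "p \<noteq> 0"
 shows "(x + 1) powr (p - 1) \<le> ((x + 1) powr p - x powr p) / p"
proof -
 have "\<exists>\<xi>. x < \<xi> \<and> \<xi> < x + 1 \<and> (x + 1) powr p - x powr p = (x + 1 - x) * (p * \<xi> powr (p - 1))"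
  using x by (intro MVT2) (auto intro!: derivative_eq_intros simp: powr_diff)
 then obtain \<xi> where \<xi>: "x < \<xi>" "\<xi> < x + 1" "(x + 1) powr p - x powr p = p * \<xi> powr (p - 1)" by auto
 have "(x + 1) powr (p - 1) \<le> \<xi> powr (p - 1)" using \<xi> x p by (intro powr_mono2') auto
 then show ?thesis using \<xi>(3) p by simp
qed

text \<open>Comparison with the integral of a decreasing power. It is used with
  \<open>p = 1 - a > 0\<close> and with \<open>p = 1 - 2 * a < 0\<close>; in the latter case the
  lower limit \<open>J\<close> governs the right-hand side.\<close>

lemma powr_sum_le:
 assumes p: "p < 1" "p \<noteq> 0" and J: "1 \<le> J" "J \<le> N"
 shows "(\<Sum>i=J..<N. real (Suc i) powr (p - 1)) \<le> (real N powr p - real J powr p) / p"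
 using J(2)
proof (induction N rule: dec_induct)
 case (step N)
 have "(\<Sum>i=J..<Suc N. real (Suc i) powr (p - 1)) = (\<Sum>i=J..<N. real (Suc i) powr (p - 1)) + (real N + 1) powr (p - 1)"
  using step by (simp add: add.commute)
 also have "\<dots> \<le> (real N powr p - real J powr p) / p + ((real N + 1) powr p - real N powr p) / p"
  using step J p by (intro add_mono powr_step_le) auto
 also have "\<dots> = (real (Suc N) powr p - real J powr p) / p"
  by (simp add: add_divide_distrib[symmetric] add.commute)
 finally show ?case .
qed simp

lemma powr_sum_le0:
 assumes p: "p < 1" "0 < p"
 shows "(\<Sum>i<N. real (Suc i) powr (p - 1)) \<le> real N powr p / p"
proof (cases "N = 0")
 case False
 have "(\<Sum>i<N. real (Suc i) powr (p - 1)) = 1 + (\<Sum>i=1..<N. real (Suc i) powr (p - 1))"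
  using False by (subst atLeast0LessThan[symmetric], subst sum.atLeast_Suc_lessThan) auto
 also have "\<dots> \<le> 1 + (real N powr p - real 1 powr p) / p"
  using p False by (intro add_left_mono powr_sum_le) auto
 also have "\<dots> \<le> real N powr p / p" using p by (simp add: field_simps)
 finally show ?thesis .
qed simp

text \<open>Discrete form of \<open>\<integral> t powr - a * min 1 (M * t powr - a) dt \<lesssim> M powr (1 / a - 1)\<close>,
 split at the time \<open>T\<close> comparable to \<open>M powr (1 / a)\<close>.\<close>

lemma time_sum:
 fixes a \<theta> T M A B m :: real
 assumes a: "1 / 2 < a" "a < 1" and \<theta>: "0 < \<theta>" "\<theta> \<le> T" and nn: "0 \<le> A" "0 \<le> B" "0 \<le> m" "0 \<le> M"
  and f: "!!i. i < N ==> f i \<le> A * m * (real (Suc i) * \<theta>) powr (- a)"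
  and g: "!!i. i < N ==> f i \<le> B * m * M * (real (Suc i) * \<theta>) powr (- 2 * a)"
 shows "\<theta> * (\<Sum>i<N. f i) \<le> A * m * T powr (1 - a) / (1 - a) + B * m * M * (T / 2) powr (1 - 2 * a) / (2 * a - 1)"
proof -
 define J where "J = min N (nat \<lfloor>T / \<theta>\<rfloor>)"
 have T: "1 \<le> T / \<theta>" using \<theta> by simp
 have fl: "real (nat \<lfloor>T / \<theta>\<rfloor>) \<le> T / \<theta>" "T / \<theta> < real (nat \<lfloor>T / \<theta>\<rfloor>) + 1" "1 \<le> real (nat \<lfloor>T / \<theta>\<rfloor>)"
 proof -
  have "1 \<le> \<lfloor>T / \<theta>\<rfloor>" using T by (simp add: le_floor_iff)
  then show "real (nat \<lfloor>T / \<theta>\<rfloor>) \<le> T / \<theta>" "T / \<theta> < real (nat \<lfloor>T / \<theta>\<rfloor>) + 1" "1 \<le> real (nat \<lfloor>T / \<theta>\<rfloor>)"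
   by linarith+
 qed
 have "real J \<le> T / \<theta>" using fl(1) by (auto simp: J_def min_def)
 then have J: "\<theta> * real J \<le> T" using \<theta> by (simp add: field_simps)
 have "\<theta> * (\<Sum>i<J. f i) \<le> \<theta> * (\<Sum>i<J. A * m * (\<theta> powr (- a) * real (Suc i) powr ((1 - a) - 1)))"
 proof (intro mult_left_mono sum_mono)
  fix i assume "i \<in> {..<J}"
  then have "f i \<le> A * m * (real (Suc i) * \<theta>) powr (- a)" by (intro f) (simp add: J_def)
  then show "f i \<le> A * m * (\<theta> powr (- a) * real (Suc i) powr ((1 - a) - 1))"
   using \<theta> by (simp add: powr_mult mult_ac)
 qed (use \<theta> in simp)
 also have "\<dots> = A * m * (\<theta> powr (1 - a) * (\<Sum>i<J. real (Suc i) powr ((1 - a) - 1)))"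
  using \<theta> by (simp add: sum_distrib_left powr_diff powr_minus field_simps)
 also have "\<dots> \<le> A * m * (\<theta> powr (1 - a) * (real J powr (1 - a) / (1 - a)))"
  using a nn by (intro mult_left_mono powr_sum_le0) auto
 also have "\<dots> = A * m * ((\<theta> * real J) powr (1 - a) / (1 - a))" using \<theta> by (simp add: powr_mult)
 also have "\<dots> \<le> A * m * (T powr (1 - a) / (1 - a))"
  using J a nn \<theta> by (intro mult_left_mono divide_right_mono powr_mono2) auto
 finally have 1: "\<theta> * (\<Sum>i<J. f i) \<le> A * m * T powr (1 - a) / (1 - a)" by simp
 have rhs2: "0 \<le> B * m * M * (T / 2) powr (1 - 2 * a) / (2 * a - 1)" using nn a by simp
 have 2: "\<theta> * (\<Sum>i=J..<N. f i) \<le> B * m * M * (T / 2) powr (1 - 2 * a) / (2 * a - 1)"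
 proof (cases "J = N")
  case True then show ?thesis using rhs2 by simp
 next
  case False
  then have Jd: "J = nat \<lfloor>T / \<theta>\<rfloor>" "J \<le> N" by (auto simp: J_def)
  have J1: "1 \<le> J" using fl(3) by (simp add: Jd(1))
  have "T / \<theta> < 2 * real J" using fl unfolding Jd(1) by linarith
  then have TJ: "T / 2 \<le> \<theta> * real J" using \<theta> by (simp add: field_simps)
  have "\<theta> * (\<Sum>i=J..<N. f i) \<le> \<theta> * (\<Sum>i=J..<N. B * m * M * (\<theta> powr (- 2 * a) * real (Suc i) powr ((1 - 2 * a) - 1)))"
  proof (intro mult_left_mono sum_mono)
   fix i assume "i \<in> {J..<N}"
   then have "f i \<le> B * m * M * (real (Suc i) * \<theta>) powr (- 2 * a)" by (intro g) simp
   then show "f i \<le> B * m * M * (\<theta> powr (- 2 * a) * real (Suc i) powr ((1 - 2 * a) - 1))"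
    using \<theta> by (simp add: powr_mult mult_ac)
  qed (use \<theta> in simp)
  also have "\<dots> = B * m * M * (\<theta> powr (1 - 2 * a) * (\<Sum>i=J..<N. real (Suc i) powr ((1 - 2 * a) - 1)))"
   using \<theta> by (simp add: sum_distrib_left powr_diff powr_minus field_simps)
  also have "\<dots> \<le> B * m * M * (\<theta> powr (1 - 2 * a) * ((real N powr (1 - 2 * a) - real J powr (1 - 2 * a)) / (1 - 2 * a)))"
   using a nn J1 Jd by (intro mult_left_mono powr_sum_le) auto
  also have "\<dots> \<le> B * m * M * (\<theta> powr (1 - 2 * a) * (real J powr (1 - 2 * a) / (2 * a - 1)))"
  proof -
   have "(real N powr (1 - 2 * a) - real J powr (1 - 2 * a)) / (1 - 2 * a) = (real J powr (1 - 2 * a) - real N powr (1 - 2 * a)) / (2 * a - 1)"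
    using a by (simp add: field_simps)
   also have "\<dots> \<le> real J powr (1 - 2 * a) / (2 * a - 1)" using a by (intro divide_right_mono) auto
   finally show ?thesis using nn by (intro mult_left_mono) auto
  qed
  also have "\<dots> = B * m * M * ((\<theta> * real J) powr (1 - 2 * a) / (2 * a - 1))" using \<theta> by (simp add: powr_mult)
  also have "\<dots> \<le> B * m * M * ((T / 2) powr (1 - 2 * a) / (2 * a - 1))"
   using TJ a nn \<theta> by (intro mult_left_mono divide_right_mono powr_mono2') auto
  finally show ?thesis by simp
 qed
 have "(\<Sum>i<N. f i) = (\<Sum>i<J. f i) + (\<Sum>i=J..<N. f i)"
  by (subst atLeast0LessThan[symmetric], subst sum.atLeastLessThan_concat[of 0 J N f, symmetric])
    (auto simp: J_def atLeast0LessThan)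
 then show ?thesis using 1 2 by (simp add: distrib_left)
qed

lemma integrable_product:
 fixes q b :: "'a::euclidean_space => real"
 assumes q: "integrable lborel q" and b: "integrable lborel b"
 shows "integrable lborel2 (\<lambda>(z, y). q z * b y)"
proof (rule lborel_pair.Fubini_integrable)
 note [measurable] = borel_measurable_integrable[OF q] borel_measurable_integrable[OF b]
 show "(\<lambda>(z, y). q z * b y) \<in> borel_measurable lborel2" by measurable
 show "integrable lborel (\<lambda>x. \<integral>y. norm (case (x, y) of (z, y) => q z * b y) \<partial>lborel)"
  using q by (simp add: abs_mult)
 show "AE x in lborel. integrable lborel (\<lambda>y. case (x, y) of (z, y) => q z * b y)"
  using b by simp
qed

lemma cv_Fubini:
 fixes \<Psi> :: "'a::euclidean_space => 'a => real"
 assumes q: "integrable lborel q" and b: "integrable lborel b"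
  and \<Psi>: "case_prod \<Psi> \<in> borel_measurable borel2" and le: "!!y x. \<bar>\<Psi> y x\<bar> \<le> b y"
 shows "cv q (\<lambda>x. \<integral>y. \<Psi> y x \<partial>lborel) x = (LBINT y. cv q (\<Psi> y) x)"
  and "case_prod (\<lambda>y. cv q (\<Psi> y)) \<in> borel_measurable borel2"
proof -
 note [measurable] = borel_measurable_integrable[OF q] measurable_case_prod_compose[OF \<Psi>]
 have i: "integrable lborel2 (\<lambda>(z, y). q z * \<Psi> y (x + z))"
 proof (rule bochner_bound[OF integrable_product[OF q b]])
  show "(\<lambda>(z, y). q z * \<Psi> y (x + z)) \<in> borel_measurable lborel2" by measurable
  show "AE p in lborel2. norm (case p of (z, y) => q z * \<Psi> y (x + z)) \<le> norm (case p of (z, y) => q z * b y)"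
   using le by (auto simp: abs_mult split: prod.split intro!: AE_I2 mult_left_mono intro: order_trans[OF le abs_ge_self])
 qed
 have "cv q (\<lambda>x. \<integral>y. \<Psi> y x \<partial>lborel) x = (LBINT z. (LBINT y. q z * \<Psi> y (x + z)))"
  by (simp add: cv_def)
 also have "\<dots> = (LBINT y. (LBINT z. q z * \<Psi> y (x + z)))"
  using lborel_pair.Fubini_integral[OF i] by simp
 finally show "cv q (\<lambda>x. \<integral>y. \<Psi> y x \<partial>lborel) x = (LBINT y. cv q (\<Psi> y) x)"
  by (simp add: cv_def)
 have "(\<lambda>p. \<integral>z. q z * \<Psi> (fst p) (snd p + z) \<partial>lborel) \<in> borel_measurable borel2"
  by (rule lborel.borel_measurable_lebesgue_integral) measurable
 then show "case_prod (\<lambda>y. cv q (\<Psi> y)) \<in> borel_measurable borel2"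
  by (simp add: cv_def split_beta')
qed

definition time_constant :: "real => real => real => real" where
 "time_constant n s lam = smoothing_constant n s lam * (2 / (1 - 1 / (2 * s)))"

text \<open>\<open>\<beta>\<close> makes the splitting time \<open>\<beta> * M powr (2 * s)\<close>
  at least as long as one step \<open>theta\<close>, as the discrete time sum requires.\<close>

definition double_time_constant :: "real => real => real => real" where
 "double_time_constant n s lam = (let a = 1 / (2 * s); \<beta> = max 1 (1 / bump_constant n s lam); c = smoothing_constant n s lam
   in 2 * c * \<beta> powr (1 - a) / (1 - a) + 4 * c\<^sup>2 * (\<beta> / 2) powr (1 - 2 * a) / (2 * a - 1))"

context near_kernel begin

text \<open>The number of jumps during one unit of time: long enough for the resolvent to lose a
  factor 2, short enough for the smoothing lemma, which stops at time 4.\<close>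

definition steps :: nat where "steps = nat \<lceil>1 / theta\<rceil>"

lemma steps: assumes "theta \<le> 1" shows "1 \<le> real steps * theta" "real (Suc steps) * theta \<le> 3"
proof -
 have "1 / theta \<le> real steps" "real steps < 1 / theta + 1"
  using theta_pos by (auto simp: steps_def) linarith+
 then show "1 \<le> real steps * theta" "real (Suc steps) * theta \<le> 3"
  using theta_pos assms by (auto simp: field_simps)
qed

lemma exponent: "1 / 2 < 1 / (2 * s)" "1 / (2 * s) < 1" using s by (auto simp: field_simps)

abbreviation "C1 \<equiv> time_constant n s lam"
abbreviation "C2 \<equiv> double_time_constant n s lam"

lemma C1_pos: "0 < C1" using csm_pos exponent by (simp add: time_constant_def)
lemma C2_nonneg: "0 \<le> C2" using csm_pos exponent by (simp add: double_time_constant_def Let_def)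

text \<open>Summing the smoothing bound over one unit of time amounts to integrating
  \<open>t powr (- 1 / (2 * s))\<close> from 0, which is finite since
  \<open>s > 1 / 2\<close>.\<close>

lemma sum_increment:
 assumes th: "theta \<le> 1" and h: "tau \<le> norm h" and f: "bbd B f"
 shows "theta * (\<Sum>i<steps. \<bar>(P ^^ i) f (x + h) - (P ^^ i) f x\<bar>) \<le> C1 * norm h * B"
proof -
 define a where "a = 1 / (2 * s)"
 have a: "0 < a" "a < 1" using exponent s by (auto simp: a_def)
 note B = bbd_nonneg[OF f]
 have "theta * (\<Sum>i<steps. \<bar>(P ^^ i) f (x + h) - (P ^^ i) f x\<bar>)
   \<le> theta * (\<Sum>i<steps. csm * norm h * B * (theta powr (- a) * real (Suc i) powr ((1 - a) - 1)))"
 proof (intro mult_left_mono sum_mono)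
  fix i assume "i \<in> {..<steps}"
  then have "real (Suc i) * theta \<le> real (Suc steps) * theta" using theta_pos by (intro mult_right_mono) auto
  then have "real (Suc i) * theta \<le> 4" using steps[OF th] by simp
  from smD[OF smoothing[OF h this] f, of x]
  show "\<bar>(P ^^ i) f (x + h) - (P ^^ i) f x\<bar> \<le> csm * norm h * B * (theta powr (- a) * real (Suc i) powr ((1 - a) - 1))"
   using theta_pos by (simp add: powr_mult a_def mult_ac)
 qed (use theta_pos in simp)
 also have "\<dots> = csm * norm h * B * (theta powr (1 - a) * (\<Sum>i<steps. real (Suc i) powr ((1 - a) - 1)))"
  using theta_pos by (simp add: sum_distrib_left powr_diff powr_minus field_simps)
 also have "\<dots> \<le> csm * norm h * B * (theta powr (1 - a) * (real steps powr (1 - a) / (1 - a)))"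
  using a csm_pos B by (intro mult_left_mono powr_sum_le0) auto
 also have "\<dots> = csm * norm h * B * ((real steps * theta) powr (1 - a) / (1 - a))"
  using theta_pos by (simp add: powr_mult mult_ac)
 also have "\<dots> \<le> csm * norm h * B * (2 / (1 - a))"
 proof -
  have "real steps * theta \<le> 2"
  proof -
   have "real steps < 1 / theta + 1" using theta_pos by (auto simp: steps_def) linarith
   then show ?thesis using theta_pos th by (auto simp: field_simps)
  qed
  then have "(real steps * theta) powr (1 - a) \<le> (2::real) powr 1"
   using a theta_pos by (intro order_trans[OF powr_mono2 powr_mono]) auto
  then show ?thesis using a csm_pos B by (intro mult_left_mono divide_right_mono) auto
 qed
 finally show ?thesis by (simp add: time_constant_def a_def mult_ac)
qed

text \<open>With \<open>m\<close> and \<open>M\<close> the smaller and the larger length and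
  \<open>a = 1 / (2 * s)\<close>, two bounds compete: smoothing in the shorter increment alone, of
  order \<open>m * t powr (- a)\<close>, and smoothing by each half of the walk in one of the
  increments, of order \<open>m * M * t powr (- 2 * a)\<close>. The latter is not integrable at time
  0, where the former takes over; they cross at times comparable to
  \<open>M powr (2 * s)\<close>.\<close>

lemma sum_second_increment:
 assumes th: "theta \<le> 1" and h: "tau \<le> norm h" and y: "tau \<le> norm y" and f: "bbd B f"
 shows "theta * (\<Sum>i<steps. \<bar>((P ^^ i) f (x + h + y) - (P ^^ i) f (x + h)) - ((P ^^ i) f (x + y) - (P ^^ i) f x)\<bar>)
  \<le> C2 * min (norm h) (norm y) * max (norm h) (norm y) powr (2 * s - 1) * B"
proof -
 define a where "a = 1 / (2 * s)"
 define m where "m = min (norm h) (norm y)"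
 define M where "M = max (norm h) (norm y)"
 define \<beta> where "\<beta> = max 1 (1 / bump_rate)"
 define T where "T = \<beta> * M powr (2 * s)"
 have a: "1 / 2 < a" "a < 1" using exponent by (auto simp: a_def)
 note B = bbd_nonneg[OF f]
 have mM: "tau \<le> m" "m \<le> M" "norm h * norm y = m * M" using h y by (auto simp: m_def M_def min_def max_def)
 have M: "0 < M" "0 < m" using mM tau by auto
 have ae: "2 * s * (1 - a) = 2 * s - 1" "2 * s * (1 - 2 * a) = 2 * s - 2"
  using s by (auto simp: a_def field_simps)
 have beta: "1 \<le> \<beta>" by (simp add: \<beta>_def)
 have "theta \<le> tau powr (2 * s) * (1 / bump_rate)" using theta_le by simp
 also have "\<dots> \<le> M powr (2 * s) * \<beta>"
  using mM tau s bump_rate_pos by (intro mult_mono powr_mono2) (auto simp: \<beta>_def)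
 finally have thT: "theta \<le> T" by (simp add: T_def mult_ac)
 have le4: "real (Suc i) * theta \<le> 4" if "i < steps" for i
 proof -
  have "real (Suc i) * theta \<le> real (Suc steps) * theta" using theta_pos that by (intro mult_right_mono) auto
  then show ?thesis using steps[OF th] by simp
 qed
 let ?d = "\<lambda>i. \<bar>((P ^^ i) f (x + h + y) - (P ^^ i) f (x + h)) - ((P ^^ i) f (x + y) - (P ^^ i) f x)\<bar>"
 have first: "?d i \<le> (2 * csm * B) * m * (real (Suc i) * theta) powr (- a)" if "i < steps" for i
 proof (cases "norm h \<le> norm y")
  case True
  then have m: "m = norm h" by (simp add: m_def)
  have "?d i = \<bar>((P ^^ i) f ((x + y) + h) - (P ^^ i) f (x + y)) - ((P ^^ i) f (x + h) - (P ^^ i) f x)\<bar>"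
   by (simp add: ac_simps)
  also have "\<dots> \<le> csm * norm h * (real (Suc i) * theta) powr (- a) * B + csm * norm h * (real (Suc i) * theta) powr (- a) * B"
   using smD[OF smoothing[OF h le4[OF that]] f, of "x + y"] smD[OF smoothing[OF h le4[OF that]] f, of x]
   unfolding a_def minus_divide_left by linarith
  finally show ?thesis by (simp add: m mult_ac)
 next
  case False
  then have m: "m = norm y" by (simp add: m_def)
  have "?d i \<le> csm * norm y * (real (Suc i) * theta) powr (- a) * B + csm * norm y * (real (Suc i) * theta) powr (- a) * B"
   using smD[OF smoothing[OF y le4[OF that]] f, of "x + h"] smD[OF smoothing[OF y le4[OF that]] f, of x]
   unfolding a_def minus_divide_left by linarith
  then show ?thesis by (simp add: m mult_ac)
 qed
 have second: "?d i \<le> (4 * csm\<^sup>2 * B) * m * M * (real (Suc i) * theta) powr (- 2 * a)" if "i < steps" for i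
 proof -
  \<comment> \<open>\<open>P ^^ i\<close> is split into \<open>P ^^ u\<close> after
    \<open>P ^^ w\<close>: the inner part handles the increment \<open>y\<close>, the outer one the
    increment \<open>h\<close>.\<close>
  define u where "u = i div 2"
  define w where "w = i - u"
  define t where "t = real (Suc i) * theta"
  have t: "0 < t" using theta_pos by (simp add: t_def)
  have uw: "i = u + w" "u < steps" "w < steps" using that by (auto simp: u_def w_def)
  have half: "(real (Suc j) * theta) powr (- a) \<le> 2 * t powr (- a)" if "Suc i \<le> 2 * Suc j" for j
  proof -
   have "real (Suc i) \<le> 2 * real (Suc j)" using that by linarith
   then have "t / 2 \<le> real (Suc j) * theta" using theta_pos by (simp add: t_def)
   then have "(real (Suc j) * theta) powr (- a) \<le> (t / 2) powr (- a)" using t a by (intro powr_mono2') auto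
   also have "\<dots> = 2 powr a * t powr (- a)" using t by (simp add: powr_divide powr_minus field_simps)
   also have "\<dots> \<le> 2 powr 1 * t powr (- a)" using a by (intro mult_right_mono powr_mono) auto
   finally show ?thesis by simp
  qed
  have hu: "(real (Suc u) * theta) powr (- a) \<le> 2 * t powr (- a)" by (rule half) (simp add: u_def)
  have hw: "(real (Suc w) * theta) powr (- a) \<le> 2 * t powr (- a)" by (rule half) (simp add: w_def u_def)
  define F where "F = (\<lambda>x. (P ^^ w) f (x + y) - (P ^^ w) f x)"
  have Fb: "bbd (csm * norm y * (2 * t powr (- a)) * B) F"
  proof (rule bbdI)
   show "F \<in> Borel" using bbd_measurable[OF Pi_bbd[OF f, of w]] by (simp add: F_def)
   fix x
   have "\<bar>F x\<bar> \<le> csm * norm y * (real (Suc w) * theta) powr (- 1 / (2 * s)) * B"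
    unfolding F_def by (rule smD[OF smoothing[OF y le4[OF uw(3)]] f])
   also have "\<dots> \<le> csm * norm y * (2 * t powr (- a)) * B"
    using hw csm_pos B by (intro mult_right_mono mult_left_mono) (auto simp: a_def)
   finally show "\<bar>F x\<bar> \<le> csm * norm y * (2 * t powr (- a)) * B" .
  qed
  have "(P ^^ u) F = (\<lambda>x. (P ^^ i) f (x + y) - (P ^^ i) f x)"
   unfolding F_def uw(1) using Pi_diff[OF bbd_shift[OF Pi_bbd[OF f]] Pi_bbd[OF f]] by (simp add: Pi_shift funpow_add)
  then have "?d i = \<bar>(P ^^ u) F (x + h) - (P ^^ u) F x\<bar>" by simp
  also have "\<dots> \<le> csm * norm h * (real (Suc u) * theta) powr (- 1 / (2 * s)) * (csm * norm y * (2 * t powr (- a)) * B)"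
   by (rule smD[OF smoothing[OF h le4[OF uw(2)]] Fb])
  also have "\<dots> \<le> csm * norm h * (2 * t powr (- a)) * (csm * norm y * (2 * t powr (- a)) * B)"
   using hu csm_pos B by (intro mult_right_mono mult_left_mono) (auto simp: a_def)
  also have "\<dots> = 4 * csm\<^sup>2 * B * (norm h * norm y) * (t powr (- a) * t powr (- a))"
   by (simp add: power2_eq_square)
  also have "t powr (- a) * t powr (- a) = t powr (- 2 * a)" using t by (simp add: powr_add[symmetric])
  finally show ?thesis unfolding mM(3) t_def by (simp add: mult.assoc)
 qed
 have "theta * (\<Sum>i<steps. ?d i) \<le> (2 * csm * B) * m * T powr (1 - a) / (1 - a) + (4 * csm\<^sup>2 * B) * m * M * (T / 2) powr (1 - 2 * a) / (2 * a - 1)"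
  by (rule time_sum) (use a theta_pos thT csm_pos B M first second in auto)
 also have "T powr (1 - a) = \<beta> powr (1 - a) * M powr (2 * s - 1)"
  using M beta by (simp only: T_def powr_mult powr_powr ae)
 also have "(T / 2) powr (1 - 2 * a) = (\<beta> / 2) powr (1 - 2 * a) * M powr (2 * s - 2)"
 proof -
  have "T / 2 = \<beta> / 2 * M powr (2 * s)" by (simp add: T_def)
  then show ?thesis using M beta by (simp only: powr_mult powr_powr ae)
 qed
 also have "(4 * csm\<^sup>2 * B) * m * M * ((\<beta> / 2) powr (1 - 2 * a) * M powr (2 * s - 2)) / (2 * a - 1)
   = (4 * csm\<^sup>2 * B) * m * ((\<beta> / 2) powr (1 - 2 * a) * M powr (2 * s - 1)) / (2 * a - 1)"
 proof -
  have "M * M powr (2 * s - 2) = M powr (2 * s - 1)" using powr_mult_base[of M "2 * s - 2"] M by (simp add: add_diff_eq)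
  moreover have "a * b * M * (c * X) = a * b * (c * (M * X))" for a b c X :: real by simp
  ultimately show ?thesis by simp
 qed
 also have "(2 * csm * B) * m * (\<beta> powr (1 - a) * M powr (2 * s - 1)) / (1 - a)
   + (4 * csm\<^sup>2 * B) * m * ((\<beta> / 2) powr (1 - 2 * a) * M powr (2 * s - 1)) / (2 * a - 1)
  = C2 * m * M powr (2 * s - 1) * B"
 proof -
  have "(2 * c * b) * z * (p * X) / u + (4 * d * b) * z * (r * X) / v = (2 * c * p / u + 4 * d * r / v) * z * X * b"
   for c d b z p r X u v :: real by (simp add: divide_inverse algebra_simps)
  then show ?thesis
   unfolding double_time_constant_def Let_def a_def[symmetric] \<beta>_def[symmetric] by blast
 qed
 finally show ?thesis unfolding m_def M_def .
qed

text \<open>The walk acts under an integral over a parameter; this allows a source in divergence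
  form to be smoothed for one jump \<open>y\<close> at a time.\<close>

lemma Pi_Fubini:
 fixes \<Psi> :: "'a => 'a => real"
 assumes b: "integrable lborel b"
  and \<Psi>: "case_prod \<Psi> \<in> borel_measurable borel2" and le: "!!y x. \<bar>\<Psi> y x\<bar> \<le> b y"
 shows "(P ^^ i) (\<lambda>x. \<integral>y. \<Psi> y x \<partial>lborel) = (\<lambda>x. \<integral>y. (P ^^ i) (\<Psi> y) x \<partial>lborel)
  \<and> case_prod (\<lambda>y. (P ^^ i) (\<Psi> y)) \<in> borel_measurable borel2
  \<and> (\<forall>y x. \<bar>(P ^^ i) (\<Psi> y) x\<bar> \<le> b y)"
proof (induction i)
 case (Suc i)
 have bb: "bbd (b y) (\<Psi> y)" for y
 proof (rule bbdI[OF _ le])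
  have "(\<lambda>x. \<Psi> y x) \<in> Borel" by (rule measurable_case_prod_compose[OF \<Psi>]) simp_all
  then show "\<Psi> y \<in> Borel" by simp
 qed
 have *: "\<bar>(P ^^ Suc i) (\<Psi> y) x\<bar> \<le> b y" for y x using bbd_le[OF Pi_bbd[OF bb]] .
 have "case_prod (\<lambda>y. (P ^^ i) (\<Psi> y)) \<in> borel_measurable borel2" "!!y x. \<bar>(P ^^ i) (\<Psi> y) x\<bar> \<le> b y"
  using Suc by auto
 from cv_Fubini[OF kk(1) b this] show ?case using Suc *
  by (simp add: P_def)
qed (use \<Psi> le in simp)

text \<open>In terms of \<open>P\<close> the equation reads
  \<open>w = (P w + theta * H) / (1 + theta)\<close>, which is iterated \<open>N\<close> times.
  Stopping at a finite \<open>N\<close> with a remainder, instead of summing the full series, keeps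
  the times within the range of the smoothing lemma.\<close>

lemma resolvent_representation:
 assumes w: "bbd W w" and H: "bbd Z H" and eq: "!!x. w x + 2 * (LBINT z. (w x - w (x + z)) * k z) = H x"
 shows "w = (\<lambda>x. (1 / (1 + theta)) ^ N * (P ^^ N) w x + theta * (\<Sum>i<N. (1 / (1 + theta)) ^ Suc i * (P ^^ i) H x))"
proof (induction N)
 case (Suc N)
 define q where "q = 1 / (1 + theta)"
 have "w x = q * (P w x + theta * H x)" for x
 proof -
  have "(LBINT z. (w x - w (x + z)) * k z) = (LBINT z. w x * k z - k z * w (x + z))" by (simp add: algebra_simps)
  also have "\<dots> = w x * kap - kap * P w x"
   using k_integrable bbd_integrable(1)[OF k_integrable w, of x] kap_pos
   by (simp add: bochner_diff kap_def P_def cv_def)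
  finally have "w x + 2 * (w x * kap - kap * P w x) = H x" using eq[of x] by simp
  then have "theta * (w x + 2 * (w x * kap - kap * P w x)) = theta * H x" by simp
  then have "theta * w x + (w x - P w x) = theta * H x" using kap_pos by (simp add: theta_def field_simps)
  then show ?thesis using theta_pos by (simp add: q_def field_simps)
 qed
 then have wq: "w = (\<lambda>x. q * P w x + q * (theta * H x))" by (auto simp: distrib_left)
 have "(P ^^ N) w = (P ^^ N) (\<lambda>x. q * P w x + q * (theta * H x))" using wq by simp
 also have "\<dots> = (\<lambda>x. q * (P ^^ Suc N) w x + q * (theta * (P ^^ N) H x))"
  using Pi_add[OF bbd_scale[OF P_bbd[OF w]] bbd_scale[OF bbd_scale[OF H]], of N q q theta]
  by (simp only: Pi_scale) (simp add: funpow_swap1)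
 finally have PN: "(P ^^ N) w = (\<lambda>x. q * (P ^^ Suc N) w x + q * (theta * (P ^^ N) H x))" .
 show ?case
 proof
  fix x
  have "w x = q ^ N * (P ^^ N) w x + theta * (\<Sum>i<N. q ^ Suc i * (P ^^ i) H x)"
   using Suc unfolding q_def by (rule fun_cong)
  also have "(P ^^ N) w x = q * (P ^^ Suc N) w x + q * (theta * (P ^^ N) H x)" by (simp only: PN)
  finally show "w x = (1 / (1 + theta)) ^ Suc N * (P ^^ Suc N) w x + theta * (\<Sum>i<Suc N. (1 / (1 + theta)) ^ Suc i * (P ^^ i) H x)"
   unfolding q_def[symmetric] by (simp add: algebra_simps)
 qed
qed simp

end

section \<open>Right-hand sides in divergence form\<close>

definition core_constant :: "real => real => real => real => real" where
 "core_constant n s lam \<gamma> = (let c = smoothing_constant n s lam; c1 = time_constant n s lam; c2 = double_time_constant n s lam;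
   r1 = radial_const n (\<gamma> + 1 - 2 * s); r2 = radial_const n (1 - \<gamma>)
   in (2 + c) * (4 + c1 + c1 * r1) + c1 + c2 + c2 * (r1 + r2))"

text \<open>The qualitative bound \<open>W\<close> guarantees that the supremum is finite, without
  which it could not be moved to the other side; its size does not enter the result.\<close>

lemma sup_absorb:
 fixes w :: "'a => real"
 assumes bd: "!!x. \<bar>w x\<bar> \<le> W" and step: "!!V. (!!x. \<bar>w x\<bar> \<le> V) ==> 0 \<le> V ==> (!!x. \<bar>w x\<bar> \<le> V / 2 + E)"
 shows "\<bar>w x\<bar> \<le> 2 * E"
proof -
 define V where "V = (SUP x. \<bar>w x\<bar>)"
 have bdd: "bdd_above (range (\<lambda>x. \<bar>w x\<bar>))" using bd by (auto intro!: bdd_aboveI)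
 have V: "\<bar>w x\<bar> \<le> V" for x unfolding V_def by (rule cSUP_upper[OF _ bdd]) simp
 have "\<bar>w x\<bar> \<le> V / 2 + E" for x by (rule step[OF V]) (use V[of x] in linarith)
 then have "V \<le> V / 2 + E" unfolding V_def by (intro cSUP_least) auto
 then show ?thesis using V[of x] by linarith
qed

lemma sum_integral_le:
 fixes f :: "nat => 'a => real"
 assumes i: "!!i. integrable M (f i)" and g: "integrable M g" and le: "!!y. c * (\<Sum>i<N. f i y) \<le> g y"
 shows "c * (\<Sum>i<N. \<integral>y. f i y \<partial>M) \<le> (\<integral>y. g y \<partial>M)"
proof -
 have "c * (\<Sum>i<N. \<integral>y. f i y \<partial>M) = (\<integral>y. c * (\<Sum>i<N. f i y) \<partial>M)"
  using i by (simp add: bochner_integral_sum)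
 also have "\<dots> \<le> (\<integral>y. g y \<partial>M)" using i g le by (intro integral_mono) auto
 finally show ?thesis .
qed

text \<open>About the exponents: near the diagonal \<open>F\<close> is not integrable uniformly in
  \<open>tau\<close>, as \<open>\<gamma> < 2 * s\<close>. Antisymmetry yields a difference in
  \<open>x\<close> and thereby a factor \<open>norm y\<close> from the walk, which suffices since
  \<open>2 * s - 1 < \<gamma>\<close>. For increments of order \<open>\<gamma>\<close> the long
  jumps converge since \<open>\<gamma> < 1\<close>.\<close>

locale flux = near_kernel +
 fixes \<gamma> A :: real and F :: "'a => 'a => real"
 assumes gam: "2 * s - 1 < \<gamma>" "\<gamma> < 1" and A: "0 \<le> A"
  and F_measurable: "case_prod F \<in> borel_measurable borel2"
  and F_antisym: "!!x y. F y x = - F x y"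
  and F_le: "!!x y. \<bar>F x y\<bar> \<le> (if tau < norm (x - y) \<and> norm (x - y) < 1 then A * norm (x - y) powr (\<gamma> - n - 2 * s) else 0)"
begin

definition wt :: "'a => real" where
 "wt z = (if tau < norm z \<and> norm z < 1 then norm z powr (\<gamma> - n - 2 * s) else 0)"

lemma wt_measurable [measurable]: "wt \<in> Borel" unfolding wt_def by measurable

lemma wt_nonneg: "0 \<le> wt z" by (simp add: wt_def)

lemma wt_integrable: "integrable lborel wt"
proof (rule far_integral_bound(1)[of wt tau 1 "2 * s - \<gamma>", unfolded n])
 fix z :: 'a
 have "- (2 * s - \<gamma>) - n = \<gamma> - n - 2 * s" by simp
 then show "\<bar>wt z\<bar> \<le> (if tau \<le> norm z then 1 * norm z powr (- (2 * s - \<gamma>) - n) else 0)"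
  by (simp only:) (simp add: wt_def)
qed (use gam s tau in auto)

text \<open>The jumps \<open>y\<close> and \<open>- y\<close> combined: with
  \<open>f x = F x (x + y)\<close> this is \<open>f x - f (x - y)\<close>, a difference to which the
  smoothing of the walk applies.\<close>

definition \<Psi> :: "'a => 'a => real" where "\<Psi> y x = F x (x + y) - F (x - y) x"

definition dvg :: "'a => real" where "dvg x = 2 * (LBINT z. F x (x + z))"

lemma F_le': "\<bar>F x (x + y)\<bar> \<le> A * wt y" "\<bar>F (x - y) x\<bar> \<le> A * wt y"
 using F_le[of x "x + y"] F_le[of "x - y" x] by (auto simp: wt_def split: if_splits)

lemma F_meas2: "f \<in> M \<rightarrow>\<^sub>M borel ==> g \<in> M \<rightarrow>\<^sub>M borel ==> (\<lambda>x. F (f x) (g x)) \<in> borel_measurable M"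
 by (rule measurable_case_prod_compose[OF F_measurable])

lemma Psi_measurable: "case_prod \<Psi> \<in> borel_measurable borel2"
 unfolding \<Psi>_def split_beta' by (intro borel_measurable_diff F_meas2) measurable

lemma Psi_le: "\<bar>\<Psi> y x\<bar> \<le> 2 * A * wt y"
 using F_le'[of x y] by (simp add: \<Psi>_def)

lemma F_integrable: "integrable lborel (\<lambda>y. F x (x + y))" "integrable lborel (\<lambda>y. F (x - y) x)"
 by (rule bochner_bound[OF integrable_mult_right[OF wt_integrable, of A]];
   use F_le'[of x] A wt_nonneg in \<open>auto intro!: AE_I2 F_meas2\<close>)+

text \<open>One of the two copies of the integral is reflected in \<open>z\<close> and rewritten by
  antisymmetry; this is what the factor 2 is good for.\<close>

lemma dvg_eq: "dvg = (\<lambda>x. \<integral>y. \<Psi> y x \<partial>lborel)"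
proof
 fix x
 have "(LBINT z. F x (x + z)) = (LBINT z. F x (x + - z))"
  using reflect_integral(1)[of "\<lambda>z. F x (x + z)"] F_meas2[of "\<lambda>_. x" borel "\<lambda>z. x + z"] by simp
 also have "\<dots> = (LBINT z. - F (x - z) x)" using F_antisym[of "x - _" x] by simp
 finally have "(LBINT z. F x (x + z)) = - (LBINT z. F (x - z) x)" by simp
 then have "dvg x = (LBINT z. F x (x + z)) - (LBINT z. F (x - z) x)" by (simp add: dvg_def)
 also have "\<dots> = (LBINT y. \<Psi> y x)"
  using F_integrable[of x] by (simp add: \<Psi>_def bochner_diff)
 finally show "dvg x = (LBINT y. \<Psi> y x)" .
qed

lemma Pi_Psi: "(P ^^ i) dvg = (\<lambda>x. \<integral>y. (P ^^ i) (\<Psi> y) x \<partial>lborel)"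
  "case_prod (\<lambda>y. (P ^^ i) (\<Psi> y)) \<in> borel_measurable borel2"
  "\<bar>(P ^^ i) (\<Psi> y) x\<bar> \<le> 2 * A * wt y"
 using Pi_Fubini[OF integrable_mult_right[OF wt_integrable, of "2 * A"] Psi_measurable Psi_le, of i]
 by (auto simp: dvg_eq)

lemma Pi_Psi_integrable: "integrable lborel (\<lambda>y. (P ^^ i) (\<Psi> y) x)"
proof (rule bochner_bound[OF integrable_mult_right[OF wt_integrable, of "2 * A"]])
 show "(\<lambda>y. (P ^^ i) (\<Psi> y) x) \<in> borel_measurable lborel"
  using measurable_case_prod_compose[OF Pi_Psi(2), of "\<lambda>y. y" lborel "\<lambda>_. x"] by simp
 show "AE y in lborel. norm ((P ^^ i) (\<Psi> y) x) \<le> norm (2 * A * wt y)"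
  using Pi_Psi(3) A wt_nonneg by (auto intro!: AE_I2)
qed

lemma dvg_bbd: "bbd (2 * A * (LBINT y. wt y)) dvg"
proof (rule bbdI)
 show "dvg \<in> Borel"
  unfolding dvg_def by (intro borel_measurable_times borel_measurable_const lborel.borel_measurable_lebesgue_integral)
   (auto simp: split_beta' intro!: F_meas2)
 fix x
 have "\<bar>\<integral>y. \<Psi> y x \<partial>lborel\<bar> \<le> (LBINT y. 2 * A * wt y)"
  using Pi_Psi_integrable[of 0 x] wt_integrable Psi_le[of _ x]
  by (intro order_trans[OF integral_abs_bound integral_mono]) auto
 then show "\<bar>dvg x\<bar> \<le> 2 * A * (LBINT y. wt y)" by (simp add: dvg_eq)
qed

abbreviation "r1 \<equiv> radial_const n (\<gamma> + 1 - 2 * s)"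
abbreviation "r2 \<equiv> radial_const n (1 - \<gamma>)"

lemma r_pos: "0 < r1" "0 < r2" using gam n_pos by (auto intro!: radial_const_pos)

lemma Phi_bbd: "bbd (A * wt y) (\<lambda>x. F x (x + y))"
 using F_le'(1)[of _ y] by (auto intro!: bbdI F_meas2)

lemma Pi_Psi_eq: "(P ^^ i) (\<Psi> y) x = (P ^^ i) (\<lambda>x. F x (x + y)) x - (P ^^ i) (\<lambda>x. F x (x + y)) (x + - y)"
proof -
 define f where "f = (\<lambda>x. F x (x + y))"
 have fb: "bbd (A * wt y) f" unfolding f_def by (rule Phi_bbd)
 have "\<Psi> y = (\<lambda>x. f x - f (x + - y))" by (auto simp: \<Psi>_def f_def)
 then show ?thesis using Pi_diff[OF fb bbd_shift[OF fb, of "- y"], of i] Pi_shift[of i f "- y"]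
  unfolding f_def[symmetric] by simp
qed

lemma sum_Pi_div:
 assumes th: "theta \<le> 1"
 shows "theta * (\<Sum>i<steps. \<bar>(P ^^ i) dvg x\<bar>) \<le> C1 * r1 * A"
proof -
 have "theta * (\<Sum>i<steps. \<bar>(P ^^ i) dvg x\<bar>) \<le> theta * (\<Sum>i<steps. \<integral>y. \<bar>(P ^^ i) (\<Psi> y) x\<bar> \<partial>lborel)"
  using theta_pos by (intro mult_left_mono sum_mono) (auto simp: Pi_Psi(1) intro: integral_abs_bound)
 also have "\<dots> \<le> (LBINT y. C1 * A * (norm y * wt y))"
 proof (rule sum_integral_le)
  show "integrable lborel (\<lambda>y. C1 * A * (norm (y::'a) * wt y))"
  proof (rule bochner_bound[OF integrable_mult_right[OF wt_integrable, of "C1 * A"]])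
   show "AE y in lborel. norm (C1 * A * (norm y * wt y)) \<le> norm (C1 * A * wt y)"
    using A C1_pos by (intro AE_I2) (auto simp: wt_def abs_mult intro!: mult_left_mono mult_left_le_one_le)
  qed measurable
  fix y :: 'a
  show "theta * (\<Sum>i<steps. \<bar>(P ^^ i) (\<Psi> y) x\<bar>) \<le> C1 * A * (norm y * wt y)"
  proof (cases "tau < norm y")
   case True
   have "theta * (\<Sum>i<steps. \<bar>(P ^^ i) (\<Psi> y) x\<bar>)
     = theta * (\<Sum>i<steps. \<bar>(P ^^ i) (\<lambda>x. F x (x + y)) (x + - y) - (P ^^ i) (\<lambda>x. F x (x + y)) x\<bar>)"
    by (simp only: Pi_Psi_eq abs_minus_commute)
   also have "\<dots> \<le> C1 * norm (- y) * (A * wt y)"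
    using True by (intro sum_increment[OF th _ Phi_bbd]) simp
   finally show ?thesis by (simp add: mult_ac)
  next
   case False
   then have "(P ^^ i) (\<Psi> y) x = 0" for i using Pi_Psi(3)[of i y x] by (simp add: wt_def)
   then show ?thesis using False by (simp add: wt_def)
  qed
 qed (intro integrable_abs Pi_Psi_integrable)
 also have "\<dots> = C1 * A * (LBINT y. norm y * wt y)" by simp
 also have "\<dots> \<le> C1 * A * (1 * (1 powr (\<gamma> + 1 - 2 * s) * r1))"
 proof (intro mult_left_mono)
  show "(LBINT y. norm y * wt y) \<le> 1 * (1 powr (\<gamma> + 1 - 2 * s) * r1)"
  proof (rule order_trans[OF abs_ge_self near_integral_bound(3)[where f="\<lambda>y::'a. norm y * wt y" and R=1, unfolded n]])
   fix z :: 'a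
   have "norm z * norm z powr (\<gamma> - n - 2 * s) = norm z powr (\<gamma> + 1 - 2 * s - n)" if "z \<noteq> 0"
    using powr_add[of "norm z" 1 "\<gamma> - n - 2 * s"] that by (simp add: algebra_simps)
   then show "\<bar>norm z * wt z\<bar> \<le> (if norm z < 1 then 1 * norm z powr (\<gamma> + 1 - 2 * s - n) else 0)"
    using tau by (cases "z = 0") (auto simp: wt_def)
  qed (use gam s in auto)
 qed (use C1_pos A in auto)
 finally show ?thesis by (simp add: mult_ac)
qed

text \<open>For each jump \<open>y\<close> this is a second difference with increments
  \<open>h\<close> and \<open>- y\<close>. Jumps shorter than \<open>h\<close> contribute the power
  \<open>\<gamma> + 1 - 2 * s - n\<close>, integrable at the origin; longer ones the power
  \<open>\<gamma> - 1 - n\<close>, integrable at infinity. Both integrals are of order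
  \<open>norm h powr \<gamma>\<close>.\<close>

lemma sum_increment_div:
 assumes th: "theta \<le> 1" and h: "tau \<le> norm h" "norm h \<le> 1"
 shows "theta * (\<Sum>i<steps. \<bar>(P ^^ i) dvg (x + h) - (P ^^ i) dvg x\<bar>) \<le> C2 * (r1 + r2) * norm h powr \<gamma> * A"
proof -
 define H where "H = norm h"
 have H: "0 < H" "H \<le> 1" "tau \<le> H" using h tau by (auto simp: H_def)
 define g1 where "g1 = (\<lambda>y. if norm y < H then H powr (2 * s - 1) * norm (y::'a) powr (\<gamma> + 1 - 2 * s - n) else 0)"
 define g2 where "g2 = (\<lambda>y. if H \<le> norm y then H * norm (y::'a) powr (- (1 - \<gamma>) - n) else 0)"
 have g1: "integrable lborel g1" "\<bar>\<integral>y. g1 y \<partial>lborel\<bar> \<le> H powr (2 * s - 1) * (H powr (\<gamma> + 1 - 2 * s) * r1)"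
  using near_integral_bound(1,3)[where f=g1 and R=H and A="H powr (2 * s - 1)" and e="\<gamma> + 1 - 2 * s", unfolded n] gam s H
  by (simp_all add: g1_def)
 have g2: "integrable lborel g2" "\<bar>\<integral>y. g2 y \<partial>lborel\<bar> \<le> H * (H powr (- (1 - \<gamma>)) * r2)"
  using far_integral_bound(1,3)[where f=g2 and R=H and A=H and e="1 - \<gamma>", unfolded n] gam s H
  by (simp_all add: g2_def)
 have "theta * (\<Sum>i<steps. \<bar>(P ^^ i) dvg (x + h) - (P ^^ i) dvg x\<bar>)
   \<le> theta * (\<Sum>i<steps. \<integral>y. \<bar>(P ^^ i) (\<Psi> y) (x + h) - (P ^^ i) (\<Psi> y) x\<bar> \<partial>lborel)"
 proof (intro mult_left_mono sum_mono)
  fix i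
  have "(P ^^ i) dvg (x + h) - (P ^^ i) dvg x = (LBINT y. (P ^^ i) (\<Psi> y) (x + h) - (P ^^ i) (\<Psi> y) x)"
   unfolding Pi_Psi(1) by (rule bochner_diff[symmetric]) (rule Pi_Psi_integrable)+
  then show "\<bar>(P ^^ i) dvg (x + h) - (P ^^ i) dvg x\<bar> \<le> (LBINT y. \<bar>(P ^^ i) (\<Psi> y) (x + h) - (P ^^ i) (\<Psi> y) x\<bar>)"
   by (simp only:) (rule integral_abs_bound)
 qed (use theta_pos in simp)
 also have "\<dots> \<le> (LBINT y. C2 * A * (g1 y + g2 y))"
 proof (rule sum_integral_le)
  fix y :: 'a
  show "theta * (\<Sum>i<steps. \<bar>(P ^^ i) (\<Psi> y) (x + h) - (P ^^ i) (\<Psi> y) x\<bar>) \<le> C2 * A * (g1 y + g2 y)"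
  proof (cases "tau < norm y \<and> norm y < 1")
   case True
   define f where "f = (\<lambda>x. F x (x + y))"
   have "theta * (\<Sum>i<steps. \<bar>(P ^^ i) (\<Psi> y) (x + h) - (P ^^ i) (\<Psi> y) x\<bar>)
     = theta * (\<Sum>i<steps. \<bar>((P ^^ i) f (x + h + - y) - (P ^^ i) f (x + h)) - ((P ^^ i) f (x + - y) - (P ^^ i) f x)\<bar>)"
    unfolding Pi_Psi_eq f_def[symmetric] by (intro arg_cong[where f="\<lambda>S. theta * S"] sum.cong) auto
   also have "\<dots> \<le> C2 * min (norm h) (norm (- y)) * max (norm h) (norm (- y)) powr (2 * s - 1) * (A * wt y)"
    using True h by (intro sum_second_increment[OF th]) (auto simp: f_def Phi_bbd)
   also have "\<dots> = C2 * A * (min H (norm y) * max H (norm y) powr (2 * s - 1) * wt y)" by (simp add: H_def)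
   also have "\<dots> \<le> C2 * A * (g1 y + g2 y)"
   proof (intro mult_left_mono)
    have y: "0 < norm y" using True tau by linarith
    show "min H (norm y) * max H (norm y) powr (2 * s - 1) * wt y \<le> g1 y + g2 y"
    proof (cases "norm y < H")
     case h: True
     have "norm y * norm y powr (\<gamma> - n - 2 * s) = norm y powr (\<gamma> + 1 - 2 * s - n)"
      using powr_add[of "norm y" 1 "\<gamma> - n - 2 * s"] y by (simp add: algebra_simps)
     then have "norm y * (H powr (2 * s - 1) * norm y powr (\<gamma> - n - 2 * s)) = H powr (2 * s - 1) * norm y powr (\<gamma> + 1 - 2 * s - n)"
      by (simp add: mult_ac)
     moreover have "min H (norm y) = norm y" "max H (norm y) = H" "wt y = norm y powr (\<gamma> - n - 2 * s)"
      "g1 y = H powr (2 * s - 1) * norm y powr (\<gamma> + 1 - 2 * s - n)" "g2 y = 0"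
      using h True by (auto simp: wt_def g1_def g2_def)
     ultimately show ?thesis by (simp only: mult.assoc add_0_right order_refl)
    next
     case h: False
     have "norm y powr (2 * s - 1) * norm y powr (\<gamma> - n - 2 * s) = norm y powr (- (1 - \<gamma>) - n)"
      using y by (simp add: powr_add[symmetric] algebra_simps)
     then have "H * (norm y powr (2 * s - 1) * norm y powr (\<gamma> - n - 2 * s)) = H * norm y powr (- (1 - \<gamma>) - n)"
      by simp
     moreover have "min H (norm y) = H" "max H (norm y) = norm y" "wt y = norm y powr (\<gamma> - n - 2 * s)"
      "g2 y = H * norm y powr (- (1 - \<gamma>) - n)" "g1 y = 0"
      using h True by (auto simp: wt_def g1_def g2_def)
     ultimately show ?thesis by (simp only: mult.assoc add_0_left order_refl)
    qed
   qed (use C2_nonneg A in auto)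
   finally show ?thesis .
  next
   case False
   then have "wt y = 0" by (auto simp: wt_def)
   then have "(P ^^ i) (\<Psi> y) x = 0" for i x using Pi_Psi(3)[of i y x] by simp
   then show ?thesis using C2_nonneg A H by (auto simp: g1_def g2_def)
  qed
 next
  show "integrable lborel (\<lambda>y. \<bar>(P ^^ i) (\<Psi> y) (x + h) - (P ^^ i) (\<Psi> y) x\<bar>)" for i
   by (intro integrable_abs bochner_integrable_diff Pi_Psi_integrable)
  show "integrable lborel (\<lambda>y. C2 * A * (g1 y + g2 y))"
   using g1(1) g2(1) by simp
 qed
 also have "\<dots> = C2 * A * ((LBINT y. g1 y) + (LBINT y. g2 y))" using g1(1) g2(1) by simp
 also have "\<dots> \<le> C2 * A * (H powr \<gamma> * r1 + H powr \<gamma> * r2)"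
 proof (intro mult_left_mono add_mono)
  show "(LBINT y. g1 y) \<le> H powr \<gamma> * r1" "(LBINT y. g2 y) \<le> H powr \<gamma> * r2"
   using g1(2) g2(2) H powr_add[of H "2 * s - 1" "\<gamma> + 1 - 2 * s"] powr_add[of H 1 "- (1 - \<gamma>)"]
   by (auto simp: mult.assoc[symmetric])
 qed (use C2_nonneg A in auto)
 finally show ?thesis by (simp add: H_def algebra_simps)
qed

abbreviation "CC \<equiv> core_constant n s lam \<gamma>"

lemma CC_pos: "0 < CC"
proof -
 have "0 < (2 + csm) * (4 + C1 + C1 * r1)" using csm_pos C1_pos r_pos by (intro mult_pos_pos add_pos_pos) auto
 moreover have "0 \<le> C2 * (r1 + r2)" using r_pos C2_nonneg by simp
 ultimately show ?thesis using C1_pos C2_nonneg unfolding core_constant_def Let_def by linarith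
qed

text \<open>Distributes the homogeneity \<open>2 * s\<close> of the second-difference bound between
  the increment \<open>h\<close> of the Hoelder estimate and the increment \<open>h0\<close> of the
  source.\<close>

lemma min_max_powr_le:
 fixes a b :: real
 assumes "0 < a" "0 < b"
 shows "min a b * max a b powr (2 * s - 1) \<le> a powr \<gamma> * b powr (2 * s - \<gamma>)"
proof (cases "a \<le> b")
 case True
 have "a * b powr (2 * s - 1) = a powr \<gamma> * (a powr (1 - \<gamma>) * b powr (2 * s - 1))"
  using assms powr_add[of a \<gamma> "1 - \<gamma>"] by simp
 also have "\<dots> \<le> a powr \<gamma> * (b powr (1 - \<gamma>) * b powr (2 * s - 1))"
  using True assms gam by (intro mult_left_mono mult_right_mono powr_mono2) auto
 also have "\<dots> = a powr \<gamma> * b powr (2 * s - \<gamma>)" using assms by (simp add: powr_add[symmetric])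
 finally show ?thesis using True by (simp add: min_def max_def)
next
 case False
 have "b * a powr (2 * s - 1) = a powr \<gamma> * (a powr (2 * s - 1 - \<gamma>) * b)"
  using assms by (simp add: powr_add[symmetric] mult_ac)
 also have "\<dots> \<le> a powr \<gamma> * (b powr (2 * s - 1 - \<gamma>) * b)"
  using False assms gam by (intro mult_left_mono mult_right_mono powr_mono2') auto
 also have "\<dots> = a powr \<gamma> * b powr (2 * s - \<gamma>)" using assms powr_add[of b "2 * s - 1 - \<gamma>" 1] by simp
 finally show ?thesis using False by (simp add: min_def max_def)
qed

text \<open>A source \<open>g1 (x + h0) - g1 x\<close> is what differencing an equation with merely
  bounded right-hand side produces; the power \<open>2 * s - \<gamma>\<close> of \<open>h0\<close>
  is gained for it. The zero-order term on the left makes the equation solvable for bounded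
  functions on the whole space, so that no boundary enters.\<close>

theorem core_estimate:
 assumes th: "theta \<le> 1" and w: "bbd W w" and g: "bbd G g" and g1: "bbd G1 g1"
  and h0: "tau \<le> norm h0" "norm h0 \<le> 1"
  and eq: "!!x. w x + 2 * (LBINT z. (w x - w (x + z)) * k z)
        = g x + (g1 (x + h0) - g1 x) + 2 * (LBINT z. F x (x + z))"
 shows "\<bar>w x\<bar> \<le> CC * (G + norm h0 powr (2 * s - \<gamma>) * G1 + A)"
  and "tau \<le> norm h ==> norm h \<le> 1 ==>
   \<bar>w (x + h) - w x\<bar> \<le> CC * (G + norm h0 powr (2 * s - \<gamma>) * G1 + A) * norm h powr \<gamma>"
proof -
 define H where "H = (\<lambda>x. g x + (g1 (x + h0) - g1 x) + dvg x)"
 define q where "q = 1 / (1 + theta)"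
 have q: "0 \<le> q" "q \<le> 1" using theta_pos by (auto simp: q_def)
 have Hb: "bbd (G + (G1 + G1) + 2 * A * (LBINT y. wt y)) H"
  unfolding H_def by (intro bbd_add bbd_diff bbd_shift g g1 dvg_bbd)
 have rep: "w x = q ^ steps * (P ^^ steps) w x + theta * (\<Sum>i<steps. q ^ Suc i * (P ^^ i) H x)" for x
  using resolvent_representation[OF w Hb, of steps] eq by (auto simp: H_def dvg_def q_def dest: fun_cong[of _ _ x])
 have PiH: "(P ^^ i) H x = (P ^^ i) g x + ((P ^^ i) g1 (x + h0) - (P ^^ i) g1 x) + (P ^^ i) dvg x" for i x
  unfolding H_def using Pi_add[OF bbd_add[OF g bbd_diff[OF bbd_shift[OF g1] g1]] dvg_bbd, of i h0]
   Pi_add[OF g bbd_diff[OF bbd_shift[OF g1] g1], of i h0] Pi_diff[OF bbd_shift[OF g1] g1, of i h0]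
  by (simp add: Pi_shift)
 have Gn: "0 \<le> G" "0 \<le> G1" using bbd_nonneg g g1 by auto
 define b where "b = norm h0 powr (2 * s - \<gamma>)"
 have h0p: "0 < norm h0" using h0 tau by linarith
 have b: "norm h0 \<le> b"
  unfolding b_def using powr_mono'[of "2 * s - \<gamma>" 1 "norm h0"] h0p h0 gam by simp
 define S where "S = G + b * G1 + A"
 have S: "0 \<le> S" "G \<le> S" "b * G1 \<le> S" "A \<le> S"
 proof -
  have "0 \<le> b * G1" using Gn by (simp add: b_def)
  then show "0 \<le> S" "G \<le> S" "b * G1 \<le> S" "A \<le> S" using Gn A unfolding S_def by linarith+
 qed
 \<comment> \<open>One unit of time loses a factor 2, so that the remainder can be absorbed into the
   supremum of \<open>w\<close>.\<close>
 have qs: "q ^ steps \<le> 1 / 2"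
 proof -
  have "1 + real steps * theta \<le> (1 + theta) ^ steps" using theta_pos by (intro Bernoulli_inequality) simp
  then have "2 \<le> (1 + theta) ^ steps" using steps(1)[OF th] by linarith
  then show ?thesis using theta_pos by (simp add: q_def power_divide field_simps)
 qed
 have drop: "\<bar>theta * (\<Sum>i<steps. q ^ Suc i * f i)\<bar> \<le> theta * (\<Sum>i<steps. \<bar>f i\<bar>)" for f :: "nat => real"
 proof -
  have "\<bar>\<Sum>i<steps. q ^ Suc i * f i\<bar> \<le> (\<Sum>i<steps. \<bar>f i\<bar>)"
   using q by (intro order_trans[OF sum_abs sum_mono]) (auto simp: abs_mult intro!: mult_left_le_one_le mult_le_one power_le_one)
  then show ?thesis using theta_pos by (simp add: abs_mult)
 qed
 have nth: "theta * real steps \<le> 3" using steps(2)[OF th] theta_pos by (simp add: algebra_simps)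
 define E where "E = 3 * G + C1 * norm h0 * G1 + C1 * r1 * A"
 have PiHs: "theta * (\<Sum>i<steps. \<bar>(P ^^ i) H x\<bar>) \<le> E" for x
 proof -
  have "theta * (\<Sum>i<steps. \<bar>(P ^^ i) H x\<bar>)
    \<le> theta * (\<Sum>i<steps. \<bar>(P ^^ i) g x\<bar> + \<bar>(P ^^ i) g1 (x + h0) - (P ^^ i) g1 x\<bar> + \<bar>(P ^^ i) dvg x\<bar>)"
   using theta_pos unfolding PiH by (intro mult_left_mono sum_mono) auto
  also have "\<dots> = theta * (\<Sum>i<steps. \<bar>(P ^^ i) g x\<bar>) + theta * (\<Sum>i<steps. \<bar>(P ^^ i) g1 (x + h0) - (P ^^ i) g1 x\<bar>)
    + theta * (\<Sum>i<steps. \<bar>(P ^^ i) dvg x\<bar>)" by (simp add: sum.distrib distrib_left)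
  also have "theta * (\<Sum>i<steps. \<bar>(P ^^ i) g x\<bar>) \<le> theta * (\<Sum>i<steps. G)"
   using theta_pos bbd_le[OF Pi_bbd[OF g]] by (intro mult_left_mono sum_mono) auto
  also have "theta * (\<Sum>i<steps. G) \<le> 3 * G" using mult_right_mono[OF nth Gn(1)] by (simp add: mult_ac)
  finally show ?thesis using sum_increment[OF th h0(1) g1, of x] sum_Pi_div[OF th, of x] unfolding E_def by linarith
 qed
 have E: "E \<le> (3 + C1 + C1 * r1) * S"
 proof -
  have "C1 * norm h0 * G1 \<le> C1 * S" using S(3) mult_right_mono[OF b Gn(2)] C1_pos by (simp add: mult.assoc)
  moreover have "C1 * r1 * A \<le> C1 * r1 * S" using S C1_pos r_pos by (intro mult_left_mono) auto
  ultimately show ?thesis using S unfolding E_def by (simp add: algebra_simps)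
 qed
 have w2: "\<bar>w x\<bar> \<le> 2 * E" for x
 proof (rule sup_absorb[OF bbd_le[OF w]])
  fix V x assume V: "!!x. \<bar>w x\<bar> \<le> V" "0 \<le> V"
  have "bbd V w" using w V by (simp add: bbd_def)
  then have "\<bar>q ^ steps * (P ^^ steps) w x\<bar> \<le> 1 / 2 * V"
   using bbd_le[OF Pi_bbd] q qs unfolding abs_mult by (intro mult_mono) auto
  then show "\<bar>w x\<bar> \<le> V / 2 + E"
   using drop[of "\<lambda>i. (P ^^ i) H x"] PiHs[of x] unfolding rep[of x] by linarith
 qed
 have CCe: "CC = (2 + csm) * (4 + C1 + C1 * r1) + C1 + C2 + C2 * (r1 + r2)" by (simp add: core_constant_def Let_def)
 have nn: "0 \<le> csm" "0 \<le> C1" "0 \<le> C2" "0 \<le> r1" "0 \<le> r2" using csm_pos C1_pos C2_nonneg r_pos by auto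
 show "\<bar>w x\<bar> \<le> CC * (G + norm h0 powr (2 * s - \<gamma>) * G1 + A)"
 proof -
  have "2 * (3 + C1 + C1 * r1) \<le> (2 + csm) * (4 + C1 + C1 * r1)" using nn by (intro mult_mono) auto
  also have "\<dots> \<le> CC" unfolding CCe using nn by simp
  finally have "2 * (3 + C1 + C1 * r1) * S \<le> CC * S" using S by (intro mult_right_mono) auto
  moreover have "2 * E \<le> 2 * (3 + C1 + C1 * r1) * S" using mult_left_mono[OF E, of 2] by (simp only: mult.assoc)
  ultimately have "\<bar>w x\<bar> \<le> CC * S" using w2[of x] by linarith
  then show ?thesis unfolding S_def b_def .
 qed
 assume h: "tau \<le> norm h" "norm h \<le> 1"
 have hp: "0 < norm h" using h tau by linarith
 define K where "K = norm h powr \<gamma>"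
 have K: "norm h \<le> K" "0 \<le> K" unfolding K_def using powr_mono'[of \<gamma> 1 "norm h"] hp h gam by auto
 \<comment> \<open>The walk in the remainder has run for at least a unit of time, which gives even a
   Lipschitz bound.\<close>
 have 1: "\<bar>q ^ steps * (P ^^ steps) w (x + h) - q ^ steps * (P ^^ steps) w x\<bar> \<le> csm * E * norm h"
 proof -
  have "sm steps h (csm * norm h * (real (Suc steps) * theta) powr (- 1 / (2 * s)))"
   using steps(2)[OF th] by (intro smoothing h) auto
  moreover have "(real (Suc steps) * theta) powr (- 1 / (2 * s)) \<le> 1 powr (- 1 / (2 * s))"
   using steps(1)[OF th] theta_pos s by (intro powr_mono2') (auto simp: algebra_simps)
  ultimately have "sm steps h (csm * norm h * 1)"
   using nn by (elim sm_mono, intro mult_left_mono) simp_all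
  from smD[OF this, of "2 * E" w x] w2 w have "\<bar>(P ^^ steps) w (x + h) - (P ^^ steps) w x\<bar> \<le> csm * norm h * (2 * E)"
   by (simp add: bbd_def)
  then have "q ^ steps * \<bar>(P ^^ steps) w (x + h) - (P ^^ steps) w x\<bar> \<le> 1 / 2 * (csm * norm h * (2 * E))"
   using q qs by (intro mult_mono) auto
  moreover have "\<bar>q ^ steps * (P ^^ steps) w (x + h) - q ^ steps * (P ^^ steps) w x\<bar> = q ^ steps * \<bar>(P ^^ steps) w (x + h) - (P ^^ steps) w x\<bar>"
   using q by (simp add: right_diff_distrib[symmetric] abs_mult)
  ultimately show ?thesis by (simp add: mult_ac)
 qed
 have 2: "theta * (\<Sum>i<steps. \<bar>(P ^^ i) H (x + h) - (P ^^ i) H x\<bar>)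
   \<le> C1 * norm h * G + C2 * min (norm h) (norm h0) * max (norm h) (norm h0) powr (2 * s - 1) * G1 + C2 * (r1 + r2) * K * A"
 proof -
  have "theta * (\<Sum>i<steps. \<bar>(P ^^ i) H (x + h) - (P ^^ i) H x\<bar>)
    \<le> theta * (\<Sum>i<steps. \<bar>(P ^^ i) g (x + h) - (P ^^ i) g x\<bar>
      + \<bar>((P ^^ i) g1 (x + h + h0) - (P ^^ i) g1 (x + h)) - ((P ^^ i) g1 (x + h0) - (P ^^ i) g1 x)\<bar>
      + \<bar>(P ^^ i) dvg (x + h) - (P ^^ i) dvg x\<bar>)"
   using theta_pos unfolding PiH by (intro mult_left_mono sum_mono) linarith+
  also have "\<dots> = theta * (\<Sum>i<steps. \<bar>(P ^^ i) g (x + h) - (P ^^ i) g x\<bar>)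
    + theta * (\<Sum>i<steps. \<bar>((P ^^ i) g1 (x + h + h0) - (P ^^ i) g1 (x + h)) - ((P ^^ i) g1 (x + h0) - (P ^^ i) g1 x)\<bar>)
    + theta * (\<Sum>i<steps. \<bar>(P ^^ i) dvg (x + h) - (P ^^ i) dvg x\<bar>)" by (simp add: sum.distrib distrib_left)
  finally show ?thesis
   using sum_increment[OF th h(1) g, of x] sum_second_increment[OF th h(1) h0(1) g1, of x] sum_increment_div[OF th h, of x]
   unfolding K_def by linarith
 qed
 have "w (x + h) - w x = (q ^ steps * (P ^^ steps) w (x + h) - q ^ steps * (P ^^ steps) w x)
   + theta * (\<Sum>i<steps. q ^ Suc i * ((P ^^ i) H (x + h) - (P ^^ i) H x))"
  using rep[of x] rep[of "x + h"] by (simp add: right_diff_distrib sum_subtractf)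
 then have "\<bar>w (x + h) - w x\<bar> \<le> csm * E * norm h + (C1 * norm h * G + C2 * min (norm h) (norm h0) * max (norm h) (norm h0) powr (2 * s - 1) * G1 + C2 * (r1 + r2) * K * A)"
  using 1 2 drop[of "\<lambda>i. (P ^^ i) H (x + h) - (P ^^ i) H x"] by linarith
 also have "\<dots> \<le> csm * ((3 + C1 + C1 * r1) * S) * K + (C1 * K * S + C2 * K * S + C2 * (r1 + r2) * K * S)"
 proof (intro add_mono)
  have "0 \<le> E" using w2[of x] by linarith
  then show "csm * E * norm h \<le> csm * ((3 + C1 + C1 * r1) * S) * K" using E K nn S by (intro mult_mono) auto
  show "C1 * norm h * G \<le> C1 * K * S" using K nn S Gn by (intro mult_mono) auto
  have "min (norm h) (norm h0) * max (norm h) (norm h0) powr (2 * s - 1) * G1 \<le> K * b * G1"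
   using min_max_powr_le[OF hp h0p] Gn unfolding K_def b_def by (intro mult_right_mono) auto
  also have "\<dots> \<le> K * S" using S(3) K(2) by (simp add: mult.assoc mult_left_mono)
  finally show "C2 * min (norm h) (norm h0) * max (norm h) (norm h0) powr (2 * s - 1) * G1 \<le> C2 * K * S"
   using nn by (simp add: mult.assoc mult_left_mono)
  show "C2 * (r1 + r2) * K * A \<le> C2 * (r1 + r2) * K * S" using S nn K by (intro mult_left_mono) auto
 qed
 also have "\<dots> = (csm * (3 + C1 + C1 * r1) + C1 + C2 + C2 * (r1 + r2)) * S * K" by (simp add: algebra_simps)
 also have "\<dots> \<le> CC * S * K"
 proof -
  have "csm * (3 + C1 + C1 * r1) \<le> (2 + csm) * (4 + C1 + C1 * r1)" using nn by (intro mult_mono) auto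
  then show ?thesis unfolding CCe using S K by (intro mult_right_mono) auto
 qed
 finally show "\<bar>w (x + h) - w x\<bar> \<le> CC * (G + norm h0 powr (2 * s - \<gamma>) * G1 + A) * norm h powr \<gamma>"
  unfolding S_def b_def K_def .
qed

end

section \<open>Freezing the kernel\<close>

context near_kernel begin

text \<open>The difference of the operators with kernels \<open>J\<close> and \<open>k\<close>, applied to \<open>w\<close>, is itself in divergence form. It is
 absorbed because the Hoelder seminorm of a bounded function over increments of length at least \<open>tau\<close> is finite.\<close>

theorem perturbed_estimate:
 fixes J F :: "'a => 'a => real"
 assumes th: "theta \<le> 1" and gam: "2 * s - 1 < \<gamma>" "\<gamma> < 1"
  and w: "bbd W w" and g: "bbd G g" and g1: "bbd G1 g1"
  and h0: "tau \<le> norm h0" "norm h0 \<le> 1" and A: "0 \<le> A"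
  and J_meas: "case_prod J \<in> borel_measurable borel2" and J_sym: "!!x y. J y x = J x y"
  and J_zero: "!!x y. \<not> (tau < norm (x - y) \<and> norm (x - y) < 1) ==> J x y = 0"
  and J_near: "!!x y. w x \<noteq> w y ==> tau < norm (x - y) ==> norm (x - y) < 1 ==>
    \<bar>J x y - k (x - y)\<bar> \<le> \<epsilon> * rpow n s (x - y)"
  and F_measurable: "case_prod F \<in> borel_measurable borel2"
  and F_antisym: "!!x y. F y x = - F x y"
  and F_le: "!!x y. \<bar>F x y\<bar> \<le> (if tau < norm (x - y) \<and> norm (x - y) < 1 then A * norm (x - y) powr (\<gamma> - n - 2 * s) else 0)"
  and eps: "0 \<le> \<epsilon>" "core_constant n s lam \<gamma> * \<epsilon> \<le> 1 / 2"
  and eq: "!!x. w x + 2 * (LBINT z. (w x - w (x + z)) * J x (x + z))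
        = g x + (g1 (x + h0) - g1 x) + 2 * (LBINT z. F x (x + z))"
 shows "\<bar>w x\<bar> \<le> 2 * core_constant n s lam \<gamma> * (G + norm h0 powr (2 * s - \<gamma>) * G1 + A)"
  and "tau \<le> norm h ==> norm h \<le> 1 ==>
   \<bar>w (x + h) - w x\<bar> \<le> 2 * core_constant n s lam \<gamma> * (G + norm h0 powr (2 * s - \<gamma>) * G1 + A) * norm h powr \<gamma>"
proof -
 define c where "c = core_constant n s lam \<gamma>"
 define S where "S = G + norm h0 powr (2 * s - \<gamma>) * G1 + A"
 note [measurable] = bbd_measurable[OF w]
 define E where "E = (\<lambda>x y. (w x - w y) * (k (x - y) - J x y))"
 note J_m = measurable_case_prod_compose[OF J_meas] and F_m = measurable_case_prod_compose[OF F_measurable]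
 have E_meas: "case_prod E \<in> borel_measurable borel2"
  unfolding E_def split_beta' by (intro borel_measurable_times borel_measurable_diff J_m) measurable
 have E_le: "\<bar>E x y\<bar> \<le> (if tau < norm (x - y) \<and> norm (x - y) < 1 then \<epsilon> * V * norm (x - y) powr (\<gamma> - n - 2 * s) else 0)"
  if V: "!!x y. tau < norm (x - y) ==> norm (x - y) < 1 ==> \<bar>w x - w y\<bar> \<le> V * norm (x - y) powr \<gamma>" and "0 \<le> V" for V x y
 proof (cases "tau < norm (x - y) \<and> norm (x - y) < 1")
  case True
  show ?thesis
  proof (cases "w x = w y")
   \<comment> \<open>In the other case the flux \<open>E x y\<close> vanishes whatever the kernels
     are. This confines the closeness condition \<open>J_near\<close> to pairs that meet the support
     of a localized \<open>w\<close>.\<close>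
   case False
   have "\<bar>E x y\<bar> = \<bar>w x - w y\<bar> * \<bar>J x y - k (x - y)\<bar>" by (simp add: E_def abs_mult abs_minus_commute)
   also have "\<dots> \<le> (V * norm (x - y) powr \<gamma>) * (\<epsilon> * rpow n s (x - y))"
    using True False V J_near \<open>0 \<le> V\<close> by (intro mult_mono) auto
   also have "\<dots> = \<epsilon> * V * (norm (x - y) powr \<gamma> * rpow n s (x - y))" by simp
   also have "norm (x - y) powr \<gamma> * rpow n s (x - y) = norm (x - y) powr (\<gamma> - n - 2 * s)"
    by (simp add: powr_add[symmetric] algebra_simps)
   finally show ?thesis using True by simp
  qed (use True eps \<open>0 \<le> V\<close> in \<open>simp add: E_def\<close>)
 qed (use J_zero k_zero in \<open>auto simp: E_def\<close>)
 have flux: "flux n s lam Lam tau k \<gamma> (A + \<epsilon> * V) (\<lambda>x y. F x y + E x y)"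
  if V: "!!x y. tau < norm (x - y) ==> norm (x - y) < 1 ==> \<bar>w x - w y\<bar> \<le> V * norm (x - y) powr \<gamma>" and V0: "0 \<le> V" for V
 proof (unfold_locales)
  show "(\<lambda>(x, y). F x y + E x y) \<in> borel_measurable borel2"
   using F_measurable E_meas by (simp add: split_beta')
  show "F y x + E y x = - (F x y + E x y)" for x y
   using F_antisym[of y x] J_sym[of y x] k_even[of "x - y"] by (simp add: E_def algebra_simps)
  show "\<bar>F x y + E x y\<bar> \<le> (if tau < norm (x - y) \<and> norm (x - y) < 1 then (A + \<epsilon> * V) * norm (x - y) powr (\<gamma> - n - 2 * s) else 0)" for x y
   using F_le[of x y] E_le[OF V V0, of x y] by (auto simp: distrib_right split: if_splits)
 qed (use gam A eps V0 in auto)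
 define Z where "Z = 2 * W / tau powr \<gamma>"
 have W: "0 \<le> W" using bbd_nonneg[OF w] .
 have Z0: "0 \<le> Z" using W by (simp add: Z_def)
 have gp: "0 < \<gamma>" using gam s by simp
 have big: "\<bar>w x - w y\<bar> \<le> Z * norm (x - y) powr \<gamma>" if "tau \<le> norm (x - y)" for x y
 proof -
  have "tau powr \<gamma> \<le> norm (x - y) powr \<gamma>" using that tau gp by (intro powr_mono2) auto
  then have "2 * W * 1 \<le> 2 * W * (norm (x - y) powr \<gamma> / tau powr \<gamma>)" using W tau by (intro mult_left_mono) auto
  then show ?thesis using bbd_le[OF w, of x] bbd_le[OF w, of y] by (simp add: Z_def)
 qed
 have eq': "w x + 2 * (LBINT z. (w x - w (x + z)) * k z)
   = g x + (g1 (x + h0) - g1 x) + 2 * (LBINT z. F x (x + z) + E x (x + z))" for x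
 proof -
  interpret fl: flux n s lam Lam tau k \<gamma> "A + \<epsilon> * Z" "\<lambda>x y. F x y + E x y"
   by (rule flux[OF big Z0]) simp
  interpret fF: flux n s lam Lam tau k \<gamma> A F
   by unfold_locales (rule gam A F_measurable F_antisym F_le)+
  have "integrable lborel (\<lambda>z. (F x (x + z) + E x (x + z)) - F x (x + z))"
   by (intro bochner_integrable_diff fl.F_integrable fF.F_integrable)
  then have iE: "integrable lborel (\<lambda>z. E x (x + z))" by simp
  have ik: "integrable lborel (\<lambda>z. (w x - w (x + z)) * k z)"
  proof -
   have "integrable lborel (\<lambda>z. w x * k z - k z * w (x + z))"
    using k_integrable bbd_integrable(1)[OF k_integrable w, of x] by auto
   moreover have "(\<lambda>z. w x * k z - k z * w (x + z)) = (\<lambda>z. (w x - w (x + z)) * k z)"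
    by (rule ext) (simp only: left_diff_distrib mult.commute[of "k _"])
   ultimately show ?thesis by simp
  qed
  have "(LBINT z. (w x - w (x + z)) * J x (x + z)) = (LBINT z. (w x - w (x + z)) * k z - E x (x + z))"
   using k_even by (intro bochner_cong) (auto simp: E_def algebra_simps)
  also have "\<dots> = (LBINT z. (w x - w (x + z)) * k z) - (LBINT z. E x (x + z))"
   by (rule bochner_diff[OF ik iE])
  finally have J: "(LBINT z. (w x - w (x + z)) * J x (x + z)) = (LBINT z. (w x - w (x + z)) * k z) - (LBINT z. E x (x + z))" .
  have FE: "(LBINT z. F x (x + z) + E x (x + z)) = (LBINT z. F x (x + z)) + (LBINT z. E x (x + z))"
   by (rule bochner_add[OF fF.F_integrable(1) iE])
  show ?thesis using eq[of x] unfolding J FE by simp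
 qed
 have c0: "0 < c"
 proof -
  interpret fF: flux n s lam Lam tau k \<gamma> A F
   by unfold_locales (rule gam A F_measurable F_antisym F_le)+
  show ?thesis unfolding c_def by (rule fF.CC_pos)
 qed
 have S0: "0 \<le> S" using bbd_nonneg[OF g] bbd_nonneg[OF g1] A by (simp add: S_def)
 have step: "\<bar>w x\<bar> \<le> c * (S + \<epsilon> * V)"
   "tau \<le> norm h ==> norm h \<le> 1 ==> \<bar>w (x + h) - w x\<bar> \<le> c * (S + \<epsilon> * V) * norm h powr \<gamma>"
  if V: "!!x h. tau \<le> norm h ==> norm h \<le> 1 ==> \<bar>w (x + h) - w x\<bar> \<le> V * norm h powr \<gamma>" and V0: "0 \<le> V" for V x h
 proof -
  interpret fl: flux n s lam Lam tau k \<gamma> "A + \<epsilon> * V" "\<lambda>x y. F x y + E x y"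
  proof (rule flux[OF _ V0])
   show "\<bar>w x - w y\<bar> \<le> V * norm (x - y) powr \<gamma>" if "tau < norm (x - y)" "norm (x - y) < 1" for x y
    using V[of "x - y" y] that by simp
  qed
  note * = fl.core_estimate[OF th w g g1 h0 eq', folded c_def]
  have e: "G + norm h0 powr (2 * s - \<gamma>) * G1 + (A + \<epsilon> * V) = S + \<epsilon> * V" by (simp add: S_def)
  show "\<bar>w x\<bar> \<le> c * (S + \<epsilon> * V)" using *(1)[of x] unfolding e .
  show "\<bar>w (x + h) - w x\<bar> \<le> c * (S + \<epsilon> * V) * norm h powr \<gamma>" if "tau \<le> norm h" "norm h \<le> 1"
   using *(2)[OF that, of x] unfolding e .
 qed
 have ceV: "c * (S + \<epsilon> * V) \<le> V / 2 + c * S" if "0 \<le> V" for V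
  using mult_right_mono[OF eps(2) that] by (simp add: c_def algebra_simps)
 \<comment> \<open>All difference quotients in one function of the pair, so that the absorption
   lemma applies to the Hoelder seminorm.\<close>
 define f where "f = (\<lambda>(x, h). if tau \<le> norm h \<and> norm h \<le> 1 then (w (x + h) - w x) / norm h powr \<gamma> else 0)"
 have fV: "\<bar>f p\<bar> \<le> V \<longleftrightarrow> (tau \<le> norm (snd p) \<and> norm (snd p) \<le> 1 --> \<bar>w (fst p + snd p) - w (fst p)\<bar> \<le> V * norm (snd p) powr \<gamma>)"
  if "0 \<le> V" for p V
 proof -
  have "0 < norm (snd p) powr \<gamma>" if "tau \<le> norm (snd p)" using that tau by auto
  then show ?thesis using that by (auto simp: f_def split_beta abs_divide field_simps)
 qed
 have hol: "\<bar>w (x + h) - w x\<bar> \<le> 2 * (c * S) * norm h powr \<gamma>" if "tau \<le> norm h" "norm h \<le> 1" for x h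
 proof -
  have "\<bar>f p\<bar> \<le> 2 * (c * S)" for p
  proof (rule sup_absorb[where w=f and W=Z])
   show "\<bar>f p\<bar> \<le> Z" for p unfolding fV[OF Z0] using big[of "fst p + snd p" "fst p"] by auto
   fix V p assume V: "!!p. \<bar>f p\<bar> \<le> V" "0 \<le> V"
   have V': "\<bar>w (x + h) - w x\<bar> \<le> V * norm h powr \<gamma>" if "tau \<le> norm h" "norm h \<le> 1" for x h
    using V(1)[of "(x, h)"] that unfolding fV[OF V(2)] by simp
   have "0 \<le> c * (S + \<epsilon> * V)" using c0 S0 eps V by simp
   then have "\<bar>f p\<bar> \<le> c * (S + \<epsilon> * V)" using step(2)[OF V' V(2)] by (simp add: fV)
   then show "\<bar>f p\<bar> \<le> V / 2 + c * S" using ceV[OF V(2)] by linarith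
  qed
  from this[of "(x, h)"] show ?thesis using that c0 S0 by (subst (asm) fV) auto
 qed
 have "\<bar>w x\<bar> \<le> c * (S + \<epsilon> * (2 * (c * S)))" by (rule step(1)[OF hol]) (use c0 S0 in auto)
 also have "\<dots> \<le> 2 * c * S" using ceV[of "2 * (c * S)"] c0 S0 by simp
 finally show "\<bar>w x\<bar> \<le> 2 * core_constant n s lam \<gamma> * (G + norm h0 powr (2 * s - \<gamma>) * G1 + A)"
  by (simp add: c_def S_def)
 show "\<bar>w (x + h) - w x\<bar> \<le> 2 * core_constant n s lam \<gamma> * (G + norm h0 powr (2 * s - \<gamma>) * G1 + A) * norm h powr \<gamma>"
  if "tau \<le> norm h" "norm h \<le> 1"
  using hol[OF that, of x] by (simp add: c_def S_def)
qed

end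

locale unit_kernel =
 fixes n s lam Lam tau eps \<sigma> :: real and K :: "'a::euclidean_space => 'a => real"
 assumes n [simp]: "real DIM('a) = n"
  and s: "1 / 2 < s" "s < 1" "2 * s < n"
  and lam: "0 < lam" "lam \<le> Lam"
  and tau: "0 < tau" "3 * tau \<le> 1" "tau powr (2 * s) \<le> bump_constant n s lam"
  and K_measurable: "case_prod K \<in> borel_measurable borel2"
  and K_sym: "!!x y. K y x = K x y"
  and K_zero: "!!x y. norm (x - y) \<le> tau ==> K x y = 0"
  and K_lower: "!!x y. tau < norm (x - y) ==> lam * rpow n s (x - y) \<le> K x y"
  and K_upper: "!!x y. tau < norm (x - y) ==> K x y \<le> Lam * rpow n s (x - y)"
  and sig: "0 < \<sigma>" "\<sigma> \<le> 1" and eps: "0 \<le> eps"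
  and K_holder: "!!x y h. x \<in> ball 0 8 ==> y \<in> ball 0 8 ==> norm h \<le> 8 ==>
    \<bar>K (x + h) (y + h) - K x y\<bar> \<le> eps * norm h powr \<sigma> * rpow n s (x - y)"
begin

definition Kn :: "'a => 'a => real" where "Kn x y = (if norm (x - y) < 1 then K x y else 0)"
text \<open>Freezing at a pair symmetric about the origin makes \<open>k0\<close> even, by the
  symmetry of \<open>K\<close>. Moreover \<open>K x y\<close> differs from \<open>k0 (x - y)\<close>
  by the common translation \<open>(x + y) / 2\<close>, the only direction in which \<open>K\<close>
  is assumed to be continuous.\<close>

definition k0 :: "'a => real" where
 "k0 z = (if tau < norm z \<and> norm z < 1 then K ((1/2) *\<^sub>R z) (- ((1/2) *\<^sub>R z)) else 0)"

lemma n_pos: "0 < n" using s by simp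

lemma K_m: "f \<in> M \<rightarrow>\<^sub>M borel ==> g \<in> M \<rightarrow>\<^sub>M borel ==> (\<lambda>x. K (f x) (g x)) \<in> borel_measurable M"
 by (rule measurable_case_prod_compose[OF K_measurable])

lemma Kn_m [measurable (raw)]: "f \<in> M \<rightarrow>\<^sub>M borel ==> g \<in> M \<rightarrow>\<^sub>M borel ==> (\<lambda>x. Kn (f x) (g x)) \<in> borel_measurable M"
proof -
 assume [measurable]: "f \<in> M \<rightarrow>\<^sub>M borel" "g \<in> M \<rightarrow>\<^sub>M borel"
 show "(\<lambda>x. Kn (f x) (g x)) \<in> borel_measurable M"
  unfolding Kn_def by (intro measurable_If borel_measurable_const K_m) measurable
qed

lemma Kn_measurable: "case_prod Kn \<in> borel_measurable borel2"
 unfolding split_beta' by measurable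

lemma Kn_sym: "Kn y x = Kn x y" using K_sym[of x y] by (simp add: Kn_def norm_minus_commute)

lemma K_bounds: "0 \<le> K x y" "K x y \<le> Lam * rpow n s (x - y)"
 using K_lower[of x y] K_upper[of x y] K_zero[of x y] lam
 by (cases "tau < norm (x - y)"; smt (verit) mult_nonneg_nonneg powr_ge_zero)+

lemma Kn_bounds: "0 \<le> Kn x y" "Kn x y \<le> Lam * rpow n s (x - y)"
 using K_bounds[of x y] lam by (auto simp: Kn_def)

lemma Kn_zero: "\<not> (tau < norm (x - y) \<and> norm (x - y) < 1) ==> Kn x y = 0"
 using K_zero[of x y] by (auto simp: Kn_def)

lemma near: "near_kernel n s lam Lam tau k0"
proof
 have h: "norm ((1/2) *\<^sub>R z - - ((1/2) *\<^sub>R z)) = norm z" for z :: 'a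
 proof -
  have "(1/2) *\<^sub>R z - - ((1/2) *\<^sub>R z) = z" by (simp add: scaleR_left_distrib[symmetric])
  then show ?thesis by simp
 qed
 show "k0 \<in> Borel" unfolding k0_def
  by (intro measurable_If borel_measurable_const K_m) measurable
 show "k0 (- z) = k0 z" for z using K_sym[of "(1/2) *\<^sub>R z" "- ((1/2) *\<^sub>R z)"] by (simp add: k0_def)
 show "lam * rpow n s z \<le> k0 z" "k0 z \<le> Lam * rpow n s z"
  if "tau < norm z" "norm z < 1" for z
  using K_lower[of "(1/2) *\<^sub>R z" "- ((1/2) *\<^sub>R z)"] K_upper[of "(1/2) *\<^sub>R z" "- ((1/2) *\<^sub>R z)"] that
  unfolding h by (auto simp: k0_def)
qed (use s lam tau in \<open>auto simp: k0_def\<close>)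

sublocale nk: near_kernel n s lam Lam tau k0 by (rule near)

lemma theta_le_1: "nk.theta \<le> 1"
 using nk.theta_le nk.bump_rate_pos tau(3) by (simp add: divide_le_eq_1 order_trans)

lemma frozen:
 assumes x: "x \<in> ball 0 6" "y \<in> ball 0 6" and d: "tau < norm (x - y)" "norm (x - y) < 1"
 shows "\<bar>Kn x y - k0 (x - y)\<bar> \<le> 6 * eps * rpow n s (x - y)"
proof -
 define z where "z = (1/2) *\<^sub>R (x - y)"
 define h where "h = (1/2) *\<^sub>R (x + y)"
 have e: "z + h = x" "- z + h = y" "z - - z = x - y"
  by (auto simp: z_def h_def scaleR_left_distrib[symmetric] algebra_simps)
 have "norm z < 8" using d by (simp add: z_def)
 moreover have hn: "norm h \<le> 6" using x norm_triangle_ineq[of x y] by (simp add: h_def)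
 ultimately have "\<bar>K (z + h) (- z + h) - K z (- z)\<bar> \<le> eps * norm h powr \<sigma> * rpow n s (z - - z)"
  by (intro K_holder) auto
 also have "\<dots> \<le> eps * 6 * rpow n s (z - - z)"
 proof -
  have "norm h powr \<sigma> \<le> 6 powr \<sigma>" using hn sig by (intro powr_mono2) auto
  also have "\<dots> \<le> 6 powr 1" using sig by (intro powr_mono) auto
  finally show ?thesis using eps by (intro mult_right_mono mult_left_mono) auto
 qed
 finally have "\<bar>K x y - K z (- z)\<bar> \<le> 6 * eps * rpow n s (x - y)" unfolding e by (simp add: mult_ac)
 then show ?thesis using d by (simp add: Kn_def k0_def z_def)
qed

lemma Kn_integrable:
 assumes f: "f \<in> Borel" and b: "!!z. \<bar>f z\<bar> \<le> B"
 shows "integrable lborel (\<lambda>z. f z * Kn x (x + z))"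
proof (rule far_integral_bound(1)[where f="\<lambda>z. f z * Kn x (x + z)" and R=tau and A="B * Lam" and e="2 * s", unfolded n])
 show "(\<lambda>z. f z * Kn x (x + z)) \<in> Borel" using f by measurable
 fix z :: 'a
 have B: "0 \<le> B" using b[of z] by linarith
 show "\<bar>f z * Kn x (x + z)\<bar> \<le> (if tau \<le> norm z then B * Lam * norm z powr (- (2 * s) - n) else 0)"
 proof (cases "tau \<le> norm z")
  case True
  have "\<bar>f z * Kn x (x + z)\<bar> = \<bar>f z\<bar> * Kn x (x + z)" using Kn_bounds(1) by (simp add: abs_mult)
  also have "\<dots> \<le> B * (Lam * norm (x - (x + z)) powr (- n - 2 * s))"
   using b[of z] B Kn_bounds(1)[of x "x + z"] Kn_bounds(2)[of x "x + z"] by (intro mult_mono) auto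
  also have "norm (x - (x + z)) powr (- n - 2 * s) = norm z powr (- (2 * s) - n)"
   by (simp, rule arg_cong[where f="\<lambda>t. norm z powr t"], simp)
  finally show ?thesis using True by simp
 next
  case False
  then show ?thesis using Kn_zero[of x "x + z"] by simp
 qed
 show "0 \<le> B * Lam" using b[of 0] lam by (simp add: order_trans[OF abs_ge_zero])
qed (use s tau in auto)

end

section \<open>Hoelder estimates\<close>

definition holder_constant :: "real => real => real => real => real => real" where
 "holder_constant n s lam Lam \<gamma> = (let e = \<gamma> + 1 - 2 * s; m = 1 + (2 * s - 1) / e; c = core_constant n s lam \<gamma>;
   r1 = radial_const n e; r3 = radial_const n (2 * s - 1); \<eta> = min 1 (2 powr (- m - 1) / (4 * c * Lam * r1))
   in 2 powr (m + 1) * (4 * c + 4 * c * Lam * (2 * \<eta> powr (- (2 * s - 1) / e) * r3 + 1) + 4))"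

context unit_kernel begin

text \<open>The carre du champ of \<open>\<phi>\<close> and \<open>u\<close> for the kernel
  \<open>Kn\<close>, which is the error term of the product rule.\<close>

definition cutoff_error :: "('a => real) => ('a => real) => 'a => real" where
 "cutoff_error \<phi> u x = (LBINT z. (\<phi> x - \<phi> (x + z)) * (u x - u (x + z)) * Kn x (x + z))"

lemma cutoff_error_measurable:
 assumes [measurable]: "\<phi> \<in> Borel" "u \<in> Borel"
 shows "cutoff_error \<phi> u \<in> Borel"
 unfolding cutoff_error_def[abs_def] by (rule lborel.borel_measurable_lebesgue_integral) measurable

text \<open>The product rule in the symmetrized form \<open>\<phi> u - \<phi>' u' = \<phi> (u - u')
  - (\<phi> - \<phi>') (u - u') / 2 + (u + u') (\<phi> - \<phi>') / 2\<close>. The last term is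
  antisymmetric and hence an admissible flux; in the unsymmetrized form
  \<open>(\<phi> - \<phi>') u'\<close> it would not be, and its integral need not be bounded
  uniformly in \<open>tau\<close>.\<close>

lemma cutoff_identity:
 assumes u: "bbd U u" and chi: "bbd 1 \<phi>" and supp: "!!x. x \<notin> ball 0 4 ==> \<phi> x = 0"
  and eq: "!!x. x \<in> ball 0 5 ==> 2 * (LBINT z. (u x - u (x + z)) * Kn x (x + z)) = f x"
 shows "2 * (LBINT z. (\<phi> x * u x - \<phi> (x + z) * u (x + z)) * Kn x (x + z))
  = (\<phi> x * f x - cutoff_error \<phi> u x)
   + 2 * (LBINT z. (1/2) * (u x + u (x + z)) * (\<phi> x - \<phi> (x + z)) * Kn x (x + z))"
proof (cases "x \<in> ball 0 5")
 case True
 note [measurable] = bbd_measurable[OF u] bbd_measurable[OF chi]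
 have U: "0 \<le> U" using bbd_nonneg[OF u] .
 have i1: "integrable lborel (\<lambda>z. (u x - u (x + z)) * Kn x (x + z))"
 proof (rule Kn_integrable[where B="2 * U"])
  show "\<bar>u x - u (x + z)\<bar> \<le> 2 * U" for z
   using bbd_le[OF u, of x] bbd_le[OF u, of "x + z"] by linarith
 qed measurable
 have i2: "integrable lborel (\<lambda>z. ((\<phi> x - \<phi> (x + z)) * (u x - u (x + z))) * Kn x (x + z))"
 proof (rule Kn_integrable[where B="2 * (2 * U)"])
  show "\<bar>(\<phi> x - \<phi> (x + z)) * (u x - u (x + z))\<bar> \<le> 2 * (2 * U)" for z
   unfolding abs_mult using bbd_le[OF u, of x] bbd_le[OF u, of "x + z"] bbd_le[OF chi, of x] bbd_le[OF chi, of "x + z"]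
   by (intro mult_mono) linarith+
 qed measurable
 have i3: "integrable lborel (\<lambda>z. ((1/2) * (u x + u (x + z)) * (\<phi> x - \<phi> (x + z))) * Kn x (x + z))"
 proof (rule Kn_integrable[where B="U * 2"])
  show "\<bar>(1/2) * (u x + u (x + z)) * (\<phi> x - \<phi> (x + z))\<bar> \<le> U * 2" for z
   unfolding abs_mult[of _ "\<phi> x - \<phi> (x + z)"]
  proof (rule mult_mono)
   show "\<bar>(1/2) * (u x + u (x + z))\<bar> \<le> U"
   proof -
    have "\<bar>u x + u (x + z)\<bar> \<le> 2 * U" using bbd_le[OF u, of x] bbd_le[OF u, of "x + z"] by linarith
    then show ?thesis unfolding abs_mult by simp
   qed
   show "\<bar>\<phi> x - \<phi> (x + z)\<bar> \<le> 2" using bbd_le[OF chi, of x] bbd_le[OF chi, of "x + z"] by linarith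
  qed (use U in auto)
 qed measurable
 have "(LBINT z. (\<phi> x * u x - \<phi> (x + z) * u (x + z)) * Kn x (x + z))
   = (LBINT z. (\<phi> x * ((u x - u (x + z)) * Kn x (x + z)) - (1/2) * (((\<phi> x - \<phi> (x + z)) * (u x - u (x + z))) * Kn x (x + z)))
     + ((1/2) * (u x + u (x + z)) * (\<phi> x - \<phi> (x + z))) * Kn x (x + z))"
  by (intro bochner_cong) (auto simp: field_simps)
 also have "\<dots> = (\<phi> x * (LBINT z. (u x - u (x + z)) * Kn x (x + z)) - (1/2) * cutoff_error \<phi> u x)
   + (LBINT z. ((1/2) * (u x + u (x + z)) * (\<phi> x - \<phi> (x + z))) * Kn x (x + z))"
  using i1 i2 i3 unfolding cutoff_error_def
  by (subst bochner_add, simp, simp, subst bochner_diff, simp, simp) simp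
 finally have e: "(LBINT z. (\<phi> x * u x - \<phi> (x + z) * u (x + z)) * Kn x (x + z))
  = (\<phi> x * (LBINT z. (u x - u (x + z)) * Kn x (x + z)) - (1/2) * cutoff_error \<phi> u x)
   + (LBINT z. ((1/2) * (u x + u (x + z)) * (\<phi> x - \<phi> (x + z))) * Kn x (x + z))" .
 have "f x = 2 * (LBINT z. (u x - u (x + z)) * Kn x (x + z))" using eq[OF True] by simp
 then show ?thesis unfolding e by (simp only: distrib_left right_diff_distrib)
next
 case False
 have "Kn x (x + z) = 0 \<or> \<phi> (x + z) = 0" for z
 proof (cases "norm z < 1")
  case True
  then have "x + z \<notin> ball 0 4" using False norm_triangle_ineq4[of "x + z" z] by auto
  then show ?thesis using supp by simp
 qed (simp add: Kn_def)
 moreover have "\<phi> x = 0" using False by (intro supp) auto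
 ultimately have z: "!!z. (\<phi> x * u x - \<phi> (x + z) * u (x + z)) * Kn x (x + z) = 0"
   "!!z. (\<phi> x - \<phi> (x + z)) * (u x - u (x + z)) * Kn x (x + z) = 0"
   "!!z. (1/2) * (u x + u (x + z)) * (\<phi> x - \<phi> (x + z)) * Kn x (x + z) = 0"
  by (metis diff_zero mult_zero_left mult_zero_right)+
 show ?thesis unfolding cutoff_error_def z using \<open>\<phi> x = 0\<close> by simp
qed

text \<open>Jumps below the free threshold \<open>s0\<close> are estimated by the seminorm
  \<open>N\<close>, longer ones by the supremum \<open>M\<close>. A small \<open>s0\<close> makes
  the coefficient of \<open>N\<close> as small as desired.\<close>

lemma cutoff_error_bound:
 assumes u: "u \<in> Borel" and chi: "\<phi> \<in> Borel"
  and gam: "2 * s - 1 < \<gamma>" "\<gamma> < 1" and s0: "0 < s0"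
  and lip: "!!x y. \<bar>\<phi> x - \<phi> y\<bar> \<le> L * norm (x - y)" and nn: "0 \<le> L" "0 \<le> N" "0 \<le> M"
  and N: "!!z. \<phi> x \<noteq> \<phi> (x + z) ==> tau < norm z ==> norm z < 1 ==> \<bar>u x - u (x + z)\<bar> \<le> N * norm z powr \<gamma>"
  and M: "!!z. \<phi> x \<noteq> \<phi> (x + z) ==> tau < norm z ==> norm z < 1 ==> \<bar>u x - u (x + z)\<bar> \<le> 2 * M"
 shows "\<bar>cutoff_error \<phi> u x\<bar> \<le> L * Lam * (N * s0 powr (\<gamma> + 1 - 2 * s) * radial_const n (\<gamma> + 1 - 2 * s)
   + 2 * M * s0 powr (1 - 2 * s) * radial_const n (2 * s - 1))"
proof -
 note [measurable] = u chi
 define g1 where "g1 = (\<lambda>z::'a. if norm z < s0 then L * Lam * N * norm z powr (\<gamma> + 1 - 2 * s - n) else 0)"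
 define g2 where "g2 = (\<lambda>z::'a. if s0 \<le> norm z then L * Lam * (2 * M) * norm z powr (- (2 * s - 1) - n) else 0)"
 have g1: "integrable lborel g1" "(LBINT z. g1 z) \<le> L * Lam * N * (s0 powr (\<gamma> + 1 - 2 * s) * radial_const n (\<gamma> + 1 - 2 * s))"
  using near_integral_bound(1,3)[where f=g1 and R=s0 and A="L * Lam * N" and e="\<gamma> + 1 - 2 * s", unfolded n] gam s s0 nn lam
  by (auto simp: g1_def)
 have g2: "integrable lborel g2" "(LBINT z. g2 z) \<le> L * Lam * (2 * M) * (s0 powr (- (2 * s - 1)) * radial_const n (2 * s - 1))"
  using far_integral_bound(1,3)[where f=g2 and R=s0 and A="L * Lam * (2 * M)" and e="2 * s - 1", unfolded n] gam s s0 nn lam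
  by (auto simp: g2_def)
 have le: "\<bar>(\<phi> x - \<phi> (x + z)) * (u x - u (x + z)) * Kn x (x + z)\<bar> \<le> g1 z + g2 z" for z
 proof (cases "\<phi> x \<noteq> \<phi> (x + z) \<and> tau < norm z \<and> norm z < 1")
  case True
  have z: "0 < norm z" using True tau by linarith
  have chi: "\<bar>\<phi> x - \<phi> (x + z)\<bar> \<le> L * norm z" using lip[of x "x + z"] by simp
  have K: "Kn x (x + z) \<le> Lam * rpow n s z" using Kn_bounds(2)[of x "x + z"] by simp
  have *: "\<bar>(\<phi> x - \<phi> (x + z)) * (u x - u (x + z)) * Kn x (x + z)\<bar> \<le> L * norm z * B * (Lam * rpow n s z)"
   if "\<bar>u x - u (x + z)\<bar> \<le> B" for B
   unfolding abs_mult using chi K that nn Kn_bounds(1)[of x "x + z"] by (intro mult_mono) auto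
  show ?thesis
  proof (cases "norm z < s0")
   case h: True
   have e: "norm z * norm z powr \<gamma> * rpow n s z = norm z powr (\<gamma> + 1 - 2 * s - n)"
   proof -
    have "norm z powr 1 * norm z powr \<gamma> * rpow n s z = norm z powr (\<gamma> + 1 - 2 * s - n)"
     by (simp only: powr_add[symmetric]) (rule arg_cong[where f="\<lambda>t. norm z powr t"], simp)
    then show ?thesis using z by simp
   qed
   have "L * norm z * (N * norm z powr \<gamma>) * (Lam * rpow n s z)
    = L * Lam * N * (norm z * norm z powr \<gamma> * rpow n s z)" by simp
   also note e
   finally have E: "L * norm z * (N * norm z powr \<gamma>) * (Lam * rpow n s z) = L * Lam * N * norm z powr (\<gamma> + 1 - 2 * s - n)" .
   have "\<bar>(\<phi> x - \<phi> (x + z)) * (u x - u (x + z)) * Kn x (x + z)\<bar> \<le> L * norm z * (N * norm z powr \<gamma>) * (Lam * rpow n s z)"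
    using *[OF N] True by blast
   also note E
   finally show ?thesis using h by (simp add: g1_def g2_def)
  next
   case h: False
   have e: "norm z * rpow n s z = norm z powr (- (2 * s - 1) - n)"
    using z powr_add[of "norm z" 1 "- n - 2 * s"] by (simp add: algebra_simps)
   have "L * norm z * (2 * M) * (Lam * rpow n s z)
    = L * Lam * (2 * M) * (norm z * rpow n s z)" by simp
   also note e
   finally have E: "L * norm z * (2 * M) * (Lam * rpow n s z) = L * Lam * (2 * M) * norm z powr (- (2 * s - 1) - n)" .
   have "\<bar>(\<phi> x - \<phi> (x + z)) * (u x - u (x + z)) * Kn x (x + z)\<bar> \<le> L * norm z * (2 * M) * (Lam * rpow n s z)"
    using *[OF M] True by blast
   also note E
   finally show ?thesis using h by (simp add: g1_def g2_def)
  qed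
 next
  case False
  then have "\<phi> x = \<phi> (x + z) \<or> Kn x (x + z) = 0" using Kn_zero[of x "x + z"] by auto
  moreover have "0 \<le> g1 z + g2 z" using nn lam by (auto simp: g1_def g2_def)
  ultimately show ?thesis by auto
 qed
 have "\<bar>cutoff_error \<phi> u x\<bar> \<le> (LBINT z. \<bar>(\<phi> x - \<phi> (x + z)) * (u x - u (x + z)) * Kn x (x + z)\<bar>)"
  unfolding cutoff_error_def by (rule integral_abs_bound)
 also have "\<dots> \<le> (LBINT z. g1 z + g2 z)"
 proof (rule integral_mono[OF _ _ le])
  show "integrable lborel (\<lambda>z. g1 z + g2 z)" using g1 g2 by simp
  then show "integrable lborel (\<lambda>z. \<bar>(\<phi> x - \<phi> (x + z)) * (u x - u (x + z)) * Kn x (x + z)\<bar>)"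
  proof (rule bochner_bound)
   show "AE z in lborel. norm \<bar>(\<phi> x - \<phi> (x + z)) * (u x - u (x + z)) * Kn x (x + z)\<bar> \<le> norm (g1 z + g2 z)"
    using le by (intro AE_I2) (auto intro: order_trans[OF _ abs_ge_self])
  qed measurable
 qed
 also have "\<dots> = (LBINT z. g1 z) + (LBINT z. g2 z)" using g1 g2 by simp
 finally show ?thesis using g1(2) g2(2) by (simp add: algebra_simps)
qed

lemma ex_tau_vector: obtains h0 :: 'a where "norm h0 = tau"
proof -
 obtain e :: 'a where e: "norm e = 1" by (meson norm_Basis nonempty_Basis ex_in_conv)
 have "norm (tau *\<^sub>R e) = tau" using e tau by simp
 then show ?thesis by (rule that)
qed

text \<open>The seminorm on a ball is estimated by that on a ball larger by \<open>d\<close>, which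
  enters only through the cutoff error and thus with a coefficient controlled by \<open>s0\<close>.
  Increments longer than \<open>d / 2\<close> may leave the region where the cutoff is 1, but for
  them the supremum is enough.\<close>

lemma holder_step:
 fixes \<gamma> defines "c \<equiv> core_constant n s lam \<gamma>" and "e \<equiv> \<gamma> + 1 - 2 * s"
 assumes gam: "2 * s - 1 < \<gamma>" "\<gamma> < 1" and epsc: "c * (6 * eps) \<le> 1 / 2"
  and u: "bbd U u" and uM: "!!x. x \<in> ball 0 6 ==> \<bar>u x\<bar> \<le> M"
  and f: "f \<in> Borel" and fM: "!!x. x \<in> ball 0 5 ==> \<bar>f x\<bar> \<le> M"
  and eq: "!!x. x \<in> ball 0 5 ==> 2 * (LBINT z. (u x - u (x + z)) * Kn x (x + z)) = f x"
  and d: "0 < r" "0 < d" "d \<le> 1" "r + d \<le> 4"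
  and N: "!!x h. x \<in> ball 0 (r + d) ==> tau \<le> norm h ==> norm h \<le> 1 ==> \<bar>u (x + h) - u x\<bar> \<le> N * norm h powr \<gamma>" "0 \<le> N"
  and s0: "0 < s0" and x: "x \<in> ball 0 r" and h: "tau \<le> norm h" "norm h \<le> 1"
 shows "\<bar>u (x + h) - u x\<bar> \<le> (2 * c * (2 * M + 2 / d * Lam * (N * s0 powr e * radial_const n e
   + 2 * M * s0 powr (1 - 2 * s) * radial_const n (2 * s - 1)) + M * (2 / d) * Lam) + 4 * M / d) * norm h powr \<gamma>"
proof -
 note [measurable] = bbd_measurable[OF u] f
 \<comment> \<open>Equal to 1 up to radius \<open>r + d / 2\<close>, with slope
   \<open>2 / d\<close>. Being Lipschitz suffices for a flux of order
   \<open>\<gamma> < 1\<close>.\<close>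
 define \<phi> where "\<phi> = (\<lambda>x::'a. max 0 (min 1 ((r + d - norm x) * (2 / d))))"
 have [measurable]: "\<phi> \<in> Borel" unfolding \<phi>_def by measurable
 have chi01: "0 \<le> \<phi> x" "\<phi> x \<le> 1" for x by (auto simp: \<phi>_def)
 have chi: "bbd 1 \<phi>" using chi01 by (auto intro!: bbdI simp: abs_le_iff)
 have supp: "\<phi> x = 0" if "x \<notin> ball 0 (r + d)" for x
 proof -
  have "(r + d - norm x) * (2 / d) \<le> 0" using that d by (intro mult_nonpos_nonneg) auto
  then show ?thesis by (simp add: \<phi>_def)
 qed
 have inner: "\<phi> x = 1" if "norm x \<le> r + d / 2" for x
 proof -
  have "d / 2 * (2 / d) \<le> (r + d - norm x) * (2 / d)" using that d by (intro mult_right_mono) auto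
  then show ?thesis using d by (simp add: \<phi>_def)
 qed
 have lip: "\<bar>\<phi> x - \<phi> y\<bar> \<le> 2 / d * norm (x - y)" for x y
 proof -
  have "\<bar>(r + d - norm x) * (2 / d) - (r + d - norm y) * (2 / d)\<bar> = \<bar>norm x - norm y\<bar> * (2 / d)"
  proof -
   have "(r + d - norm x) * (2 / d) - (r + d - norm y) * (2 / d) = (norm y - norm x) * (2 / d)"
    using d by (simp add: field_simps)
   then show ?thesis using d by (simp only: abs_mult) (simp add: abs_minus_commute)
  qed
  also have "\<dots> \<le> norm (x - y) * (2 / d)" using d by (intro mult_right_mono norm_triangle_ineq3) auto
  finally show ?thesis unfolding \<phi>_def by (simp add: mult.commute) linarith
 qed
 have M: "0 \<le> M" using uM[of 0] by simp
 define w where "w = (\<lambda>x. \<phi> x * u x)"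
 define g where "g = (\<lambda>x. w x + (\<phi> x * f x - cutoff_error \<phi> u x))"
 define F where "F = (\<lambda>x y. (1/2) * (u x + u y) * (\<phi> x - \<phi> y) * Kn x y)"
 define B where "B = 2 / d * Lam * (N * s0 powr e * radial_const n e + 2 * M * s0 powr (1 - 2 * s) * radial_const n (2 * s - 1))"
 define A where "A = M * (2 / d) * Lam"
 have pair: "x \<in> ball 0 6 \<and> y \<in> ball 0 6 \<and> (x \<in> ball 0 (r + d) \<or> y \<in> ball 0 (r + d))"
  if "\<phi> x \<noteq> 0 \<or> \<phi> y \<noteq> 0" "norm (x - y) < 1" for x y
 proof -
  have "x \<in> ball 0 (r + d) \<or> y \<in> ball 0 (r + d)" using that supp by blast
  then show ?thesis using that(2) d norm_triangle_ineq2[of x y] norm_triangle_ineq3[of x y] by auto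
 qed
 have uxy: "\<bar>u x - u y\<bar> \<le> N * norm (x - y) powr \<gamma>" if "\<phi> x \<noteq> 0 \<or> \<phi> y \<noteq> 0" "norm (x - y) < 1" "tau < norm (x - y)" for x y
  using pair[OF that(1,2)] N(1)[of x "y - x"] N(1)[of y "x - y"] that by (auto simp: norm_minus_commute abs_minus_commute)
 have B: "\<bar>cutoff_error \<phi> u x\<bar> \<le> B" for x
  unfolding B_def e_def
 proof (rule cutoff_error_bound[OF _ _ gam s0 lip])
  fix z assume z: "\<phi> x \<noteq> \<phi> (x + z)" "tau < norm z" "norm z < 1"
  then have "\<phi> x \<noteq> 0 \<or> \<phi> (x + z) \<noteq> 0" by auto
  note this pair[OF this] uxy[OF this]
  then show "\<bar>u x - u (x + z)\<bar> \<le> N * norm z powr \<gamma>" "\<bar>u x - u (x + z)\<bar> \<le> 2 * M"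
   using z uM[of x] uM[of "x + z"] by auto
 qed (use d N M in auto)
 have B0: "0 \<le> B" using B[of 0] by linarith
 have wM: "\<bar>w x\<bar> \<le> M" for x
 proof (cases "\<phi> x = 0")
  case False
  then have "x \<in> ball 0 6" using pair[of x x] by auto
  then have "\<bar>\<phi> x\<bar> * \<bar>u x\<bar> \<le> 1 * M" using uM chi01[of x] by (intro mult_mono) auto
  then show ?thesis by (simp add: w_def abs_mult)
 qed (simp add: w_def M)
 have fM': "\<bar>\<phi> x * f x\<bar> \<le> M" for x
 proof (cases "\<phi> x = 0")
  case False
  then have "x \<in> ball 0 (r + d)" using supp by auto
  then have "x \<in> ball 0 5" using d by auto
  then have "\<bar>\<phi> x\<bar> * \<bar>f x\<bar> \<le> 1 * M" using fM chi01[of x] by (intro mult_mono) auto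
  then show ?thesis by (simp add: abs_mult)
 qed (simp add: M)
 have w: "bbd M w" using wM by (intro bbdI) (auto simp: w_def)
 have g: "bbd (M + (M + B)) g"
 proof (rule bbdI)
  show "g \<in> Borel" unfolding g_def w_def using cutoff_error_measurable[of \<phi> u] by measurable
  show "\<bar>g x\<bar> \<le> M + (M + B)" for x using wM[of x] fM'[of x] B[of x] unfolding g_def by linarith
 qed
 obtain h0 :: 'a where h0: "norm h0 = tau" by (rule ex_tau_vector)
 have zero: "bbd 0 (\<lambda>_::'a. 0)" by (simp add: bbd_def)
 have main: "\<bar>w (x + h) - w x\<bar> \<le> 2 * c * ((M + (M + B)) + norm h0 powr (2 * s - \<gamma>) * 0 + A) * norm h powr \<gamma>"
  unfolding c_def
 proof (rule nk.perturbed_estimate(2)[OF theta_le_1 gam w g zero _ _ _ Kn_measurable Kn_sym Kn_zero, where \<epsilon>="6 * eps" and F=F])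
  show "tau \<le> norm h0" "norm h0 \<le> 1" using h0 tau by auto
  show "0 \<le> A" using M d lam by (simp add: A_def)
  show "\<bar>Kn x y - k0 (x - y)\<bar> \<le> 6 * eps * rpow n s (x - y)"
   if "w x \<noteq> w y" "tau < norm (x - y)" "norm (x - y) < 1" for x y
  proof -
   have "\<phi> x \<noteq> 0 \<or> \<phi> y \<noteq> 0" using that(1) by (auto simp: w_def)
   from pair[OF this that(3)] show ?thesis using that by (intro frozen) auto
  qed
  show "case_prod F \<in> borel_measurable borel2" unfolding F_def split_beta' by measurable
  show "F y x = - F x y" for x y using Kn_sym[of x y] by (simp add: F_def field_simps)
  show "\<bar>F x y\<bar> \<le> (if tau < norm (x - y) \<and> norm (x - y) < 1 then A * norm (x - y) powr (\<gamma> - n - 2 * s) else 0)" for x y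
  proof (cases "(tau < norm (x - y) \<and> norm (x - y) < 1) \<and> \<phi> x \<noteq> \<phi> y")
   case True
   then have "\<phi> x \<noteq> 0 \<or> \<phi> y \<noteq> 0" by auto
   with True pair have xy: "x \<in> ball 0 6" "y \<in> ball 0 6" by blast+
   have z: "0 < norm (x - y)" using True tau by linarith
   have "\<bar>F x y\<bar> = \<bar>(1/2) * (u x + u y)\<bar> * \<bar>\<phi> x - \<phi> y\<bar> * Kn x y"
    unfolding F_def abs_mult using Kn_bounds(1)[of x y] by simp
   also have "\<dots> \<le> M * (2 / d * norm (x - y)) * (Lam * rpow n s (x - y))"
   proof (intro mult_mono lip Kn_bounds)
    have "\<bar>u x + u y\<bar> \<le> 2 * M" using uM[OF xy(1)] uM[OF xy(2)] by linarith
    then show "\<bar>1 / 2 * (u x + u y)\<bar> \<le> M" unfolding abs_mult by simp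
   qed (use M d in auto)
   also have "\<dots> \<le> M * (2 / d * norm (x - y) powr \<gamma>) * (Lam * rpow n s (x - y))"
    using powr_mono'[of \<gamma> 1 "norm (x - y)"] True z gam M d lam
    by (intro mult_right_mono mult_left_mono) auto
   also have "\<dots> = A * (norm (x - y) powr \<gamma> * rpow n s (x - y))" by (simp add: A_def)
   also have "norm (x - y) powr \<gamma> * rpow n s (x - y) = norm (x - y) powr (\<gamma> - n - 2 * s)"
    by (simp add: powr_add[symmetric] algebra_simps)
   finally show ?thesis using True by simp
  next
   case False
   then have "F x y = 0" using Kn_zero[of x y] by (auto simp: F_def)
   then show ?thesis using M d lam by (simp add: A_def)
  qed
  show "w x + 2 * (LBINT z. (w x - w (x + z)) * Kn x (x + z)) = g x + (0 - 0) + 2 * (LBINT z. F x (x + z))" for x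
  proof -
   have "2 * (LBINT z. (\<phi> x * u x - \<phi> (x + z) * u (x + z)) * Kn x (x + z))
    = (\<phi> x * f x - cutoff_error \<phi> u x)
    + 2 * (LBINT z. (1/2) * (u x + u (x + z)) * (\<phi> x - \<phi> (x + z)) * Kn x (x + z))"
    by (rule cutoff_identity[OF u chi _ eq]) (use supp d in auto)
   then show ?thesis unfolding g_def F_def w_def by simp
  qed
 qed (use eps epsc h in \<open>auto simp: c_def\<close>)
 show ?thesis
 proof (cases "norm h \<le> d / 2")
  case True
  have "norm (x + h) \<le> r + d / 2" "norm x \<le> r + d / 2"
   using True x d norm_triangle_ineq[of x h] by auto
  then have "u (x + h) - u x = w (x + h) - w x" by (simp add: w_def inner)
  moreover have "0 \<le> 4 * M / d * norm h powr \<gamma>" using M d by simp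
  ultimately show ?thesis using main unfolding A_def B_def by (simp add: algebra_simps)
 next
  case False
  have hp: "0 < norm h" using h tau by linarith
  have c0: "0 \<le> c" unfolding c_def
  proof -
   have "0 < core_constant n s lam \<gamma>"
   proof -
    interpret flux n s lam Lam tau k0 \<gamma> 0 "\<lambda>_ _. 0" by unfold_locales (use gam in auto)
    show ?thesis by (rule CC_pos)
   qed
   then show "0 \<le> core_constant n s lam \<gamma>" by simp
  qed
  have "norm x < 4" "norm (x + h) < 6" using x h d norm_triangle_ineq[of x h] by auto
  then have "\<bar>u (x + h) - u x\<bar> \<le> 2 * M" using uM[of x] uM[of "x + h"] by auto
  also have "\<dots> \<le> 4 * M / d * norm h" using False d M mult_left_mono[of "d / 2" "norm h" "4 * M / d"] by simp
  also have "\<dots> \<le> 4 * M / d * norm h powr \<gamma>"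
   using powr_mono'[of \<gamma> 1 "norm h"] hp h gam M d by (intro mult_left_mono) auto
  also have "\<dots> \<le> (2 * c * (2 * M + B + A) + 4 * M / d) * norm h powr \<gamma>"
   using c0 M B0 d lam by (intro mult_right_mono) (auto simp: A_def)
  finally show ?thesis unfolding A_def B_def .
 qed
qed

text \<open>Iteration over the balls of radius \<open>4 - 2 powr (- j)\<close>. No bound independent
  of \<open>tau\<close> is known in advance for the seminorm on the larger ball, so each step has to
  shrink its coefficient faster than the constants grow with \<open>j\<close>.\<close>

theorem interior_holder:
 assumes gam: "2 * s - 1 < \<gamma>" "\<gamma> < 1" and epsc: "core_constant n s lam \<gamma> * (6 * eps) \<le> 1 / 2"
  and u: "bbd U u" and uM: "!!x. x \<in> ball 0 6 ==> \<bar>u x\<bar> \<le> M"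
  and f: "f \<in> Borel" and fM: "!!x. x \<in> ball 0 5 ==> \<bar>f x\<bar> \<le> M"
  and eq: "!!x. x \<in> ball 0 5 ==> 2 * (LBINT z. (u x - u (x + z)) * Kn x (x + z)) = f x"
  and x: "x \<in> ball 0 3" and h: "tau \<le> norm h" "norm h \<le> 1"
 shows "\<bar>u (x + h) - u x\<bar> \<le> holder_constant n s lam Lam \<gamma> * M * norm h powr \<gamma>"
proof -
 define c where "c = core_constant n s lam \<gamma>"
 define e where "e = \<gamma> + 1 - 2 * s"
 define m where "m = 1 + (2 * s - 1) / e"
 define r1 where "r1 = radial_const n e"
 define r3 where "r3 = radial_const n (2 * s - 1)"
 define \<eta> where "\<eta> = min 1 (2 powr (- m - 1) / (4 * c * Lam * r1))"
 define B where "B = 4 * c + 4 * c * Lam * (2 * \<eta> powr (- (2 * s - 1) / e) * r3 + 1) + 4"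
 have M: "0 \<le> M" using uM[of 0] by simp
 have e: "0 < e" using gam by (simp add: e_def)
 have m: "1 < m" using e s by (simp add: m_def)
 have c: "0 < c"
 proof -
  interpret flux n s lam Lam tau k0 \<gamma> 0 "\<lambda>_ _. 0" by unfold_locales (use gam in auto)
  show ?thesis unfolding c_def by (rule CC_pos)
 qed
 have r13: "0 < r1" "0 < r3" using e s n_pos by (auto simp: r1_def r3_def intro!: radial_const_pos)
 have eta: "0 < \<eta>" using c lam r13 by (simp add: \<eta>_def)
 have eta_le: "4 * c * Lam * r1 * \<eta> \<le> 2 powr (- m - 1)"
 proof -
  have p: "0 < 4 * c * Lam * r1" using c lam r13 by simp
  have "\<eta> \<le> 2 powr (- m - 1) / (4 * c * Lam * r1)" by (simp add: \<eta>_def)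
  then show ?thesis using p by (simp add: field_simps)
 qed
 have B0: "0 \<le> B" using c lam r13 by (simp add: B_def)
 define Z where "Z = 2 * M / tau powr \<gamma>"
 have gp: "0 < \<gamma>" using gam s by simp
 have Z: "0 \<le> Z" using M by (simp add: Z_def)
 \<comment> \<open>\<open>j\<close> labels the radius and \<open>i\<close> counts the applications
   of the step. The induction is on \<open>i\<close> for all \<open>j\<close> at once: each step
   refers to the radius \<open>j + 1\<close> and halves the weight of the crude bound
   \<open>Z\<close>, which depends on \<open>tau\<close> and disappears as \<open>i\<close>
   grows.\<close>
 have iter: "\<forall>x h. x \<in> ball 0 (4 - 2 powr (- real j)) --> tau \<le> norm h --> norm h \<le> 1 -->
   \<bar>u (x + h) - u x\<bar> \<le> 2 powr (m * real j) * (2 * M * B * 2 powr m + 2 powr (- real i) * Z) * norm h powr \<gamma>"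
  for i j
 proof (induction i arbitrary: j)
  case 0
  show ?case
  proof (intro allI impI)
   fix x h :: 'a assume x: "x \<in> ball 0 (4 - 2 powr - real j)" and h: "tau \<le> norm h" "norm h \<le> 1"
   have "norm x < 4" using x by (auto intro: less_trans)
   then have "norm x < 6" "norm (x + h) < 6" using h norm_triangle_ineq[of x h] by auto
   then have "\<bar>u (x + h) - u x\<bar> \<le> 2 * M" using uM[of x] uM[of "x + h"] by auto
   also have "\<dots> \<le> Z * norm h powr \<gamma>"
   proof -
    have "tau powr \<gamma> \<le> norm h powr \<gamma>" using h tau gp by (intro powr_mono2) auto
    then have "2 * M * 1 \<le> 2 * M * (norm h powr \<gamma> / tau powr \<gamma>)" using M tau by (intro mult_left_mono) auto
    then show ?thesis by (simp add: Z_def)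
   qed
   also have "\<dots> \<le> 2 powr (m * real j) * (2 * M * B * 2 powr m + 2 powr (- real 0) * Z) * norm h powr \<gamma>"
   proof (intro mult_right_mono)
    have "1 * Z \<le> 2 powr (m * real j) * (2 * M * B * 2 powr m + Z)"
     using m M B0 Z by (intro mult_mono) (auto intro: ge_one_powr_ge_zero)
    then show "Z \<le> 2 powr (m * real j) * (2 * M * B * 2 powr m + 2 powr (- real 0) * Z)" by simp
   qed simp
   finally show "\<bar>u (x + h) - u x\<bar> \<le> 2 powr (m * real j) * (2 * M * B * 2 powr m + 2 powr (- real 0) * Z) * norm h powr \<gamma>" .
  qed
 next
  case (Suc i)
  define d where "d = 2 powr (- real (Suc j))"
  have d: "0 < d" "d \<le> 1 / 2" unfolding d_def using powr_mono[of "- real (Suc j)" "-1" "2::real"] by (auto simp: powr_minus)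
  have dd: "2 powr (- real j) = 2 * d" using powr_add[of 2 1 "- real (Suc j)"] by (simp add: d_def)
  define N where "N = 2 powr (m * real (Suc j)) * (2 * M * B * 2 powr m + 2 powr (- real i) * Z)"
  \<comment> \<open>This makes the coefficient of \<open>N\<close> equal to
    \<open>4 * c * Lam * r1 * \<eta>\<close>, at most \<open>2 powr (- m - 1)\<close> and
    independent of \<open>d\<close>. The price is lower-order terms of size
    \<open>d powr (- m)\<close>, which is where the exponent \<open>m\<close> comes from.\<close>
  define s0 where "s0 = (\<eta> * d) powr (1 / e)"
  have s0: "0 < s0" "s0 powr e = \<eta> * d" "s0 powr (1 - 2 * s) = (\<eta> * d) powr (- (2 * s - 1) / e)"
   using eta d e by (auto simp: s0_def powr_powr)
  have N0: "0 \<le> N" using M B0 Z by (simp add: N_def)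
  have dm: "d powr (- m) = 2 powr (m * real (Suc j))" unfolding d_def powr_powr by (rule arg_cong[where f="\<lambda>t. 2 powr t"]) (simp add: algebra_simps)
  have "\<bar>u (x + h) - u x\<bar> \<le> 2 powr (m * real j) * (2 * M * B * 2 powr m + 2 powr (- real (Suc i)) * Z) * norm h powr \<gamma>"
   if x: "x \<in> ball 0 (4 - 2 powr (- real j))" and h: "tau \<le> norm h" "norm h \<le> 1" for x h
  proof -
   have "\<bar>u (x + h) - u x\<bar> \<le> (2 * core_constant n s lam \<gamma> * (2 * M + 2 / d * Lam * (N * s0 powr (\<gamma> + 1 - 2 * s) * radial_const n (\<gamma> + 1 - 2 * s)
    + 2 * M * s0 powr (1 - 2 * s) * radial_const n (2 * s - 1)) + M * (2 / d) * Lam) + 4 * M / d) * norm h powr \<gamma>"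
   proof (rule holder_step[OF gam epsc u uM f fM eq _ d(1) _ _ _ N0 s0(1) x h])
    show "\<bar>u (x + h) - u x\<bar> \<le> N * norm h powr \<gamma>"
     if "x \<in> ball 0 (4 - 2 powr - real j + d)" "tau \<le> norm h" "norm h \<le> 1" for x h
    proof -
     have "4 - 2 powr - real j + d = 4 - 2 powr (- real (Suc j))" unfolding dd by (simp add: d_def)
     then show ?thesis using Suc[of "Suc j"] that unfolding N_def by metis
    qed
   qed (use d dd in auto)
   also have "\<dots> \<le> (2 powr (- m - 1) * N + M * B * d powr (- m)) * norm h powr \<gamma>"
   proof (intro mult_right_mono)
    have A1: "2 * c * (2 / d * Lam * (N * s0 powr e * r1)) = 4 * c * Lam * r1 * \<eta> * N"
     unfolding s0(2) using d by (simp add: field_simps)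
    have A2: "2 / d * s0 powr (1 - 2 * s) = 2 * \<eta> powr (- (2 * s - 1) / e) * d powr (- m)"
    proof -
     have "d powr (- m) = d powr (- 1) * d powr (- (2 * s - 1) / e)"
      unfolding powr_add[symmetric] m_def by (rule arg_cong[where f="\<lambda>t. d powr t"]) (simp add: diff_divide_distrib add_divide_distrib)
     then show ?thesis unfolding s0(3) using d eta by (simp add: powr_mult powr_minus field_simps)
    qed
    have d1: "1 \<le> d powr (- m)" "1 / d \<le> d powr (- m)"
    proof -
     have "d powr (- 1) \<le> d powr (- m)" using d m by (intro powr_mono') auto
     then show "1 / d \<le> d powr (- m)" using d by (simp add: powr_minus_divide)
     moreover have "1 \<le> 1 / d" using d by simp
     ultimately show "1 \<le> d powr (- m)" by linarith
    qed
    have "2 * c * (2 * M + 2 / d * Lam * (N * s0 powr e * r1 + 2 * M * s0 powr (1 - 2 * s) * r3) + M * (2 / d) * Lam) + 4 * M / d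
     = 2 * c * (2 / d * Lam * (N * s0 powr e * r1)) + (4 * c * M * 1 + 4 * c * Lam * M * r3 * (2 / d * s0 powr (1 - 2 * s)) + 4 * c * Lam * M * (1 / d) + 4 * M * (1 / d))"
     by (simp add: algebra_simps)
    also have "\<dots> \<le> 2 powr (- m - 1) * N + (4 * c * M * d powr (- m) + 4 * c * Lam * M * r3 * (2 * \<eta> powr (- (2 * s - 1) / e) * d powr (- m))
      + 4 * c * Lam * M * d powr (- m) + 4 * M * d powr (- m))"
     unfolding A1 A2 using d1 eta_le N0 c M lam
     by (intro add_mono mult_left_mono mult_right_mono) auto
    also have "\<dots> = 2 powr (- m - 1) * N + M * B * d powr (- m)" unfolding B_def by (simp add: algebra_simps)
    finally show "2 * core_constant n s lam \<gamma> * (2 * M + 2 / d * Lam * (N * s0 powr (\<gamma> + 1 - 2 * s) * radial_const n (\<gamma> + 1 - 2 * s)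
     + 2 * M * s0 powr (1 - 2 * s) * radial_const n (2 * s - 1)) + M * (2 / d) * Lam) + 4 * M / d \<le> 2 powr (- m - 1) * N + M * B * d powr (- m)"
     unfolding c_def[symmetric] e_def[symmetric] r1_def[symmetric] r3_def[symmetric] .
   qed simp
   also have "2 powr (- m - 1) * N + M * B * d powr (- m) = 2 powr (m * real j) * (2 * M * B * 2 powr m + 2 powr (- real (Suc i)) * Z)"
   proof -
    have a: "2 powr (m * real (Suc j)) = 2 powr m * 2 powr (m * real j)" by (simp add: powr_add[symmetric] algebra_simps)
    have b: "2 powr (- m - 1) * 2 powr m = (1/2 :: real)" using powr_add[of "2::real" "- m - 1" m] by (simp add: powr_minus)
    have b': "2 powr (- m - 1) * (2 powr m * X) = X / 2" for X :: real using b by (metis mult.assoc mult.commute times_divide_eq_right mult_1_right)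
    have c: "2 powr (- real (Suc i)) = 2 powr (- real i) / (2::real)"
    proof -
     have "- real (Suc i) = - real i + - 1" by simp
     then show ?thesis by (simp only: powr_add) (simp add: powr_minus)
    qed
    show ?thesis unfolding dm N_def a c by (simp add: b' mult.assoc distrib_left)
   qed
   finally show ?thesis .
  qed
  then show ?case by blast
 qed
 have lim: "\<bar>u (x + h) - u x\<bar> \<le> (2 * M * B * 2 powr m + 2 powr (- real i) * Z) * norm h powr \<gamma>" for i
  using iter[rule_format, of x 0 h i] x h by simp
 have "(\<lambda>i. (2 * M * B * 2 powr m + (1/2) ^ i * Z) * norm h powr \<gamma>) \<longlonglongrightarrow> (2 * M * B * 2 powr m + 0 * Z) * norm h powr \<gamma>"
  by (intro tendsto_intros LIMSEQ_power_zero) auto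
 moreover have "2 powr (- real i) = (1/2 :: real) ^ i" for i
  by (simp add: powr_minus powr_realpow power_one_over inverse_eq_divide)
 ultimately have "\<bar>u (x + h) - u x\<bar> \<le> (2 * M * B * 2 powr m + 0 * Z) * norm h powr \<gamma>"
  using lim by (intro LIMSEQ_le_const) auto
 moreover have "holder_constant n s lam Lam \<gamma> * M = 2 * M * B * 2 powr m"
  unfolding holder_constant_def Let_def B_def \<eta>_def r1_def r3_def c_def m_def e_def by (simp add: powr_add mult_ac)
 ultimately show ?thesis by (simp only: mult_zero_left add_0_right)
qed

end

section \<open>Second differences\<close>

text \<open>A tent that is 1 up to radius \<open>5 / 8\<close> and 0 from \<open>7 / 8\<close> on,
  averaged over jumps shorter than \<open>1 / 8\<close>. The averaging serves mixed second
  differences: one factor is the Lipschitz bound of the tent, the other the translation bound of the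
  averaging density.\<close>

definition cutoff :: "'a::euclidean_space => real" where
 "cutoff = cv (\<lambda>z. annulus_bump (1/24) z / (LBINT (y::'a). annulus_bump (1/24) y))
   (\<lambda>x. max 0 (min 1 ((7/8 - norm x) * 4)))"

definition cutoff_constant :: "real => real" where "cutoff_constant n = 384 * 6 powr n"

lemma cutoff_properties:
 shows "bbd 1 (cutoff :: 'a::euclidean_space => real)" "0 \<le> cutoff (x::'a)" "cutoff x \<le> 1"
  and "norm x \<le> 1/2 ==> cutoff x = 1" "1 \<le> norm x ==> cutoff x = 0"
  and "\<bar>cutoff x - cutoff y\<bar> \<le> cutoff_constant (real DIM('a)) * norm (x - y)"
  and "\<bar>(cutoff (x + h) - cutoff (y + h)) - (cutoff x - cutoff y)\<bar> \<le> cutoff_constant (real DIM('a)) * norm h * norm (x - y)"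
proof -
 define \<rho> where "\<rho> = (1/24 :: real)"
 define m where "m = (LBINT (y::'a). annulus_bump \<rho> y)"
 define b where "b = (\<lambda>z::'a. annulus_bump \<rho> z / m)"
 define \<psi> where "\<psi> = (\<lambda>x::'a. max 0 (min 1 ((7/8 - norm x) * 4)))"
 define C where "C = cutoff_constant (real DIM('a))"
 have r: "0 < \<rho>" by (simp add: \<rho>_def)
 have ceq: "cutoff = cv b \<psi>" by (simp add: cutoff_def b_def \<psi>_def m_def \<rho>_def)
 have "0 < unit_ball_vol (DIM('a)) * (\<rho> / 2) ^ DIM('a) / 2" using r by simp
 then have m: "0 < m" "unit_ball_vol (DIM('a)) * (\<rho> / 2) ^ DIM('a) / 2 \<le> m"
  using annulus_bump_mass[OF r, where 'a='a] by (auto simp: m_def)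
 have b0: "0 \<le> b z" for z using m annulus_bump_range(1)[of \<rho> z] by (simp add: b_def)
 have bi: "integrable lborel b" using annulus_bump_integrable[OF r, where 'a='a] by (simp add: b_def)
 have b1: "(LBINT z. b z) = 1" using m by (simp add: b_def m_def[symmetric])
 have b1': "(LBINT z. \<bar>b z\<bar>) = 1" by (simp only: abs_of_nonneg[OF b0] b1)
 have bsupp: "b z \<noteq> 0 ==> norm z < 1/8" for z using annulus_bump_support[OF r, of z] m by (auto simp: b_def \<rho>_def)
 have psi01: "0 \<le> \<psi> x" "\<psi> x \<le> 1" for x by (auto simp: \<psi>_def)
 have psi: "bbd 1 \<psi>" by (rule bbdI) (use psi01 in \<open>auto simp: \<psi>_def\<close>)
 have psi_lip: "\<bar>\<psi> x - \<psi> y\<bar> \<le> 4 * norm (x - y)" for x y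
  using norm_triangle_ineq3[of x y] unfolding \<psi>_def by (simp add: abs_le_iff) linarith
 have i: "integrable lborel (\<lambda>z. b z * \<psi> (x + z))" for x by (rule bbd_integrable(1)[OF bi psi])
 show "bbd 1 (cutoff :: 'a => real)" unfolding ceq using cv_bbd[OF bi psi] unfolding b1' by simp
 show "0 \<le> cutoff x" unfolding ceq cv_def using b0 psi01 by (intro integral_nonneg_AE AE_I2) auto
 have "cutoff x \<le> (LBINT z. b z)"
  unfolding ceq cv_def using b0 psi01 i bi by (intro integral_mono) (auto intro: mult_right_le_one_le)
 then show "cutoff x \<le> 1" using b1 by simp
 show "cutoff x = 1" if "norm x \<le> 1/2"
 proof -
  have e: "b z * \<psi> (x + z) = b z" for z
  proof (cases "b z = 0")
   case False
   then have "norm (x + z) \<le> 5/8" using bsupp[OF False] that norm_triangle_ineq[of x z] by linarith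
   then have "\<psi> (x + z) = 1" by (simp add: \<psi>_def)
   then show ?thesis by simp
  qed simp
  show ?thesis unfolding ceq cv_def e by (rule b1)
 qed
 show "cutoff x = 0" if "1 \<le> norm x"
 proof -
  have e: "b z * \<psi> (x + z) = 0" for z
  proof (cases "b z = 0")
   case False
   then have "7/8 \<le> norm (x + z)" using bsupp[OF False] that norm_triangle_ineq2[of "x + z" z] norm_triangle_ineq4[of "x + z" z] by simp
   then have "\<psi> (x + z) = 0" by (simp add: \<psi>_def)
   then show ?thesis by simp
  qed simp
  show ?thesis unfolding ceq cv_def e by simp
 qed
 have C4: "4 \<le> C"
 proof -
  have "1 \<le> 6 powr real DIM('a)" by (intro ge_one_powr_ge_zero) auto
  then show ?thesis by (simp add: C_def cutoff_constant_def)
 qed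
 have inc: "cv b \<psi> (x + h) - cv b \<psi> x = cv b (\<lambda>x. \<psi> (x + h) - \<psi> x) x" for x h
  using cv_diff[OF bi bbd_shift[OF psi] psi] by (simp add: cv_shift)
 have dpsi: "bbd (4 * norm h) (\<lambda>x. \<psi> (x + h) - \<psi> x)" for h
 proof (rule bbdI)
  show "(\<lambda>x. \<psi> (x + h) - \<psi> x) \<in> Borel" by (simp add: \<psi>_def)
  show "\<bar>\<psi> (x + h) - \<psi> x\<bar> \<le> 4 * norm h" for x using psi_lip[of "x + h" x] by simp
 qed
 have "\<bar>cutoff x - cutoff y\<bar> \<le> 4 * norm (x - y)"
 proof -
  have "\<bar>cv b (\<lambda>u. \<psi> (u + (x - y)) - \<psi> u) y\<bar> \<le> 1 * (4 * norm (x - y))"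
   using bbd_le[OF cv_bbd[OF bi dpsi[of "x - y"]], of y] unfolding b1' .
  moreover have "cv b (\<lambda>u. \<psi> (u + (x - y)) - \<psi> u) y = cutoff x - cutoff y"
  proof -
   have "y + (x - y) = x" by simp
   then show ?thesis using inc[of y "x - y"] unfolding ceq by (simp only:)
  qed
  ultimately show ?thesis by (simp only: mult_1)
 qed
 then show "\<bar>cutoff x - cutoff y\<bar> \<le> cutoff_constant (real DIM('a)) * norm (x - y)"
  using C4 unfolding C_def by (elim order_trans) (intro mult_right_mono, auto)
 have L1: "(LBINT z. \<bar>b (z - h) - b z\<bar>) \<le> 96 * 6 powr (real DIM('a)) * norm h"
 proof -
  define w where "w = unit_ball_vol (DIM('a)) * (\<rho> / 2) ^ DIM('a)"
  have w: "0 < w" using r by (simp add: w_def)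
  have p3: "(3 * \<rho>) ^ DIM('a) = 6 ^ DIM('a) * (\<rho> / 2) ^ DIM('a)" by (simp only: power_mult_distrib[symmetric]) simp
  have p6: "6 powr real DIM('a) = (6::real) ^ DIM('a)" by (rule powr_realpow) simp
  have e: "unit_ball_vol (DIM('a)) * (3 * \<rho>) ^ DIM('a) = 6 powr (real DIM('a)) * w"
   unfolding w_def p3 p6 by (rule mult.left_commute)
  have "(LBINT z. \<bar>b (z - h) - b z\<bar>) = (LBINT z. \<bar>annulus_bump \<rho> (z - h) - annulus_bump \<rho> z\<bar>) / m"
   using m by (simp add: b_def diff_divide_distrib[symmetric] abs_divide)
  also have "\<dots> \<le> (norm h / \<rho> * (2 * (6 powr (real DIM('a)) * w))) / m"
   using annulus_bump_increment[OF r, of h] m unfolding e by (intro divide_right_mono) auto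
  also have "\<dots> \<le> (norm h / \<rho> * (2 * (6 powr (real DIM('a)) * w))) / (w / 2)"
   using m w r unfolding w_def[symmetric] by (intro divide_left_mono) auto
  also have "\<dots> = 96 * 6 powr (real DIM('a)) * norm h" using w by (simp add: \<rho>_def)
  finally show ?thesis .
 qed
 have "\<bar>cv b (\<lambda>x. \<psi> (x + (x' - y)) - \<psi> x) (y + h) - cv b (\<lambda>x. \<psi> (x + (x' - y)) - \<psi> x) y\<bar>
   \<le> 96 * 6 powr (real DIM('a)) * norm h * (4 * norm (x' - y))" for x'
  by (rule order_trans[OF cv_increment[OF bi dpsi] mult_right_mono[OF L1]]) simp
 from this[of x] have "\<bar>(cutoff (x + h) - cutoff (y + h)) - (cutoff x - cutoff y)\<bar> \<le> 96 * 6 powr (real DIM('a)) * norm h * (4 * norm (x - y))"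
 proof -
  assume a: "\<bar>cv b (\<lambda>u. \<psi> (u + (x - y)) - \<psi> u) (y + h) - cv b (\<lambda>u. \<psi> (u + (x - y)) - \<psi> u) y\<bar>
   \<le> 96 * 6 powr (real DIM('a)) * norm h * (4 * norm (x - y))"
  have "y + h + (x - y) = x + h" "y + (x - y) = x" by auto
  then show ?thesis using a inc[of "y + h" "x - y"] inc[of y "x - y"] unfolding ceq by (simp only:)
 qed
 then show "\<bar>(cutoff (x + h) - cutoff (y + h)) - (cutoff x - cutoff y)\<bar> \<le> cutoff_constant (real DIM('a)) * norm h * norm (x - y)"
  by (simp add: cutoff_constant_def)
qed

definition second_constant :: "real => real => real => real => real => real => real" where
 "second_constant n s lam Lam \<gamma> eps = (let c = core_constant n s lam \<gamma>; N = holder_constant n s lam Lam \<gamma>; C = cutoff_constant n in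
   2 * c * ((N + C) + (1 + C * Lam * (N * radial_const n (\<gamma> + 1 - 2 * s) + 2 * radial_const n (2 * s - 1))) + C * (N + 1) * (Lam + 2 * eps)))"

context unit_kernel begin

text \<open>The localized increment \<open>u (x + h) - u x\<close> solves an equation with small increments of the data, up to the divergence form
 term \<open>(u (x + h) - u (y + h)) * (K (x + h) (y + h) - K x y)\<close>, which by the estimate for \<open>u\<close> is of order
 \<open>norm h powr \<sigma> * norm (x - y) powr (\<gamma> - n - 2 * s)\<close>.\<close>

theorem second_difference:
 assumes gam: "2 * s - 1 < \<gamma>" "\<gamma> < 1" "\<sigma> \<le> \<gamma>" "\<gamma> + \<sigma> \<le> 2 * s"
  and epsc: "core_constant n s lam \<gamma> * (6 * eps) \<le> 1 / 2"
  and u: "bbd U u" and uM: "!!x. x \<in> ball 0 6 ==> \<bar>u x\<bar> \<le> M"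
  and f: "f \<in> Borel" and fM: "!!x. x \<in> ball 0 5 ==> \<bar>f x\<bar> \<le> M"
  and eq: "!!x. x \<in> ball 0 5 ==> 2 * (LBINT z. (u x - u (x + z)) * Kn x (x + z)) = f x"
  and x: "norm x + 2 * norm h \<le> 1 / 2" and h: "tau \<le> norm h"
 shows "\<bar>u (x + 2 *\<^sub>R h) - 2 * u (x + h) + u x\<bar> \<le> second_constant n s lam Lam \<gamma> eps * M * norm h powr (\<gamma> + \<sigma>)"
proof -
 note [measurable] = bbd_measurable[OF u] f
 define c where "c = core_constant n s lam \<gamma>"
 define HC where "HC = holder_constant n s lam Lam \<gamma>"
 define N where "N = HC * M"
 define C where "C = cutoff_constant n"
 define \<phi> :: "'a => real" where "\<phi> = cutoff"
 define r1 where "r1 = radial_const n (\<gamma> + 1 - 2 * s)"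
 define r3 where "r3 = radial_const n (2 * s - 1)"
 have h1: "norm h \<le> 1" and hp: "0 < norm h" using x h tau(1) norm_ge_zero[of x] norm_ge_zero[of h] by linarith+
 have M: "0 \<le> M" using uM[of 0] by simp
 have hol: "\<bar>u (x + k) - u x\<bar> \<le> N * norm k powr \<gamma>" if "x \<in> ball 0 3" "tau \<le> norm k" "norm k \<le> 1" for x k
  using interior_holder[OF gam(1,2) epsc u uM f fM eq that] by (simp add: N_def HC_def)
 obtain h1' :: 'a where "norm h1' = tau" by (rule ex_tau_vector)
 then have "0 \<le> N * tau powr \<gamma>" using order_trans[OF abs_ge_zero hol[of 0 h1']] tau by simp
 then have N0: "0 \<le> N" using tau by (simp add: zero_le_mult_iff)
 have C1: "1 \<le> C"
 proof -
  have "1 \<le> 6 powr n" using n_pos by (intro ge_one_powr_ge_zero) auto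
  then show ?thesis by (simp add: C_def cutoff_constant_def)
 qed
 note phi = cutoff_properties[where 'a='a, folded \<phi>_def, unfolded n, folded C_def]
 have [measurable]: "\<phi> \<in> Borel" using bbd_measurable[OF phi(1)] .
 have out: "norm y < 1" if "\<phi> y \<noteq> 0" for y using phi(5)[of y] that by linarith
 define v where "v = (\<lambda>x. \<phi> x * u x)"
 have [measurable]: "v \<in> Borel" unfolding v_def by measurable
 have dv: "\<bar>v (y + k) - v y\<bar> \<le> (N + C * M) * norm k powr \<gamma>" if k: "tau \<le> norm k" "norm k \<le> 1" for y k
 proof (cases "\<phi> (y + k) = 0 \<and> \<phi> y = 0")
  case False
  then have "norm y < 2" using out[of y] out[of "y + k"] norm_triangle_ineq4[of "y + k" k] k by auto
  then have y: "y \<in> ball 0 3" "\<bar>u y\<bar> \<le> M" using uM[of y] by auto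
  have kp: "0 < norm k" using k tau by linarith
  have "v (y + k) - v y = \<phi> (y + k) * (u (y + k) - u y) + (\<phi> (y + k) - \<phi> y) * u y" by (simp add: v_def algebra_simps)
  then have "\<bar>v (y + k) - v y\<bar> \<le> \<phi> (y + k) * \<bar>u (y + k) - u y\<bar> + \<bar>\<phi> (y + k) - \<phi> y\<bar> * \<bar>u y\<bar>"
   using abs_triangle_ineq[of "\<phi> (y + k) * (u (y + k) - u y)" "(\<phi> (y + k) - \<phi> y) * u y"] phi(2)[of "y + k"] by (simp add: abs_mult)
  also have "\<dots> \<le> 1 * (N * norm k powr \<gamma>) + (C * norm k) * M"
  proof (intro add_mono mult_mono)
   show "\<bar>\<phi> (y + k) - \<phi> y\<bar> \<le> C * norm k" using phi(6)[of "y + k" y] by simp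
  qed (use hol[OF y(1) k] y(2) phi(3) C1 in auto)
  also have "\<dots> \<le> 1 * (N * norm k powr \<gamma>) + (C * norm k powr \<gamma>) * M"
   using powr_mono'[of \<gamma> 1 "norm k"] kp k gam C1 M by (intro add_left_mono mult_right_mono mult_left_mono) auto
  finally show ?thesis by (simp add: algebra_simps)
 qed (use N0 C1 M in \<open>simp add: v_def\<close>)
 have vM: "\<bar>v y\<bar> \<le> M" for y
 proof (cases "\<phi> y = 0")
  case False
  then have "\<bar>u y\<bar> \<le> M" using out[of y] uM[of y] by auto
  then have "\<bar>\<phi> y\<bar> * \<bar>u y\<bar> \<le> 1 * M" using phi(2)[of y] phi(3)[of y] by (intro mult_mono) auto
  then show ?thesis by (simp add: v_def abs_mult)
 qed (simp add: v_def M)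
 define gg where "gg = (\<lambda>x. \<phi> x * f x - cutoff_error \<phi> u x)"
 define F where "F = (\<lambda>x y. (1/2) * (u x + u y) * (\<phi> x - \<phi> y) * Kn x y)"
 define dK where "dK = (\<lambda>x y. Kn (x + h) (y + h) - Kn x y)"
 define F2 where "F2 = (\<lambda>x y. F (x + h) (y + h) - F x y - (v (x + h) - v (y + h)) * dK x y)"
 define w where "w = (\<lambda>x. v (x + h) - v x)"
 define G1 where "G1 = M + C * Lam * (N * r1 + 2 * M * r3)"
 define A0 where "A0 = C * (N + M) * (Lam + 2 * eps)"
 have Fm [measurable]: "case_prod F \<in> borel_measurable borel2" unfolding F_def split_beta' by measurable
 have F_m: "p \<in> MM \<rightarrow>\<^sub>M borel ==> q \<in> MM \<rightarrow>\<^sub>M borel ==> (\<lambda>x. F (p x) (q x)) \<in> borel_measurable MM" for MM :: "'c measure" and p q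
  by (rule measurable_case_prod_compose[OF Fm])
 have gg: "bbd G1 gg"
 proof (rule bbdI)
  show "gg \<in> Borel" unfolding gg_def using cutoff_error_measurable[of \<phi> u] by measurable
  fix x
  have "\<bar>\<phi> x * f x\<bar> \<le> M"
  proof (cases "\<phi> x = 0")
   case False
   then have "\<bar>f x\<bar> \<le> M" using out[of x] fM[of x] by auto
   then have "\<bar>\<phi> x\<bar> * \<bar>f x\<bar> \<le> 1 * M" using phi(2)[of x] phi(3)[of x] by (intro mult_mono) auto
   then show ?thesis by (simp add: abs_mult)
  qed (simp add: M)
  moreover have "\<bar>cutoff_error \<phi> u x\<bar> \<le> C * Lam * (N * 1 powr (\<gamma> + 1 - 2 * s) * r1 + 2 * M * 1 powr (1 - 2 * s) * r3)"
   unfolding r1_def r3_def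
  proof (rule cutoff_error_bound[OF _ _ gam(1,2) _ phi(6)])
   fix z assume z: "\<phi> x \<noteq> \<phi> (x + z)" "tau < norm z" "norm z < 1"
   then have "\<phi> x \<noteq> 0 \<or> \<phi> (x + z) \<noteq> 0" by auto
   then have "norm x < 2" using out[of x] out[of "x + z"] norm_triangle_ineq4[of "x + z" z] z(3) by (elim disjE) auto
   moreover from this have "norm (x + z) < 3" using norm_triangle_ineq[of x z] z by linarith
   ultimately show "\<bar>u x - u (x + z)\<bar> \<le> N * norm z powr \<gamma>" "\<bar>u x - u (x + z)\<bar> \<le> 2 * M"
    using hol[of x z] uM[of x] uM[of "x + z"] z by (auto simp: abs_minus_commute)
  qed (use C1 N0 M in auto)
  ultimately show "\<bar>gg x\<bar> \<le> G1" unfolding gg_def G1_def by simp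
 qed
 have veq: "2 * (LBINT z. (v x - v (x + z)) * Kn x (x + z)) = gg x + 2 * (LBINT z. F x (x + z))" for x
  unfolding v_def gg_def F_def
  by (rule cutoff_identity[OF u phi(1) _ eq]) (use phi(5) in auto)
 have close: "norm x < 3 \<and> norm y < 3" if "\<phi> x \<noteq> 0 \<or> \<phi> y \<noteq> 0 \<or> \<phi> (x + h) \<noteq> 0 \<or> \<phi> (y + h) \<noteq> 0" "norm (x - y) < 1" for x y
 proof -
  have "norm x < 2 \<or> norm y < 2"
   using that(1) out[of x] out[of y] out[of "x + h"] out[of "y + h"] h1
    norm_triangle_ineq4[of "x + h" h] norm_triangle_ineq4[of "y + h" h] by auto
  then show ?thesis using that(2) norm_triangle_ineq3[of x y] by linarith
 qed
 have F2_le: "\<bar>F2 x y\<bar> \<le> norm h powr \<sigma> * A0 * norm (x - y) powr (\<gamma> - n - 2 * s)"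
  if d: "tau < norm (x - y)" "norm (x - y) < 1" for x y
 proof (cases "\<phi> x \<noteq> 0 \<or> \<phi> y \<noteq> 0 \<or> \<phi> (x + h) \<noteq> 0 \<or> \<phi> (y + h) \<noteq> 0")
  case True
  define D where "D = norm (x - y)"
  define q where "q = D powr (- n - 2 * s)"
  define H where "H = norm h powr \<sigma>"
  have D: "0 < D" "D < 1" "tau < D" using d tau by (auto simp: D_def)
  have q0: "0 \<le> q" "0 \<le> H" by (auto simp: q_def H_def)
  from close[OF True d(2)] have xy: "norm x < 3" "norm y < 3" by auto
  then have U: "\<bar>u x\<bar> \<le> M" "\<bar>u y\<bar> \<le> M" using uM[of x] uM[of y] by auto
  have K: "0 \<le> Kn (x + h) (y + h)" "Kn (x + h) (y + h) \<le> Lam * q"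
   using Kn_bounds[of "x + h" "y + h"] by (auto simp: q_def D_def)
  have dK: "\<bar>dK x y\<bar> \<le> eps * H * q"
   using K_holder[of x y h] xy h1 d by (simp add: dK_def Kn_def q_def D_def H_def)
  have Hg: "norm h powr \<gamma> \<le> H" "norm h \<le> H"
   unfolding H_def using powr_mono'[of \<sigma> \<gamma> "norm h"] powr_mono'[of \<sigma> 1 "norm h"] hp h1 gam sig by auto
  have Dg: "D \<le> D powr \<gamma>" using powr_mono'[of \<gamma> 1 D] D gam by auto
  \<comment> \<open>The increment of the flux is split so that each term carries one increment in
    the direction \<open>h\<close>: that of \<open>u\<close>, of the differences of
    \<open>\<phi>\<close>, or of the kernel. Each of these is of order
    \<open>norm h powr \<sigma>\<close>.\<close>
  have T: "F2 x y = (1/2) * ((u (x + h) - u x) + (u (y + h) - u y)) * (\<phi> (x + h) - \<phi> (y + h)) * Kn (x + h) (y + h)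
    + (1/2) * (u x + u y) * ((\<phi> (x + h) - \<phi> (y + h)) - (\<phi> x - \<phi> y)) * Kn (x + h) (y + h)
    + (1/2) * (u x + u y) * (\<phi> x - \<phi> y) * dK x y
    - (v (x + h) - v (y + h)) * dK x y"
   unfolding F2_def F_def dK_def by (simp add: field_simps)
  have 1: "\<bar>(1/2) * ((u (x + h) - u x) + (u (y + h) - u y)) * (\<phi> (x + h) - \<phi> (y + h)) * Kn (x + h) (y + h)\<bar> \<le> (N * H) * (C * D powr \<gamma>) * (Lam * q)"
   unfolding abs_mult[of _ "Kn (x + h) (y + h)"] abs_mult[of _ "\<phi> (x + h) - \<phi> (y + h)"]
  proof (intro mult_mono)
   have "N * norm h powr \<gamma> \<le> N * H" using Hg N0 by (intro mult_left_mono) auto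
   then have "\<bar>u (x + h) - u x\<bar> \<le> N * H" "\<bar>u (y + h) - u y\<bar> \<le> N * H"
    using hol[of x h] hol[of y h] xy h h1 by auto
   then have "\<bar>(u (x + h) - u x) + (u (y + h) - u y)\<bar> \<le> 2 * (N * H)" by linarith
   then show "\<bar>(1/2) * ((u (x + h) - u x) + (u (y + h) - u y))\<bar> \<le> N * H" unfolding abs_mult by simp
   have "\<bar>\<phi> (x + h) - \<phi> (y + h)\<bar> \<le> C * D" using phi(6)[of "x + h" "y + h"] by (simp add: D_def)
   also have "\<dots> \<le> C * D powr \<gamma>" using Dg C1 by (intro mult_left_mono) auto
   finally show "\<bar>\<phi> (x + h) - \<phi> (y + h)\<bar> \<le> C * D powr \<gamma>" .
  qed (use K N0 q0 C1 in auto)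
  have uu: "\<bar>(1/2) * (u x + u y)\<bar> \<le> M"
  proof -
   have "\<bar>u x + u y\<bar> \<le> 2 * M" using U by linarith
   then show ?thesis unfolding abs_mult by simp
  qed
  have 2: "\<bar>(1/2) * (u x + u y) * ((\<phi> (x + h) - \<phi> (y + h)) - (\<phi> x - \<phi> y)) * Kn (x + h) (y + h)\<bar> \<le> M * (C * H * D powr \<gamma>) * (Lam * q)"
   unfolding abs_mult[of _ "Kn (x + h) (y + h)"] abs_mult[of _ "(\<phi> (x + h) - \<phi> (y + h)) - (\<phi> x - \<phi> y)"]
  proof (intro mult_mono)
   have "\<bar>(\<phi> (x + h) - \<phi> (y + h)) - (\<phi> x - \<phi> y)\<bar> \<le> C * norm h * D" using phi(7)[of x h y] by (simp add: D_def)
   also have "\<dots> \<le> C * H * D powr \<gamma>" using Dg Hg C1 D q0 by (intro mult_mono) auto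
   finally show "\<bar>(\<phi> (x + h) - \<phi> (y + h)) - (\<phi> x - \<phi> y)\<bar> \<le> C * H * D powr \<gamma>" .
  qed (use K uu M q0 C1 in auto)
  have 3: "\<bar>(1/2) * (u x + u y) * (\<phi> x - \<phi> y) * dK x y\<bar> \<le> M * (C * D powr \<gamma>) * (eps * H * q)"
   unfolding abs_mult[of _ "dK x y"] abs_mult[of _ "\<phi> x - \<phi> y"]
  proof (intro mult_mono)
   have "\<bar>\<phi> x - \<phi> y\<bar> \<le> C * D" using phi(6)[of x y] by (simp add: D_def)
   also have "\<dots> \<le> C * D powr \<gamma>" using Dg C1 by (intro mult_left_mono) auto
   finally show "\<bar>\<phi> x - \<phi> y\<bar> \<le> C * D powr \<gamma>" .
  qed (use dK uu M C1 in auto)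
  have 4: "\<bar>(v (x + h) - v (y + h)) * dK x y\<bar> \<le> ((N + C * M) * D powr \<gamma>) * (eps * H * q)"
   unfolding abs_mult
  proof (intro mult_mono)
   show "\<bar>v (x + h) - v (y + h)\<bar> \<le> (N + C * M) * D powr \<gamma>"
    using dv[of "x - y" "y + h"] d by (simp add: D_def algebra_simps)
  qed (use dK N0 C1 M in auto)
  have "\<bar>F2 x y\<bar> \<le> (N * H) * (C * D powr \<gamma>) * (Lam * q) + M * (C * H * D powr \<gamma>) * (Lam * q)
    + M * (C * D powr \<gamma>) * (eps * H * q) + ((N + C * M) * D powr \<gamma>) * (eps * H * q)"
   unfolding T using 1 2 3 4 by linarith
  also have "\<dots> = (C * (N + M) * Lam + (N + 2 * C * M) * eps) * (H * D powr \<gamma> * q)" by (simp add: algebra_simps)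
  also have "\<dots> \<le> A0 * (H * D powr \<gamma> * q)"
  proof (intro mult_right_mono)
   have "1 * N \<le> C * N" using C1 N0 by (intro mult_right_mono) auto
   moreover have "0 \<le> C * N" using C1 N0 by simp
   ultimately have "N + 2 * C * M \<le> 2 * (C * (N + M))" by (simp add: algebra_simps)
   then have "(N + 2 * C * M) * eps \<le> 2 * (C * (N + M)) * eps" using eps by (intro mult_right_mono)
   then show "C * (N + M) * Lam + (N + 2 * C * M) * eps \<le> A0" unfolding A0_def by (simp add: algebra_simps)
  qed (use q0 in auto)
  also have "\<dots> = H * A0 * (D powr \<gamma> * q)" by simp
  also have "D powr \<gamma> * q = D powr (\<gamma> - n - 2 * s)" unfolding q_def by (simp add: powr_add[symmetric] algebra_simps)
  finally show ?thesis unfolding H_def D_def .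
 next
  case False
  then have "F2 x y = 0" by (simp add: F2_def F_def v_def)
  then show ?thesis using C1 N0 M lam eps by (simp add: A0_def)
 qed
 define G where "G = (N + C * M) * norm h powr \<sigma>"
 have w: "bbd (2 * M) w"
 proof (rule bbdI)
  show "w \<in> Borel" unfolding w_def by measurable
  show "\<bar>w x\<bar> \<le> 2 * M" for x using vM[of x] vM[of "x + h"] unfolding w_def by linarith
 qed
 \<comment> \<open>The equation for \<open>w\<close> has no zero-order term; \<open>w\<close> is
   added on both sides and has to be of order \<open>norm h powr \<sigma>\<close> as a
   source.\<close>
 have wG: "bbd G w"
 proof (rule bbdI)
  show "w \<in> Borel" unfolding w_def by measurable
  fix x
  have "(N + C * M) * norm h powr \<gamma> \<le> G" unfolding G_def
   using powr_mono'[of \<sigma> \<gamma> "norm h"] hp h1 gam N0 C1 M by (intro mult_left_mono) auto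
  then show "\<bar>w x\<bar> \<le> G" using dv[OF h h1, of x] unfolding w_def by linarith
 qed
 have c0: "0 < c"
 proof -
  interpret flux n s lam Lam tau k0 \<gamma> 0 "\<lambda>_ _. 0" by unfold_locales (use gam in auto)
  show ?thesis unfolding c_def by (rule CC_pos)
 qed
 have main: "\<bar>w (x + h) - w x\<bar> \<le> 2 * c * (G + norm h powr (2 * s - \<gamma>) * G1 + norm h powr \<sigma> * A0) * norm h powr \<gamma>"
  unfolding c_def
 proof (rule nk.perturbed_estimate(2)[OF theta_le_1 gam(1,2) w wG gg h h1 _ Kn_measurable Kn_sym Kn_zero, where \<epsilon>="6 * eps" and F=F2])
  show "0 \<le> norm h powr \<sigma> * A0" using C1 N0 M lam eps by (simp add: A0_def)
  show "\<bar>Kn x y - k0 (x - y)\<bar> \<le> 6 * eps * rpow n s (x - y)"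
   if "w x \<noteq> w y" "tau < norm (x - y)" "norm (x - y) < 1" for x y
  proof -
   have "\<phi> x \<noteq> 0 \<or> \<phi> y \<noteq> 0 \<or> \<phi> (x + h) \<noteq> 0 \<or> \<phi> (y + h) \<noteq> 0" using that(1) by (auto simp: w_def v_def)
   from close[OF this that(3)] show ?thesis using that by (intro frozen) auto
  qed
  show "case_prod F2 \<in> borel_measurable borel2"
   unfolding F2_def dK_def split_beta' by (intro borel_measurable_diff borel_measurable_times F_m) measurable
  show "F2 y x = - F2 x y" for x y
   using Kn_sym[of x y] Kn_sym[of "x + h" "y + h"] by (simp add: F2_def F_def dK_def field_simps)
  show "\<bar>F2 x y\<bar> \<le> (if tau < norm (x - y) \<and> norm (x - y) < 1 then norm h powr \<sigma> * A0 * norm (x - y) powr (\<gamma> - n - 2 * s) else 0)" for x y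
  proof (cases "tau < norm (x - y) \<and> norm (x - y) < 1")
   case False
   then show ?thesis using Kn_zero[of x y] Kn_zero[of "x + h" "y + h"] by (auto simp: F2_def F_def dK_def)
  qed (use F2_le in auto)
  fix x
  have i1: "integrable lborel (\<lambda>z. (v y - v (y + z)) * Kn y' (y' + z))" for y y'
  proof (rule Kn_integrable[where B="2 * M"])
   show "\<bar>v y - v (y + z)\<bar> \<le> 2 * M" for z using vM[of y] vM[of "y + z"] by linarith
  qed measurable
  have i2: "integrable lborel (\<lambda>z. (v (x + h) - v (x + h + z)) * dK x (x + z))"
  proof -
   have "integrable lborel (\<lambda>z. (v (x + h) - v (x + h + z)) * Kn (x + h) (x + h + z) - (v (x + h) - v (x + h + z)) * Kn x (x + z))"
    by (intro bochner_integrable_diff i1)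
   then show ?thesis by (simp add: dK_def right_diff_distrib ac_simps)
  qed
  have i3: "integrable lborel (\<lambda>z. F y (y + z))" for y
  proof -
   have "\<exists>B. \<forall>z. \<bar>(1/2) * (u y + u (y + z)) * (\<phi> y - \<phi> (y + z))\<bar> \<le> B"
   proof (intro exI allI)
    fix z
    show "\<bar>(1/2) * (u y + u (y + z)) * (\<phi> y - \<phi> (y + z))\<bar> \<le> U * 2"
     unfolding abs_mult[of _ "\<phi> y - \<phi> (y + z)"]
    proof (rule mult_mono)
     have "\<bar>u y + u (y + z)\<bar> \<le> 2 * U" using bbd_le[OF u, of y] bbd_le[OF u, of "y + z"] by linarith
     then show "\<bar>(1/2) * (u y + u (y + z))\<bar> \<le> U" unfolding abs_mult by simp
     show "\<bar>\<phi> y - \<phi> (y + z)\<bar> \<le> 2" using bbd_le[OF phi(1), of y] bbd_le[OF phi(1), of "y + z"] by linarith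
    qed (use bbd_nonneg[OF u] in auto)
   qed
   then obtain B where B: "!!z. \<bar>(1/2) * (u y + u (y + z)) * (\<phi> y - \<phi> (y + z))\<bar> \<le> B" by blast
   show ?thesis unfolding F_def by (rule Kn_integrable[OF _ B]) measurable
  qed
  have "(LBINT z. (w x - w (x + z)) * Kn x (x + z))
    = (LBINT z. ((v (x + h) - v (x + h + z)) * Kn (x + h) (x + h + z) - (v (x + h) - v (x + h + z)) * dK x (x + z)) - (v x - v (x + z)) * Kn x (x + z))"
   by (intro bochner_cong) (auto simp: w_def dK_def algebra_simps)
  also have "\<dots> = ((LBINT z. (v (x + h) - v (x + h + z)) * Kn (x + h) (x + h + z)) - (LBINT z. (v (x + h) - v (x + h + z)) * dK x (x + z)))
     - (LBINT z. (v x - v (x + z)) * Kn x (x + z))"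
   using i1[of "x + h" "x + h"] i1[of x x] i2
   by (subst bochner_diff, simp, simp, subst bochner_diff, simp, simp) simp
  finally have a: "2 * (LBINT z. (w x - w (x + z)) * Kn x (x + z))
    = (gg (x + h) + 2 * (LBINT z. F (x + h) (x + h + z))) - 2 * (LBINT z. (v (x + h) - v (x + h + z)) * dK x (x + z))
     - (gg x + 2 * (LBINT z. F x (x + z)))"
   unfolding veq[symmetric] by simp
  have "(LBINT z. F2 x (x + z)) = (LBINT z. (F (x + h) (x + h + z) - F x (x + z)) - (v (x + h) - v (x + h + z)) * dK x (x + z))"
   by (simp add: F2_def ac_simps)
  also have "\<dots> = ((LBINT z. F (x + h) (x + h + z)) - (LBINT z. F x (x + z))) - (LBINT z. (v (x + h) - v (x + h + z)) * dK x (x + z))"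
   using i3[of "x + h"] i3[of x] i2
   by (subst bochner_diff, simp, simp, subst bochner_diff, simp, simp) simp
  finally have b: "(LBINT z. F2 x (x + z)) = ((LBINT z. F (x + h) (x + h + z)) - (LBINT z. F x (x + z))) - (LBINT z. (v (x + h) - v (x + h + z)) * dK x (x + z))" .
  show "w x + 2 * (LBINT z. (w x - w (x + z)) * Kn x (x + z)) = w x + (gg (x + h) - gg x) + 2 * (LBINT z. F2 x (x + z))"
   unfolding a b by simp
 qed (use eps epsc h h1 in auto)
 have inner: "\<phi> (x + 2 *\<^sub>R h) = 1" "\<phi> (x + h) = 1" "\<phi> x = 1"
 proof -
  have "norm (2 *\<^sub>R h) = 2 * norm h" by simp
  then have "norm (x + 2 *\<^sub>R h) \<le> 1 / 2" "norm (x + h) \<le> 1 / 2" "norm x \<le> 1 / 2"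
   using x norm_triangle_ineq[of x "2 *\<^sub>R h"] norm_triangle_ineq[of x h] norm_ge_zero[of h] by linarith+
  then show "\<phi> (x + 2 *\<^sub>R h) = 1" "\<phi> (x + h) = 1" "\<phi> x = 1" by (auto intro!: phi(4))
 qed
 have "u (x + 2 *\<^sub>R h) - 2 * u (x + h) + u x = w (x + h) - w x"
  using inner by (simp add: w_def v_def scaleR_2 add.assoc[symmetric])
 then have "\<bar>u (x + 2 *\<^sub>R h) - 2 * u (x + h) + u x\<bar> \<le> 2 * c * (G + norm h powr (2 * s - \<gamma>) * G1 + norm h powr \<sigma> * A0) * norm h powr \<gamma>"
  using main by simp
 \<comment> \<open>Here \<open>\<gamma> + \<sigma> \<le> 2 * s\<close> enters: the gain
   \<open>2 * s - \<gamma>\<close> for differenced sources is at least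
   \<open>\<sigma>\<close>.\<close>
 also have "\<dots> \<le> 2 * c * (G + norm h powr \<sigma> * G1 + norm h powr \<sigma> * A0) * norm h powr \<gamma>"
  using powr_mono'[of \<sigma> "2 * s - \<gamma>" "norm h"] hp h1 gam c0 bbd_nonneg[OF gg]
  by (intro mult_right_mono mult_left_mono add_mono) auto
 also have "\<dots> = 2 * c * ((N + C * M) + G1 + A0) * (norm h powr \<sigma> * norm h powr \<gamma>)" by (simp add: G_def algebra_simps)
 also have "norm h powr \<sigma> * norm h powr \<gamma> = norm h powr (\<gamma> + \<sigma>)" by (simp add: powr_add)
 also have "2 * c * ((N + C * M) + G1 + A0) = second_constant n s lam Lam \<gamma> eps * M"
  unfolding second_constant_def Let_def c_def[symmetric] HC_def[symmetric] C_def[symmetric] r1_def[symmetric] r3_def[symmetric]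
   G1_def A0_def N_def by (simp add: algebra_simps)
 finally show ?thesis .
qed

end

section \<open>Maximum principle, barrier and weak Harnack inequality\<close>

lemma bounded_fixpoint:
 fixes J :: "'a::euclidean_space => 'a => real"
 assumes J_meas: "case_prod J \<in> borel_measurable borel2" and J0: "!!x y. 0 \<le> J x y"
  and Ji: "!!x. integrable lborel (\<lambda>z. J x (x + z))" and Jq: "!!x. (LBINT z. J x (x + z)) \<le> q" and q: "0 \<le> q" "q < 1"
  and h: "bbd B h"
 shows "\<exists>b. bbd (B / (1 - q)) b \<and> (\<forall>x. b x = h x + (LBINT z. J x (x + z) * b (x + z)))"
proof -
 note J_m = measurable_case_prod_compose[OF J_meas]
 define T where "T = (\<lambda>f x. LBINT z. J x (x + z) * f (x + z))"
 have i: "integrable lborel (\<lambda>z. J x (x + z) * f (x + z))" and le: "\<bar>T f x\<bar> \<le> q * A" if f: "bbd A f" for f A x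
 proof -
  have A: "0 \<le> A" using bbd_nonneg[OF f] .
  show "integrable lborel (\<lambda>z. J x (x + z) * f (x + z))" by (rule bbd_integrable(1)[OF Ji f])
  have "\<bar>T f x\<bar> \<le> (LBINT z. \<bar>J x (x + z)\<bar>) * A" unfolding T_def by (rule bbd_integrable(2)[OF Ji f])
  also have "\<dots> \<le> q * A" using Jq[of x] A J0 by (intro mult_right_mono) auto
  finally show "\<bar>T f x\<bar> \<le> q * A" .
 qed
 \<comment> \<open>The terms of the Neumann series; they are bounded by \<open>q ^ i * B\<close> and
   summed point by point.\<close>
 define d where "d = (\<lambda>i. (T ^^ i) h)"
 have d: "bbd (q ^ i * B) (d i)" for i
 proof (induction i)
  case (Suc i)
  have [measurable]: "d i \<in> Borel" using bbd_measurable[OF Suc] .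
  have "(\<lambda>x. LBINT z. J x (x + z) * d i (x + z)) \<in> Borel"
   unfolding split_beta' by (rule lborel.borel_measurable_lebesgue_integral) (use J_m in measurable)
  then show ?case using le[OF Suc] by (auto simp: d_def T_def bbd_def mult.assoc)
 qed (use h in \<open>simp add: d_def\<close>)
 have B: "0 \<le> B" using bbd_nonneg[OF h] .
 have qs: "summable (\<lambda>i. q ^ i * B)" "(\<Sum>i. q ^ i * B) = B / (1 - q)"
 proof -
  have g: "summable (\<lambda>i. q ^ i)" using q by (intro summable_geometric) simp
  show "summable (\<lambda>i. q ^ i * B)" by (rule summable_mult2[OF g])
  have "(\<Sum>i. q ^ i * B) = (\<Sum>i. q ^ i) * B" by (rule suminf_mult2[OF g, symmetric])
  then show "(\<Sum>i. q ^ i * B) = B / (1 - q)" using q by (simp add: suminf_geometric)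
 qed
 have dsum: "summable (\<lambda>i. norm (d i x))" for x
  by (rule summable_comparison_test'[OF qs(1), of 0]) (use bbd_le[OF d] in auto)
 define b where "b = (\<lambda>x. \<Sum>i. d i x)"
 have b: "bbd (B / (1 - q)) b"
 proof (rule bbdI)
  show "b \<in> Borel" unfolding b_def using bbd_measurable[OF d] by (intro borel_measurable_suminf)
  fix x
  have "\<bar>b x\<bar> \<le> (\<Sum>i. norm (d i x))" unfolding b_def using summable_norm[OF dsum] by simp
  also have "\<dots> \<le> (\<Sum>i. q ^ i * B)" using dsum qs bbd_le[OF d] by (intro suminf_le) auto
  finally show "\<bar>b x\<bar> \<le> B / (1 - q)" unfolding qs .
 qed
 have "b x = h x + (LBINT z. J x (x + z) * b (x + z))" for x
 proof -
  have "(LBINT z. J x (x + z) * b (x + z)) = (LBINT z. \<Sum>i. J x (x + z) * d i (x + z))"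
   unfolding b_def by (simp add: suminf_mult[OF summable_norm_cancel[OF dsum]])
  also have "\<dots> = (\<Sum>i. LBINT z. J x (x + z) * d i (x + z))"
  proof (rule integral_suminf)
   show "AE z in lborel. summable (\<lambda>i. norm (J x (x + z) * d i (x + z)))"
    using dsum by (auto simp: abs_mult intro!: AE_I2 summable_mult)
   show "summable (\<lambda>i. LBINT z. norm (J x (x + z) * d i (x + z)))"
   proof (rule summable_comparison_test'[OF summable_mult[OF qs(1), of q], of 0])
    fix i
    have "\<bar>LBINT z. J x (x + z) * \<bar>d i (x + z)\<bar>\<bar> \<le> q * (q ^ i * B)"
    proof -
     have "bbd (q ^ i * B) (\<lambda>x. \<bar>d i x\<bar>)" using d[of i] by (auto simp: bbd_def)
     from le[OF this, of x] show ?thesis by (simp add: T_def)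
    qed
    then show "norm (LBINT z. norm (J x (x + z) * d i (x + z))) \<le> q * (q ^ i * B)"
     using J0 by (simp add: abs_mult)
   qed
  qed (rule i[OF d])
  also have "\<dots> = (\<Sum>i. d (Suc i) x)" by (simp add: d_def T_def)
  also have "\<dots> = b x - h x" unfolding b_def
   using suminf_split_head[OF summable_norm_cancel[OF dsum[of x]]] by (simp add: d_def)
  finally show ?thesis by simp
 qed
 then show ?thesis using b by blast
qed

text \<open>A lower bound for the rate of jumps into a ball of radius \<open>R\<close> centred at
  distance \<open>4 * R\<close>; such jumps lead from any point of \<open>ball 0 R\<close> out of
  it. It does not involve \<open>tau\<close>, so it yields uniform bounds for solutions.\<close>

definition far_rate :: "real => real => real => real => real" where
 "far_rate n s lam R = lam * (5 * R) powr (- n - 2 * s) * (unit_ball_vol n * R powr n)"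

locale jump_kernel =
 fixes n s lam Lam tau :: real and K :: "'a::euclidean_space => 'a => real"
 assumes dim [simp]: "real DIM('a) = n"
  and s: "1 / 2 < s" "s < 1" "2 * s < n"
  and lam: "0 < lam" "lam \<le> Lam" and tau: "0 < tau"
  and K_measurable: "case_prod K \<in> borel_measurable borel2"
  and K_sym: "!!x y. K y x = K x y"
  and K_zero: "!!x y. norm (x - y) \<le> tau ==> K x y = 0"
  and K_lower: "!!x y. tau < norm (x - y) ==> lam * rpow n s (x - y) \<le> K x y"
  and K_upper: "!!x y. tau < norm (x - y) ==> K x y \<le> Lam * rpow n s (x - y)"
begin

lemma K_m [measurable (raw)]: "f \<in> M \<rightarrow>\<^sub>M borel ==> g \<in> M \<rightarrow>\<^sub>M borel ==> (\<lambda>x. K (f x) (g x)) \<in> borel_measurable M"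
 by (rule measurable_case_prod_compose[OF K_measurable])

lemma K_bounds: "0 \<le> K x y" "K x y \<le> Lam * rpow n s (x - y)"
 using K_lower[of x y] K_upper[of x y] K_zero[of x y] lam
 by (cases "tau < norm (x - y)"; smt (verit) mult_nonneg_nonneg powr_ge_zero)+

text \<open>An upper bound for the total jump rate from a point. It grows like
  \<open>tau powr (- 2 * s)\<close> and is therefore used only qualitatively, for integrability,
  contraction and the choice of small quantities.\<close>

definition mass :: real where "mass = Lam * (tau powr (- (2 * s)) * radial_const n (2 * s))"

lemma mass_pos: "0 < mass" using lam tau s by (auto simp: mass_def intro!: mult_pos_pos radial_const_pos)

lemma K_integrable:
 assumes f: "f \<in> Borel" and b: "!!z. \<bar>f z\<bar> \<le> B"
 shows "integrable lborel (\<lambda>z. f z * K x (x + z))" "(LBINT z. \<bar>f z * K x (x + z)\<bar>) \<le> B * mass"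
  "\<bar>LBINT z. f z * K x (x + z)\<bar> \<le> B * mass"
proof -
 have B: "0 \<le> B" using b[of 0] by linarith
 have m: "(\<lambda>z. f z * K x (x + z)) \<in> Borel" using f by measurable
 have le: "\<bar>f z * K x (x + z)\<bar> \<le> (if tau \<le> norm z then B * Lam * norm z powr (- (2 * s) - n) else 0)" for z
 proof (cases "tau \<le> norm z")
  case True
  have "\<bar>f z * K x (x + z)\<bar> = \<bar>f z\<bar> * K x (x + z)" using K_bounds(1) by (simp add: abs_mult)
  also have "\<dots> \<le> B * (Lam * norm (x - (x + z)) powr (- n - 2 * s))"
   using b[of z] B K_bounds(1)[of x "x + z"] K_bounds(2)[of x "x + z"] by (intro mult_mono) auto
  also have "norm (x - (x + z)) powr (- n - 2 * s) = norm z powr (- (2 * s) - n)"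
   by (simp, rule arg_cong[where f="\<lambda>t. norm z powr t"], simp)
  finally show ?thesis using True by simp
 qed (use K_zero[of x "x + z"] in simp)
 note * = far_integral_bound[of "\<lambda>z. f z * K x (x + z)", unfolded dim, OF m le]
 show "integrable lborel (\<lambda>z. f z * K x (x + z))" "(LBINT z. \<bar>f z * K x (x + z)\<bar>) \<le> B * mass"
  "\<bar>LBINT z. f z * K x (x + z)\<bar> \<le> B * mass"
  using * s tau B lam by (auto simp: mass_def mult.assoc)
qed

definition Lop :: "('a => real) => 'a => real" where
 "Lop u x = 2 * (LBINT z. (u x - u (x + z)) * K x (x + z))"

lemma Lop_integrable: "bbd U u ==> integrable lborel (\<lambda>z. (u x - u (x + z)) * K x (x + z))"
proof (rule K_integrable(1)[where B="2 * U"])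
 assume u: "bbd U u"
 show "(\<lambda>z. u x - u (x + z)) \<in> Borel" using bbd_measurable[OF u] by measurable
 show "\<bar>u x - u (x + z)\<bar> \<le> 2 * U" for z using bbd_le[OF u, of x] bbd_le[OF u, of "x + z"] by linarith
qed

lemma Lop_diff: "bbd U u ==> bbd V v ==> Lop (\<lambda>x. u x - v x) x = Lop u x - Lop v x"
 using bochner_diff[OF Lop_integrable[of U u x] Lop_integrable[of V v x]]
 unfolding Lop_def by (simp add: algebra_simps)

lemma Lop_scale: "Lop (\<lambda>x. c * u x) x = c * Lop u x"
proof -
 have e: "(c * u x - c * u (x + z)) * K x (x + z) = c * ((u x - u (x + z)) * K x (x + z))" for z by (simp add: algebra_simps)
 show ?thesis unfolding Lop_def e by simp
qed

lemma far_mass: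
 assumes R: "0 < R" "tau \<le> R"
 obtains S where "S \<in> sets borel" "0 < far_rate n s lam R" "!!z. z \<in> S ==> 3 * R < norm z"
  "!!x. far_rate n s lam R \<le> (LBINT z. indicator S z * K x (x + z))"
proof -
 obtain e :: 'a where e: "norm e = 1" by (meson norm_Basis nonempty_Basis ex_in_conv)
 define S where "S = ball ((4 * R) *\<^sub>R e) R"
 define c where "c = lam * (5 * R) powr (- n - 2 * s)"
 have S: "3 * R < norm z" "norm z < 5 * R" if "z \<in> S" for z
  using that norm_triangle_ineq2[of "(4 * R) *\<^sub>R e" "(4 * R) *\<^sub>R e - z"] norm_triangle_ineq2[of z "(4 * R) *\<^sub>R e"] e R
  by (auto simp: S_def dist_norm norm_minus_commute)
 have e: "far_rate n s lam R = c * (unit_ball_vol n * R ^ DIM('a))"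
  using R powr_realpow[of R "DIM('a)"] by (simp add: far_rate_def c_def)
 have "far_rate n s lam R \<le> (LBINT z. indicator S z * K x (x + z))" for x
 proof -
  have "(LBINT z. c * indicator S z) \<le> (LBINT z. indicator S z * K x (x + z))"
  proof (rule integral_mono)
   show "integrable lborel (\<lambda>z. c * indicator S z)" unfolding S_def by (intro integrable_mult_right integrable_ball_indicator)
   show "integrable lborel (\<lambda>z. indicator S z * K x (x + z))"
    by (rule K_integrable(1)[where B=1]) (auto simp: S_def intro!: borel_measurable_indicator split: split_indicator)
   fix z
   show "c * indicator S z \<le> indicator S z * K x (x + z)"
   proof (cases "z \<in> S")
    case True
    have "(5 * R) powr (- n - 2 * s) \<le> rpow n s z"
     using S[OF True] s R by (intro powr_mono2') auto
    then have "c \<le> lam * norm (x - (x + z)) powr (- n - 2 * s)" using lam by (simp add: c_def)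
    also have "\<dots> \<le> K x (x + z)" using S[OF True] R by (intro K_lower) auto
    finally show ?thesis using True by simp
   qed simp
  qed
  then show ?thesis using integral_ball_indicator[of R "(4 * R) *\<^sub>R e"] R unfolding e by (simp add: S_def)
 qed
 moreover have "0 < far_rate n s lam R" using lam R s by (simp add: far_rate_def)
 moreover have "S \<in> sets borel" by (simp add: S_def)
 ultimately show ?thesis using S by (intro that[of S]) auto
qed

text \<open>A bounded Borel function need not attain its infimum, so the equation is evaluated at a
  point within \<open>\<delta>\<close> of a negative infimum. Jumps from \<open>F\<close> lead to
  the outside of \<open>S\<close>, where \<open>W\<close> is nonnegative, at a rate of at least
  \<open>\<eta>\<close>; for small \<open>\<delta>\<close> they outweigh \<open>\<delta>\<close>
  times the total mass.\<close>

theorem max_principle: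
 assumes W: "bbd B W" and S: "S \<subseteq> ball 0 R" and LW: "!!x. x \<in> S ==> 0 \<le> Lop W x"
  and out: "!!x. x \<notin> S ==> 0 \<le> W x"
 shows "0 \<le> W x"
proof (rule ccontr)
 note [measurable] = bbd_measurable[OF W]
 assume "\<not> 0 \<le> W x"
 define \<mu> where "\<mu> = (INF x. W x)"
 have bdd: "bdd_below (range W)" using bbd_le[OF W] by (auto intro!: bdd_belowI[of _ "- B"] simp: abs_le_iff minus_le_iff)
 have mu_le: "\<mu> \<le> W x" for x unfolding \<mu>_def by (rule cINF_lower[OF bdd]) simp
 have mu: "\<mu> < 0" using mu_le[of x] \<open>\<not> 0 \<le> W x\<close> by linarith
 define \<eta> where "\<eta> = far_rate n s lam (max \<bar>R\<bar> tau)"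
 obtain F where F: "F \<in> sets borel" "0 < \<eta>" "!!z. z \<in> F ==> 3 * max \<bar>R\<bar> tau < norm z"
  "!!x. \<eta> \<le> (LBINT z. indicator F z * K x (x + z))"
  using far_mass[of "max \<bar>R\<bar> tau"] tau unfolding \<eta>_def by auto
 note [measurable] = F(1)
 define \<delta> where "\<delta> = min (- \<mu>) (- \<mu> * \<eta> / (2 * mass))"
 have delta: "0 < \<delta>" "\<delta> \<le> - \<mu>" "\<delta> * mass \<le> - \<mu> * \<eta> / 2"
 proof -
  show "0 < \<delta>" "\<delta> \<le> - \<mu>" using mu F(2) mass_pos by (auto simp: \<delta>_def intro!: divide_neg_pos mult_neg_pos)
  have "\<delta> * mass \<le> - \<mu> * \<eta> / (2 * mass) * mass" using mass_pos by (intro mult_right_mono) (auto simp: \<delta>_def)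
  then show "\<delta> * mass \<le> - \<mu> * \<eta> / 2" using mass_pos by simp
 qed
 obtain y where y: "W y < \<mu> + \<delta>"
  using cINF_less_iff[OF _ bdd, of "\<mu> + \<delta>"] delta by (auto simp: \<mu>_def)
 then have yS: "y \<in> S" using out[of y] delta by force
 then have yR: "norm y < \<bar>R\<bar>" using S by force
 have "(LBINT z. (W y - W (y + z)) * K y (y + z)) \<le> (LBINT z. \<delta> * K y (y + z) + \<mu> * (indicator F z * K y (y + z)))"
 proof (rule integral_mono[OF Lop_integrable[OF W]])
  have i: "integrable lborel (\<lambda>z. indicator F z * K y (y + z))"
   by (rule K_integrable(1)[where B=1]) (auto split: split_indicator)
  then show "integrable lborel (\<lambda>z. \<delta> * K y (y + z) + \<mu> * (indicator F z * K y (y + z)))"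
   using K_integrable(1)[of "\<lambda>_. 1" 1 y] by simp
  fix z
  have "W y - W (y + z) \<le> \<delta> + \<mu> * indicator F z"
  proof (cases "z \<in> F")
   case True
   then have "\<bar>R\<bar> < norm (y + z)" using F(3)[OF True] yR norm_triangle_ineq4[of "y + z" y] by auto
   then have "y + z \<notin> S" using S by force
   then have "0 \<le> W (y + z)" by (rule out)
   then show ?thesis using y True by simp
  qed (use y mu_le[of "y + z"] in simp)
  then have "(W y - W (y + z)) * K y (y + z) \<le> (\<delta> + \<mu> * indicator F z) * K y (y + z)"
   using K_bounds(1) by (intro mult_right_mono)
  then show "(W y - W (y + z)) * K y (y + z) \<le> \<delta> * K y (y + z) + \<mu> * (indicator F z * K y (y + z))"
   by (simp add: distrib_right mult.assoc)
 qed
 also have "\<dots> = \<delta> * (LBINT z. K y (y + z)) + \<mu> * (LBINT z. indicator F z * K y (y + z))"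
 proof -
  have "integrable lborel (\<lambda>z. indicator F z * K y (y + z))"
   by (rule K_integrable(1)[where B=1]) (auto split: split_indicator)
  then show ?thesis using K_integrable(1)[of "\<lambda>_. 1" 1 y] by simp
 qed
 also have "\<dots> \<le> \<delta> * mass + \<mu> * \<eta>"
  using K_integrable(3)[of "\<lambda>_. 1" 1 y] delta F(4)[of y] mu by (intro add_mono mult_left_mono mult_left_mono_neg) auto
 also have "\<dots> < 0" using delta(3) mult_neg_pos[OF mu F(2)] by linarith
 finally show False using LW[OF yS] by (simp add: Lop_def)
qed

end

sublocale unit_kernel \<subseteq> jk: jump_kernel n s lam Lam tau K
 by unfold_locales (use s lam tau(1) K_measurable K_sym K_zero K_lower K_upper in auto)

definition weak_harnack_constant :: "real => real => real => real => real" where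
 "weak_harnack_constant n s lam Lam = lam * 2 powr (- n - 2 * s)
   / (cutoff_constant n * Lam * radial_const n (2 - 2 * s) + 1 + 8 * Lam * radial_const n (2 * s))"

context unit_kernel begin

text \<open>The barrier is the cutoff \<open>\<phi>\<close> corrected by the solution \<open>\<zeta>\<close> of \<open>\<zeta> + L \<zeta> = dvg\<close>, where \<open>L\<close> has kernel \<open>J\<close> and \<open>dvg\<close> is
 the operator with kernel \<open>k0 - J\<close> applied to \<open>\<phi>\<close>: it is small, and only the smooth operator with kernel \<open>k0\<close> acts on \<open>\<phi>\<close>.\<close>

lemma barrier:
 assumes gam: "2 * s - 1 < \<gamma>" "\<gamma> < 1" and epsc: "core_constant n s lam \<gamma> * (6 * eps) \<le> 1 / 2"
  and small: "2 * core_constant n s lam \<gamma> * (6 * cutoff_constant n * eps) \<le> 1 / 8"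
 obtains b where "bbd 2 b" "1 / 2 \<le> b 0" "!!x. 1 \<le> norm x ==> b x \<le> 0"
  "!!x. norm x < 1 ==> jk.Lop b x \<le> cutoff_constant n * Lam * radial_const n (2 - 2 * s) + 1 + 8 * Lam * radial_const n (2 * s)"
proof -
 define C where "C = cutoff_constant n"
 define \<phi> :: "'a => real" where "\<phi> = cutoff"
 note phi = cutoff_properties[where 'a='a, folded \<phi>_def, unfolded n, folded C_def]
 have [measurable]: "\<phi> \<in> Borel" using bbd_measurable[OF phi(1)] .
 have [measurable]: "k0 \<in> Borel" by (rule nk.k_measurable)
 have C0: "0 \<le> C" by (simp add: C_def cutoff_constant_def)
 define J where "J = (\<lambda>x y. if norm x < 2 \<and> norm y < 2 then Kn x y else k0 (x - y))"
 define A where "A = 6 * C * eps"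
 define F where "F = (\<lambda>x y. (\<phi> x - \<phi> y) * (k0 (x - y) - J x y))"
 have A0: "0 \<le> A" using C0 eps by (simp add: A_def)
 have Jm: "case_prod J \<in> borel_measurable borel2" unfolding J_def split_beta' by measurable
 note [measurable (raw)] = measurable_case_prod_compose[OF Jm]
 have J_sym: "J y x = J x y" for x y using Kn_sym[of x y] nk.k_even[of "x - y"] by (auto simp: J_def)
 have J_zero: "J x y = 0" if "\<not> (tau < norm (x - y) \<and> norm (x - y) < 1)" for x y
  using Kn_zero[OF that] nk.k_zero[OF that] by (simp add: J_def)
 have J_near: "\<bar>J x y - k0 (x - y)\<bar> \<le> 6 * eps * rpow n s (x - y)" if "tau < norm (x - y)" "norm (x - y) < 1" for x y
  using frozen[of x y] that eps by (auto simp: J_def)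
 have k0_le: "k0 z \<le> Lam * rpow n s z" for z
  using nk.k_upper[of z] nk.k_zero[of z] lam by (cases "tau < norm z \<and> norm z < 1") auto
 have J_le: "0 \<le> J x y" "J x y \<le> Lam * rpow n s (x - y)" for x y
  using Kn_bounds[of x y] nk.k_nonneg[of "x - y"] k0_le[of "x - y"] by (auto simp: J_def)
 have F_le: "\<bar>F x y\<bar> \<le> (if tau < norm (x - y) \<and> norm (x - y) < 1 then A * norm (x - y) powr (\<gamma> - n - 2 * s) else 0)" for x y
 proof (cases "tau < norm (x - y) \<and> norm (x - y) < 1")
  case True
  define D where "D = norm (x - y)"
  have D: "0 < D" "D < 1" using True tau by (auto simp: D_def)
  have "\<bar>F x y\<bar> \<le> (C * D) * (6 * eps * D powr (- n - 2 * s))"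
   unfolding F_def abs_mult using phi(6)[of x y] J_near[of x y] True C0
   by (intro mult_mono) (auto simp: D_def abs_minus_commute)
  also have "\<dots> \<le> (C * D powr \<gamma>) * (6 * eps * D powr (- n - 2 * s))"
   using powr_mono'[of \<gamma> 1 D] D gam C0 eps by (intro mult_right_mono mult_left_mono) auto
  also have "\<dots> = A * (D powr \<gamma> * D powr (- n - 2 * s))" by (simp add: A_def)
  also have "D powr \<gamma> * D powr (- n - 2 * s) = D powr (\<gamma> - n - 2 * s)" by (simp add: powr_add[symmetric] algebra_simps)
  finally show ?thesis using True by (simp add: D_def)
 qed (use J_zero nk.k_zero in \<open>auto simp: F_def\<close>)
 have F_anti: "F y x = - F x y" for x y using J_sym[of x y] nk.k_even[of "x - y"] by (simp add: F_def algebra_simps)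
 have Fm: "case_prod F \<in> borel_measurable borel2" unfolding F_def split_beta' by measurable
 interpret fl: flux n s lam Lam tau k0 \<gamma> A F
  by unfold_locales (rule gam A0 Fm F_anti F_le)+
 have J_int: "integrable lborel (\<lambda>z. f z * J x (x + z))" "\<bar>LBINT z. f z * J x (x + z)\<bar> \<le> B * jk.mass"
  if f: "f \<in> Borel" "!!z. \<bar>f z\<bar> \<le> B" for f B x
 proof -
  have B: "0 \<le> B" using f(2)[of 0] by linarith
  have m: "(\<lambda>z. f z * J x (x + z)) \<in> Borel" using f(1) by measurable
  have le: "\<bar>f z * J x (x + z)\<bar> \<le> (if tau \<le> norm z then B * Lam * norm z powr (- (2 * s) - n) else 0)" for z
  proof (cases "tau \<le> norm z")
   case True
   have "\<bar>f z * J x (x + z)\<bar> = \<bar>f z\<bar> * J x (x + z)" using J_le(1) by (simp add: abs_mult)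
   also have "\<dots> \<le> B * (Lam * norm (x - (x + z)) powr (- n - 2 * s))"
    using f(2)[of z] B J_le(1)[of x "x + z"] J_le(2)[of x "x + z"] by (intro mult_mono) auto
   also have "norm (x - (x + z)) powr (- n - 2 * s) = norm z powr (- (2 * s) - n)"
    by (simp, rule arg_cong[where f="\<lambda>t. norm z powr t"], simp)
   finally show ?thesis using True by simp
  qed (use J_zero[of x "x + z"] in simp)
  note * = far_integral_bound[of "\<lambda>z. f z * J x (x + z)", unfolded n, OF m le]
  show "integrable lborel (\<lambda>z. f z * J x (x + z))" "\<bar>LBINT z. f z * J x (x + z)\<bar> \<le> B * jk.mass"
   using * s tau B lam by (auto simp: jk.mass_def mult.assoc)
 qed
 define j where "j = (\<lambda>x. LBINT z. J x (x + z))"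
 have j: "0 \<le> j x" "j x \<le> jk.mass" "integrable lborel (\<lambda>z. J x (x + z))" for x
  using J_int[of "\<lambda>_. 1" 1 x] J_le(1) by (auto simp: j_def)
 have jm [measurable]: "j \<in> Borel" unfolding j_def
  by (rule lborel.borel_measurable_lebesgue_integral) measurable
 \<comment> \<open>Solving the equation for \<open>\<zeta> x\<close>, the zero-order term turns the
   kernel into \<open>2 * J x y / (1 + 2 * j x)\<close>, whose mass is at most
   \<open>q < 1\<close>.\<close>
 define q where "q = 2 * jk.mass / (1 + 2 * jk.mass)"
 have "\<exists>\<zeta>. bbd (2 * A * (LBINT y. fl.wt y) / (1 - q)) \<zeta> \<and>
  (\<forall>x. \<zeta> x = fl.dvg x / (1 + 2 * j x) + (LBINT z. 2 * J x (x + z) / (1 + 2 * j x) * \<zeta> (x + z)))"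
 proof (rule bounded_fixpoint[where J="\<lambda>x y. 2 * J x y / (1 + 2 * j x)"])
  show "(\<lambda>(x, y). 2 * J x y / (1 + 2 * j x)) \<in> borel_measurable borel2" unfolding split_beta' by measurable
  show "0 \<le> 2 * J x y / (1 + 2 * j x)" for x y using J_le(1)[of x y] j(1)[of x] by simp
  show "integrable lborel (\<lambda>z. 2 * J x (x + z) / (1 + 2 * j x))" for x using j(3) by simp
  show "(LBINT z. 2 * J x (x + z) / (1 + 2 * j x)) \<le> q" for x
  proof -
   have "(LBINT z. 2 * J x (x + z) / (1 + 2 * j x)) = 2 * j x / (1 + 2 * j x)" by (simp add: j_def)
   also have "\<dots> \<le> q" using j[of x] unfolding q_def by (simp add: divide_simps algebra_simps)
   finally show ?thesis .
  qed
  show "0 \<le> q" "q < 1" using jk.mass_pos by (auto simp: q_def divide_simps)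
  show "bbd (2 * A * (LBINT y. fl.wt y)) (\<lambda>x. fl.dvg x / (1 + 2 * j x))"
  proof (rule bbdI)
   show "(\<lambda>x. fl.dvg x / (1 + 2 * j x)) \<in> Borel" using bbd_measurable[OF fl.dvg_bbd] by measurable
   fix x
   have "\<bar>fl.dvg x / (1 + 2 * j x)\<bar> \<le> \<bar>fl.dvg x\<bar> / 1" using j(1)[of x] unfolding abs_divide by (intro frac_le) auto
   then show "\<bar>fl.dvg x / (1 + 2 * j x)\<bar> \<le> 2 * A * (LBINT y. fl.wt y)" using bbd_le[OF fl.dvg_bbd, of x] by simp
  qed
 qed
 then obtain \<zeta> Zb where zb: "bbd Zb \<zeta>"
  and zeq: "!!x. \<zeta> x = fl.dvg x / (1 + 2 * j x) + (LBINT z. 2 * J x (x + z) / (1 + 2 * j x) * \<zeta> (x + z))" by blast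
 note [measurable] = bbd_measurable[OF zb]
 have zJ: "integrable lborel (\<lambda>z. J x (x + z) * \<zeta> (x + z))" for x by (rule bbd_integrable(1)[OF j(3) zb])
 have zeta_eq: "\<zeta> x + 2 * (LBINT z. (\<zeta> x - \<zeta> (x + z)) * J x (x + z)) = fl.dvg x" for x
 proof -
  have "(LBINT z. 2 * J x (x + z) / (1 + 2 * j x) * \<zeta> (x + z)) = (LBINT z. (2 / (1 + 2 * j x)) * (J x (x + z) * \<zeta> (x + z)))"
   by (intro bochner_cong) (simp_all add: field_simps)
  also have "\<dots> = 2 / (1 + 2 * j x) * (LBINT z. J x (x + z) * \<zeta> (x + z))" by (rule integral_mult_right_zero)
  finally have "\<zeta> x * (1 + 2 * j x) = fl.dvg x + 2 * (LBINT z. J x (x + z) * \<zeta> (x + z))"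
  proof -
   assume I: "(LBINT z. 2 * J x (x + z) / (1 + 2 * j x) * \<zeta> (x + z)) = 2 / (1 + 2 * j x) * (LBINT z. J x (x + z) * \<zeta> (x + z))"
   have "\<zeta> x = (fl.dvg x + 2 * (LBINT z. J x (x + z) * \<zeta> (x + z))) / (1 + 2 * j x)"
    using zeq[of x] unfolding I by (simp only: add_divide_distrib times_divide_eq_left)
   moreover have "1 + 2 * j x \<noteq> 0" using j(1)[of x] by linarith
   ultimately show ?thesis by (rule iffD1[OF nonzero_eq_divide_eq, rotated])
  qed
  moreover have "(LBINT z. (\<zeta> x - \<zeta> (x + z)) * J x (x + z)) = (LBINT z. \<zeta> x * J x (x + z) - J x (x + z) * \<zeta> (x + z))"
   by (intro bochner_cong) (simp_all add: algebra_simps)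
  moreover have "\<dots> = \<zeta> x * j x - (LBINT z. J x (x + z) * \<zeta> (x + z))"
   using j(3)[of x] zJ[of x] by (simp add: j_def)
  ultimately show ?thesis by (simp add: algebra_simps)
 qed
 define Z where "Z = 2 * core_constant n s lam \<gamma> * A"
 obtain h0 :: 'a where h0: "norm h0 = tau" by (rule ex_tau_vector)
 have zero: "bbd 0 (\<lambda>_::'a. 0)" by (simp add: bbd_def)
 have Z: "\<bar>\<zeta> x\<bar> \<le> Z" for x
 proof -
  have "\<bar>\<zeta> x\<bar> \<le> 2 * core_constant n s lam \<gamma> * (0 + norm h0 powr (2 * s - \<gamma>) * 0 + A)"
   by (rule nk.perturbed_estimate(1)[OF theta_le_1 gam zb zero zero _ _ fl.A Jm J_sym J_zero J_near Fm F_anti F_le _ epsc])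
    (use h0 tau eps zeta_eq in \<open>auto simp: fl.dvg_def\<close>)
  then show ?thesis by (simp add: Z_def)
 qed
 have Z8: "Z \<le> 1 / 8" "0 \<le> Z" using small Z[of 0] by (auto simp: Z_def A_def C_def mult_ac)
 \<comment> \<open>As \<open>\<zeta>\<close> is bounded by \<open>Z\<close>, subtracting
   \<open>2 * Z\<close> makes \<open>b\<close> nonpositive where \<open>\<phi>\<close> vanishes;
   since \<open>3 * Z \<le> 3 / 8\<close>, at least \<open>1 / 2\<close> is left at the
   origin.\<close>
 define b where "b = (\<lambda>x. \<phi> x + \<zeta> x - 2 * Z)"
 have [measurable]: "b \<in> Borel" unfolding b_def by measurable
 have b2: "bbd 2 b"
 proof (rule bbdI)
  show "\<bar>b x\<bar> \<le> 2" for x using phi(2)[of x] phi(3)[of x] Z[of x] Z8 unfolding b_def by linarith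
 qed measurable
 show ?thesis
 proof (rule that[OF b2])
  show "1 / 2 \<le> b 0" using phi(4)[of 0] Z[of 0] Z8 unfolding b_def by simp
  show "b x \<le> 0" if "1 \<le> norm x" for x using phi(5)[OF that] Z[of x] Z8 unfolding b_def by simp
  fix x :: 'a assume x: "norm x < 1"
  have i1: "integrable lborel (\<lambda>z. (\<phi> x - \<phi> (x + z)) * k0 z)"
  proof -
   have "integrable lborel (\<lambda>z. \<phi> x * k0 z - k0 z * \<phi> (x + z))"
    by (intro bochner_integrable_diff integrable_mult_right nk.k_integrable bbd_integrable(1)[OF nk.k_integrable phi(1)])
   moreover have "(\<lambda>z. \<phi> x * k0 z - k0 z * \<phi> (x + z)) = (\<lambda>z. (\<phi> x - \<phi> (x + z)) * k0 z)"
    by (rule ext) (simp only: left_diff_distrib mult.commute[of "k0 _"])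
   ultimately show ?thesis by simp
  qed
  have i2: "integrable lborel (\<lambda>z. (\<zeta> x - \<zeta> (x + z)) * J x (x + z))"
  proof (rule J_int(1)[where B="2 * Z"])
   show "\<bar>\<zeta> x - \<zeta> (x + z)\<bar> \<le> 2 * Z" for z using Z[of x] Z[of "x + z"] by linarith
  qed measurable
  have i3: "integrable lborel (\<lambda>z. (b x - b (x + z)) * (K x (x + z) - Kn x (x + z)))"
   and far: "\<bar>LBINT z. (b x - b (x + z)) * (K x (x + z) - Kn x (x + z))\<bar> \<le> 4 * Lam * (1 powr (- (2 * s)) * radial_const n (2 * s))"
  proof -
   have le: "\<bar>(b x - b (x + z)) * (K x (x + z) - Kn x (x + z))\<bar> \<le> (if 1 \<le> norm z then 4 * Lam * norm z powr (- (2 * s) - n) else 0)" for z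
   proof (cases "1 \<le> norm z")
    case True
    have "\<bar>b x - b (x + z)\<bar> \<le> 4" using bbd_le[OF b2, of x] bbd_le[OF b2, of "x + z"] by linarith
    then have "\<bar>(b x - b (x + z)) * (K x (x + z) - Kn x (x + z))\<bar> \<le> 4 * (Lam * norm (x - (x + z)) powr (- n - 2 * s))"
     unfolding abs_mult using True K_bounds(1)[of x "x + z"] K_bounds(2)[of x "x + z"] by (intro mult_mono) (auto simp: Kn_def)
    also have "norm (x - (x + z)) powr (- n - 2 * s) = norm z powr (- (2 * s) - n)"
     by (simp, rule arg_cong[where f="\<lambda>t. norm z powr t"], simp)
    finally show ?thesis using True by simp
   qed (simp add: Kn_def)
   have m: "(\<lambda>z. (b x - b (x + z)) * (K x (x + z) - Kn x (x + z))) \<in> Borel" by measurable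
   note * = far_integral_bound[of "\<lambda>z. (b x - b (x + z)) * (K x (x + z) - Kn x (x + z))", unfolded n, OF m le]
   show "integrable lborel (\<lambda>z. (b x - b (x + z)) * (K x (x + z) - Kn x (x + z)))"
    "\<bar>LBINT z. (b x - b (x + z)) * (K x (x + z) - Kn x (x + z))\<bar> \<le> 4 * Lam * (1 powr (- (2 * s)) * radial_const n (2 * s))"
    using *(1,3) s lam by auto
  qed
  have KJ: "Kn x (x + z) = J x (x + z)" for z
  proof (cases "norm z < 1")
   case True
   then have "norm (x + z) < 2" using x norm_triangle_ineq[of x z] by linarith
   then show ?thesis using x by (simp add: J_def)
  qed (use Kn_zero[of x "x + z"] J_zero[of x "x + z"] in auto)
  have "(b x - b (x + z)) * K x (x + z) = ((\<phi> x - \<phi> (x + z)) * k0 z - F x (x + z)) + ((\<zeta> x - \<zeta> (x + z)) * J x (x + z)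
    + (b x - b (x + z)) * (K x (x + z) - Kn x (x + z)))" for z
   using nk.k_even[of z] unfolding KJ by (simp add: b_def F_def algebra_simps)
  then have "(LBINT z. (b x - b (x + z)) * K x (x + z)) = (LBINT z. ((\<phi> x - \<phi> (x + z)) * k0 z - F x (x + z)) + ((\<zeta> x - \<zeta> (x + z)) * J x (x + z)
    + (b x - b (x + z)) * (K x (x + z) - Kn x (x + z))))" by simp
  also have "\<dots> = (LBINT z. (\<phi> x - \<phi> (x + z)) * k0 z) - (LBINT z. F x (x + z)) + ((LBINT z. (\<zeta> x - \<zeta> (x + z)) * J x (x + z))
    + (LBINT z. (b x - b (x + z)) * (K x (x + z) - Kn x (x + z))))"
   using i1 i2 i3 fl.F_integrable(1)[of x] by (simp only: bochner_add bochner_diff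
     bochner_integrable_add bochner_integrable_diff)
  finally have "jk.Lop b x = 2 * (LBINT z. (\<phi> x - \<phi> (x + z)) * k0 z) - \<zeta> x + 2 * (LBINT z. (b x - b (x + z)) * (K x (x + z) - Kn x (x + z)))"
   using zeta_eq[of x] unfolding jk.Lop_def fl.dvg_def by simp
  moreover have "2 * (LBINT z. (\<phi> x - \<phi> (x + z)) * k0 z) \<le> C * Lam * (1 powr (2 - 2 * s) * radial_const n (2 - 2 * s))"
  proof -
   \<comment> \<open>As \<open>k0\<close> is even, adding the reflected integral produces second
     differences of \<open>\<phi>\<close>, which are quadratic in \<open>z\<close>; first
     differences would not be integrable uniformly in \<open>tau\<close>.\<close>
   have r: "(LBINT z. (\<phi> x - \<phi> (x + z)) * k0 z) = (LBINT z. (\<phi> x - \<phi> (x - z)) * k0 z)"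
    "integrable lborel (\<lambda>z. (\<phi> x - \<phi> (x - z)) * k0 z)"
    using reflect_integral[of "\<lambda>z. (\<phi> x - \<phi> (x + z)) * k0 z"] nk.k_even i1 by simp_all
   have "2 * (LBINT z. (\<phi> x - \<phi> (x + z)) * k0 z) = (LBINT z. (\<phi> x - \<phi> (x + z)) * k0 z) + (LBINT z. (\<phi> x - \<phi> (x - z)) * k0 z)"
    unfolding r(1)[symmetric] by simp
   also have "\<dots> = (LBINT z. (\<phi> x - \<phi> (x + z)) * k0 z + (\<phi> x - \<phi> (x - z)) * k0 z)"
    by (rule bochner_add[symmetric, OF i1 r(2)])
   also have "\<dots> \<le> C * Lam * (1 powr (2 - 2 * s) * radial_const n (2 - 2 * s))"
   proof (rule order_trans[OF abs_ge_self near_integral_bound(3)[where f="\<lambda>z. (\<phi> x - \<phi> (x + z)) * k0 z + (\<phi> x - \<phi> (x - z)) * k0 z", unfolded n]])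
    fix z :: 'a
    show "\<bar>(\<phi> x - \<phi> (x + z)) * k0 z + (\<phi> x - \<phi> (x - z)) * k0 z\<bar> \<le> (if norm z < 1 then C * Lam * norm z powr (2 - 2 * s - n) else 0)"
    proof (cases "tau < norm z \<and> norm z < 1")
     case True
     then have z: "0 < norm z" using tau by linarith
     have "\<bar>(\<phi> (x + z) - \<phi> (x - z + z)) - (\<phi> x - \<phi> (x - z))\<bar> \<le> C * norm z * norm (x - (x - z))" by (rule phi(7))
     then have "\<bar>(\<phi> x - \<phi> (x + z)) + (\<phi> x - \<phi> (x - z))\<bar> \<le> C * norm z * norm z" by (simp add: abs_le_iff algebra_simps)
     then have "\<bar>((\<phi> x - \<phi> (x + z)) + (\<phi> x - \<phi> (x - z))) * k0 z\<bar> \<le> (C * norm z * norm z) * (Lam * rpow n s z)"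
      unfolding abs_mult using nk.k_nonneg[of z] nk.k_upper[of z] True C0 by (intro mult_mono) auto
     also have "\<dots> = C * Lam * (norm z powr 1 * norm z powr 1 * rpow n s z)" using z by simp
     also have "norm z powr 1 * norm z powr 1 * rpow n s z = norm z powr (2 - 2 * s - n)"
      by (simp only: powr_add[symmetric]) (rule arg_cong[where f="\<lambda>t. norm z powr t"], simp)
     finally show ?thesis
      using True unfolding distrib_right[of "\<phi> x - \<phi> (x + z)" "\<phi> x - \<phi> (x - z)" "k0 z"] by simp
    qed (use nk.k_zero[of z] C0 lam in auto)
   qed (use s C0 lam in auto)
   finally show ?thesis .
  qed
  ultimately show "jk.Lop b x \<le> cutoff_constant n * Lam * radial_const n (2 - 2 * s) + 1 + 8 * Lam * radial_const n (2 * s)"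
   using far Z[of x] Z8 unfolding C_def by simp
 qed
qed

text \<open>Deleting \<open>u\<close> outside the ball of radius \<open>3 / 2\<close> gives a
  function \<open>u1\<close> with \<open>Lop u1 \<ge> c\<close> on the unit ball, \<open>c\<close>
  being proportional to the deleted tail: what could be reached by long jumps acts as a source.
  Comparison with \<open>c / Q\<close> times the barrier bounds \<open>u 0\<close> from
  below.\<close>

theorem weak_harnack:
 assumes gam: "2 * s - 1 < \<gamma>" "\<gamma> < 1" and epsc: "core_constant n s lam \<gamma> * (6 * eps) \<le> 1 / 2"
  and small: "2 * core_constant n s lam \<gamma> * (6 * cutoff_constant n * eps) \<le> 1 / 8"
  and u: "bbd U u" and u0: "!!x. 0 \<le> u x" and Lu: "!!x. norm x < 1 ==> jk.Lop u x = 0"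
 shows "weak_harnack_constant n s lam Lam * (LBINT y. (if 3 / 2 \<le> norm y then u y * rpow n s y else 0)) \<le> u 0"
proof -
 note [measurable] = bbd_measurable[OF u]
 define T where "T = (LBINT y. (if 3 / 2 \<le> norm y then u y * rpow n s y else 0))"
 define Q where "Q = cutoff_constant n * Lam * radial_const n (2 - 2 * s) + 1 + 8 * Lam * radial_const n (2 * s)"
 obtain b where b: "bbd 2 b" "1 / 2 \<le> b 0" "!!x. 1 \<le> norm x ==> b x \<le> 0" "!!x. norm x < 1 ==> jk.Lop b x \<le> Q"
  apply (rule barrier[OF gam epsc small, folded Q_def])
  subgoal premises p for b by (rule that[of b]) (fact p)+
  done
 have U: "0 \<le> U" using bbd_nonneg[OF u] .
 have T0: "0 \<le> T" unfolding T_def using u0 by (intro integral_nonneg_AE AE_I2) auto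
 have Q: "1 \<le> Q"
 proof -
  have "0 < radial_const n (2 - 2 * s)" "0 < radial_const n (2 * s)" using s by (auto intro!: radial_const_pos)
  then show ?thesis using lam by (simp add: Q_def cutoff_constant_def)
 qed
 define c where "c = 2 * lam * 2 powr (- n - 2 * s) * T"
 define u1 where "u1 = (\<lambda>y. if norm y < 3 / 2 then u y else 0)"
 have [measurable]: "u1 \<in> Borel" unfolding u1_def by measurable
 have u1: "bbd U u1" using bbd_le[OF u] U by (intro bbdI) (auto simp: u1_def)
 have Tint: "integrable lborel (\<lambda>y. if 3 / 2 \<le> norm y then u y * rpow n s y else 0)"
 proof (rule far_integral_bound(1)[where R="3/2" and A=U and e="2 * s", unfolded n])
  fix z
  have e: "- (2 * s) - real DIM('a) = - n - 2 * s" by simp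
  show "\<bar>if 3 / 2 \<le> norm z then u z * rpow n s z else 0\<bar> \<le> (if 3 / 2 \<le> norm z then U * norm z powr (- (2 * s) - real DIM('a)) else 0)"
   unfolding e using bbd_le[OF u, of z] by (auto simp: abs_mult intro!: mult_right_mono)
 qed (use s U in auto)
 have Lu1: "c \<le> jk.Lop u1 x" if x: "norm x < 1" for x
 proof -
  define v where "v = (\<lambda>y. u y - u1 y)"
  have [measurable]: "v \<in> Borel" unfolding v_def by measurable
  have v: "v y = (if 3 / 2 \<le> norm y then u y else 0)" for y by (auto simp: v_def u1_def)
  have iv: "integrable lborel (\<lambda>z. v (x + z) * K x (x + z))"
   by (rule jk.K_integrable(1)[where B=U]) (use bbd_le[OF u] U in \<open>auto simp: v\<close>)
  have "(u1 x - u1 (x + z)) * K x (x + z) = (u x - u (x + z)) * K x (x + z) + v (x + z) * K x (x + z)" for z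
   using x by (auto simp: v_def u1_def algebra_simps)
  then have "jk.Lop u1 x = jk.Lop u x + 2 * (LBINT z. v (x + z) * K x (x + z))"
   unfolding jk.Lop_def using jk.Lop_integrable[OF u, of x] iv by simp
  also have "\<dots> = 2 * (LBINT z. v (x + z) * K x (x + z))" using Lu[OF x] by simp
  also have "\<dots> \<ge> c"
  proof -
   have "lam * 2 powr (- n - 2 * s) * T = (LBINT z. lam * 2 powr (- n - 2 * s) * (if 3 / 2 \<le> norm (x + z) then u (x + z) * rpow n s (x + z) else 0))"
    unfolding T_def using shift_integral(1)[of "\<lambda>y. if 3 / 2 \<le> norm y then u y * rpow n s y else 0" x] by simp
   also have "\<dots> \<le> (LBINT z. v (x + z) * K x (x + z))"
   proof (rule integral_mono[OF _ iv])
    show "integrable lborel (\<lambda>z. lam * 2 powr (- n - 2 * s) * (if 3 / 2 \<le> norm (x + z) then u (x + z) * rpow n s (x + z) else 0))"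
     using shift_integral(2)[of "\<lambda>y. if 3 / 2 \<le> norm y then u y * rpow n s y else 0" x] Tint
     by (intro integrable_mult_right) simp
    fix z
    show "lam * 2 powr (- n - 2 * s) * (if 3 / 2 \<le> norm (x + z) then u (x + z) * rpow n s (x + z) else 0) \<le> v (x + z) * K x (x + z)"
    proof (cases "3 / 2 \<le> norm (x + z)")
     case True
     have z: "norm z \<le> 2 * norm (x + z)" "1 / 2 < norm z"
      using True x norm_triangle_ineq4[of "x + z" x] norm_triangle_ineq[of x z] by auto
     have "lam * (2 powr (- n - 2 * s) * rpow n s (x + z)) = lam * (2 * norm (x + z)) powr (- n - 2 * s)"
      by (simp add: powr_mult)
     also have "\<dots> \<le> lam * norm (x - (x + z)) powr (- n - 2 * s)"
     proof -
      have "(2 * norm (x + z)) powr (- n - 2 * s) \<le> rpow n s z" using z s by (intro powr_mono2') auto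
      then show ?thesis using lam by simp
     qed
     also have "\<dots> \<le> K x (x + z)" using z tau by (intro K_lower) auto
     finally have "u (x + z) * (lam * (2 powr (- n - 2 * s) * rpow n s (x + z))) \<le> u (x + z) * K x (x + z)"
      using u0 by (intro mult_left_mono) auto
     then show ?thesis using True by (simp add: v mult_ac)
    qed (simp add: v)
   qed
   finally show ?thesis by (simp add: c_def)
  qed
  finally show ?thesis .
 qed
 have "0 \<le> u1 0 - c / Q * b 0"
 proof (rule jk.max_principle[where W="\<lambda>x. u1 x - c / Q * b x" and S="ball 0 1" and R=1])
  have cQ: "0 \<le> c / Q" using T0 Q lam by (simp add: c_def)
  show "bbd (U + \<bar>c / Q\<bar> * 2) (\<lambda>x. u1 x - c / Q * b x)" by (intro bbd_diff u1 bbd_scale b(1))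
  show "0 \<le> jk.Lop (\<lambda>x. u1 x - c / Q * b x) x" if "x \<in> ball 0 1" for x
  proof -
   have "jk.Lop (\<lambda>x. u1 x - c / Q * b x) x = jk.Lop u1 x - c / Q * jk.Lop b x"
    using jk.Lop_diff[OF u1 bbd_scale[OF b(1), of "c / Q"], of x] unfolding jk.Lop_scale .
   moreover have "c / Q * jk.Lop b x \<le> c / Q * Q" using b(4)[of x] that cQ by (intro mult_left_mono) auto
   ultimately show ?thesis using Lu1[of x] that Q by auto
  qed
  show "0 \<le> u1 x - c / Q * b x" if "x \<notin> ball 0 1" for x
  proof -
   have "c / Q * b x \<le> 0" using that by (intro mult_nonneg_nonpos[OF cQ b(3)]) simp
   moreover have "0 \<le> u1 x" using u0 by (simp add: u1_def)
   ultimately show ?thesis by linarith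
  qed
 qed simp
 moreover have "c / Q * (1 / 2) \<le> c / Q * b 0" using b(2) T0 Q lam by (intro mult_left_mono) (auto simp: c_def)
 ultimately have "c / Q * (1 / 2) \<le> u 0" by (simp add: u1_def)
 then show ?thesis unfolding weak_harnack_constant_def T_def[symmetric] Q_def[symmetric] by (simp add: c_def)
qed

end

section \<open>Localization and rescaling\<close>

definition local_constant :: "real => real => real => real" where
 "local_constant n s Lam = 2 + 4 * Lam * radial_const n (2 * s) + 2 * Lam * 6 powr (n + 2 * s)"

context unit_kernel begin

text \<open>Jumps of length at least 1 are moved to the right-hand side. If they land beyond radius
  6, then \<open>norm (x + z) \<le> 6 * norm z\<close> replaces the kernel centred at
  \<open>x\<close> by the one centred at 0, and the tail bound applies; hence the factor
  \<open>6 powr (n + 2 * s)\<close> in the constant.\<close>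

lemma far_source:
 assumes u: "bbd U u" and uM: "!!x. x \<in> ball 0 6 ==> \<bar>u x\<bar> \<le> M"
  and tail: "(LBINT y. (if 6 \<le> norm y then \<bar>u y\<bar> * rpow n s y else 0)) \<le> M"
  and Lu: "!!x. x \<in> ball 0 5 ==> jk.Lop u x = g0 x" and g0: "g0 \<in> Borel" "!!x. x \<in> ball 0 5 ==> \<bar>g0 x\<bar> \<le> M"
 obtains f where "f \<in> Borel" "!!x. x \<in> ball 0 5 ==> \<bar>f x\<bar> \<le> local_constant n s Lam * M"
  "!!x. x \<in> ball 0 5 ==> 2 * (LBINT z. (u x - u (x + z)) * Kn x (x + z)) = f x"
proof -
 note [measurable] = bbd_measurable[OF u] g0(1)
 have M: "0 \<le> M" using uM[of 0] by simp
 have U: "0 \<le> U" using bbd_nonneg[OF u] .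
 define t where "t = (\<lambda>y. if 6 \<le> norm y then \<bar>u y\<bar> * rpow n s y else 0)"
 have [measurable]: "t \<in> Borel" unfolding t_def by measurable
 have ti: "integrable lborel t"
 proof (rule far_integral_bound(1)[where R="6" and A=U and e="2 * s"])
  fix z
  have e: "- (2 * s) - real DIM('a) = - n - 2 * s" by simp
  show "\<bar>t z\<bar> \<le> (if 6 \<le> norm z then U * norm z powr (- (2 * s) - real DIM('a)) else 0)"
   unfolding e t_def using bbd_le[OF u, of z] by (auto simp: abs_mult intro!: mult_right_mono)
 qed (use s U in auto)
 define D where "D = (\<lambda>x z. (u x - u (x + z)) * (K x (x + z) - Kn x (x + z)))"
 define f where "f = (\<lambda>x. g0 x + - 2 * (LBINT z. D x z))"
 have fm: "f \<in> Borel" unfolding f_def D_def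
  by (intro borel_measurable_add g0(1) borel_measurable_times borel_measurable_const lborel.borel_measurable_lebesgue_integral) measurable
 have Di: "integrable lborel (D x)" for x
 proof -
  have "integrable lborel (\<lambda>z. (u x - u (x + z)) * K x (x + z) - (u x - u (x + z)) * Kn x (x + z))"
  proof (intro bochner_integrable_diff jk.Lop_integrable[OF u] Kn_integrable[where B="2 * U"])
   show "\<bar>u x - u (x + z)\<bar> \<le> 2 * U" for z using bbd_le[OF u, of x] bbd_le[OF u, of "x + z"] by linarith
  qed measurable
  then show ?thesis by (simp add: D_def[abs_def] right_diff_distrib)
 qed
 define c where "c = Lam * 6 powr (n + 2 * s)"
 define g where "g = (\<lambda>z::'a. if 1 \<le> norm z then 2 * M * Lam * norm z powr (- (2 * s) - n) else 0)"
 have g: "integrable lborel g" "(LBINT z. g z) \<le> 2 * M * Lam * (1 powr (- (2 * s)) * radial_const n (2 * s))"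
  using far_integral_bound(1,3)[where f=g and R=1 and A="2 * M * Lam" and e="2 * s", unfolded n] s M lam
  by (auto simp: g_def)
 have le: "\<bar>D x z\<bar> \<le> g z + c * t (x + z)" if x: "x \<in> ball 0 5" for x z
 proof (cases "1 \<le> norm z")
  case True
  have ux: "\<bar>u x\<bar> \<le> M" using x uM[of x] by auto
  have e: "rpow n s z = norm z powr (- (2 * s) - n)" by (rule arg_cong[where f="\<lambda>t. norm z powr t"]) simp
  have gz: "g z = 2 * (M * (Lam * rpow n s z))" using True by (simp add: g_def e)
  have D: "\<bar>D x z\<bar> \<le> (\<bar>u x\<bar> + \<bar>u (x + z)\<bar>) * (Lam * rpow n s z)"
   unfolding D_def abs_mult using True K_bounds[of x "x + z"] by (intro mult_mono) (auto simp: Kn_def)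
  show ?thesis
  proof (cases "norm (x + z) < 6")
   case h: True
   have "(\<bar>u x\<bar> + \<bar>u (x + z)\<bar>) * (Lam * rpow n s z) \<le> (2 * M) * (Lam * rpow n s z)"
    using ux uM[of "x + z"] h lam by (intro mult_right_mono) auto
   moreover have "t (x + z) = 0" using h by (simp add: t_def)
   ultimately show ?thesis using D unfolding gz by simp
  next
   case h: False
   have z: "norm (x + z) \<le> 6 * norm z" using x True norm_triangle_ineq[of x z] by simp
   have "rpow n s z \<le> (norm (x + z) / 6) powr (- n - 2 * s)"
    using z h s by (intro powr_mono2') auto
   also have "\<dots> = 6 powr (n + 2 * s) * rpow n s (x + z)"
   proof -
    have "(1/6) powr (- n - 2 * s) = 6 powr (n + 2 * s)" by (simp add: powr_divide powr_minus_divide[of 6 "n + 2 * s", simplified] powr_diff powr_add powr_minus field_simps)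
    then show ?thesis using powr_mult[of "1/6" "norm (x + z)" "- n - 2 * s"] by simp
   qed
   finally have p: "rpow n s z \<le> 6 powr (n + 2 * s) * rpow n s (x + z)" .
   have "\<bar>u (x + z)\<bar> * (Lam * rpow n s z) \<le> \<bar>u (x + z)\<bar> * (Lam * (6 powr (n + 2 * s) * rpow n s (x + z)))"
    using p lam by (intro mult_left_mono) auto
   moreover have "\<bar>u x\<bar> * (Lam * rpow n s z) \<le> (2 * M) * (Lam * rpow n s z)"
    using ux M lam by (intro mult_right_mono) auto
   moreover have "c * t (x + z) = \<bar>u (x + z)\<bar> * (Lam * (6 powr (n + 2 * s) * rpow n s (x + z)))"
    using h by (simp add: t_def c_def)
   ultimately show ?thesis using D unfolding gz distrib_right by simp
  qed
 qed (use lam M in \<open>auto simp: D_def Kn_def g_def c_def t_def\<close>)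
 have fb: "\<bar>f x\<bar> \<le> local_constant n s Lam * M" if x: "x \<in> ball 0 5" for x
 proof -
  have tx: "integrable lborel (\<lambda>z. t (x + z))" "(LBINT z. t (x + z)) = (LBINT z. t z)"
   using shift_integral[of t x] ti by auto
  have "\<bar>LBINT z. D x z\<bar> \<le> (LBINT z. \<bar>D x z\<bar>)" by (rule integral_abs_bound)
  also have "\<dots> \<le> (LBINT z. g z + c * t (x + z))"
   using Di[of x] g(1) tx(1) le[OF x] by (intro integral_mono) auto
  also have "\<dots> = (LBINT z. g z) + c * (LBINT z. t z)" using g(1) tx by simp
  also have "\<dots> \<le> 2 * M * Lam * radial_const n (2 * s) + c * M"
   using g(2) tail lam by (intro add_mono mult_left_mono) (auto simp: t_def c_def)
  finally have "\<bar>f x\<bar> \<le> M + 2 * (2 * M * Lam * radial_const n (2 * s) + c * M)"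
  proof -
   assume "\<bar>LBINT z. D x z\<bar> \<le> 2 * M * Lam * radial_const n (2 * s) + c * M"
   then have "\<bar>g0 x\<bar> + 2 * \<bar>LBINT z. D x z\<bar> \<le> M + 2 * (2 * M * Lam * radial_const n (2 * s) + c * M)"
    using g0(2)[OF x] by (intro add_mono mult_left_mono) auto
   moreover have "\<bar>f x\<bar> \<le> \<bar>g0 x\<bar> + 2 * \<bar>LBINT z. D x z\<bar>"
    unfolding f_def by (rule order_trans[OF abs_triangle_ineq]) (simp add: abs_mult)
   ultimately show ?thesis by (rule order_trans[rotated])
  qed
  also have "\<dots> \<le> local_constant n s Lam * M" using M by (simp add: local_constant_def c_def algebra_simps)
  finally show ?thesis .
 qed
 have feq: "2 * (LBINT z. (u x - u (x + z)) * Kn x (x + z)) = f x" if x: "x \<in> ball 0 5" for x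
 proof -
  have "(LBINT z. (u x - u (x + z)) * Kn x (x + z)) = (LBINT z. (u x - u (x + z)) * K x (x + z) - D x z)"
   by (intro bochner_cong) (auto simp: D_def algebra_simps)
  also have "\<dots> = (LBINT z. (u x - u (x + z)) * K x (x + z)) - (LBINT z. D x z)"
   by (rule bochner_diff[OF jk.Lop_integrable[OF u] Di])
  finally show ?thesis using Lu[OF x] by (simp add: f_def jk.Lop_def)
 qed
 show ?thesis by (rule that[OF fm fb feq])
qed

lemma local_constant_ge_1: "1 \<le> local_constant n s Lam"
 using lam radial_const_pos[of "2 * s" n] s by (simp add: local_constant_def)

theorem unit_estimates:
 assumes gam: "2 * s - 1 < \<gamma>" "\<gamma> < 1" "\<sigma> \<le> \<gamma>" "\<gamma> + \<sigma> \<le> 2 * s"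
  and epsc: "core_constant n s lam \<gamma> * (6 * eps) \<le> 1 / 2"
  and u: "bbd U u" and uM: "!!x. x \<in> ball 0 6 ==> \<bar>u x\<bar> \<le> M"
  and tail: "(LBINT y. (if 6 \<le> norm y then \<bar>u y\<bar> * rpow n s y else 0)) \<le> M"
  and Lu: "!!x. x \<in> ball 0 5 ==> jk.Lop u x = g0 x" and g0: "g0 \<in> Borel" "!!x. x \<in> ball 0 5 ==> \<bar>g0 x\<bar> \<le> M" and h: "tau \<le> norm h"
 shows "norm h \<le> 1 ==> \<bar>u h - u 0\<bar> \<le> holder_constant n s lam Lam \<gamma> * (local_constant n s Lam * M) * norm h powr \<gamma>"
  and "norm x + 2 * norm h \<le> 1 / 2 ==>
   \<bar>u (x + 2 *\<^sub>R h) - 2 * u (x + h) + u x\<bar> \<le> second_constant n s lam Lam \<gamma> eps * (local_constant n s Lam * M) * norm h powr (\<gamma> + \<sigma>)"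
proof -
 have M: "0 \<le> M" using uM[of 0] by simp
 obtain f where f: "f \<in> Borel" "!!x. x \<in> ball 0 5 ==> \<bar>f x\<bar> \<le> local_constant n s Lam * M"
  "!!x. x \<in> ball 0 5 ==> 2 * (LBINT z. (u x - u (x + z)) * Kn x (x + z)) = f x"
  apply (rule far_source[OF u uM tail Lu g0])
  subgoal by assumption
  subgoal by assumption
  subgoal by assumption
  subgoal premises p for f by (rule that[of f]) (fact p)+
  done
 have uM': "\<bar>u x\<bar> \<le> local_constant n s Lam * M" if "x \<in> ball 0 6" for x
  using uM[OF that] mult_right_mono[OF local_constant_ge_1 M] by simp
 show "\<bar>u h - u 0\<bar> \<le> holder_constant n s lam Lam \<gamma> * (local_constant n s Lam * M) * norm h powr \<gamma>" if "norm h \<le> 1"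
  using interior_holder[OF gam(1,2) epsc u uM' f _ h that, of 0] by simp
 show "\<bar>u (x + 2 *\<^sub>R h) - 2 * u (x + h) + u x\<bar> \<le> second_constant n s lam Lam \<gamma> eps * (local_constant n s Lam * M) * norm h powr (\<gamma> + \<sigma>)"
  if "norm x + 2 * norm h \<le> 1 / 2"
  by (rule second_difference[OF gam epsc u uM' f that h])
qed

end

text \<open>\<open>eps\<close> is the admissible oscillation of the kernel at unit scale; its first
  bound serves to absorb the freezing error, the second to keep the correction of the barrier small.
  \<open>tau0\<close> is the admissible ratio of the truncation length to the scale.\<close>

locale kernel_params =
 fixes n s lam Lam \<sigma> \<gamma> eps tau0 :: real
 assumes params: "1 / 2 < s" "s < 1" "2 * s < n" "0 < lam" "lam \<le> Lam"
  and gam: "2 * s - 1 < \<gamma>" "\<gamma> < 1" "\<sigma> \<le> \<gamma>" "\<gamma> + \<sigma> \<le> 2 * s" and sig: "0 < \<sigma>" "\<sigma> \<le> 1"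
  and eps: "0 < eps" "core_constant n s lam \<gamma> * (6 * eps) \<le> 1 / 2"
   "2 * core_constant n s lam \<gamma> * (6 * cutoff_constant n * eps) \<le> 1 / 8"
  and tau0: "0 < tau0" "3 * tau0 \<le> 1" "tau0 powr (2 * s) \<le> bump_constant n s lam"

locale local_kernel = kernel_params n s lam Lam \<sigma> \<gamma> eps tau0 + jump_kernel n s lam Lam tau K
 for n s lam Lam \<sigma> \<gamma> eps tau0 tau :: real and K :: "'a::euclidean_space => 'a => real"
begin

abbreviation "hc \<equiv> holder_constant n s lam Lam \<gamma> * local_constant n s Lam"
abbreviation "sc \<equiv> second_constant n s lam Lam \<gamma> eps * local_constant n s Lam"
abbreviation "wc \<equiv> weak_harnack_constant n s lam Lam"

text \<open>All that rescaling the surroundings of \<open>x0\<close> to unit size needs. At unit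
  scale the Hoelder constant of the kernel becomes \<open>Lam * R powr \<sigma>\<close>, so its
  smallness is bought by choosing a small scale.\<close>

definition good :: "'a => real => bool" where
 "good x0 R \<longleftrightarrow> 0 < R \<and> Lam * R powr \<sigma> \<le> eps \<and> tau \<le> tau0 * R \<and>
  (\<forall>x\<in>ball x0 (8 * R). \<forall>y\<in>ball x0 (8 * R). \<forall>h. norm h \<le> 8 * R -->
    \<bar>K (x + h) (y + h) - K x y\<bar> \<le> Lam * norm h powr \<sigma> * rpow n s (x - y))"

definition scaled :: "'a => real => 'a => 'a => real" where
 "scaled x0 R x y = R powr (n + 2 * s) * K (x0 + R *\<^sub>R x) (x0 + R *\<^sub>R y)"

lemma unit_scaled:
 assumes g: "good x0 R"
 shows "unit_kernel n s lam Lam (tau / R) eps \<sigma> (scaled x0 R)"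
proof
 have R: "0 < R" and LR: "Lam * R powr \<sigma> \<le> eps" and tR: "tau \<le> tau0 * R" using g by (auto simp: good_def)
 have d: "norm ((x0 + R *\<^sub>R x) - (x0 + R *\<^sub>R y)) = R * norm (x - y)" for x y
  using R by (simp add: scaleR_diff_right[symmetric])
 have p: "R powr (n + 2 * s) * (R * norm (x - y)) powr (- n - 2 * s) = rpow n s (x - y)" for x y :: 'a
  using R by (simp add: powr_mult mult.assoc[symmetric] powr_add[symmetric])
 have "3 * tau \<le> R"
 proof -
  have "3 * tau0 * R \<le> 1 * R" using tau0(2) R by (intro mult_right_mono) auto
  then show ?thesis using tR by linarith
 qed
 then show "0 < tau / R" "3 * (tau / R) \<le> 1" using tau R by (auto simp: field_simps)
 have "(tau / R) powr (2 * s) \<le> tau0 powr (2 * s)" using tR R tau s by (intro powr_mono2) (auto simp: field_simps)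
 then show "(tau / R) powr (2 * s) \<le> bump_constant n s lam" using tau0 by linarith
 show "case_prod (scaled x0 R) \<in> borel_measurable borel2" unfolding scaled_def split_beta' by measurable
 show "scaled x0 R y x = scaled x0 R x y" for x y using K_sym by (simp add: scaled_def)
 show "scaled x0 R x y = 0" if "norm (x - y) \<le> tau / R" for x y
 proof -
  have "norm ((x0 + R *\<^sub>R x) - (x0 + R *\<^sub>R y)) \<le> tau" unfolding d using that R by (simp add: field_simps)
  from K_zero[OF this] show ?thesis by (simp add: scaled_def)
 qed
 show "lam * rpow n s (x - y) \<le> scaled x0 R x y" "scaled x0 R x y \<le> Lam * rpow n s (x - y)"
  if "tau / R < norm (x - y)" for x y
 proof -
  have "tau < norm ((x0 + R *\<^sub>R x) - (x0 + R *\<^sub>R y))" unfolding d using that R by (simp add: field_simps)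
  from K_lower[OF this] K_upper[OF this]
  have "R powr (n + 2 * s) * (lam * (R * norm (x - y)) powr (- n - 2 * s)) \<le> scaled x0 R x y"
   "scaled x0 R x y \<le> R powr (n + 2 * s) * (Lam * (R * norm (x - y)) powr (- n - 2 * s))"
   unfolding d scaled_def by (auto intro!: mult_left_mono)
  then show "lam * rpow n s (x - y) \<le> scaled x0 R x y" "scaled x0 R x y \<le> Lam * rpow n s (x - y)"
   unfolding mult.left_commute[of "R powr (n + 2 * s)"] p by auto
 qed
 show "\<bar>scaled x0 R (x + h) (y + h) - scaled x0 R x y\<bar> \<le> eps * norm h powr \<sigma> * rpow n s (x - y)"
  if "x \<in> ball 0 8" "y \<in> ball 0 8" "norm h \<le> 8" for x y h
 proof -
  have "\<bar>K ((x0 + R *\<^sub>R x) + R *\<^sub>R h) ((x0 + R *\<^sub>R y) + R *\<^sub>R h) - K (x0 + R *\<^sub>R x) (x0 + R *\<^sub>R y)\<bar>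
    \<le> Lam * norm (R *\<^sub>R h) powr \<sigma> * norm ((x0 + R *\<^sub>R x) - (x0 + R *\<^sub>R y)) powr (- n - 2 * s)"
  proof -
   have "x0 + R *\<^sub>R x \<in> ball x0 (8 * R)" "x0 + R *\<^sub>R y \<in> ball x0 (8 * R)" "norm (R *\<^sub>R h) \<le> 8 * R"
    using that R by (auto simp: dist_norm)
   then show ?thesis using g unfolding good_def by blast
  qed
  then have "R powr (n + 2 * s) * \<bar>K ((x0 + R *\<^sub>R x) + R *\<^sub>R h) ((x0 + R *\<^sub>R y) + R *\<^sub>R h) - K (x0 + R *\<^sub>R x) (x0 + R *\<^sub>R y)\<bar>
    \<le> R powr (n + 2 * s) * (Lam * (R * norm h) powr \<sigma> * (R * norm (x - y)) powr (- n - 2 * s))"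
   unfolding d using R by (intro mult_left_mono) auto
  also have "\<dots> = (Lam * R powr \<sigma>) * norm h powr \<sigma> * (R powr (n + 2 * s) * (R * norm (x - y)) powr (- n - 2 * s))"
   using R by (simp add: powr_mult)
  also have "\<dots> \<le> eps * norm h powr \<sigma> * rpow n s (x - y)"
   unfolding p using LR by (intro mult_right_mono) auto
  finally show ?thesis unfolding scaled_def right_diff_distrib[symmetric] abs_mult by (simp add: scaleR_add_right add.assoc)
 qed
qed (use s lam sig eps in auto)

lemma scaled_tail:
 assumes R: "0 < R" and u: "(u :: 'a => real) \<in> Borel"
 shows "(LBINT y. (if a \<le> norm y then u (x0 + R *\<^sub>R y) * rpow n s y else 0))
  = R powr (2 * s) * (LBINT y. (if a * R \<le> norm (y - x0) then u y * rpow n s (y - x0) else 0))"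
proof -
 note [measurable] = u
 let ?f = "\<lambda>y. if a * R \<le> norm (y - x0) then u y * rpow n s (y - x0) else 0"
 have "(LBINT y. ?f (x0 + R *\<^sub>R y)) = (LBINT y. ?f y) / R powr n"
  using affine_integral(1)[of R ?f x0] R by (simp add: powr_realpow[symmetric])
 moreover have "?f (x0 + R *\<^sub>R y) = R powr (- n - 2 * s) * (if a \<le> norm y then u (x0 + R *\<^sub>R y) * rpow n s y else 0)" for y
  using R by (simp add: powr_mult field_simps)
 ultimately have "R powr (- n - 2 * s) * (LBINT y. (if a \<le> norm y then u (x0 + R *\<^sub>R y) * rpow n s y else 0)) = (LBINT y. ?f y) / R powr n"
  by simp
 then have "R powr (n + 2 * s) * (R powr (- n - 2 * s) * (LBINT y. (if a \<le> norm y then u (x0 + R *\<^sub>R y) * rpow n s y else 0))) = R powr (n + 2 * s) * ((LBINT y. ?f y) / R powr n)"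
  by simp
 then show ?thesis using R by (simp add: mult.assoc[symmetric] powr_add[symmetric]) (simp add: powr_add field_simps)
qed

lemma scaled_Lop:
 assumes g: "good x0 R" and u: "bbd U u"
 shows "jump_kernel.Lop (scaled x0 R) (\<lambda>x. u (x0 + R *\<^sub>R x)) x = R powr (2 * s) * Lop u (x0 + R *\<^sub>R x)"
proof -
 interpret uk: unit_kernel n s lam Lam "tau / R" eps \<sigma> "scaled x0 R" by (rule unit_scaled[OF g])
 have R: "0 < R" using g by (simp add: good_def)
 note [measurable] = bbd_measurable[OF u]
 let ?X = "x0 + R *\<^sub>R x"
 let ?f = "\<lambda>z. (u ?X - u (?X + z)) * K ?X (?X + z)"
 have "(LBINT z. ?f (0 + R *\<^sub>R z)) = (LBINT z. ?f z) / R powr n"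
  using affine_integral(1)[of R ?f 0] R by (simp add: powr_realpow[symmetric])
 moreover have "(u ?X - u (x0 + R *\<^sub>R (x + z))) * scaled x0 R x (x + z) = R powr (n + 2 * s) * ?f (0 + R *\<^sub>R z)" for z
  by (simp add: scaled_def scaleR_add_right add.assoc)
 ultimately have "uk.jk.Lop (\<lambda>x. u (x0 + R *\<^sub>R x)) x = 2 * (R powr (n + 2 * s) * ((LBINT z. ?f z) / R powr n))"
  unfolding uk.jk.Lop_def by simp
 then show ?thesis using R by (simp add: Lop_def powr_add)
qed

lemma scaled_bbd: "bbd U u ==> bbd U (\<lambda>x. u (x0 + R *\<^sub>R x))"
 by (auto simp: bbd_def)

theorem scaled_weak_harnack:
 assumes g: "good x0 R" and u: "bbd U u" and u0: "!!x. 0 \<le> u x" and Lu: "!!x. x \<in> ball x0 R ==> Lop u x = 0"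
 shows "wc * (R powr (2 * s) * (LBINT y. (if 3 / 2 * R \<le> norm (y - x0) then u y * rpow n s (y - x0) else 0))) \<le> u x0"
proof -
 interpret uk: unit_kernel n s lam Lam "tau / R" eps \<sigma> "scaled x0 R" by (rule unit_scaled[OF g])
 have R: "0 < R" using g by (simp add: good_def)
 have "wc * (LBINT y. (if 3 / 2 \<le> norm y then u (x0 + R *\<^sub>R y) * rpow n s y else 0)) \<le> u (x0 + R *\<^sub>R 0)"
 proof (rule uk.weak_harnack[OF gam(1,2) eps(2,3) scaled_bbd[OF u] u0])
  fix x :: 'a assume "norm x < 1"
  then have "x0 + R *\<^sub>R x \<in> ball x0 R" using R by (simp add: dist_norm)
  then show "uk.jk.Lop (\<lambda>x. u (x0 + R *\<^sub>R x)) x = 0" using scaled_Lop[OF g u] Lu by simp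
 qed
 then show ?thesis unfolding scaled_tail[OF R bbd_measurable[OF u]] by simp
qed

lemma scaled_estimates:
 assumes g: "good x0 R" and u: "bbd U u" and uM: "!!x. x \<in> ball x0 (6 * R) ==> \<bar>u x\<bar> \<le> M"
  and tail: "R powr (2 * s) * (LBINT y. (if 6 * R \<le> norm (y - x0) then \<bar>u y\<bar> * rpow n s (y - x0) else 0)) \<le> M"
  and Lu: "!!x. x \<in> ball x0 (5 * R) ==> Lop u x = g0 x" and g0: "g0 \<in> Borel"
   "!!x. x \<in> ball x0 (5 * R) ==> R powr (2 * s) * \<bar>g0 x\<bar> \<le> M"
  and h: "tau \<le> norm h"
 shows "norm h \<le> R ==> \<bar>u (x0 + h) - u x0\<bar> \<le> hc * M * (norm h / R) powr \<gamma>"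
  and "norm (x - x0) + 2 * norm h \<le> R / 2 ==>
   \<bar>u (x + 2 *\<^sub>R h) - 2 * u (x + h) + u x\<bar> \<le> sc * M * (norm h / R) powr (\<gamma> + \<sigma>)"
proof -
 interpret uk: unit_kernel n s lam Lam "tau / R" eps \<sigma> "scaled x0 R" by (rule unit_scaled[OF g])
 have R: "0 < R" using g by (simp add: good_def)
 let ?v = "\<lambda>x. u (x0 + R *\<^sub>R x)"
 have v: "bbd U ?v" by (rule scaled_bbd[OF u])
 have vM: "\<bar>?v x\<bar> \<le> M" if "x \<in> ball 0 6" for x using that R uM[of "x0 + R *\<^sub>R x"] by (simp add: dist_norm mult.commute)
 have m: "(\<lambda>x. \<bar>u x\<bar>) \<in> Borel" using bbd_measurable[OF u] by measurable
 have vt: "(LBINT y. (if 6 \<le> norm y then \<bar>?v y\<bar> * rpow n s y else 0)) \<le> M"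
  using scaled_tail[OF R m, of 6 x0] tail by simp
 have vL: "uk.jk.Lop ?v x = R powr (2 * s) * g0 (x0 + R *\<^sub>R x)" if "x \<in> ball 0 5" for x
  using that R Lu[of "x0 + R *\<^sub>R x"] scaled_Lop[OF g u, of x] by (simp add: dist_norm mult.commute)
 have vg: "(\<lambda>x. R powr (2 * s) * g0 (x0 + R *\<^sub>R x)) \<in> Borel" using g0(1) by measurable
 have vg': "\<bar>R powr (2 * s) * g0 (x0 + R *\<^sub>R x)\<bar> \<le> M" if "x \<in> ball 0 5" for x
  using that R g0(2)[of "x0 + R *\<^sub>R x"] by (simp add: dist_norm mult.commute abs_mult)
 have h': "tau / R \<le> norm ((1 / R) *\<^sub>R h)" "norm ((1 / R) *\<^sub>R h) = norm h / R" using h R by (auto simp: divide_right_mono)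
 have sR: "R *\<^sub>R ((1 / R) *\<^sub>R y) = y" for y :: 'a using R by simp
 note est = uk.unit_estimates[OF gam eps(2) v vM vt vL vg vg' h'(1)]
 show "\<bar>u (x0 + h) - u x0\<bar> \<le> hc * M * (norm h / R) powr \<gamma>" if "norm h \<le> R"
  using est(1) that R unfolding h'(2) sR by (simp add: mult_ac)
 show "\<bar>u (x + 2 *\<^sub>R h) - 2 * u (x + h) + u x\<bar> \<le> sc * M * (norm h / R) powr (\<gamma> + \<sigma>)"
  if x: "norm (x - x0) + 2 * norm h \<le> R / 2"
 proof -
  have "norm ((1 / R) *\<^sub>R (x - x0)) + 2 * (norm h / R) = (norm (x - x0) + 2 * norm h) / R" using R by (simp add: add_divide_distrib)
  also have "\<dots> \<le> 1 / 2" using x R by (simp add: field_simps)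
  finally have "norm ((1 / R) *\<^sub>R (x - x0)) + 2 * (norm h / R) \<le> 1 / 2" .
  then have "\<bar>u (x0 + R *\<^sub>R ((1 / R) *\<^sub>R (x - x0) + 2 *\<^sub>R ((1 / R) *\<^sub>R h))) - 2 * u (x0 + R *\<^sub>R ((1 / R) *\<^sub>R (x - x0) + (1 / R) *\<^sub>R h)) + u (x0 + R *\<^sub>R ((1 / R) *\<^sub>R (x - x0)))\<bar>
   \<le> second_constant n s lam Lam \<gamma> eps * (local_constant n s Lam * M) * (norm h / R) powr (\<gamma> + \<sigma>)"
   using est(2)[of "(1 / R) *\<^sub>R (x - x0)"] unfolding h'(2) by simp
  moreover have "x0 + R *\<^sub>R ((1 / R) *\<^sub>R (x - x0) + 2 *\<^sub>R ((1 / R) *\<^sub>R h)) = x + 2 *\<^sub>R h"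
   "x0 + R *\<^sub>R ((1 / R) *\<^sub>R (x - x0) + (1 / R) *\<^sub>R h) = x + h" "x0 + R *\<^sub>R ((1 / R) *\<^sub>R (x - x0)) = x"
   using R by (auto simp: scaleR_add_right)
  ultimately show ?thesis by (simp only: mult.assoc)
 qed
qed

end

section \<open>The Harnack inequality\<close>

text \<open>The fraction of the radius within which the Hoelder estimate lets the solution change by
  at most half of its value at the centre.\<close>

definition theta_harnack :: "real => real => real => real => real => real" where
 "theta_harnack n s lam Lam \<gamma> = (let w = weak_harnack_constant n s lam Lam;
   A = holder_constant n s lam Lam \<gamma> * local_constant n s Lam * (2 powr (n + 1) + 1 / w)
   in min 1 ((1 / (2 * (A + 1))) powr (1 / \<gamma>)))"

text \<open>In the sum, the first term comes from the two weak Harnack steps, the second from the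
  case in which the distance to the sphere is only a multiple of \<open>tau\<close>. The factor
  \<open>16 powr n\<close> removes the weight, as the points of interest have distance at least
  \<open>R / 16\<close> from the sphere.\<close>

definition harnack_constant :: "real => real => real => real => real => real => real" where
 "harnack_constant n s lam Lam \<gamma> tau0 = (let w = weak_harnack_constant n s lam Lam; t = theta_harnack n s lam Lam \<gamma>;
   a = w * (1 / 16) powr (2 * s) * unit_ball_vol n
   in 16 powr n * (4 / (a * a * (t / 48) powr n * (1 / 16) powr n) + 2 * (48 / t + 12 / tau0) powr n))"

definition difference_constant :: "real => real => real => real => real => real => real => real => real" where
 "difference_constant n s lam Lam \<sigma> \<gamma> eps tau0 = second_constant n s lam Lam \<gamma> eps * local_constant n s Lam
   * (harnack_constant n s lam Lam \<gamma> tau0 + 1 / weak_harnack_constant n s lam Lam) * 96 powr (\<gamma> + \<sigma>)"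

abbreviation (in kernel_params) "hk \<equiv> harnack_constant n s lam Lam \<gamma> tau0"
abbreviation (in kernel_params) "dk \<equiv> difference_constant n s lam Lam \<sigma> \<gamma> eps tau0"

context local_kernel begin

lemma n_pos: "0 < n" using s by simp

lemma pow_n: "0 < x ==> x ^ DIM('a) = x powr n"
 by (metis dim powr_realpow)

lemma wc_pos: "0 < wc"
proof -
 have "0 < radial_const n (2 - 2 * s)" "0 < radial_const n (2 * s)" using s by (auto intro!: radial_const_pos)
 then have "0 < cutoff_constant n * Lam * radial_const n (2 - 2 * s) + 1 + 8 * Lam * radial_const n (2 * s)"
  using lam by (intro add_pos_pos add_nonneg_pos) (auto simp: cutoff_constant_def)
 then show ?thesis using lam by (simp add: weak_harnack_constant_def)
qed

lemma good_sub:
 assumes g: "good x0 R" and d: "dist x0 x + 8 * r \<le> 8 * R" "0 < r" and t: "tau \<le> tau0 * r"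
 shows "good x r"
 unfolding good_def
proof (intro conjI ballI allI impI)
 have rR: "r \<le> R" using d zero_le_dist[of x0 x] by linarith
 have "Lam * r powr \<sigma> \<le> Lam * R powr \<sigma>" using rR d sig lam by (intro mult_left_mono powr_mono2) auto
 then show "Lam * r powr \<sigma> \<le> eps" using g by (simp add: good_def)
 fix y z h :: 'a assume yz: "y \<in> ball x (8 * r)" "z \<in> ball x (8 * r)" "norm h \<le> 8 * r"
 have "y \<in> ball x0 (8 * R)" "z \<in> ball x0 (8 * R)" "norm h \<le> 8 * R"
  using yz d rR dist_triangle[of x0 y x] dist_triangle[of x0 z x] by auto
 then show "\<bar>K (y + h) (z + h) - K y z\<bar> \<le> Lam * norm h powr \<sigma> * rpow n s (y - z)"
  using g by (simp add: good_def)
qed (use d t in auto)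

text \<open>A lower bound on a ball that is neither too close to \<open>x0\<close> nor too far from
  it passes to \<open>x0\<close>, since the tail integral is at least its part over this
  ball.\<close>

lemma weak_harnack_ball:
 assumes g: "good x0 R" and u: "bbd U u" and u0: "!!x. 0 \<le> u x" and Lu: "!!x. x \<in> ball x0 R ==> Lop u x = 0"
  and b: "!!y. y \<in> ball p r ==> m \<le> u y \<and> 3 / 2 * R \<le> dist x0 y \<and> dist x0 y \<le> 16 * R" and r: "0 < r" and m: "0 \<le> m"
 shows "wc * (1 / 16) powr (2 * s) * unit_ball_vol n * m * (r / (16 * R)) powr n \<le> u x0"
proof -
 note [measurable] = bbd_measurable[OF u]
 have R: "0 < R" using g by (simp add: good_def)
 let ?f = "\<lambda>y. if 3 / 2 * R \<le> norm (y - x0) then u y * rpow n s (y - x0) else 0"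
 have fi: "integrable lborel ?f"
 proof -
  have "integrable lborel (\<lambda>z. ?f (x0 + z))"
  proof (rule far_integral_bound(1)[where R="3 / 2 * R" and A=U and e="2 * s"])
   fix z :: 'a
   have e: "- (2 * s) - real DIM('a) = - n - 2 * s" by simp
   show "\<bar>?f (x0 + z)\<bar> \<le> (if 3 / 2 * R \<le> norm z then U * norm z powr (- (2 * s) - real DIM('a)) else 0)"
    unfolding e using bbd_le[OF u, of "x0 + z"] by (auto simp: abs_mult intro!: mult_right_mono)
  qed (use s R bbd_nonneg[OF u] in auto)
  then show ?thesis using shift_integral(2)[of ?f x0] by simp
 qed
 define c where "c = m * (16 * R) powr (- n - 2 * s)"
 have "(LBINT y. c * indicator (ball p r) y) \<le> (LBINT y. ?f y)"
 proof (rule integral_mono[OF _ fi])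
  show "integrable lborel (\<lambda>y. c * indicator (ball p r) y)" by (intro integrable_mult_right integrable_ball_indicator)
  fix y
  show "c * indicator (ball p r) y \<le> ?f y"
  proof (cases "y \<in> ball p r")
   case True
   from b[OF this] have y: "m \<le> u y" "3 / 2 * R \<le> norm (y - x0)" "norm (y - x0) \<le> 16 * R"
    by (auto simp: dist_norm norm_minus_commute)
   have "(16 * R) powr (- n - 2 * s) \<le> rpow n s (y - x0)"
    using y R s by (intro powr_mono2') auto
   then have "c \<le> u y * rpow n s (y - x0)" unfolding c_def using y m by (intro mult_mono) auto
   then show ?thesis using y True by simp
  qed (use u0 in simp)
 qed
 then have "c * (unit_ball_vol n * r powr n) \<le> (LBINT y. ?f y)"
  using integral_ball_indicator[of r p] r by (simp add: pow_n)
 then have "wc * (R powr (2 * s) * (c * (unit_ball_vol n * r powr n))) \<le> wc * (R powr (2 * s) * (LBINT y. ?f y))"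
  using wc_pos by (intro mult_left_mono) auto
 also have "\<dots> \<le> u x0" by (rule scaled_weak_harnack[OF g u u0 Lu])
 also have "wc * (R powr (2 * s) * (c * (unit_ball_vol n * r powr n))) = wc * (1 / 16) powr (2 * s) * unit_ball_vol n * m * (r / (16 * R)) powr n"
 proof -
  have "R powr (2 * s) * (16 * R) powr (- n - 2 * s) = (1 / 16) powr (2 * s) * (16 * R) powr (- n)"
  proof -
   have "R powr (2 * s) = (1 / 16) powr (2 * s) * (16 * R) powr (2 * s)" using R by (simp add: powr_mult[symmetric])
   moreover have "(16 * R) powr (2 * s) * (16 * R) powr (- n - 2 * s) = (16 * R) powr (- n)" by (simp add: powr_add[symmetric])
   ultimately show ?thesis by (simp only: mult.assoc)
  qed
  moreover have "(16 * R) powr (- n) * r powr n = (r / (16 * R)) powr n" using R r by (simp add: powr_divide powr_minus field_simps)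
  ultimately have "R powr (2 * s) * (16 * R) powr (- n - 2 * s) * r powr n = (1 / 16) powr (2 * s) * (r / (16 * R)) powr n" by (simp only: mult.assoc)
  moreover have "wc * (R powr (2 * s) * (c * (unit_ball_vol n * r powr n))) = wc * unit_ball_vol n * m * (R powr (2 * s) * (16 * R) powr (- n - 2 * s) * r powr n)"
   by (simp add: c_def mult_ac)
  ultimately show ?thesis by (simp add: mult_ac)
 qed
 finally show ?thesis .
qed

abbreviation "Th \<equiv> theta_harnack n s lam Lam \<gamma>"

lemma hc_nonneg: "0 \<le> hc"
proof -
 have "0 < core_constant n s lam \<gamma>"
 proof -
  obtain e :: 'a where "norm e = 1" by (meson norm_Basis nonempty_Basis ex_in_conv)
  \<comment> \<open>Positivity of the constant is available in a context that contains a kernel; any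
    kernel with the right bounds gives access to it.\<close>
  define kk where "kk = (\<lambda>z::'a. if tau0 < norm z \<and> norm z < 1 then lam * rpow n s z else 0)"
  interpret flux n s lam Lam tau0 kk \<gamma> 0 "\<lambda>_ _. 0"
   by unfold_locales (use s lam tau0 gam in \<open>auto simp: kk_def intro!: mult_right_mono\<close>)
  show ?thesis by (rule CC_pos)
 qed
 moreover have "0 < radial_const n (\<gamma> + 1 - 2 * s)" "0 < radial_const n (2 * s - 1)" "0 < radial_const n (2 * s)"
  using gam s by (auto intro!: radial_const_pos)
 ultimately show ?thesis using lam
  by (simp add: holder_constant_def local_constant_def Let_def)
qed

lemma Th: "0 < Th" "Th \<le> 1" "hc * (2 powr (n + 1) + 1 / wc) * Th powr \<gamma> \<le> 1 / 2"
proof -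
 define A where "A = hc * (2 powr (n + 1) + 1 / wc)"
 have A: "0 \<le> A" using hc_nonneg wc_pos by (simp add: A_def)
 have g: "0 < \<gamma>" using gam s by simp
 have Te: "Th = min 1 ((1 / (2 * (A + 1))) powr (1 / \<gamma>))" by (simp add: theta_harnack_def A_def Let_def)
 show "0 < Th" "Th \<le> 1" using A unfolding Te by auto
 then have "Th powr \<gamma> \<le> ((1 / (2 * (A + 1))) powr (1 / \<gamma>)) powr \<gamma>" using g unfolding Te by (intro powr_mono2) auto
 also have "\<dots> = 1 / (2 * (A + 1))" using g A by (simp add: powr_powr)
 finally have "A * Th powr \<gamma> \<le> A * (1 / (2 * (A + 1)))" using A by (intro mult_left_mono)
 also have "\<dots> \<le> 1 / 2" using A by (simp add: field_simps)
 finally show "hc * (2 powr (n + 1) + 1 / wc) * Th powr \<gamma> \<le> 1 / 2" by (simp add: A_def)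
qed

text \<open>At a point \<open>x\<close> almost maximizing \<open>d(x) powr n * u x\<close>, where \<open>d\<close> is the distance to the sphere of radius
 \<open>R / 8\<close>, the solution is at least \<open>u x / 2\<close> on a ball of radius comparable to \<open>d x\<close>; two applications of the weak
 Harnack inequality carry this mass to the centre. Both steps need \<open>d x\<close> to be large against \<open>tau\<close>; otherwise
 \<open>d(x) powr n * u x\<close> is small.\<close>

theorem harnack_tau:
 assumes g: "good x0 R" and t: "tau \<le> tau0 * (R / 16)" and u: "bbd U u" and u0: "!!x. 0 \<le> u x"
  and Lu: "!!x. x \<in> ball x0 R ==> Lop u x = 0" and z: "dist x0 z < R / 16"
 shows "u z \<le> hk * (u x0 + U * (tau / R) powr n)"
proof (rule ccontr)
 assume neg: "\<not> u z \<le> hk * (u x0 + U * (tau / R) powr n)"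
 have R: "0 < R" using g by (simp add: good_def)
 have U: "0 \<le> U" using bbd_nonneg[OF u] .
 define a where "a = wc * (1 / 16) powr (2 * s) * unit_ball_vol n"
 have a: "0 < a" using wc_pos n_pos by (simp add: a_def)
 define B1 where "B1 = 4 / (a * a * (Th / 48) powr n * (1 / 16) powr n)"
 define B2 where "B2 = 2 * (48 / Th + 12 / tau0) powr n"
 have hk: "hk = 16 powr n * (B1 + B2)" by (simp add: harnack_constant_def Let_def a_def B1_def B2_def)
 have "0 < 48 / Th + 12 / tau0" using Th tau0 by (intro add_pos_pos divide_pos_pos) auto
 then have B: "0 < B1" "0 < B2" using a Th tau0 by (auto simp: B1_def B2_def)
 define d where "d = (\<lambda>x. R / 8 - dist x0 x)"
 define \<Phi> where "\<Phi> = (SUP x\<in>ball x0 (R / 8). d x powr n * u x)"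
 have uU: "u x \<le> U" for x using bbd_le[OF u, of x] by linarith
 have bdd: "bdd_above ((\<lambda>x. d x powr n * u x) ` ball x0 (R / 8))"
 proof (rule bdd_aboveI2)
  fix x assume "x \<in> ball x0 (R / 8)"
  then have "d x powr n \<le> (R / 8) powr n" using n_pos by (intro powr_mono2) (auto simp: d_def)
  then show "d x powr n * u x \<le> (R / 8) powr n * U" using uU u0 U by (intro mult_mono) auto
 qed
 have Phi: "d x powr n * u x \<le> \<Phi>" if "x \<in> ball x0 (R / 8)" for x
  unfolding \<Phi>_def by (rule cSUP_upper[OF that bdd])
 have hk0: "0 < hk" using B by (simp add: hk)
 have "0 \<le> hk * (u x0 + U * (tau / R) powr n)" using hk0 u0 U by simp
 then have uz: "0 < u z" using neg by linarith
 have zb: "z \<in> ball x0 (R / 8)" using z R by simp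
 have "0 < d z powr n * u z" using uz zb by (simp add: d_def)
 then have Phi0: "0 < \<Phi>" using Phi[OF zb] by linarith
 obtain x where x: "x \<in> ball x0 (R / 8)" "\<Phi> / 2 < d x powr n * u x"
  using less_cSUP_iff[OF _ bdd, of "\<Phi> / 2"] R Phi0 by (auto simp: \<Phi>_def[symmetric])
 define D where "D = d x"
 have D: "0 < D" "D \<le> R / 8" using x(1) by (auto simp: D_def d_def)
 \<comment> \<open>\<open>6 * \<rho>\<close> is \<open>D / 2\<close>, so the distance
   \<open>d\<close> to the sphere is at least \<open>D / 2\<close> on the ball of radius
   \<open>6 * \<rho>\<close> around \<open>x\<close>, and almost maximality bounds \<open>u\<close>
   there by \<open>2 powr (n + 1) * u x\<close>.\<close>
 define \<rho> where "\<rho> = D / 12"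
 have r: "0 < \<rho>" using D by (simp add: \<rho>_def)
 have main: "\<Phi> \<le> R powr n * (B1 * u x0 + B2 * (U * (tau / R) powr n))"
 proof (cases "tau \<le> tau0 * \<rho> \<and> tau \<le> Th * \<rho> / 4")
  case False
  have "D \<le> (48 / Th + 12 / tau0) * tau"
  proof -
   have "Th * D \<le> 48 * tau \<or> tau0 * D \<le> 12 * tau" using False by (auto simp: \<rho>_def)
   then have "D \<le> 48 * tau / Th \<or> D \<le> 12 * tau / tau0" using Th tau0 by (auto simp: field_simps)
   moreover have "0 \<le> 48 * tau / Th" "0 \<le> 12 * tau / tau0" using Th tau tau0 by auto
   ultimately have "D \<le> 48 * tau / Th + 12 * tau / tau0" by linarith
   then show ?thesis by (simp add: distrib_right)
  qed
  then have "D powr n \<le> ((48 / Th + 12 / tau0) * tau) powr n" using D n_pos by (intro powr_mono2) auto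
  also have "\<dots> = (48 / Th + 12 / tau0) powr n * (tau / R) powr n * R powr n"
   using Th tau0 tau R by (simp add: powr_mult powr_divide)
  finally have "D powr n * u x \<le> (48 / Th + 12 / tau0) powr n * (tau / R) powr n * R powr n * U"
   using uU[of x] u0[of x] by (intro mult_mono) auto
  then have "\<Phi> \<le> R powr n * (B2 * (U * (tau / R) powr n))" using x(2) by (simp add: D_def B2_def mult_ac)
  moreover have "0 \<le> R powr n * (B1 * u x0)" using B u0[of x0] by simp
  ultimately show ?thesis by (simp add: distrib_left)
 next
  case True
  have xx: "dist x0 x \<le> R / 8 - 12 * \<rho>"
  proof -
   have "12 * \<rho> = d x" by (simp add: \<rho>_def D_def)
   then show ?thesis by (simp add: d_def)
  qed
  have gx: "good x \<rho>" by (rule good_sub[OF g]) (use xx r R True in auto)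
  have gx': "ball x (5 * \<rho>) \<subseteq> ball x0 R" "ball x \<rho> \<subseteq> ball x0 R"
  proof -
   have "dist x0 y < R" if "dist x y < 5 * \<rho>" for y using that xx r R dist_triangle[of x0 y x] by linarith
   then show "ball x (5 * \<rho>) \<subseteq> ball x0 R" "ball x \<rho> \<subseteq> ball x0 R" using r by force+
  qed
  have tail: "wc * (\<rho> powr (2 * s) * (LBINT y. (if 3 / 2 * \<rho> \<le> norm (y - x) then u y * rpow n s (y - x) else 0))) \<le> u x"
   using gx'(2) Lu by (intro scaled_weak_harnack[OF gx u u0]) auto
  define M where "M = (2 powr (n + 1) + 1 / wc) * u x"
  have hol: "\<bar>u (x + h) - u x\<bar> \<le> hc * M * (norm h / \<rho>) powr \<gamma>" if h: "tau \<le> norm h" "norm h \<le> \<rho>" for h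
  proof (rule scaled_estimates(1)[OF gx u _ _ _ _ _ h, where ?g0.0="\<lambda>_. 0"])
   show "\<bar>u y\<bar> \<le> M" if y: "y \<in> ball x (6 * \<rho>)" for y
   proof -
    have dy: "D / 2 \<le> d y" using y dist_triangle[of x0 y x] by (simp add: d_def D_def \<rho>_def)
    then have yb: "y \<in> ball x0 (R / 8)" using D by (simp add: d_def)
    have "(D / 2) powr n * u y \<le> d y powr n * u y"
     using dy D n_pos u0 by (intro mult_right_mono powr_mono2) auto
    also have "\<dots> \<le> \<Phi>" by (rule Phi[OF yb])
    also have "\<dots> \<le> 2 * (D powr n * u x)" using x(2) by (simp add: D_def)
    also have "\<dots> = (D / 2) powr n * (2 powr (n + 1) * u x)" using D by (simp add: powr_divide powr_add)
    finally have "u y \<le> 2 powr (n + 1) * u x" using D by simp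
    moreover have "0 \<le> 1 / wc * u x" using wc_pos u0 by simp
    ultimately show ?thesis using u0[of y] by (simp add: M_def distrib_right)
   qed
   show "\<rho> powr (2 * s) * (LBINT y. (if 6 * \<rho> \<le> norm (y - x) then \<bar>u y\<bar> * rpow n s (y - x) else 0)) \<le> M"
   proof -
    note [measurable] = bbd_measurable[OF u]
    let ?f = "\<lambda>a y. if a * \<rho> \<le> norm (y - x) then u y * rpow n s (y - x) else 0"
    have fi: "integrable lborel (?f b)" if b: "0 < b" for b
    proof -
     have "integrable lborel (\<lambda>z. ?f b (x + z))"
     proof (rule far_integral_bound(1)[where R="b * \<rho>" and A=U and e="2 * s"])
      fix z :: 'a
      have e: "- (2 * s) - real DIM('a) = - n - 2 * s" by simp
      show "\<bar>?f b (x + z)\<bar> \<le> (if b * \<rho> \<le> norm z then U * norm z powr (- (2 * s) - real DIM('a)) else 0)"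
       unfolding e using bbd_le[OF u, of "x + z"] by (auto simp: abs_mult intro!: mult_right_mono)
     qed (use s r U b in auto)
     then show ?thesis using shift_integral(2)[of "?f b" x] by simp
    qed
    have "(LBINT y. (if 6 * \<rho> \<le> norm (y - x) then \<bar>u y\<bar> * rpow n s (y - x) else 0)) = (LBINT y. ?f 6 y)"
     using u0 by (intro bochner_cong) auto
    also have "\<dots> \<le> (LBINT y. ?f (3/2) y)" using r u0 by (intro integral_mono fi) auto
    finally have "wc * (\<rho> powr (2 * s) * (LBINT y. (if 6 * \<rho> \<le> norm (y - x) then \<bar>u y\<bar> * rpow n s (y - x) else 0))) \<le> u x"
     using wc_pos by (intro order_trans[OF _ tail] mult_left_mono) auto
    then have "\<rho> powr (2 * s) * (LBINT y. (if 6 * \<rho> \<le> norm (y - x) then \<bar>u y\<bar> * rpow n s (y - x) else 0)) \<le> 1 / wc * u x"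
     using wc_pos by (simp add: field_simps)
    also have "\<dots> \<le> M" using u0[of x] by (simp add: M_def distrib_right)
    finally show ?thesis .
   qed
   show "Lop u y = 0" if "y \<in> ball x (5 * \<rho>)" for y using that gx' Lu by auto
   show "\<rho> powr (2 * s) * \<bar>0\<bar> \<le> M" using u0[of x] wc_pos by (simp add: M_def)
  qed simp
  obtain e :: 'a where e: "norm e = 1" by (meson norm_Basis nonempty_Basis ex_in_conv)
  \<comment> \<open>The ball of radius \<open>r0\<close> around \<open>c\<close> stays away from
    \<open>x\<close>: its points have distance at least \<open>r0 \<ge> tau\<close> from
    \<open>x\<close>, and shorter increments are not controlled.\<close>
  define c where "c = x + (Th * \<rho> / 2) *\<^sub>R e"
  define r0 where "r0 = Th * \<rho> / 4"
  have r0: "0 < r0" using Th r by (simp add: r0_def)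
  have cx: "dist x c = 2 * r0" using e r Th by (simp add: c_def r0_def dist_norm)
  have near: "u x / 2 \<le> u y \<and> dist x y \<le> \<rho>" if y: "y \<in> ball c r0" for y
  proof -
   have dxy: "r0 \<le> dist x y" "dist x y \<le> 3 * r0"
    using y cx dist_triangle[of x c y] dist_triangle[of x y c] by (auto simp: dist_commute)
   have Tr: "3 * r0 \<le> Th * \<rho>" "Th * \<rho> \<le> \<rho>" using Th r by (auto simp: r0_def mult_left_le_one_le)
   have ny: "norm (y - x) = dist x y" by (simp add: dist_norm norm_minus_commute)
   have "\<bar>u (x + (y - x)) - u x\<bar> \<le> hc * M * (norm (y - x) / \<rho>) powr \<gamma>"
    using dxy Tr True unfolding r0_def by (intro hol) (auto simp: ny)
   also have "\<dots> \<le> hc * M * Th powr \<gamma>"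
   proof -
    have "norm (y - x) / \<rho> \<le> Th" using dxy Tr r by (simp add: ny field_simps)
    then show ?thesis using hc_nonneg u0[of x] wc_pos r gam s unfolding M_def by (intro mult_left_mono powr_mono2) auto
   qed
   also have "\<dots> = (hc * (2 powr (n + 1) + 1 / wc) * Th powr \<gamma>) * u x" by (simp add: M_def mult_ac)
   also have "\<dots> \<le> 1 / 2 * u x" using Th(3) u0 by (intro mult_right_mono)
   finally have "\<bar>u (x + (y - x)) - u x\<bar> \<le> 1 / 2 * u x" .
   moreover have "x + (y - x) = y" by simp
   ultimately have "\<bar>u y - u x\<bar> \<le> 1 / 2 * u x" by (simp only:)
   then have "u x / 2 \<le> u y" by linarith
   then show ?thesis using dxy Tr by linarith
  qed
  \<comment> \<open>A detour: the ball around \<open>c\<close> may lie close to \<open>x0\<close>,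
    where the tail integral at \<open>x0\<close> misses it. It is seen from every \<open>q\<close>
    near \<open>P\<close>, and the ball around \<open>P\<close> is seen from
    \<open>x0\<close>.\<close>
  define P where "P = x0 + (3 * R / 8) *\<^sub>R e"
  have xP: "dist x0 P = 3 * R / 8" using e R by (simp add: P_def dist_norm)
  have g16: "good q (R / 16)" "ball q (R / 16) \<subseteq> ball x0 R" if "dist x0 q \<le> R / 2" for q
  proof -
   show "good q (R / 16)" by (rule good_sub[OF g]) (use that R t in auto)
   show "ball q (R / 16) \<subseteq> ball x0 R"
   proof
    fix y assume "y \<in> ball q (R / 16)"
    then show "y \<in> ball x0 R" using that R dist_triangle[of x0 y q] by simp
   qed
  qed
  have up: "a * (u x / 2) * (r0 / R) powr n \<le> u q" if q: "q \<in> ball P (R / 16)" for q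
  proof -
   have xq: "5 * R / 16 \<le> dist x0 q" "dist x0 q \<le> 7 * R / 16"
    using q xP dist_triangle[of x0 P q] dist_triangle[of x0 q P] by (auto simp: dist_commute)
   have "wc * (1 / 16) powr (2 * s) * unit_ball_vol n * (u x / 2) * (r0 / (16 * (R / 16))) powr n \<le> u q"
   proof (rule weak_harnack_ball[OF g16(1) u u0])
    show "dist x0 q \<le> R / 2" using xq R by simp
    then show "Lop u y = 0" if "y \<in> ball q (R / 16)" for y using g16(2) that by (intro Lu) blast
    fix y assume y: "y \<in> ball c r0"
    have "dist x0 y \<le> R / 8" using near[OF y] xx r dist_triangle[of x0 y x] by linarith
    then have "3 / 2 * (R / 16) \<le> dist q y" "dist q y \<le> 16 * (R / 16)"
     using xq R dist_triangle[of x0 q y] dist_triangle[of q y x0] by (auto simp: dist_commute)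
    then show "u x / 2 \<le> u y \<and> 3 / 2 * (R / 16) \<le> dist q y \<and> dist q y \<le> 16 * (R / 16)" using near[OF y] by blast
   qed (use r0 u0 in auto)
   then show ?thesis by (simp add: a_def)
  qed
  have "wc * (1 / 16) powr (2 * s) * unit_ball_vol n * (a * (u x / 2) * (r0 / R) powr n) * (R / 16 / (16 * (R / 16))) powr n \<le> u x0"
  proof (rule weak_harnack_ball[OF g16(1) u u0])
   show "dist x0 x0 \<le> R / 2" using R by simp
   then show "Lop u y = 0" if "y \<in> ball x0 (R / 16)" for y using g16(2) that by (intro Lu) blast
   fix q assume q: "q \<in> ball P (R / 16)"
   have "5 * R / 16 \<le> dist x0 q" "dist x0 q \<le> 7 * R / 16"
    using q xP dist_triangle[of x0 P q] dist_triangle[of x0 q P] by (auto simp: dist_commute)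
   then show "a * (u x / 2) * (r0 / R) powr n \<le> u q \<and> 3 / 2 * (R / 16) \<le> dist x0 q \<and> dist x0 q \<le> 16 * (R / 16)"
    using up[OF q] R by auto
  qed (use R a u0 in auto)
  then have "a * (a * (u x / 2) * (r0 / R) powr n) * (1 / 16) powr n \<le> u x0" using R by (simp add: a_def)
  moreover have "(r0 / R) powr n = (Th / 48) powr n * (D / R) powr n"
   unfolding r0_def \<rho>_def using D R Th by (simp add: powr_mult[symmetric])
  ultimately have "(2 / B1) * ((D / R) powr n * u x) \<le> u x0" by (simp add: B1_def mult_ac)
  then have "2 * ((D / R) powr n * u x) \<le> B1 * u x0" using B by (simp add: field_simps)
  moreover have "(D / R) powr n = D powr n / R powr n" using D R by (simp add: powr_divide)
  ultimately have "2 * (D powr n * u x) \<le> R powr n * (B1 * u x0)" using R by (simp add: field_simps)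
  then have "\<Phi> \<le> R powr n * (B1 * u x0)" using x(2) by (simp add: D_def)
  moreover have "0 \<le> R powr n * (B2 * (U * (tau / R) powr n))" using B U by simp
  ultimately show ?thesis by (simp add: distrib_left)
 qed
 have "(R / 16) powr n * u z \<le> d z powr n * u z"
  using z R n_pos u0 by (intro mult_right_mono powr_mono2) (auto simp: d_def)
 also have "\<dots> \<le> \<Phi>" by (rule Phi[OF zb])
 also have "\<dots> \<le> R powr n * ((B1 + B2) * (u x0 + U * (tau / R) powr n))"
 proof (rule order_trans[OF main mult_left_mono])
  show "B1 * u x0 + B2 * (U * (tau / R) powr n) \<le> (B1 + B2) * (u x0 + U * (tau / R) powr n)"
   using B u0[of x0] U by (simp add: algebra_simps)
 qed simp
 finally have "u z \<le> 16 powr n * ((B1 + B2) * (u x0 + U * (tau / R) powr n))" (is "?l \<le> ?r * ?q")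
 proof -
  assume "(R / 16) powr n * u z \<le> R powr n * ?q"
  then have "R powr n * u z \<le> R powr n * (?r * ?q)" using R by (simp only: powr_divide) (simp add: field_simps del: distrib_left distrib_right)
  then show ?thesis using R by simp
 qed
 then show False using neg by (simp add: hk mult.assoc)
qed

text \<open>In the local second-difference estimate, Harnack's inequality takes care of the supremum
  and the weak one of the tail: both are multiples of the value at the centre, up to the truncation
  error.\<close>

theorem second_difference_tau:
 assumes g: "good x0 R" and t: "tau \<le> tau0 * (R / 96)" and u: "bbd U u" and u0: "!!x. 0 \<le> u x"
  and Lu: "!!x. x \<in> ball x0 R ==> Lop u x = 0" and h: "tau \<le> norm h" and x: "norm (x - x0) + 2 * norm h \<le> R / 192"
 shows "\<bar>u (x + 2 *\<^sub>R h) - 2 * u (x + h) + u x\<bar> \<le> dk * (u x0 + U * (tau / R) powr n) * (norm h / R) powr (\<gamma> + \<sigma>)"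
proof -
 note [measurable] = bbd_measurable[OF u]
 have R: "0 < R" using g by (simp add: good_def)
 have U: "0 \<le> U" using bbd_nonneg[OF u] .
 define \<rho> where "\<rho> = R / 96"
 have r: "0 < \<rho>" using R by (simp add: \<rho>_def)
 have gr: "good x0 \<rho>" by (rule good_sub[OF g]) (use R t in \<open>auto simp: \<rho>_def\<close>)
 have hk0: "0 \<le> hk" using wc_pos Th tau0 n_pos by (simp add: harnack_constant_def Let_def)
 define S where "S = u x0 + U * (tau / R) powr n"
 have S: "u x0 \<le> S" "0 \<le> S" using u0[of x0] U by (auto simp: S_def)
 define M where "M = (hk + 1 / wc) * S"
 have "\<bar>u (x + 2 *\<^sub>R h) - 2 * u (x + h) + u x\<bar> \<le> sc * M * (norm h / \<rho>) powr (\<gamma> + \<sigma>)"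
 proof (rule scaled_estimates(2)[OF gr u _ _ _ _ _ h, where ?g0.0="\<lambda>_. 0"])
  have t16: "tau \<le> tau0 * (R / 16)"
  proof -
   have "tau0 * (R / 96) \<le> tau0 * (R / 16)" using R tau0 by (intro mult_left_mono) auto
   then show ?thesis using t by linarith
  qed
  show "\<bar>u y\<bar> \<le> M" if y: "y \<in> ball x0 (6 * \<rho>)" for y
  proof -
   have "u y \<le> hk * S" unfolding S_def by (rule harnack_tau[OF g t16 u u0 Lu]) (use y in \<open>auto simp: \<rho>_def\<close>)
   also have "\<dots> \<le> M" using wc_pos S by (simp add: M_def distrib_right)
   finally show ?thesis using u0[of y] by simp
  qed
  let ?f = "\<lambda>a y. if a * \<rho> \<le> norm (y - x0) then u y * rpow n s (y - x0) else 0"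
  have fi: "integrable lborel (?f b)" if b: "0 < b" for b
  proof -
   have "integrable lborel (\<lambda>z. ?f b (x0 + z))"
   proof (rule far_integral_bound(1)[where R="b * \<rho>" and A=U and e="2 * s"])
    fix z :: 'a
    have e: "- (2 * s) - real DIM('a) = - n - 2 * s" by simp
    show "\<bar>?f b (x0 + z)\<bar> \<le> (if b * \<rho> \<le> norm z then U * norm z powr (- (2 * s) - real DIM('a)) else 0)"
     unfolding e using bbd_le[OF u, of "x0 + z"] by (auto simp: abs_mult intro!: mult_right_mono)
   qed (use s r U b in auto)
   then show ?thesis using shift_integral(2)[of "?f b" x0] by simp
  qed
  have "(LBINT y. (if 6 * \<rho> \<le> norm (y - x0) then \<bar>u y\<bar> * rpow n s (y - x0) else 0)) = (LBINT y. ?f 6 y)"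
   using u0 by (intro bochner_cong) auto
  also have "\<dots> \<le> (LBINT y. ?f (3/2) y)" using r u0 by (intro integral_mono fi) auto
  finally have "wc * (\<rho> powr (2 * s) * (LBINT y. (if 6 * \<rho> \<le> norm (y - x0) then \<bar>u y\<bar> * rpow n s (y - x0) else 0)))
    \<le> wc * (\<rho> powr (2 * s) * (LBINT y. ?f (3/2) y))"
   using wc_pos by (intro mult_left_mono) auto
  also have "\<dots> \<le> u x0" by (rule scaled_weak_harnack[OF gr u u0]) (use Lu R in \<open>auto simp: \<rho>_def\<close>)
  finally have "\<rho> powr (2 * s) * (LBINT y. (if 6 * \<rho> \<le> norm (y - x0) then \<bar>u y\<bar> * rpow n s (y - x0) else 0)) \<le> 1 / wc * u x0"
   using wc_pos by (simp add: field_simps)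
  also have "\<dots> \<le> 1 / wc * S" using wc_pos S by (intro mult_left_mono) auto
  also have "\<dots> \<le> M" using hk0 S by (simp add: M_def distrib_right)
  finally show "\<rho> powr (2 * s) * (LBINT y. (if 6 * \<rho> \<le> norm (y - x0) then \<bar>u y\<bar> * rpow n s (y - x0) else 0)) \<le> M" .
  show "Lop u y = 0" if "y \<in> ball x0 (5 * \<rho>)" for y using that R by (intro Lu) (auto simp: \<rho>_def)
  show "\<rho> powr (2 * s) * \<bar>0\<bar> \<le> M" using hk0 wc_pos S by (simp add: M_def)
  show "norm (x - x0) + 2 * norm h \<le> \<rho> / 2" using x by (simp add: \<rho>_def)
 qed simp
 also have "(norm h / \<rho>) powr (\<gamma> + \<sigma>) = 96 powr (\<gamma> + \<sigma>) * (norm h / R) powr (\<gamma> + \<sigma>)"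
  using R by (simp add: \<rho>_def powr_mult[symmetric] mult.commute)
 finally show ?thesis by (simp add: difference_constant_def M_def S_def mult_ac)
qed

end

section \<open>The Dirichlet problem for truncated kernels, energy and compactness\<close>

context jump_kernel begin

text \<open>Solving the equation for \<open>u x\<close> gives a fixpoint problem for the jumps
  within \<open>S\<close>, normalized by the total rate \<open>\<kappa>\<close>. From a point of
  \<open>S\<close> the jumps in \<open>F\<close> always leave \<open>S\<close>, which keeps the
  normalized mass below 1.\<close>

theorem dirichlet:
 assumes S: "S \<in> sets borel" "S \<subseteq> ball 0 R" and R: "0 < R" "tau \<le> R"
  and \<psi>: "bbd B \<psi>" "!!x. 0 \<le> \<psi> x"
 shows "\<exists>u. bbd (B / (2 * far_rate n s lam R)) u \<and> (\<forall>x. 0 \<le> u x) \<and> (\<forall>x. x \<notin> S --> u x = 0) \<and> (\<forall>x\<in>S. Lop u x = \<psi> x)"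
proof -
 define \<eta> where "\<eta> = far_rate n s lam R"
 obtain F where F: "F \<in> sets borel" "0 < \<eta>" "!!z. z \<in> F ==> 3 * R < norm z"
  "!!x. \<eta> \<le> (LBINT z. indicator F z * K x (x + z))"
  using far_mass[OF R] unfolding \<eta>_def by auto
 note [measurable] = S(1) F(1) bbd_measurable[OF \<psi>(1)]
 define \<kappa> where "\<kappa> = (\<lambda>x. LBINT z. K x (x + z))"
 have Ki: "integrable lborel (\<lambda>z. K x (x + z))" for x using K_integrable(1)[of "\<lambda>_. 1" 1 x] by simp
 have Fi: "integrable lborel (\<lambda>z. indicator F z * K x (x + z))" for x
  by (rule K_integrable(1)[where B=1]) (auto split: split_indicator)
 have km [measurable]: "\<kappa> \<in> Borel" unfolding \<kappa>_def
  by (rule lborel.borel_measurable_lebesgue_integral) measurable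
 have k: "\<eta> \<le> \<kappa> x" "\<kappa> x \<le> mass" for x
 proof -
  have "(LBINT z. indicator F z * K x (x + z)) \<le> \<kappa> x" unfolding \<kappa>_def
   using K_bounds(1) by (intro integral_mono[OF Fi Ki]) (auto split: split_indicator)
  then show "\<eta> \<le> \<kappa> x" using F(4)[of x] by linarith
  show "\<kappa> x \<le> mass" using K_integrable(3)[of "\<lambda>_. 1" 1 x] by (simp add: \<kappa>_def)
 qed
 have k0: "0 < \<kappa> x" for x using k(1)[of x] F(2) by linarith
 define J where "J = (\<lambda>x y. indicator S x * indicator S y * K x y / \<kappa> x)"
 define h where "h = (\<lambda>x. indicator S x * \<psi> x / (2 * \<kappa> x))"
 have off: "x + z \<notin> S" if "x \<in> S" "z \<in> F" for x z
 proof
  assume "x + z \<in> S"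
  then have "norm (x + z) < R" "norm x < R" using S(2) that by auto
  then show False using F(3)[OF that(2)] norm_triangle_ineq4[of "x + z" x] R by simp
 qed
 have "\<exists>b. bbd (B / (2 * \<eta>) / (1 - (1 - \<eta> / mass))) b \<and> (\<forall>x. b x = h x + (LBINT z. J x (x + z) * b (x + z)))"
 proof (rule bounded_fixpoint)
  show "case_prod J \<in> borel_measurable borel2" unfolding J_def split_beta' by measurable
  show "0 \<le> J x y" for x y using K_bounds(1)[of x y] k0[of x] by (simp add: J_def)
  show i: "integrable lborel (\<lambda>z. J x (x + z))" for x
  proof -
   have "integrable lborel (\<lambda>z. (indicator S x * indicator S (x + z) / \<kappa> x) * K x (x + z))"
    by (rule K_integrable(1)[where B="1 / \<kappa> x"]) (use k0[of x] in \<open>auto split: split_indicator\<close>)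
   then show ?thesis by (simp add: J_def)
  qed
  show "(LBINT z. J x (x + z)) \<le> 1 - \<eta> / mass" for x
  proof (cases "x \<in> S")
   case True
   have "(LBINT z. J x (x + z)) \<le> (LBINT z. (K x (x + z) - indicator F z * K x (x + z)) / \<kappa> x)"
   proof (rule integral_mono[OF i])
    show "integrable lborel (\<lambda>z. (K x (x + z) - indicator F z * K x (x + z)) / \<kappa> x)" using Ki Fi by simp
    show "J x (x + z) \<le> (K x (x + z) - indicator F z * K x (x + z)) / \<kappa> x" for z
     using K_bounds(1)[of x "x + z"] k0[of x] off[OF True, of z] True
     by (auto simp: J_def divide_right_mono split: split_indicator)
   qed
   also have "\<dots> = (\<kappa> x - (LBINT z. indicator F z * K x (x + z))) / \<kappa> x" using Ki Fi by (simp add: \<kappa>_def)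
   also have "\<dots> \<le> (\<kappa> x - \<eta>) / \<kappa> x" using F(4)[of x] k0[of x] by (intro divide_right_mono) auto
   also have "\<dots> = 1 - \<eta> / \<kappa> x" using k0[of x] by (simp add: field_simps)
   also have "\<dots> \<le> 1 - \<eta> / mass" using k[of x] k0[of x] F(2) by (simp add: frac_le)
   finally show ?thesis .
  next
   case False
   have "\<eta> / mass \<le> 1" using k[of x] mass_pos by simp
   then show ?thesis using False by (simp add: J_def)
  qed
  show "0 \<le> 1 - \<eta> / mass" "1 - \<eta> / mass < 1" using k[of 0] mass_pos F(2) by auto
  show "bbd (B / (2 * \<eta>)) h"
  proof (rule bbdI)
   show "h \<in> Borel" unfolding h_def by measurable
   show "\<bar>h x\<bar> \<le> B / (2 * \<eta>)" for x
    using bbd_le[OF \<psi>(1), of x] bbd_nonneg[OF \<psi>(1)] k[of x] k0[of x] F(2)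
    by (auto simp: h_def abs_mult intro!: frac_le split: split_indicator)
  qed
 qed
 then obtain b Z where b: "bbd Z b" and beq: "!!x. b x = h x + (LBINT z. J x (x + z) * b (x + z))" by blast
 note [measurable] = bbd_measurable[OF b]
 have b_off: "b x = 0" if "x \<notin> S" for x using beq[of x] that by (simp add: h_def J_def)
 have Lb: "Lop b x = \<psi> x" if x: "x \<in> S" for x
 proof -
  have Kb: "integrable lborel (\<lambda>z. K x (x + z) * b (x + z))" by (rule bbd_integrable(1)[OF Ki b])
  have "J x (x + z) * b (x + z) = (K x (x + z) * b (x + z)) / \<kappa> x" for z
   using x b_off[of "x + z"] by (auto simp: J_def split: split_indicator)
  then have "b x = (\<psi> x / 2 + (LBINT z. K x (x + z) * b (x + z))) / \<kappa> x"
   using beq[of x] x by (simp add: h_def add_divide_distrib)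
  then have e: "b x * \<kappa> x = \<psi> x / 2 + (LBINT z. K x (x + z) * b (x + z))" using k0[of x] by (simp add: field_simps)
  have "(LBINT z. (b x - b (x + z)) * K x (x + z)) = (LBINT z. b x * K x (x + z) - K x (x + z) * b (x + z))"
   by (intro bochner_cong) (simp_all add: algebra_simps)
  also have "\<dots> = b x * \<kappa> x - (LBINT z. K x (x + z) * b (x + z))"
   using Ki[of x] Kb by (simp add: \<kappa>_def)
  finally show ?thesis unfolding Lop_def using e by simp
 qed
 have b0: "0 \<le> b x" for x
  by (rule max_principle[OF b S(2)]) (use Lb \<psi>(2) b_off in auto)
 \<comment> \<open>The bound from the fixpoint depends on \<open>tau\<close> through the mass. One
   that does not follows from comparison with \<open>c\<close> times the indicator of
   \<open>ball 0 R\<close>, whose image under the operator is at least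
   \<open>c * (2 * \<eta>) = B\<close> on \<open>S\<close>.\<close>
 define c where "c = B / (2 * \<eta>)"
 have c0: "0 \<le> c" using bbd_nonneg[OF \<psi>(1)] F(2) by (simp add: c_def)
 define w where "w = (indicator (ball 0 R) :: 'a => real)"
 have w: "bbd 1 w" unfolding w_def by (rule bbdI, rule borel_measurable_indicator) (auto split: split_indicator)
 have up: "0 \<le> c * w x - b x" for x
 proof (rule max_principle[OF bbd_diff[OF bbd_scale[OF w] b] S(2)])
  show "0 \<le> Lop (\<lambda>x. c * w x - b x) x" if x: "x \<in> S" for x
  proof -
   have "\<eta> \<le> (LBINT z. indicator F z * K x (x + z))" by (rule F(4))
   also have "\<dots> \<le> (LBINT z. (w x - w (x + z)) * K x (x + z))"
   proof (rule integral_mono[OF Fi Lop_integrable[OF w]])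
    fix z
    have "indicator F z \<le> w x - w (x + z)"
    proof (cases "z \<in> F")
     case True
     have "norm x < R" using x S(2) by auto
     then have "R \<le> norm (x + z)" using F(3)[OF True] norm_triangle_ineq4[of "x + z" x] R(1) by simp
     then show ?thesis using \<open>norm x < R\<close> by (auto simp: w_def split: split_indicator)
    qed (use x S(2) in \<open>auto simp: w_def split: split_indicator\<close>)
    then show "indicator F z * K x (x + z) \<le> (w x - w (x + z)) * K x (x + z)" using K_bounds(1) by (intro mult_right_mono)
   qed
   finally have "c * (2 * \<eta>) \<le> c * Lop w x" using c0 unfolding Lop_def by (intro mult_left_mono) auto
   moreover have "c * (2 * \<eta>) = B" using F(2) by (simp add: c_def)
   ultimately show ?thesis
    using Lop_diff[OF bbd_scale[OF w, of c] b, of x] Lb[OF x] bbd_le[OF \<psi>(1), of x] unfolding Lop_scale by simp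
  qed
  show "0 \<le> c * w x - b x" if "x \<notin> S" for x using b_off[OF that] c0 by (simp add: w_def)
 qed
 have "b x \<le> c" for x using up[of x] c0 by (auto simp: w_def split: split_indicator_asm)
 then have "bbd c b" using b0 by (intro bbdI) auto
 then show ?thesis using b0 b_off Lb unfolding c_def \<eta>_def by blast
qed

text \<open>Off the truncated diagonal the kernel is integrable in each variable, so the product may
  be split and the variables exchanged by symmetry. As \<open>v\<close> is merely integrable, the
  identity is available for all later test functions.\<close>

lemma energy_identity:
 assumes u: "bbd U u" and v: "integrable lborel v"
 shows "integrable lborel2 (\<lambda>(x, y). (u x - u y) * (v x - v y) * K x y)"
  and "(\<integral>(x, y). (u x - u y) * (v x - v y) * K x y \<partial>lborel2) = (LBINT x. Lop u x * v x)"
proof -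
 note [measurable] = bbd_measurable[OF u] borel_measurable_integrable[OF v]
 let ?f = "\<lambda>(x, y). (u x - u y) * v x * K x y"
 have sh: "integrable lborel (\<lambda>y. (u x - u y) * v x * K x y)" "(LBINT y. \<bar>(u x - u y) * v x * K x y\<bar>) \<le> 2 * U * mass * \<bar>v x\<bar>"
  "(LBINT y. (u x - u y) * v x * K x y) = Lop u x * v x / 2" for x
 proof -
  have b: "\<bar>(u x - u (x + z)) * v x\<bar> \<le> 2 * U * \<bar>v x\<bar>" for z
   unfolding abs_mult using bbd_le[OF u, of x] bbd_le[OF u, of "x + z"] by (intro mult_right_mono) linarith+
  have m: "(\<lambda>z. (u x - u (x + z)) * v x) \<in> Borel" by measurable
  note * = K_integrable[OF m b, of x]
  have m1: "(\<lambda>y. (u x - u y) * v x * K x y) \<in> Borel" "(\<lambda>y. \<bar>(u x - u y) * v x * K x y\<bar>) \<in> Borel" by measurable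
  show "integrable lborel (\<lambda>y. (u x - u y) * v x * K x y)" using *(1) shift_integral(2)[OF m1(1), of x] by simp
  show "(LBINT y. \<bar>(u x - u y) * v x * K x y\<bar>) \<le> 2 * U * mass * \<bar>v x\<bar>"
   using *(2) shift_integral(1)[OF m1(2), of x] by (simp add: mult_ac)
  have "(LBINT y. (u x - u y) * v x * K x y) = (LBINT z. (u x - u (x + z)) * v x * K x (x + z))"
   using shift_integral(1)[OF m1(1), of x] by simp
  also have "\<dots> = (LBINT z. v x * ((u x - u (x + z)) * K x (x + z)))" by (simp add: mult_ac)
  also have "\<dots> = Lop u x * v x / 2" by (simp add: Lop_def)
  finally show "(LBINT y. (u x - u y) * v x * K x y) = Lop u x * v x / 2" .
 qed
 have fi: "integrable lborel2 ?f"
 proof (rule lborel_pair.Fubini_integrable)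
  show "?f \<in> borel_measurable lborel2" by measurable
  show "integrable lborel (\<lambda>x. LBINT y. norm (case (x, y) of (x, y) => (u x - u y) * v x * K x y))"
  proof (rule bochner_bound[OF integrable_mult_right[OF integrable_abs[OF v], of "2 * U * mass"]])
   show "(\<lambda>x. LBINT y. norm (case (x, y) of (x, y) => (u x - u y) * v x * K x y)) \<in> borel_measurable lborel"
    unfolding prod.case by (rule lborel.borel_measurable_lebesgue_integral) measurable
   show "AE x in lborel. norm (LBINT y. norm (case (x, y) of (x, y) => (u x - u y) * v x * K x y)) \<le> norm (2 * U * mass * \<bar>v x\<bar>)"
   proof (rule AE_I2)
    fix x
    have "0 \<le> (LBINT y. \<bar>(u x - u y) * v x * K x y\<bar>)" by (intro integral_nonneg_AE AE_I2) simp
    then show "norm (LBINT y. norm (case (x, y) of (x, y) => (u x - u y) * v x * K x y)) \<le> norm (2 * U * mass * \<bar>v x\<bar>)"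
     using sh(2)[of x] by simp
   qed
  qed
 qed (use sh in auto)
 have fs: "integrable lborel2 (\<lambda>(x, y). ?f (y, x))" "(\<integral>(x, y). ?f (y, x) \<partial>lborel2) = integral\<^sup>L lborel2 ?f"
  using lborel_pair.integrable_product_swap[OF fi] lborel_pair.integral_product_swap[OF borel_measurable_integrable[OF fi]] by auto
 have e: "(\<lambda>(x, y). (u x - u y) * (v x - v y) * K x y) = (\<lambda>p. ?f p + (case p of (x, y) => ?f (y, x)))"
  using K_sym by (auto simp: fun_eq_iff algebra_simps)
 show "integrable lborel2 (\<lambda>(x, y). (u x - u y) * (v x - v y) * K x y)"
  unfolding e by (intro bochner_integrable_add fi fs)
 have "(\<integral>(x, y). (u x - u y) * (v x - v y) * K x y \<partial>lborel2) = 2 * integral\<^sup>L lborel2 ?f"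
  unfolding e using fi fs by simp
 also have "integral\<^sup>L lborel2 ?f = (LBINT x. LBINT y. (u x - u y) * v x * K x y)"
  using lborel_pair.integral_fst'[OF fi] by simp
 also have "\<dots> = (LBINT x. Lop u x * v x) / 2" unfolding sh(3) by simp
 finally show "(\<integral>(x, y). (u x - u y) * (v x - v y) * K x y \<partial>lborel2) = (LBINT x. Lop u x * v x)" by simp
qed

end

lemma integrable_square_diff:
 fixes f g :: "'a => real"
 assumes [measurable]: "f \<in> borel_measurable M" "g \<in> borel_measurable M"
  and i: "integrable M (\<lambda>x. (f x)\<^sup>2)" "integrable M (\<lambda>x. (g x)\<^sup>2)"
 shows "integrable M (\<lambda>x. (f x - g x)\<^sup>2)" "integrable M (\<lambda>x. f x * g x)"
  "(\<integral>x. (f x - g x)\<^sup>2 \<partial>M) \<le> 2 * (\<integral>x. (f x)\<^sup>2 \<partial>M) + 2 * (\<integral>x. (g x)\<^sup>2 \<partial>M)"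
proof -
 have j: "integrable M (\<lambda>x. 2 * (f x)\<^sup>2 + 2 * (g x)\<^sup>2)" using i by simp
 have le: "(a - b)\<^sup>2 \<le> 2 * a\<^sup>2 + 2 * b\<^sup>2" "\<bar>a * b\<bar> \<le> 2 * a\<^sup>2 + 2 * b\<^sup>2" for a b :: real
 proof -
  have "0 \<le> (a + b)\<^sup>2" "0 \<le> (\<bar>a\<bar> - \<bar>b\<bar>)\<^sup>2" "0 \<le> a\<^sup>2" "0 \<le> b\<^sup>2" by simp_all
  moreover have "(a + b)\<^sup>2 + (a - b)\<^sup>2 = 2 * a\<^sup>2 + 2 * b\<^sup>2" "(\<bar>a\<bar> - \<bar>b\<bar>)\<^sup>2 = a\<^sup>2 + b\<^sup>2 - 2 * \<bar>a * b\<bar>"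
   by (auto simp: power2_eq_square abs_mult algebra_simps)
  ultimately show "(a - b)\<^sup>2 \<le> 2 * a\<^sup>2 + 2 * b\<^sup>2" "\<bar>a * b\<bar> \<le> 2 * a\<^sup>2 + 2 * b\<^sup>2" by linarith+
 qed
 show d: "integrable M (\<lambda>x. (f x - g x)\<^sup>2)"
  by (rule bochner_bound[OF j]) (auto intro!: AE_I2 order_trans[OF le(1)])
 show "integrable M (\<lambda>x. f x * g x)"
  by (rule bochner_bound[OF j]) (auto intro!: AE_I2 order_trans[OF le(2)])
 have "(\<integral>x. (f x - g x)\<^sup>2 \<partial>M) \<le> (\<integral>x. 2 * (f x)\<^sup>2 + 2 * (g x)\<^sup>2 \<partial>M)" by (rule integral_mono[OF d j le(1)])
 then show "(\<integral>x. (f x - g x)\<^sup>2 \<partial>M) \<le> 2 * (\<integral>x. (f x)\<^sup>2 \<partial>M) + 2 * (\<integral>x. (g x)\<^sup>2 \<partial>M)" using i by simp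
qed

text \<open>A bounded sequence in \<open>L\<^sup>2\<close> which converges pointwise converges weakly: with \<open>D = F j - L\<close>,
 \<open>\<bar>D g\<bar> \<le> \<delta> D\<^sup>2 + min \<bar>D g\<bar> (g\<^sup>2 / (4 \<delta>))\<close>, and the last term is dominated.\<close>

lemma pointwise_L2_limit:
 fixes F :: "nat => 'a => real"
 assumes [measurable]: "!!j. F j \<in> borel_measurable M" "L \<in> borel_measurable M" "g \<in> borel_measurable M"
  and i: "!!j. integrable M (\<lambda>x. (F j x)\<^sup>2)" and C: "!!j. (\<integral>x. (F j x)\<^sup>2 \<partial>M) \<le> C"
  and lim: "!!x. (\<lambda>j. F j x) \<longlonglongrightarrow> L x" and g: "integrable M (\<lambda>x. (g x)\<^sup>2)"
 shows "integrable M (\<lambda>x. (L x)\<^sup>2)" "(\<lambda>j. \<integral>x. F j x * g x \<partial>M) \<longlonglongrightarrow> (\<integral>x. L x * g x \<partial>M)"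
proof -
 have "(\<integral>\<^sup>+x. ennreal ((L x)\<^sup>2) \<partial>M) = (\<integral>\<^sup>+x. liminf (\<lambda>j. ennreal ((F j x)\<^sup>2)) \<partial>M)"
 proof (rule nn_integral_cong)
  fix x
  have "(\<lambda>j. ennreal ((F j x)\<^sup>2)) \<longlonglongrightarrow> ennreal ((L x)\<^sup>2)" by (rule tendsto_ennrealI) (intro tendsto_intros lim)
  then show "ennreal ((L x)\<^sup>2) = liminf (\<lambda>j. ennreal ((F j x)\<^sup>2))"
   by (rule lim_imp_Liminf[OF trivial_limit_sequentially, symmetric])
 qed
 also have "\<dots> \<le> liminf (\<lambda>j. \<integral>\<^sup>+x. ennreal ((F j x)\<^sup>2) \<partial>M)" by (rule nn_integral_liminf) measurable
 also have "\<dots> \<le> liminf (\<lambda>j::nat. ennreal C)"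
  using C i by (intro Liminf_mono always_eventually allI) (auto simp: nn_integral_eq_integral intro!: ennreal_leI)
 also have "\<dots> = ennreal C" by (simp add: Liminf_const)
 finally have "(\<integral>\<^sup>+x. ennreal ((L x)\<^sup>2) \<partial>M) \<le> ennreal C" .
 then show L2: "integrable M (\<lambda>x. (L x)\<^sup>2)" by (intro integrableI_nonneg) (auto intro: le_less_trans)
 define D where "D = (\<lambda>j x. F j x - L x)"
 have [measurable]: "D j \<in> borel_measurable M" for j unfolding D_def by measurable
 have D2: "integrable M (\<lambda>x. (D j x)\<^sup>2)" "(\<integral>x. (D j x)\<^sup>2 \<partial>M) \<le> 2 * C + 2 * (\<integral>x. (L x)\<^sup>2 \<partial>M)" for j
  using integrable_square_diff(1,3)[OF assms(1,2) i L2, of j] C[of j] by (auto simp: D_def)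
 have Dg: "integrable M (\<lambda>x. D j x * g x)" for j using integrable_square_diff(2)[OF _ _ D2(1) g] by simp
 define Q where "Q = 2 * C + 2 * (\<integral>x. (L x)\<^sup>2 \<partial>M)"
 have "0 \<le> (\<integral>x. (D 0 x)\<^sup>2 \<partial>M)" by (rule integral_nonneg_AE) auto
 then have Q0: "0 \<le> Q" using D2(2)[of 0] unfolding Q_def by linarith
 have "(\<lambda>j. \<integral>x. D j x * g x \<partial>M) \<longlonglongrightarrow> 0"
 proof (rule LIMSEQ_I)
  fix r :: real assume r: "0 < r"
  define \<delta> where "\<delta> = r / (2 * (Q + 1))"
  have \<delta>: "0 < \<delta>" "\<delta> * Q < r / 2" using r Q0 by (auto simp: \<delta>_def field_simps)
  define m where "m = (\<lambda>j x. min \<bar>D j x * g x\<bar> ((g x)\<^sup>2 / (4 * \<delta>)))"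
  have [measurable]: "m j \<in> borel_measurable M" for j unfolding m_def by measurable
  have gi: "integrable M (\<lambda>x. (g x)\<^sup>2 / (4 * \<delta>))" using g by simp
  have mle: "norm (m j x) \<le> (g x)\<^sup>2 / (4 * \<delta>)" for j x using \<delta> by (auto simp: m_def)
  have mi: "integrable M (m j)" for j
  proof (rule bochner_bound[OF gi])
   show "AE x in M. norm (m j x) \<le> norm ((g x)\<^sup>2 / (4 * \<delta>))"
    unfolding real_norm_def[of "(g _)\<^sup>2 / _"] by (intro AE_I2 order_trans[OF mle abs_ge_self])
  qed measurable
  have "(\<lambda>j. \<integral>x. m j x \<partial>M) \<longlonglongrightarrow> (\<integral>x. 0 \<partial>M)"
  proof (rule integral_dominated_convergence[OF _ _ gi])
   show "AE x in M. (\<lambda>j. m j x) \<longlonglongrightarrow> 0"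
   proof (rule AE_I2)
    fix x
    have "(\<lambda>j. min \<bar>(F j x - L x) * g x\<bar> ((g x)\<^sup>2 / (4 * \<delta>))) \<longlonglongrightarrow> min \<bar>(L x - L x) * g x\<bar> ((g x)\<^sup>2 / (4 * \<delta>))"
     using lim[of x] by (intro tendsto_intros)
    then show "(\<lambda>j. m j x) \<longlonglongrightarrow> 0" using \<delta> by (simp add: m_def D_def)
   qed
  qed (use mle in auto)
  then have "(\<lambda>j. \<integral>x. m j x \<partial>M) \<longlonglongrightarrow> 0" by simp
  then obtain N where N: "!!j. j \<ge> N ==> norm ((\<integral>x. m j x \<partial>M) - 0) < r / 2" using LIMSEQ_D[of _ 0 "r / 2"] r by (metis half_gt_zero)
  have "norm ((\<integral>x. D j x * g x \<partial>M) - 0) < r" if "j \<ge> N" for j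
  proof -
   have pt: "\<bar>D j x * g x\<bar> \<le> \<delta> * (D j x)\<^sup>2 + m j x" for x
   proof (cases "\<bar>D j x * g x\<bar> \<le> (g x)\<^sup>2 / (4 * \<delta>)")
    case False
    have "0 \<le> (2 * \<delta> * \<bar>D j x\<bar> - \<bar>g x\<bar>)\<^sup>2" by simp
    then have "4 * \<delta> * \<bar>D j x * g x\<bar> \<le> 4 * \<delta> * (\<delta> * (D j x)\<^sup>2) + (g x)\<^sup>2"
     by (simp add: power2_eq_square abs_mult algebra_simps)
    then have "\<bar>D j x * g x\<bar> \<le> \<delta> * (D j x)\<^sup>2 + (g x)\<^sup>2 / (4 * \<delta>)" using \<delta> by (simp add: field_simps)
    then show ?thesis using False by (simp add: m_def)
   qed (use \<delta> in \<open>simp add: m_def\<close>)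
   have "\<bar>\<integral>x. D j x * g x \<partial>M\<bar> \<le> (\<integral>x. \<bar>D j x * g x\<bar> \<partial>M)" by (rule integral_abs_bound)
   also have "\<dots> \<le> (\<integral>x. \<delta> * (D j x)\<^sup>2 + m j x \<partial>M)" using Dg D2(1) mi pt by (intro integral_mono) auto
   also have "\<dots> = \<delta> * (\<integral>x. (D j x)\<^sup>2 \<partial>M) + (\<integral>x. m j x \<partial>M)" using D2(1) mi by simp
   also have "\<dots> \<le> \<delta> * Q + (\<integral>x. m j x \<partial>M)" using D2(2)[of j] \<delta> by (simp add: Q_def)
   also have "\<dots> < r" using \<delta> N[OF that] by simp
   finally show ?thesis by simp
  qed
  then show "\<exists>no. \<forall>n\<ge>no. norm ((\<integral>x. D n x * g x \<partial>M) - 0) < r" by blast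
 qed
 moreover have "(\<integral>x. F j x * g x \<partial>M) = (\<integral>x. D j x * g x \<partial>M) + (\<integral>x. L x * g x \<partial>M)" for j
 proof -
  have "integrable M (\<lambda>x. L x * g x)" using integrable_square_diff(2)[OF _ _ L2 g] by simp
  then have "(\<integral>x. D j x * g x \<partial>M) + (\<integral>x. L x * g x \<partial>M) = (\<integral>x. D j x * g x + L x * g x \<partial>M)" using Dg[of j] by simp
  then show ?thesis by (simp add: D_def left_diff_distrib)
 qed
 ultimately show "(\<lambda>j. \<integral>x. F j x * g x \<partial>M) \<longlonglongrightarrow> (\<integral>x. L x * g x \<partial>M)"
  using tendsto_add[OF _ tendsto_const[of "\<integral>x. L x * g x \<partial>M"], of "\<lambda>j. \<integral>x. D j x * g x \<partial>M" 0] by simp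
qed

lemma bounded_subsequence_countable:
 fixes f :: "nat => 'a => real"
 assumes D: "countable D" and b: "!!n x. \<bar>f n x\<bar> \<le> B"
 shows "\<exists>r. strict_mono r \<and> (\<forall>x\<in>D. convergent (\<lambda>n. f (r n) x))"
proof (cases "D = {}")
 case False
 define P where "P = (\<lambda>n r. convergent (\<lambda>j. f (r j) (from_nat_into D n)))"
 interpret subseqs P
 proof
  fix n and s :: "nat => nat" assume "strict_mono s"
  have "bounded (range (\<lambda>j. f (s j) (from_nat_into D n)))" using b by (auto intro!: boundedI[of _ B])
  then obtain l r where "strict_mono r" "((\<lambda>j. f (s j) (from_nat_into D n)) \<circ> r) \<longlonglongrightarrow> l" using bounded_imp_convergent_subsequence by blast
  then show "\<exists>r'. strict_mono r' \<and> P n (s \<circ> r')" unfolding P_def by (auto simp: o_def convergent_def)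
 qed
 have "P k (diagseq \<circ> (+) (Suc k))" for k
 proof (rule diagseq_holds)
  fix r s :: "nat => nat" and n assume "strict_mono r" "P n s"
  then show "P n (s \<circ> r)" unfolding P_def convergent_def
   using LIMSEQ_subseq_LIMSEQ[of "\<lambda>j. f (s j) (from_nat_into D n)"] by (auto simp: o_def)
 qed
 moreover define r where "r = diagseq"
 ultimately have P: "P k (r \<circ> (+) (Suc k))" for k by simp
 have "convergent (\<lambda>n. f (r n) (from_nat_into D k))" for k
  using P[of k] LIMSEQ_offset[of "\<lambda>n. f (r n) (from_nat_into D k)" "Suc k"]
  unfolding P_def convergent_def o_def by (auto simp: add.commute)
 then have "\<forall>x\<in>D. convergent (\<lambda>n. f (r n) x)" by (metis D False from_nat_into_surj)
 then show ?thesis using subseq_diagseq unfolding r_def by blast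
qed (auto intro: strict_mono_id)

section \<open>Weak solutions\<close>

locale holder_kernel = kernel_params n s lam Lam \<sigma> \<gamma> eps tau0
 for n s lam Lam \<sigma> \<gamma> eps tau0 :: real +
 fixes K :: "'a::euclidean_space => 'a => real" and \<Omega> :: "'a set" and R0 :: real
 assumes dim: "real DIM('a) = n"
  and K_measurable: "case_prod K \<in> borel_measurable borel2"
  and K_sym: "!!x y. K y x = K x y" and K_diag: "!!x. K x x = 0"
  and K_lower: "!!x y. x \<noteq> y ==> lam * rpow n s (x - y) \<le> K x y"
  and K_upper: "!!x y. x \<noteq> y ==> K x y \<le> Lam * rpow n s (x - y)"
  and \<Omega>: "open \<Omega>" "\<Omega> \<subseteq> ball 0 R0" and R0: "0 < R0"
  and K_holder: "!!x y h. x \<in> \<Omega> ==> y \<in> \<Omega> ==> x + h \<in> \<Omega> ==> y + h \<in> \<Omega> ==> norm h < 1 ==> x \<noteq> y ==>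
    \<bar>K (x + h) (y + h) - K x y\<bar> \<le> Lam * norm h powr \<sigma> * rpow n s (x - y)"
begin

definition trunc :: "real => 'a => 'a => real" where
 "trunc \<tau> x y = (if \<tau> < norm (x - y) then K x y else 0)"

lemma K_nonneg: "0 \<le> K x y"
proof (cases "x = y")
 case False
 have "0 \<le> lam * rpow n s (x - y)" using params by simp
 then show ?thesis using K_lower[OF False] by linarith
qed (simp add: K_diag)

lemma K_m [measurable (raw)]: "f \<in> M \<rightarrow>\<^sub>M borel ==> g \<in> M \<rightarrow>\<^sub>M borel ==> (\<lambda>x. K (f x) (g x)) \<in> borel_measurable M"
 by (rule measurable_case_prod_compose[OF K_measurable])

lemma local: assumes "0 < \<tau>" shows "local_kernel n s lam Lam \<sigma> \<gamma> eps tau0 \<tau> (trunc \<tau>)"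
proof
 show "case_prod (trunc \<tau>) \<in> borel_measurable borel2" unfolding trunc_def split_beta' by measurable
 show "trunc \<tau> y x = trunc \<tau> x y" for x y using K_sym by (simp add: trunc_def norm_minus_commute)
 show "lam * rpow n s (x - y) \<le> trunc \<tau> x y" "trunc \<tau> x y \<le> Lam * rpow n s (x - y)"
  if "\<tau> < norm (x - y)" for x y
 proof -
  have "x \<noteq> y" using that assms by auto
  then show "lam * rpow n s (x - y) \<le> trunc \<tau> x y" "trunc \<tau> x y \<le> Lam * rpow n s (x - y)"
   using that K_lower[of x y] K_upper[of x y] by (auto simp: trunc_def)
 qed
qed (use dim params assms in \<open>auto simp: trunc_def\<close>)

text \<open>\<open>16 * R\<close> leaves room for the points of a ball of radius
  \<open>8 * R\<close> together with their translates by at most \<open>8 * R\<close>;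
  \<open>8 * R < 1\<close> meets the restriction on \<open>h\<close> in the Hoelder
  condition.\<close>

lemma good:
 assumes t: "0 < \<tau>" "\<tau> \<le> tau0 * R" and R: "0 < R" "Lam * R powr \<sigma> \<le> eps" "8 * R < 1" and b: "ball x0 (16 * R) \<subseteq> \<Omega>"
 shows "local_kernel.good n s Lam \<sigma> eps tau0 \<tau> (trunc \<tau>) x0 R"
proof -
 interpret lk: local_kernel n s lam Lam \<sigma> \<gamma> eps tau0 \<tau> "trunc \<tau>" by (rule local[OF t(1)])
 show ?thesis unfolding lk.good_def
 proof (intro conjI ballI allI impI t R)
  fix x y h :: 'a assume xy: "x \<in> ball x0 (8 * R)" "y \<in> ball x0 (8 * R)" and h: "norm h \<le> 8 * R"
  have "x + h \<in> ball x0 (16 * R)" "y + h \<in> ball x0 (16 * R)"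
   using xy h dist_triangle[of x0 "x + h" x] dist_triangle[of x0 "y + h" y] by (auto simp: dist_norm)
  moreover have "x \<in> ball x0 (16 * R)" "y \<in> ball x0 (16 * R)" using xy R by auto
  ultimately have in_om: "x \<in> \<Omega>" "y \<in> \<Omega>" "x + h \<in> \<Omega>" "y + h \<in> \<Omega>" using b by auto
  have e: "norm (x + h - (y + h)) = norm (x - y)" by simp
  show "\<bar>trunc \<tau> (x + h) (y + h) - trunc \<tau> x y\<bar> \<le> Lam * norm h powr \<sigma> * rpow n s (x - y)"
  proof (cases "\<tau> < norm (x - y)")
   case True
   then have "x \<noteq> y" using t by auto
   moreover have "norm h < 1" using h R by linarith
   ultimately show ?thesis unfolding trunc_def e using K_holder[OF in_om] True by simp
  qed (use params in \<open>simp add: trunc_def\<close>)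
 qed
qed

definition sup_factor :: real where "sup_factor = 1 / (2 * far_rate n s lam R0)"

text \<open>Harnack's inequality and the second-difference bound are part of the predicate because
  they are inherited from the truncated problems, and not derived from the weak equation. Test
  functions are Borel and vanish at every point outside \<open>\<Omega>\<close>; the passage to
  Lebesgue measurable ones is made separately.\<close>

definition solves :: "real => ('a => real) => ('a => real) => bool" where
 "solves B \<psi> u \<longleftrightarrow> bbd (sup_factor * B) u \<and> (\<forall>x. 0 \<le> u x) \<and> (\<forall>x. x \<notin> \<Omega> --> u x = 0) \<and> continuous_on \<Omega> u
  \<and> integrable lborel2 (\<lambda>(x, y). (u x - u y)\<^sup>2 * K x y)
  \<and> (\<forall>v. integrable lborel v --> (\<forall>x. x \<notin> \<Omega> --> v x = 0) --> integrable lborel2 (\<lambda>(x, y). (v x - v y)\<^sup>2 * K x y) -->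
    v \<in> Borel -->
    (\<integral>(x, y). (u x - u y) * (v x - v y) * K x y \<partial>lborel2) = (LBINT x. \<psi> x * v x))
  \<and> (\<forall>x0 R. 0 < R --> Lam * R powr \<sigma> \<le> eps --> 8 * R < 1 --> ball x0 (16 * R) \<subseteq> \<Omega> --> (\<forall>x\<in>ball x0 R. \<psi> x = 0) -->
    (\<forall>z. dist x0 z < R / 16 --> u z \<le> hk * u x0)
   \<and> (\<forall>x h. norm (x - x0) + 2 * norm h \<le> R / 192 -->
      \<bar>u (x + 2 *\<^sub>R h) - 2 * u (x + h) + u x\<bar> \<le> dk * u x0 * (norm h / R) powr (\<gamma> + \<sigma>)))"

theorem solution:
 assumes \<psi>: "bbd B \<psi>" "!!x. 0 \<le> \<psi> x"
 shows "\<exists>u. solves B \<psi> u"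
proof -
 \<comment> \<open>The truncation lengths start at \<open>R0\<close>, since the uniform bound for
   the Dirichlet problem requires \<open>tau \<le> R0\<close>.\<close>
 define \<tau> where "\<tau> = (\<lambda>j::nat. R0 / real (Suc j))"
 have t: "0 < \<tau> j" "\<tau> j \<le> R0" for j using R0 by (auto simp: \<tau>_def field_simps)
 have t0: "\<tau> \<longlonglongrightarrow> 0" unfolding \<tau>_def using LIMSEQ_Suc[OF lim_const_over_n[of R0]] by simp
 have lk: "local_kernel n s lam Lam \<sigma> \<gamma> eps tau0 (\<tau> j) (trunc (\<tau> j))" for j by (rule local[OF t(1)])
 have om: "\<Omega> \<in> sets borel" using \<Omega>(1) by simp
 define C0 where "C0 = sup_factor * B"
 have "\<exists>u. bbd C0 u \<and> (\<forall>x. 0 \<le> u x) \<and> (\<forall>x. x \<notin> \<Omega> --> u x = 0) \<and> (\<forall>x\<in>\<Omega>. jump_kernel.Lop (trunc (\<tau> j)) u x = \<psi> x)" for j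
 proof -
  interpret local_kernel n s lam Lam \<sigma> \<gamma> eps tau0 "\<tau> j" "trunc (\<tau> j)" by (rule lk)
  show ?thesis using dirichlet[OF om \<Omega>(2) R0 t(2) \<psi>] by (simp add: C0_def sup_factor_def)
 qed
 then obtain w where w: "!!j. bbd C0 (w j)" "!!j x. 0 \<le> w j x" "!!j x. x \<notin> \<Omega> ==> w j x = 0"
  "!!j x. x \<in> \<Omega> ==> jump_kernel.Lop (trunc (\<tau> j)) (w j) x = \<psi> x" by metis
 have C0: "0 \<le> C0" using bbd_nonneg[OF w(1)] .
 \<comment> \<open>Equicontinuity at interior points, with constants independent of
   \<open>j\<close>, but only for increments of length at least \<open>\<tau> j\<close>.\<close>
 have equi: "\<exists>C R. 0 \<le> C \<and> 0 < R \<and> (\<forall>j. \<tau> j \<le> tau0 * R --> (\<forall>h. \<tau> j \<le> norm h --> norm h \<le> R --> \<bar>w j (x + h) - w j x\<bar> \<le> C * norm h powr \<gamma>))"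
  if x: "x \<in> \<Omega>" for x
 proof -
  obtain e where e: "0 < e" "ball x e \<subseteq> \<Omega>" using \<Omega>(1) x open_contains_ball by blast
  have "\<exists>R>0. Lam * R powr \<sigma> \<le> eps \<and> 8 * R < 1 \<and> 16 * R \<le> e"
  proof -
   define R where "R = min ((eps / Lam) powr (1 / \<sigma>)) (min (1 / 9) (e / 16))"
   have L: "0 < Lam" using params by simp
   have R: "0 < R" "R \<le> (eps / Lam) powr (1 / \<sigma>)" using eps(1) L e by (auto simp: R_def)
   have "R powr \<sigma> \<le> ((eps / Lam) powr (1 / \<sigma>)) powr \<sigma>" using R sig by (intro powr_mono2) auto
   also have "\<dots> = eps / Lam" using sig eps(1) L by (simp add: powr_powr)
   finally have "Lam * R powr \<sigma> \<le> eps" using L by (simp add: field_simps)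
   then show ?thesis using R by (intro exI[of _ R]) (auto simp: R_def)
  qed
  then obtain R where R: "0 < R" "Lam * R powr \<sigma> \<le> eps" "8 * R < 1" "16 * R \<le> e" by blast
  have sub: "ball x (16 * R) \<subseteq> \<Omega>" using R(4) e(2) by (meson order_trans subset_ball)
  have sub5: "y \<in> \<Omega>" if "y \<in> ball x (5 * R)" for y
   by (rule subsetD[OF sub]) (use that R(1) in simp)
  define M where "M = C0 * (1 + radial_const n (2 * s)) + R powr (2 * s) * B"
  define HC where "HC = holder_constant n s lam Lam \<gamma> * local_constant n s Lam"
  have B: "0 \<le> B" using bbd_nonneg[OF \<psi>(1)] .
  have rc: "0 < radial_const n (2 * s)" using params by (intro radial_const_pos) auto
  have M: "C0 \<le> M" "C0 * radial_const n (2 * s) \<le> M" "R powr (2 * s) * B \<le> M" "0 \<le> M"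
   using C0 B rc by (auto simp: M_def distrib_left)
  have hol: "\<bar>w j (x + h) - w j x\<bar> \<le> HC * M * (norm h / R) powr \<gamma>"
   if tj: "\<tau> j \<le> tau0 * R" and h: "\<tau> j \<le> norm h" "norm h \<le> R" for j h
  proof -
   interpret lo: local_kernel n s lam Lam \<sigma> \<gamma> eps tau0 "\<tau> j" "trunc (\<tau> j)" by (rule lk)
   note [measurable] = bbd_measurable[OF w(1)[of j]]
   let ?f = "\<lambda>y. if 6 * R \<le> norm (y - x) then \<bar>w j y\<bar> * rpow n s (y - x) else 0"
   have "\<bar>LBINT z. ?f (x + z)\<bar> \<le> C0 * ((6 * R) powr (- (2 * s)) * radial_const (real DIM('a)) (2 * s))"
   proof (rule far_integral_bound(3))
    fix z :: 'a
    have e: "- (2 * s) - real DIM('a) = - n - 2 * s" using dim by simp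
    show "\<bar>?f (x + z)\<bar> \<le> (if 6 * R \<le> norm z then C0 * norm z powr (- (2 * s) - real DIM('a)) else 0)"
     unfolding e using bbd_le[OF w(1), of j "x + z"] by (auto simp: abs_mult intro!: mult_right_mono)
   qed (use params R C0 in auto)
   then have "(LBINT y. ?f y) \<le> C0 * ((6 * R) powr (- (2 * s)) * radial_const n (2 * s))"
    using shift_integral(1)[of ?f x] by (simp add: dim)
   then have "R powr (2 * s) * (LBINT y. ?f y) \<le> R powr (2 * s) * (C0 * ((6 * R) powr (- (2 * s)) * radial_const n (2 * s)))"
    by (intro mult_left_mono) auto
   also have "\<dots> \<le> R powr (2 * s) * (C0 * (R powr (- (2 * s)) * radial_const n (2 * s)))"
    using R C0 rc params by (intro mult_left_mono mult_right_mono powr_mono2') auto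
   also have "\<dots> = C0 * radial_const n (2 * s)" using R by (simp add: powr_minus field_simps)
   finally have tail: "R powr (2 * s) * (LBINT y. ?f y) \<le> M" using M(2) by linarith
   show ?thesis unfolding HC_def
   proof (rule lo.scaled_estimates(1)[OF good[OF t(1) tj R(1-3) sub] w(1) _ tail _ bbd_measurable[OF \<psi>(1)] _ h])
    show "\<bar>w j y\<bar> \<le> M" for y using bbd_le[OF w(1), of j y] M by linarith
    show "lo.Lop (w j) y = \<psi> y" if "y \<in> ball x (5 * R)" for y by (rule w(4)[OF sub5[OF that]])
    show "R powr (2 * s) * \<bar>\<psi> y\<bar> \<le> M" for y
     using mult_left_mono[OF bbd_le[OF \<psi>(1), of y], of "R powr (2 * s)"] M by simp
   qed
  qed
  interpret lo: local_kernel n s lam Lam \<sigma> \<gamma> eps tau0 "\<tau> 0" "trunc (\<tau> 0)" by (rule lk)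
  have "0 \<le> HC * M / R powr \<gamma>" using lo.hc_nonneg M by (simp add: HC_def)
  moreover have "\<bar>w j (x + h) - w j x\<bar> \<le> HC * M / R powr \<gamma> * norm h powr \<gamma>"
   if "\<tau> j \<le> tau0 * R" "\<tau> j \<le> norm h" "norm h \<le> R" for j h
   using hol[OF that] R(1) by (simp add: powr_divide)
  ultimately show ?thesis using R(1) by (intro exI[of _ "HC * M / R powr \<gamma>"] exI[of _ R]) blast
 qed
 have gp: "0 < \<gamma>" using gam params by simp
 have small: "\<exists>\<delta>>0. \<delta> \<le> R \<and> (\<forall>t. 0 \<le> t --> t < \<delta> --> C * t powr \<gamma> < e)" if "0 \<le> C" "0 < R" "0 < e" for C R e :: real
 proof -
  define \<delta> where "\<delta> = min R ((e / (C + 1)) powr (1 / \<gamma>))"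
  have d: "0 < \<delta>" "\<delta> \<le> R" using that by (auto simp: \<delta>_def)
  have "C * t powr \<gamma> < e" if t: "0 \<le> t" "t < \<delta>" for t
  proof -
   have "t powr \<gamma> \<le> ((e / (C + 1)) powr (1 / \<gamma>)) powr \<gamma>" using t gp by (intro powr_mono2) (auto simp: \<delta>_def)
   also have "\<dots> = e / (C + 1)" using gp \<open>0 \<le> C\<close> \<open>0 < e\<close> by (simp add: powr_powr)
   finally have "C * t powr \<gamma> \<le> C * (e / (C + 1))" using \<open>0 \<le> C\<close> by (intro mult_left_mono)
   also have "\<dots> < e" using \<open>0 \<le> C\<close> \<open>0 < e\<close> by (simp add: field_simps)
   finally show ?thesis .
  qed
  then show ?thesis using d by blast
 qed
 obtain D :: "'a set" where D: "countable D" "!!X. open X ==> X \<noteq> {} ==> \<exists>d\<in>D. d \<in> X" by (rule countable_dense_setE) blast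
 obtain r where r: "strict_mono r" "!!x. x \<in> D ==> convergent (\<lambda>j. w (r j) x)"
  using bounded_subsequence_countable[OF D(1), of w C0] bbd_le[OF w(1)] by blast
 have tr: "(\<lambda>j. \<tau> (r j)) \<longlonglongrightarrow> 0" using LIMSEQ_subseq_LIMSEQ[OF t0 r(1)] by (simp add: o_def)
 have ev: "\<forall>\<^sub>F j in sequentially. \<tau> (r j) < c" if "0 < c" for c using order_tendstoD(2)[OF tr that] .
 have conv: "convergent (\<lambda>j. w (r j) x)" for x
 proof (cases "x \<in> \<Omega>")
  case False
  then show ?thesis using w(3) by (simp add: convergent_const)
 next
  case True
  from equi[OF this] obtain C R where CR: "0 \<le> C" "0 < R"
   "!!j h. \<tau> j \<le> tau0 * R ==> \<tau> j \<le> norm h ==> norm h \<le> R ==> \<bar>w j (x + h) - w j x\<bar> \<le> C * norm h powr \<gamma>" by blast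
  have "Cauchy (\<lambda>j. w (r j) x)"
  proof (rule CauchyI)
   fix e :: real assume e: "0 < e"
   obtain \<delta> where d: "0 < \<delta>" "\<delta> \<le> R" "!!t. 0 \<le> t ==> t < \<delta> ==> C * t powr \<gamma> < e / 3"
    using small[OF CR(1,2), of "e / 3"] e by auto
   obtain b :: 'a where b: "norm b = 1" by (meson norm_Basis nonempty_Basis ex_in_conv)
   \<comment> \<open>The point of \<open>D\<close> must differ from \<open>x\<close>: only for a
     nonzero increment is \<open>\<tau> (r j)\<close> eventually below its length.\<close>
   have "x + (\<delta> / 2) *\<^sub>R b \<in> ball x \<delta> - {x}" using d b by (auto simp: dist_norm)
   then have "ball x \<delta> - {x} \<noteq> {}" by blast
   moreover have "open (ball x \<delta> - {x})" by (rule open_delete) simp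
   ultimately obtain y where y: "y \<in> D" "y \<in> ball x \<delta> - {x}" using D(2) by blast
   define h where "h = y - x"
   have h: "0 < norm h" "norm h < \<delta>" "x + h = y" using y by (auto simp: h_def dist_norm norm_minus_commute)
   have "Cauchy (\<lambda>j. w (r j) y)" using r(2)[OF y(1)] by (rule convergent_Cauchy)
   then obtain N1 where N1: "!!i j. i \<ge> N1 ==> j \<ge> N1 ==> norm (w (r i) y - w (r j) y) < e / 3"
    using e by (metis CauchyD divide_pos_pos zero_less_numeral)
   have "0 < min (tau0 * R) (norm h)" using tau0(1) CR(2) h(1) by simp
   from ev[OF this] obtain N2 where N2: "!!j. j \<ge> N2 ==> \<tau> (r j) < min (tau0 * R) (norm h)"
    unfolding eventually_sequentially by blast
   have cl: "\<bar>w (r j) y - w (r j) x\<bar> < e / 3" if "j \<ge> N2" for j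
    using CR(3)[of "r j" h] N2[OF that] h d(2) d(3)[of "norm h"] by auto
   have "norm (w (r i) x - w (r j) x) < e" if "i \<ge> max N1 N2" "j \<ge> max N1 N2" for i j
   proof -
    have "\<bar>w (r i) y - w (r i) x\<bar> < e / 3" "\<bar>w (r j) y - w (r j) x\<bar> < e / 3" "\<bar>w (r i) y - w (r j) y\<bar> < e / 3"
     using cl[of i] cl[of j] N1[of i j] that by auto
    then show ?thesis unfolding real_norm_def abs_less_iff by linarith
   qed
   then show "\<exists>M. \<forall>m\<ge>M. \<forall>n\<ge>M. norm (w (r m) x - w (r n) x) < e" by blast
  qed
  then show ?thesis by (simp add: Cauchy_convergent)
 qed
 define u where "u = (\<lambda>x. lim (\<lambda>j. w (r j) x))"
 have lim: "(\<lambda>j. w (r j) x) \<longlonglongrightarrow> u x" for x using conv[of x] by (simp add: u_def convergent_LIMSEQ_iff)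
 have u_m [measurable]: "u \<in> Borel"
  by (rule borel_measurable_LIMSEQ_real[OF lim]) (use bbd_measurable[OF w(1)] in auto)
 have u0: "0 \<le> u x" for x by (rule LIMSEQ_le_const[OF lim]) (use w(2) in auto)
 have uC: "u x \<le> C0" for x by (rule LIMSEQ_le_const2[OF lim]) (use bbd_le[OF w(1)] in \<open>auto simp: abs_le_iff\<close>)
 have u: "bbd C0 u" using u0 uC by (intro bbdI) auto
 have uoff: "u x = 0" if "x \<notin> \<Omega>" for x using LIMSEQ_unique[OF lim[of x]] w(3)[OF that] by simp
 have cont: "continuous_on \<Omega> u"
 proof (rule continuous_at_imp_continuous_on, rule ballI)
  fix x assume "x \<in> \<Omega>"
  from equi[OF this] obtain C R where CR: "0 \<le> C" "0 < R"
   "!!j h. \<tau> j \<le> tau0 * R ==> \<tau> j \<le> norm h ==> norm h \<le> R ==> \<bar>w j (x + h) - w j x\<bar> \<le> C * norm h powr \<gamma>" by blast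
  have hol: "\<bar>u (x + h) - u x\<bar> \<le> C * norm h powr \<gamma>" if h: "0 < norm h" "norm h \<le> R" for h
  proof (rule tendsto_upperbound[OF tendsto_rabs[OF tendsto_diff[OF lim lim]]])
   have "0 < min (tau0 * R) (norm h)" using tau0(1) CR(2) h(1) by simp
   from ev[OF this] show "\<forall>\<^sub>F j in sequentially. \<bar>w (r j) (x + h) - w (r j) x\<bar> \<le> C * norm h powr \<gamma>"
    by eventually_elim (use CR(3) h in auto)
  qed simp
  show "isCont u x" unfolding continuous_at_eps_delta
  proof (intro allI impI)
   fix e :: real assume e: "0 < e"
   obtain \<delta> where d: "0 < \<delta>" "\<delta> \<le> R" "!!t. 0 \<le> t ==> t < \<delta> ==> C * t powr \<gamma> < e"
    using small[OF CR(1,2) e] by auto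
   have "dist (u y) (u x) < e" if "dist y x < \<delta>" for y
   proof (cases "y = x")
    case False
    then show ?thesis using hol[of "y - x"] that d(2) d(3)[of "norm (y - x)"] by (auto simp: dist_norm)
   qed (use e in simp)
   then show "\<exists>d>0. \<forall>y. dist y x < d --> dist (u y) (u x) < e" using d by blast
  qed
 qed
 \<comment> \<open>A square root of the kernel is attached to each factor, so that the energy form
   becomes a scalar product of square integrable functions. On the side of the test function the
   full kernel can be kept for all \<open>j\<close>, since
   \<open>sqrt (trunc c x y) * sqrt (K x y) = trunc c x y\<close>.\<close>
 define F where "F = (\<lambda>j (x, y). (w (r j) x - w (r j) y) * sqrt (trunc (\<tau> (r j)) x y))"
 define L where "L = (\<lambda>(x, y). (u x - u y) * sqrt (K x y))"
 have tr0: "0 \<le> trunc c x y" for c x y by (simp add: trunc_def K_nonneg)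
 have Fm [measurable]: "F j \<in> borel_measurable lborel2" for j
  unfolding F_def trunc_def using bbd_measurable[OF w(1)[of "r j"]] by measurable
 have Lm [measurable]: "L \<in> borel_measurable lborel2" unfolding L_def by measurable
 have w_int: "integrable lborel (w j)" for j
 proof (rule bochner_bound[OF integrable_mult_right[OF integrable_ball_indicator[of 0 R0], of C0]])
  show "AE x in lborel. norm (w j x) \<le> norm (C0 * indicator (ball 0 R0) x)"
  proof (rule AE_I2)
   fix x show "norm (w j x) \<le> norm (C0 * indicator (ball 0 R0) x)"
    using w(3)[of x j] bbd_le[OF w(1), of j x] \<Omega>(2) C0 by (cases "x \<in> \<Omega>") auto
  qed
 qed (use bbd_measurable[OF w(1)] in auto)
 \<comment> \<open>A uniform bound for the energies, obtained by testing each equation with its own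
   solution.\<close>
 define E where "E = B * C0 * (LBINT x. indicator (ball 0 R0) (x::'a))"
 have F2: "integrable lborel2 (\<lambda>p. (F j p)\<^sup>2)" "(\<integral>p. (F j p)\<^sup>2 \<partial>lborel2) \<le> E"
  and Fg: "integrable lborel v ==> (!!x. x \<notin> \<Omega> ==> v x = 0) ==>
   (\<integral>p. F j p * (case p of (x, y) => (v x - v y) * sqrt (K x y)) \<partial>lborel2) = (LBINT x. \<psi> x * v x)" for j v
 proof -
  interpret lo: local_kernel n s lam Lam \<sigma> \<gamma> eps tau0 "\<tau> (r j)" "trunc (\<tau> (r j))" by (rule lk)
  have e: "(\<lambda>p. (F j p)\<^sup>2) = (\<lambda>(x, y). (w (r j) x - w (r j) y) * (w (r j) x - w (r j) y) * trunc (\<tau> (r j)) x y)"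
   using tr0 by (auto simp: F_def fun_eq_iff power_mult_distrib power2_eq_square mult_ac)
  note id = lo.energy_identity[OF w(1)[of "r j"]]
  have Lv: "(LBINT x. lo.Lop (w (r j)) x * v x) = (LBINT x. \<psi> x * v x)" if "!!x. x \<notin> \<Omega> ==> v x = 0" for v
  proof (intro bochner_cong refl)
   fix x show "lo.Lop (w (r j)) x * v x = \<psi> x * v x" using w(4)[of x "r j"] that[of x] by (cases "x \<in> \<Omega>") auto
  qed
  show "integrable lborel2 (\<lambda>p. (F j p)\<^sup>2)" unfolding e by (rule id(1)[OF w_int])
  have "(\<integral>p. (F j p)\<^sup>2 \<partial>lborel2) = (LBINT x. \<psi> x * w (r j) x)"
   unfolding e id(2)[OF w_int] by (rule Lv) (rule w(3))
  also have "\<dots> \<le> (LBINT x. B * C0 * indicator (ball 0 R0) (x::'a))"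
  proof (rule integral_mono)
   have "integrable lborel (\<lambda>x. w (r j) x * \<psi> (0 + x))" by (rule bbd_integrable(1)[OF w_int \<psi>(1)])
   then show "integrable lborel (\<lambda>x. \<psi> x * w (r j) x)" by (simp add: mult.commute)
   show "integrable lborel (\<lambda>x. B * C0 * indicator (ball 0 R0) (x::'a))" by (intro integrable_mult_right integrable_ball_indicator)
   fix x
   show "\<psi> x * w (r j) x \<le> B * C0 * indicator (ball 0 R0) x"
   proof (cases "x \<in> \<Omega>")
    case True
    have "\<psi> x * w (r j) x \<le> B * C0" using bbd_le[OF \<psi>(1), of x] bbd_le[OF w(1), of "r j" x] \<psi>(2)[of x] w(2)[of "r j" x] by (intro mult_mono) auto
    then show ?thesis using True \<Omega>(2) by auto
   next
    case False
    then show ?thesis using w(3) C0 bbd_nonneg[OF \<psi>(1)] by simp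
   qed
  qed
  also have "\<dots> = E" by (simp add: E_def)
  finally show "(\<integral>p. (F j p)\<^sup>2 \<partial>lborel2) \<le> E" .
  assume v: "integrable lborel v" "!!x. x \<notin> \<Omega> ==> v x = 0"
  have "sqrt (trunc c x y) * sqrt (K x y) = trunc c x y" for c x y using K_nonneg[of x y] by (simp add: trunc_def)
  then have e2: "(\<lambda>p. F j p * (case p of (x, y) => (v x - v y) * sqrt (K x y))) = (\<lambda>(x, y). (w (r j) x - w (r j) y) * (v x - v y) * trunc (\<tau> (r j)) x y)"
   by (auto simp: F_def fun_eq_iff mult_ac)
  show "(\<integral>p. F j p * (case p of (x, y) => (v x - v y) * sqrt (K x y)) \<partial>lborel2) = (LBINT x. \<psi> x * v x)"
   unfolding e2 id(2)[OF v(1)] by (rule Lv[OF v(2)])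
 qed
 have FL: "(\<lambda>j. F j p) \<longlonglongrightarrow> L p" for p
 proof -
  obtain x y where p: "p = (x, y)" by (cases p)
  have "(\<lambda>j. sqrt (trunc (\<tau> (r j)) x y)) \<longlonglongrightarrow> sqrt (K x y)"
  proof (cases "x = y")
   case False
   then have "0 < norm (x - y)" by simp
   from ev[OF this] have "\<forall>\<^sub>F j in sequentially. sqrt (K x y) = sqrt (trunc (\<tau> (r j)) x y)"
    by eventually_elim (simp add: trunc_def)
   then show ?thesis by (rule tendsto_cong[THEN iffD1]) (rule tendsto_const)
  qed (simp add: trunc_def K_diag if_distrib cong: if_cong)
  then show ?thesis unfolding p F_def L_def prod.case by (intro tendsto_mult tendsto_diff lim)
 qed
 have L2: "integrable lborel2 (\<lambda>p. (L p)\<^sup>2)"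
  by (rule pointwise_L2_limit(1)[OF Fm Lm _ F2 FL, where g="\<lambda>_. 0"]) simp_all
 have L2e: "(\<lambda>p. (L p)\<^sup>2) = (\<lambda>(x, y). (u x - u y)\<^sup>2 * K x y)"
  by (auto simp: L_def fun_eq_iff power_mult_distrib K_nonneg)
 have weak: "(\<integral>(x, y). (u x - u y) * (v x - v y) * K x y \<partial>lborel2) = (LBINT x. \<psi> x * v x)"
  if v: "integrable lborel v" "!!x. x \<notin> \<Omega> ==> v x = 0" "integrable lborel2 (\<lambda>(x, y). (v x - v y)\<^sup>2 * K x y)"
   "v \<in> Borel" for v
 proof -
  define g where "g = (\<lambda>(x, y). (v x - v y) * sqrt (K x y))"
  have gm: "g \<in> borel_measurable lborel2" unfolding g_def using v(4) by measurable
  have "(\<lambda>p. (g p)\<^sup>2) = (\<lambda>(x, y). (v x - v y)\<^sup>2 * K x y)" by (auto simp: g_def fun_eq_iff power_mult_distrib K_nonneg)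
  then have g2: "integrable lborel2 (\<lambda>p. (g p)\<^sup>2)" using v(3) by simp
  have "(\<lambda>j. \<integral>p. F j p * g p \<partial>lborel2) \<longlonglongrightarrow> (\<integral>p. L p * g p \<partial>lborel2)"
   by (rule pointwise_L2_limit(2)[OF Fm Lm gm F2 FL g2])
  moreover have "(\<integral>p. F j p * g p \<partial>lborel2) = (LBINT x. \<psi> x * v x)" for j
   unfolding g_def by (rule Fg[OF v(1,2)])
  ultimately have "(\<integral>p. L p * g p \<partial>lborel2) = (LBINT x. \<psi> x * v x)"
   by (simp add: LIMSEQ_const_iff)
  moreover have "(\<lambda>p. L p * g p) = (\<lambda>(x, y). (u x - u y) * (v x - v y) * K x y)"
  proof
   fix p :: "'a \<times> 'a"
   obtain x y where p: "p = (x, y)" by (cases p)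
   have "sqrt (K x y) * sqrt (K x y) = K x y" using K_nonneg[of x y] by simp
   moreover have "a * q * (b * q) = a * b * (q * q)" for a b q :: real by simp
   ultimately show "L p * g p = (case p of (x, y) => (u x - u y) * (v x - v y) * K x y)" by (simp add: p L_def g_def)
  qed
  ultimately show ?thesis by simp
 qed
 have est: "(\<forall>z. dist x0 z < R / 16 --> u z \<le> hk * u x0)
   \<and> (\<forall>x h. norm (x - x0) + 2 * norm h \<le> R / 192 -->
      \<bar>u (x + 2 *\<^sub>R h) - 2 * u (x + h) + u x\<bar> \<le> dk * u x0 * (norm h / R) powr (\<gamma> + \<sigma>))"
  if R: "0 < R" "Lam * R powr \<sigma> \<le> eps" "8 * R < 1" "ball x0 (16 * R) \<subseteq> \<Omega>" and z: "!!x. x \<in> ball x0 R ==> \<psi> x = 0" for x0 R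
 proof -
  define q where "q = (\<lambda>j. C0 * (\<tau> (r j) / R) powr n)"
  have np: "0 < n" using params by simp
  have "(\<lambda>j. \<tau> (r j) / R) \<longlonglongrightarrow> 0" using tendsto_divide[OF tr tendsto_const[of R]] R by simp
  then have "(\<lambda>j. (\<tau> (r j) / R) powr n) \<longlonglongrightarrow> 0"
   by (rule tendsto_zero_powrI[OF _ tendsto_const _ np]) (use t(1) R in \<open>auto intro!: always_eventually less_imp_le\<close>)
  then have q: "q \<longlonglongrightarrow> 0" unfolding q_def by (rule tendsto_mult_right_zero)
  have zL: "jump_kernel.Lop (trunc (\<tau> (r j))) (w (r j)) x = 0" if "x \<in> ball x0 R" for j x
  proof -
   have "x \<in> \<Omega>" using that R by auto
   then show ?thesis using w(4)[of x "r j"] z[OF that] by simp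
  qed
  have gd: "local_kernel.good n s Lam \<sigma> eps tau0 (\<tau> (r j)) (trunc (\<tau> (r j))) x0 R" if "\<tau> (r j) \<le> tau0 * (R / 96)" for j
  proof (rule good[OF t(1) _ R])
   show "\<tau> (r j) \<le> tau0 * R" using that R tau0 mult_left_mono[of "R / 96" R tau0] by linarith
  qed
  have e96: "\<forall>\<^sub>F j in sequentially. \<tau> (r j) < tau0 * (R / 96)" by (rule ev) (use tau0 R in auto)
  show ?thesis
  proof (intro conjI allI impI)
   fix y :: 'a assume y: "dist x0 y < R / 16"
   have rhs: "(\<lambda>j. hk * (w (r j) x0 + q j)) \<longlonglongrightarrow> hk * (u x0 + 0)"
    by (intro tendsto_intros lim q)
   have "u y \<le> hk * (u x0 + 0)"
   proof (rule tendsto_le[OF sequentially_bot rhs lim])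
    show "\<forall>\<^sub>F j in sequentially. w (r j) y \<le> hk * (w (r j) x0 + q j)"
     using e96
    proof eventually_elim
     case (elim j)
     interpret lo: local_kernel n s lam Lam \<sigma> \<gamma> eps tau0 "\<tau> (r j)" "trunc (\<tau> (r j))" by (rule lk)
     have "\<tau> (r j) \<le> tau0 * (R / 16)" using elim R tau0 mult_left_mono[of "R / 96" "R / 16" tau0] by linarith
     then show ?case unfolding q_def by (intro lo.harnack_tau[OF gd _ w(1,2) zL y]) (use elim in auto)
    qed
   qed
   then show "u y \<le> hk * u x0" by simp
  next
   fix x h :: 'a assume x: "norm (x - x0) + 2 * norm h \<le> R / 192"
   show "\<bar>u (x + 2 *\<^sub>R h) - 2 * u (x + h) + u x\<bar> \<le> dk * u x0 * (norm h / R) powr (\<gamma> + \<sigma>)"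
   proof (cases "h = 0")
    case False
    have rhs: "(\<lambda>j. dk * (w (r j) x0 + q j) * (norm h / R) powr (\<gamma> + \<sigma>)) \<longlonglongrightarrow> dk * (u x0 + 0) * (norm h / R) powr (\<gamma> + \<sigma>)"
     by (intro tendsto_intros lim q)
    have lhs: "(\<lambda>j. \<bar>w (r j) (x + 2 *\<^sub>R h) - 2 * w (r j) (x + h) + w (r j) x\<bar>) \<longlonglongrightarrow> \<bar>u (x + 2 *\<^sub>R h) - 2 * u (x + h) + u x\<bar>"
     by (intro tendsto_intros lim)
    have "0 < norm h" using False by simp
    note e2 = ev[OF this]
    have "\<bar>u (x + 2 *\<^sub>R h) - 2 * u (x + h) + u x\<bar> \<le> dk * (u x0 + 0) * (norm h / R) powr (\<gamma> + \<sigma>)"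
    proof (rule tendsto_le[OF sequentially_bot rhs lhs])
     show "\<forall>\<^sub>F j in sequentially. \<bar>w (r j) (x + 2 *\<^sub>R h) - 2 * w (r j) (x + h) + w (r j) x\<bar> \<le> dk * (w (r j) x0 + q j) * (norm h / R) powr (\<gamma> + \<sigma>)"
      using e96 e2
     proof eventually_elim
      case (elim j)
      interpret lo: local_kernel n s lam Lam \<sigma> \<gamma> eps tau0 "\<tau> (r j)" "trunc (\<tau> (r j))" by (rule lk)
      show ?case unfolding q_def by (intro lo.second_difference_tau[OF gd _ w(1,2) zL _ x]) (use elim in auto)
     qed
    qed
    then show ?thesis by simp
   qed simp
  qed
 qed
 show ?thesis unfolding solves_def
  by (intro exI[of _ u] conjI allI impI u[unfolded C0_def] u0 uoff cont L2[unfolded L2e] weak est) auto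
qed

end

section \<open>Gradients from second differences\<close>

lemma bounded_additive_imp_linear:
 fixes d :: "'a::real_normed_vector => real"
 assumes add: "!!h k. d (h + k) = d h + d k" and r: "0 < r" and B: "!!h. norm h \<le> r ==> \<bar>d h\<bar> \<le> B"
 shows "linear d"
proof (rule linearI[OF add])
 fix c :: real and h :: 'a
 have d0: "d 0 = 0" using add[of 0 0] by simp
 have pow: "d (2 ^ k *\<^sub>R h) = 2 ^ k * d h" for k h
 proof (induction k)
  case (Suc k)
  have "2 ^ Suc k *\<^sub>R h = 2 ^ k *\<^sub>R h + 2 ^ k *\<^sub>R h" by (simp add: scaleR_2 flip: scaleR_scaleR)
  then show ?case using Suc by (simp add: add)
 qed simp
 obtain k :: nat where k: "norm h / r < 2 ^ k" using real_arch_pow[of 2 "norm h / r"] by auto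
 have B2: "\<bar>d v\<bar> \<le> 2 ^ k * B" if "norm v \<le> norm h" for v
 proof -
  have "norm (inverse (2 ^ k) *\<^sub>R v) \<le> r" using that k r by (simp add: field_simps)
  from B[OF this] have "\<bar>d (2 ^ k *\<^sub>R (inverse (2 ^ k) *\<^sub>R v))\<bar> \<le> 2 ^ k * B" unfolding pow by (simp add: abs_mult)
  then show ?thesis by simp
 qed
 \<comment> \<open>f is additive, has period 1 and is bounded on the unit interval, hence bounded, hence zero.\<close>
 define f where "f = (\<lambda>t. d (t *\<^sub>R h) - t * d h)"
 have fadd: "f (a + b) = f a + f b" for a b by (simp add: f_def scaleR_left_distrib add algebra_simps)
 have f1: "f 1 = 0" "f 0 = 0" using d0 by (simp_all add: f_def)
 have fneg: "f (- a) = - f a" for a using fadd[of a "- a"] f1 by simp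
 have fnat: "f (real m) = 0" for m by (induction m) (simp_all add: f1 fadd)
 have fint: "f (of_int m) = 0" for m by (cases m) (simp_all add: fnat fneg flip: of_nat_Suc)
 define B' where "B' = 2 ^ k * B + \<bar>d h\<bar>"
 have fB: "\<bar>f t\<bar> \<le> B'" for t
 proof -
  have "f t = f (frac t)" using fadd[of "frac t" "of_int \<lfloor>t\<rfloor>"] fint by (simp add: frac_def)
  have fr: "0 \<le> frac t" "frac t \<le> 1" using frac_lt_1[of t] by auto
  have "\<bar>d (frac t *\<^sub>R h)\<bar> \<le> 2 ^ k * B" by (rule B2) (use fr in \<open>simp add: mult_left_le_one_le\<close>)
  moreover have "\<bar>frac t * d h\<bar> \<le> \<bar>d h\<bar>" unfolding abs_mult by (rule mult_left_le_one_le) (use fr in auto)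
  ultimately have "\<bar>f (frac t)\<bar> \<le> B'" unfolding f_def B'_def by linarith
  then show ?thesis using \<open>f t = f (frac t)\<close> by simp
 qed
 have fp: "f (2 ^ m * t) = 2 ^ m * f t" for m t
  using pow[of m "t *\<^sub>R h"] by (simp add: f_def algebra_simps)
 have "f c = 0"
 proof (rule ccontr)
  assume "f c \<noteq> 0"
  then obtain m :: nat where "B' / \<bar>f c\<bar> < 2 ^ m" using real_arch_pow[of 2 "B' / \<bar>f c\<bar>"] by auto
  then have "B' < \<bar>2 ^ m * f c\<bar>" using \<open>f c \<noteq> 0\<close> by (simp add: abs_mult pos_divide_less_eq)
  then show False using fB[of "2 ^ m * c"] unfolding fp by simp
 qed
 then show "d (c *\<^sub>R h) = c *\<^sub>R d h" by (simp add: f_def)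
qed

text \<open>In each step the rescaled increments
  \<open>a k h = 2 ^ k * (u (x0 + h / 2 ^ k) - u x0)\<close> change by a rescaled second difference
  of \<open>u\<close>, hence by a geometrically small amount as the exponent exceeds 1. The limit
  \<open>d\<close> is additive by further second differences, bounded near 0 by \<open>M\<close> and
  the error, and therefore linear.\<close>

lemma gradient_of_second_differences:
 fixes u :: "'a::euclidean_space => real"
 assumes r: "0 < r" and \<beta>: "0 < \<beta>" and C: "0 \<le> C"
  and M: "!!x. norm (x - x0) \<le> r ==> \<bar>u x - u x0\<bar> \<le> M"
  and D2: "!!x h. norm (x - x0) + 2 * norm h \<le> r ==> \<bar>u (x + 2 *\<^sub>R h) - 2 * u (x + h) + u x\<bar> \<le> C * norm h powr (1 + \<beta>)"
 shows "\<exists>D. GDERIV u x0 :> D \<and> norm D \<le> M / r + C / (1 - 2 powr - \<beta>) * r powr \<beta>"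
proof -
 define q where "q = 2 powr - \<beta>"
 have q: "0 < q" "q < 1" using \<beta> by (auto simp: q_def powr_less_one)
 define E where "E = C / (1 - q)"
 have E: "0 \<le> E" "C + E * q = E" using C q by (auto simp: E_def field_simps)
 define g where "g = (\<lambda>h. u (x0 + h) - u x0)"
 define a where "a = (\<lambda>k h. 2 ^ k * g (inverse (2 ^ k) *\<^sub>R h))"
 have gd: "\<bar>g (2 *\<^sub>R h) - 2 * g h\<bar> \<le> C * norm h powr (1 + \<beta>)" if "2 * norm h \<le> r" for h
  using D2[of x0 h] that by (simp add: g_def algebra_simps)
 have half: "norm (inverse (2 ^ k) *\<^sub>R h) = norm h / 2 ^ k" for k and h :: 'a by (simp add: field_simps)
 have pw: "2 ^ k * (norm h / 2 ^ k) powr (1 + \<beta>) = norm h powr (1 + \<beta>) * q ^ k" for k and h :: 'a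
 proof -
  have "(2 ^ k) powr (1 + \<beta>) = (2::real) ^ k * (2 powr \<beta>) ^ k"
   by (simp add: powr_add powr_powr flip: powr_realpow) (simp add: powr_powr mult.commute)
  moreover have "q ^ k = inverse ((2 powr \<beta>) ^ k)" by (simp add: q_def powr_minus power_inverse)
  ultimately show ?thesis by (simp add: powr_divide field_simps)
 qed
 have step: "\<bar>a (Suc k) h - a k h\<bar> \<le> C * norm h powr (1 + \<beta>) * q ^ k" if h: "norm h / 2 ^ k \<le> r" for k h
 proof -
  define v where "v = inverse (2 ^ Suc k) *\<^sub>R h"
  have nv: "norm v = norm h / 2 ^ Suc k" unfolding v_def half ..
  have v2: "2 *\<^sub>R v = inverse (2 ^ k) *\<^sub>R h" by (simp add: v_def)
  have "\<bar>g (2 *\<^sub>R v) - 2 * g v\<bar> \<le> C * norm v powr (1 + \<beta>)" by (rule gd) (use h nv in simp)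
  also have "\<dots> \<le> C * (norm h / 2 ^ k) powr (1 + \<beta>)"
   using C \<beta> by (intro mult_left_mono powr_mono2) (auto simp: nv field_simps)
  finally have "2 ^ k * \<bar>g (2 *\<^sub>R v) - 2 * g v\<bar> \<le> C * (2 ^ k * (norm h / 2 ^ k) powr (1 + \<beta>))" by simp
  moreover have "a (Suc k) h - a k h = - (2 ^ k * (g (2 *\<^sub>R v) - 2 * g v))"
   unfolding a_def v2 by (simp add: v_def algebra_simps)
  ultimately show ?thesis unfolding pw by (simp add: abs_mult mult.assoc)
 qed
 have sm: "summable (\<lambda>k. a (Suc k) h - a k h)" for h
 proof (rule summable_comparison_test_ev)
  obtain m :: nat where "norm h / r < 2 ^ m" using real_arch_pow[of 2 "norm h / r"] by auto
  then have m: "norm h / 2 ^ m \<le> r" using r by (simp add: field_simps)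
  show "\<forall>\<^sub>F k in sequentially. norm (a (Suc k) h - a k h) \<le> C * norm h powr (1 + \<beta>) * q ^ k"
   using eventually_ge_at_top[of m]
  proof eventually_elim
   case (elim k)
   have "norm h / 2 ^ k \<le> norm h / 2 ^ m" using elim by (intro divide_left_mono power_increasing) auto
   then show ?case using step[of h k] m by simp
  qed
  show "summable (\<lambda>k. C * norm h powr (1 + \<beta>) * q ^ k)" using q by (intro summable_mult summable_geometric) simp
 qed
 define d where "d = (\<lambda>h. lim (\<lambda>k. a k h))"
 have ad: "(\<lambda>k. a k h) \<longlonglongrightarrow> d h" for h
 proof -
  have "(\<lambda>k. a k h - a 0 h) \<longlonglongrightarrow> (\<Sum>k. a (Suc k) h - a k h)"
   using summable_LIMSEQ[OF sm[of h]] unfolding sum_lessThan_telescope[where f="\<lambda>k. a k h"] .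
  then have "convergent (\<lambda>k. a k h - a 0 h + a 0 h)" by (intro convergent_add convergent_const) (auto simp: convergent_def)
  then show ?thesis by (simp add: d_def convergent_LIMSEQ_iff)
 qed
 have err: "\<bar>d h - g h\<bar> \<le> E * norm h powr (1 + \<beta>)" if h: "norm h \<le> r" for h
 proof -
  have "\<bar>a k h - g h\<bar> \<le> E * norm h powr (1 + \<beta>) * (1 - q ^ k)" for k
  proof (induction k)
   case (Suc k)
   have "norm h / 2 ^ k \<le> norm h" using divide_left_mono[of 1 "2 ^ k" "norm h"] by simp
   then have "\<bar>a (Suc k) h - a k h\<bar> \<le> C * norm h powr (1 + \<beta>) * q ^ k" using h by (intro step) linarith
   then have "\<bar>a (Suc k) h - g h\<bar> \<le> E * norm h powr (1 + \<beta>) * (1 - q ^ k) + C * norm h powr (1 + \<beta>) * q ^ k" using Suc by linarith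
   also have "\<dots> = E * norm h powr (1 + \<beta>) + (C - E) * norm h powr (1 + \<beta>) * q ^ k" by (simp add: algebra_simps)
   also have "C - E = - E * q" using E(2) by simp
   finally show ?case by (simp add: algebra_simps)
  qed (simp add: a_def)
  also have "E * norm h powr (1 + \<beta>) * (1 - q ^ k) \<le> E * norm h powr (1 + \<beta>)" for k
   using E q by (intro mult_left_le) auto
  finally have le: "\<bar>a k h - g h\<bar> \<le> E * norm h powr (1 + \<beta>)" for k .
  show ?thesis by (rule LIMSEQ_le_const2[OF tendsto_rabs[OF tendsto_diff[OF ad tendsto_const]]]) (use le in auto)
 qed
 have dd: "d (h + k) = d h + d k" for h k
 proof -
  have "(\<lambda>j. a j h + a j k - a (Suc j) (h + k)) \<longlonglongrightarrow> 0"
  proof (rule tendsto_norm_zero_cancel, rule tendsto_sandwich[OF _ _ tendsto_const])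
   obtain m :: nat where "(norm h + norm (k - h)) / r < 2 ^ m" using real_arch_pow[of 2 "(norm h + norm (k - h)) / r"] by auto
   then have m: "norm h + norm (k - h) \<le> r * 2 ^ m" using r by (simp add: field_simps)
   show "\<forall>\<^sub>F j in sequentially. norm (a j h + a j k - a (Suc j) (h + k)) \<le> C * norm (k - h) powr (1 + \<beta>) * q ^ j"
    using eventually_ge_at_top[of m]
   proof eventually_elim
    case (elim j)
    let ?c = "inverse (2 ^ j) :: real"
    \<comment> \<open>Half of the way from \<open>h / 2 ^ j\<close> to \<open>k / 2 ^ j\<close>: the
      midpoint of this second difference is \<open>x0 + (h + k) / 2 ^ (j + 1)\<close>, whence the
      index shift in \<open>a (Suc j) (h + k)\<close>.\<close>
    define v where "v = (?c / 2) *\<^sub>R (k - h)"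
    have "norm v = \<bar>?c / 2\<bar> * norm (k - h)" unfolding v_def by (rule norm_scaleR)
    moreover have "\<bar>?c / 2\<bar> = ?c / 2" by simp
    ultimately have nv: "2 * norm v = norm (k - h) / 2 ^ j" by (metis (no_types, lifting) divide_inverse_commute mult.assoc nonzero_mult_div_cancel_left times_divide_eq_right zero_neq_numeral)
    have "r * 2 ^ m \<le> r * 2 ^ j" using elim r by (intro mult_left_mono power_increasing) auto
    then have "norm (x0 + ?c *\<^sub>R h - x0) + 2 * norm v \<le> r" unfolding nv using m by (simp add: field_simps)
    from D2[OF this] have le0: "\<bar>u (x0 + ?c *\<^sub>R h + 2 *\<^sub>R v) - 2 * u (x0 + ?c *\<^sub>R h + v) + u (x0 + ?c *\<^sub>R h)\<bar> \<le> C * norm v powr (1 + \<beta>)" .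
    have e1: "x0 + ?c *\<^sub>R h + 2 *\<^sub>R v = x0 + ?c *\<^sub>R k" by (simp add: v_def algebra_simps)
    have e2: "x0 + ?c *\<^sub>R h + v = x0 + inverse (2 ^ Suc j) *\<^sub>R (h + k)"
    proof -
     have "?c *\<^sub>R h = (?c / 2) *\<^sub>R h + (?c / 2) *\<^sub>R h" by (simp flip: scaleR_left_distrib)
     moreover have "inverse (2 ^ Suc j) = ?c / 2" by (simp add: field_simps)
     ultimately show ?thesis unfolding v_def by (simp add: scaleR_right_diff_distrib scaleR_right_distrib)
    qed
    have le: "\<bar>g (?c *\<^sub>R k) - 2 * g (inverse (2 ^ Suc j) *\<^sub>R (h + k)) + g (?c *\<^sub>R h)\<bar> \<le> C * norm v powr (1 + \<beta>)"
     using le0 unfolding e1 e2 g_def by (rule ord_eq_le_trans[rotated]) (rule arg_cong[where f=abs], simp)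
    have "C * norm v powr (1 + \<beta>) \<le> C * (norm (k - h) / 2 ^ j) powr (1 + \<beta>)"
     using C \<beta> nv norm_ge_zero[of v] by (intro mult_left_mono powr_mono2) linarith+
    with le have "2 ^ j * \<bar>g (?c *\<^sub>R k) - 2 * g (inverse (2 ^ Suc j) *\<^sub>R (h + k)) + g (?c *\<^sub>R h)\<bar> \<le> 2 ^ j * (C * (norm (k - h) / 2 ^ j) powr (1 + \<beta>))"
     by (intro mult_left_mono) auto
    also have "\<dots> = C * (2 ^ j * (norm (k - h) / 2 ^ j) powr (1 + \<beta>))" by simp
    finally have fin: "2 ^ j * \<bar>g (?c *\<^sub>R k) - 2 * g (inverse (2 ^ Suc j) *\<^sub>R (h + k)) + g (?c *\<^sub>R h)\<bar> \<le> C * norm (k - h) powr (1 + \<beta>) * q ^ j"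
     unfolding pw by simp
    have "a j h + a j k - a (Suc j) (h + k) = 2 ^ j * (g (?c *\<^sub>R k) - 2 * g (inverse (2 ^ Suc j) *\<^sub>R (h + k)) + g (?c *\<^sub>R h))"
     by (simp add: a_def algebra_simps)
    then show ?case using fin by (simp add: abs_mult)
   qed
   show "(\<lambda>j. C * norm (k - h) powr (1 + \<beta>) * q ^ j) \<longlonglongrightarrow> 0"
    using q by (intro tendsto_mult_right_zero LIMSEQ_power_zero) auto
  qed simp
  moreover have "(\<lambda>j. a j h + a j k - a (Suc j) (h + k)) \<longlonglongrightarrow> d h + d k - d (h + k)"
   by (intro tendsto_intros ad LIMSEQ_Suc)
  ultimately show ?thesis using LIMSEQ_unique by force
 qed
 define B where "B = M + E * r powr (1 + \<beta>)"
 have dB: "\<bar>d h\<bar> \<le> B" if h: "norm h \<le> r" for h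
 proof -
  have "\<bar>g h\<bar> \<le> M" using M[of "x0 + h"] h by (simp add: g_def)
  moreover have "E * norm h powr (1 + \<beta>) \<le> E * r powr (1 + \<beta>)" using E h \<beta> by (intro mult_left_mono powr_mono2) auto
  ultimately show ?thesis using err[OF h] unfolding B_def by linarith
 qed
 have lin: "linear d" by (rule bounded_additive_imp_linear[OF dd r dB])
 define D where "D = (\<Sum>b\<in>Basis. d b *\<^sub>R b)"
 have dD: "d h = h \<bullet> D" for h
 proof -
  have "d h = d (\<Sum>b\<in>Basis. (h \<bullet> b) *\<^sub>R b)" by (simp add: euclidean_representation)
  also have "\<dots> = (\<Sum>b\<in>Basis. (h \<bullet> b) * d b)" by (simp add: linear_sum[OF lin] linear_scale[OF lin])
  also have "\<dots> = h \<bullet> D" unfolding D_def inner_sum_right by (simp add: inner_commute mult.commute)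
  finally show ?thesis .
 qed
 have gder: "GDERIV u x0 :> D" unfolding gderiv_def
 proof (rule has_derivativeI_sandwich[of r])
  show "bounded_linear (\<lambda>h. h \<bullet> D)" by (rule bounded_linear_inner_left)
  fix y assume y: "y \<noteq> x0" "dist y x0 < r"
  have "norm (u y - u x0 - (y - x0) \<bullet> D) \<le> E * norm (y - x0) powr (1 + \<beta>)"
   using err[of "y - x0"] y by (simp add: g_def dD[symmetric] dist_norm abs_minus_commute)
  then have "norm (u y - u x0 - (y - x0) \<bullet> D) / norm (y - x0) \<le> E * norm (y - x0) powr (1 + \<beta>) / norm (y - x0)"
   by (rule divide_right_mono) simp
  then show "norm (u y - u x0 - (y - x0) \<bullet> D) / norm (y - x0) \<le> E * norm (y - x0) powr \<beta>"
   using y by (simp add: powr_add)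
 next
  have "((\<lambda>y. norm (y - x0)) \<longlongrightarrow> 0) (at x0)" by (rule tendsto_eq_intros | simp)+
  then show "((\<lambda>y. E * norm (y - x0) powr \<beta>) \<longlongrightarrow> 0) (at x0)"
   by (intro tendsto_mult_right_zero tendsto_zero_powrI[OF _ tendsto_const _ \<beta>]) auto
 qed (use r in auto)
 have "norm D \<le> B / r"
 proof (cases "D = 0")
  case False
  define h where "h = (r / norm D) *\<^sub>R D"
  have "\<bar>d h\<bar> \<le> B" by (rule dB) (use False r in \<open>simp add: h_def\<close>)
  then have "norm D * r \<le> B" unfolding dD h_def using False r by (simp add: power2_norm_eq_inner[symmetric] power2_eq_square mult.commute)
  then show ?thesis using r by (simp add: field_simps)
 next
  case True
  have "0 \<le> B" using dB[of 0] r by simp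
  then show ?thesis using r True by simp
 qed
 also have "\<dots> = M / r + C / (1 - 2 powr - \<beta>) * r powr \<beta>" using r by (simp add: B_def E_def q_def powr_add field_simps)
 finally show ?thesis using gder by blast
qed

section \<open>A Borel version of the kernel\<close>

lemma AE_lborel_affine:
 fixes P :: "'a::euclidean_space => bool"
 assumes P: "AE z in lborel. P z" and c: "c \<noteq> 0"
 shows "AE z in lborel. P (t + c *\<^sub>R z)"
proof -
 obtain N where N: "{z. \<not> P z} \<subseteq> N" "emeasure lborel N = 0" "N \<in> sets borel" using AE_E[OF P] by auto
 let ?D = "distr lborel borel (\<lambda>z::'a. t + c *\<^sub>R z)"
 have n: "AE z in lborel. z \<notin> N" using N by (intro AE_not_in) (simp add: null_sets_def)
 have E: "lborel = density ?D (\<lambda>_. ennreal (\<bar>c\<bar> ^ DIM('a)))" using lborel_affine[OF c, of t] by simp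
 have "AE z in density ?D (\<lambda>_. ennreal (\<bar>c\<bar> ^ DIM('a))). z \<notin> N" using n by (simp only: E[symmetric])
 then have "AE z in ?D. z \<notin> N" by (subst (asm) AE_density) (use c in auto)
 then have "AE z in lborel. t + c *\<^sub>R z \<notin> N" by (subst (asm) AE_distr_iff) (use N(3) in auto)
 then show ?thesis by eventually_elim (use N(1) in auto)
qed

lemma AE_lborel_pair_swap:
 fixes N :: "('a::euclidean_space \<times> 'a) set"
 assumes N: "AE p in lborel2. p \<notin> N" and m: "N \<in> sets borel"
 shows "AE p in lborel2. prod.swap p \<notin> N"
proof (rule lborel_pair.AE_pair_measure)
 have [measurable]: "N \<in> sets borel2" using m unfolding borel_prod .
 show "{p \<in> space lborel2. prod.swap p \<notin> N} \<in> sets lborel2" unfolding prod.swap_def by measurable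
 have "AE x in lborel. AE y in lborel. (x, y) \<notin> N" by (rule lborel_pair.AE_pair[OF N])
 moreover have "{p \<in> space lborel2. (fst p, snd p) \<notin> N} \<in> sets lborel2" by measurable
 ultimately show "AE x in lborel. AE y in lborel. prod.swap (x, y) \<notin> N"
  by (subst (asm) lborel_pair.AE_commute) auto
qed

lemma AE_lborel_pair_diff:
 fixes N :: "'a::euclidean_space set"
 assumes N: "AE z in lborel. z \<notin> N" and [measurable]: "N \<in> sets borel"
 shows "AE p in lborel2. fst p - snd p \<notin> N"
proof (rule lborel_pair.AE_pair_measure)
 show "{p \<in> space lborel2. fst p - snd p \<notin> N} \<in> sets lborel2" by measurable
 show "AE x in lborel. AE y in lborel. fst (x, y) - snd (x, y) \<notin> N"
  using AE_lborel_affine[OF N, of "-1"] by simp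
qed

lemma average_error:
 fixes f :: "'a::euclidean_space => real"
 assumes fm [measurable]: "f \<in> Borel" and r: "0 < r" and \<delta>: "0 \<le> \<delta>"
  and f: "AE x in lborel. x \<in> ball a r --> \<bar>f x - c\<bar> \<le> \<delta>"
 shows "integrable lborel (\<lambda>x. indicator (ball a r) x * f x)"
  and "\<bar>(LBINT x. indicator (ball a r) x * f x) / (unit_ball_vol DIM('a) * r ^ DIM('a)) - c\<bar> \<le> \<delta>"
proof -
 let ?i = "indicator (ball a r) :: 'a => real"
 have V: "0 < unit_ball_vol DIM('a) * r ^ DIM('a)" using r by simp
 have ib: "integrable lborel (\<lambda>x. C * ?i x)" "(LBINT x. C * ?i x) = C * (unit_ball_vol DIM('a) * r ^ DIM('a))" for C
  using integrable_ball_indicator[of a r] integral_ball_indicator[of r a] r by simp_all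
 show int: "integrable lborel (\<lambda>x. ?i x * f x)"
 proof (rule bochner_bound[OF ib(1)[of "\<bar>c\<bar> + \<delta>"]])
  show "AE x in lborel. norm (?i x * f x) \<le> norm ((\<bar>c\<bar> + \<delta>) * ?i x)"
   using f by eventually_elim (auto simp: indicator_def)
 qed (use fm in \<open>auto intro!: borel_measurable_times borel_measurable_indicator\<close>)
 have "(LBINT x. ?i x * f x) \<le> (LBINT x. (c + \<delta>) * ?i x)" "(LBINT x. (c - \<delta>) * ?i x) \<le> (LBINT x. ?i x * f x)"
  using f by (intro integral_mono_AE[OF int ib(1)] integral_mono_AE[OF ib(1) int]; elim eventually_mono; auto simp: indicator_def)+
 then show "\<bar>(LBINT x. ?i x * f x) / (unit_ball_vol DIM('a) * r ^ DIM('a)) - c\<bar> \<le> \<delta>"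
  unfolding ib(2) pos_divide_le_eq[OF V, symmetric] pos_le_divide_eq[OF V, symmetric] by linarith
qed

text \<open>The given kernel is only Lebesgue measurable, while the walk and the iterated integrals
  call for a Borel kernel that is symmetric, bounded and Hoelder continuous at every point. An
  arbitrary Borel version would lose these pointwise conditions; so the given values are kept off a
  null set adapted to them.\<close>

lemma kernel_regularization:
 fixes k :: "'a::euclidean_space => 'a => real"
 assumes meas: "case_prod k \<in> borel_measurable lebesgue" and sym: "!!x y. k y x = k x y"
  and lower: "!!x y. x \<noteq> y ==> lam * norm (x - y) powr p \<le> k x y"
  and upper: "!!x y. x \<noteq> y ==> k x y \<le> Lam * norm (x - y) powr p"
  and lam: "0 < lam" "lam \<le> Lam" and \<sigma>: "0 < \<sigma>" and \<Omega>: "open \<Omega>"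
  and hol: "!!x y h. x \<in> \<Omega> ==> y \<in> \<Omega> ==> norm h < 1 ==> x \<noteq> y ==>
    \<bar>k (x + h) (y + h) - k x y\<bar> \<le> Lam * norm h powr \<sigma> * norm (x - y) powr p"
 obtains K where "case_prod K \<in> borel_measurable borel2" "!!x y. K y x = K x y" "!!x. K x x = 0"
  "!!x y. x \<noteq> y ==> lam * norm (x - y) powr p \<le> K x y" "!!x y. x \<noteq> y ==> K x y \<le> Lam * norm (x - y) powr p"
  "!!x y h. x \<in> \<Omega> ==> y \<in> \<Omega> ==> x + h \<in> \<Omega> ==> y + h \<in> \<Omega> ==> norm h < 1 ==> x \<noteq> y ==>
    \<bar>K (x + h) (y + h) - K x y\<bar> \<le> Lam * norm h powr \<sigma> * norm (x - y) powr p"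
  "AE z in lborel2. case_prod K z = case_prod k z"
proof -
 have leb: "(lborel :: ('a \<times> 'a) measure) = lborel2" by (simp add: lborel_prod)
 obtain k0' where k0': "k0' \<in> borel_measurable lborel2" "AE z in lborel2. case_prod k z = k0' z"
  using completion_ex_borel_measurable_real[OF meas] unfolding leb by blast
 define k0 where "k0 = curry k0'"
 have k0m: "case_prod k0 \<in> borel_measurable borel2" using k0'(1) by (simp add: k0_def cong: measurable_cong_sets)
 have d0: "AE z in lborel. z \<notin> {0::'a}" using AE_lborel_singleton[of 0] by simp
 have "AE z in lborel2. fst z - snd z \<notin> {0::'a}" by (rule AE_lborel_pair_diff[OF d0]) simp
 with k0'(2) have "AE z in lborel2. case_prod k z = case_prod k0 z \<and> fst z \<noteq> snd z"
  by eventually_elim (auto simp: k0_def)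
 then obtain W0 where W0': "{z \<in> space lborel2. \<not> (case_prod k z = case_prod k0 z \<and> fst z \<noteq> snd z)} \<subseteq> W0"
  "emeasure lborel2 W0 = 0" "W0 \<in> sets lborel2"
  by (rule AE_E)
 have W0: "k x y = k0 x y \<and> x \<noteq> y" if "(x, y) \<notin> W0" for x y using subsetD[OF W0'(1), of "(x, y)"] that by (auto simp: space_pair_measure)
 have "sets lborel2 = sets (borel \<Otimes>\<^sub>M borel :: ('a \<times> 'a) measure)" by (intro sets_pair_measure_cong sets_lborel)
 then have [measurable]: "W0 \<in> sets borel2" using W0'(3) by simp
 have W0b: "W0 \<in> sets borel" by (simp add: borel_prod[symmetric])
 have W0n: "AE z in lborel2. z \<notin> W0" using W0'(2) by (intro AE_not_in) (simp add: null_sets_def)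
 \<comment> \<open>On almost every line along the diagonal direction the kernel agrees almost everywhere with its Borel version,
  so on such a line its values are limits of averages of the Borel version.\<close>
 have "AE x in lborel. AE y in lborel. (x, y) \<notin> W0" by (rule lborel_pair.AE_pair[OF W0n])
 then have "AE x in lborel. AE z in lborel. (x, x - z) \<notin> W0"
 proof eventually_elim
  case (elim x)
  show ?case using AE_lborel_affine[OF elim, of "-1" x] by simp
 qed
 moreover have "{p \<in> space lborel2. (fst p, fst p - snd p) \<notin> W0} \<in> sets lborel2" by measurable
 ultimately have "AE z in lborel. AE x in lborel. (x, x - z) \<notin> W0" by (subst (asm) lborel_pair.AE_commute) auto
 with d0 have "AE z in lborel. (AE x in lborel. (x, x - z) \<notin> W0) \<and> z \<noteq> 0" by eventually_elim auto
 then obtain Z0 where Z0': "{z \<in> space lborel. \<not> ((AE x in lborel. (x, x - z) \<notin> W0) \<and> z \<noteq> 0)} \<subseteq> Z0"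
  "emeasure lborel Z0 = 0" "Z0 \<in> sets lborel"
  by (rule AE_E)
 have Z0: "(AE x in lborel. (x, x - z) \<notin> W0) \<and> z \<noteq> 0" if "z \<notin> Z0" for z using Z0'(1) that by auto
 have Z0m [measurable]: "Z0 \<in> sets borel" using Z0'(3) by simp
 have Z0n: "AE z in lborel. z \<notin> Z0" using Z0'(2) by (intro AE_not_in) (simp add: null_sets_def)
 \<comment> \<open>Within \<open>\<Omega>\<close> the exceptional set depends on
   \<open>x - y\<close> only: a common translation neither enters nor leaves it, and the Hoelder
   condition survives. For the other pairs a symmetric null set off which the kernel equals its
   Borel version will do.\<close>
 define bad where "bad = (\<lambda>x y. if x \<in> \<Omega> \<and> y \<in> \<Omega> then x - y \<in> Z0 \<or> y - x \<in> Z0 else (x, y) \<in> W0 \<or> (y, x) \<in> W0)"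
 have [measurable]: "\<Omega> \<in> sets borel" using \<Omega> by simp
 have badm: "Measurable.pred borel2 (\<lambda>z. bad (fst z) (snd z))" unfolding bad_def by measurable
 have bad_sym: "bad y x = bad x y" for x y by (auto simp: bad_def)
 have bad_diag: "x \<noteq> y" if "\<not> bad x y" for x y using that W0[of x y] Z0[of "x - y"] by (auto simp: bad_def split: if_splits)
 define K where "K = (\<lambda>x y. if bad x y then lam * norm (x - y) powr p else k x y)"
 define a where "a = (\<lambda>j x y. (LBINT h. indicator (ball 0 (inverse (real (Suc j)))) h * k0 (x + h) (y + h))
   / (unit_ball_vol DIM('a) * inverse (real (Suc j)) ^ DIM('a)))"
 have lim: "(\<lambda>j. a j x y) \<longlonglongrightarrow> k x y" if xy: "x \<in> \<Omega>" "y \<in> \<Omega>" and nb: "\<not> bad x y" for x y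
 proof -
  have ne: "x \<noteq> y" by (rule bad_diag[OF nb])
  have "AE x' in lborel. (x', x' - (x - y)) \<notin> W0" using nb xy Z0[of "x - y"] by (auto simp: bad_def)
  from AE_lborel_affine[OF this, of 1 x] have "AE h in lborel. (x + h, y + h) \<notin> W0" by (simp add: algebra_simps)
  then have eq: "AE h in lborel. k0 (x + h) (y + h) = k (x + h) (y + h)" by eventually_elim (use W0 in auto)
  define \<delta> where "\<delta> = (\<lambda>j. Lam * inverse (real (Suc j)) powr \<sigma> * norm (x - y) powr p)"
  have ij: "inverse (real (Suc j)) \<le> 1" for j by (simp add: field_simps)
  have le: "\<bar>a j x y - k x y\<bar> \<le> \<delta> j" for j
   unfolding a_def
  proof (rule average_error(2))
   show "(\<lambda>h. k0 (x + h) (y + h)) \<in> Borel" by (rule measurable_case_prod_compose[OF k0m]) measurable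
   show "AE h in lborel. h \<in> ball 0 (inverse (real (Suc j))) --> \<bar>k0 (x + h) (y + h) - k x y\<bar> \<le> \<delta> j"
    using eq
   proof (eventually_elim, intro impI)
    fix h :: 'a assume e: "k0 (x + h) (y + h) = k (x + h) (y + h)" and "h \<in> ball 0 (inverse (real (Suc j)))"
    then have h: "norm h < inverse (real (Suc j))" by simp
    have "\<bar>k (x + h) (y + h) - k x y\<bar> \<le> Lam * norm h powr \<sigma> * norm (x - y) powr p"
     using h ij[of j] by (intro hol xy ne) linarith
    also have "\<dots> \<le> \<delta> j" unfolding \<delta>_def using h lam \<sigma> by (intro mult_right_mono mult_left_mono powr_mono2) auto
    finally show "\<bar>k0 (x + h) (y + h) - k x y\<bar> \<le> \<delta> j" using e by simp
   qed
  qed (use lam in \<open>auto simp: \<delta>_def\<close>)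
  have "\<delta> \<longlonglongrightarrow> 0" unfolding \<delta>_def
   by (intro tendsto_mult_left_zero tendsto_mult_right_zero tendsto_zero_powrI[OF LIMSEQ_inverse_real_of_nat tendsto_const _ \<sigma>]) auto
  with always_eventually have "(\<lambda>j. a j x y - k x y) \<longlonglongrightarrow> 0"
   by (rule Lim_null_comparison) (rule allI, unfold real_norm_def, rule le)
  then show ?thesis by (simp add: LIM_zero_iff)
 qed
 show ?thesis
 proof (rule that[of K])
  define g where "g = (\<lambda>j. indicator (ball 0 (inverse (real (Suc j)))) :: 'a => real)"
  have gm [measurable]: "g j \<in> Borel" for j unfolding g_def by (intro borel_measurable_indicator) simp
  have k0a [measurable]: "(\<lambda>x. k0 (fst (fst x) + snd x) (snd (fst x) + snd x)) \<in> borel_measurable ((borel \<Otimes>\<^sub>M borel) \<Otimes>\<^sub>M lborel)"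
   by (rule measurable_case_prod_compose[OF k0m]) measurable
  have k0b [measurable]: "(\<lambda>x. k0 (fst x) (snd x)) \<in> borel_measurable borel2"
   by (rule measurable_case_prod_compose[OF k0m]) measurable
  have ae: "a j x y = (LBINT h. g j h * k0 (x + h) (y + h)) / (unit_ball_vol DIM('a) * inverse (real (Suc j)) ^ DIM('a))" for j x y
   by (simp add: a_def g_def)
  have am [measurable]: "(\<lambda>z. a j (fst z) (snd z)) \<in> borel_measurable borel2" for j
   unfolding ae by measurable
  define b where "b = (\<lambda>j z. if bad (fst z) (snd z) then lam * norm (fst z - snd z) powr p
    else if fst z \<in> \<Omega> \<and> snd z \<in> \<Omega> then a j (fst z) (snd z) else k0 (fst z) (snd z))"
  have bm: "b j \<in> borel_measurable borel2" for j unfolding b_def using badm by measurable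
  have "(\<lambda>j. b j z) \<longlonglongrightarrow> case_prod K z" for z
  proof (cases "bad (fst z) (snd z)")
   case True then show ?thesis by (simp add: b_def K_def split_beta)
  next
   case nb: False
   show ?thesis
   proof (cases "fst z \<in> \<Omega> \<and> snd z \<in> \<Omega>")
    case True then show ?thesis using lim[of "fst z" "snd z"] nb by (simp add: b_def K_def split_beta)
   next
    case False
    then have "k (fst z) (snd z) = k0 (fst z) (snd z)" using nb W0[of "fst z" "snd z"] by (auto simp: bad_def)
    then show ?thesis using nb False by (auto simp: b_def K_def split_beta)
   qed
  qed
  then show "case_prod K \<in> borel_measurable borel2" by (rule borel_measurable_LIMSEQ_real) (rule bm)
  show "K y x = K x y" for x y using sym by (simp add: K_def bad_sym norm_minus_commute)
  show "K x x = 0" for x using bad_diag[of x x] by (auto simp: K_def)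
  show "lam * norm (x - y) powr p \<le> K x y" if "x \<noteq> y" for x y using lower[OF that] by (simp add: K_def)
  show "K x y \<le> Lam * norm (x - y) powr p" if "x \<noteq> y" for x y using upper[OF that] lam by (simp add: K_def mult_right_mono)
  show "\<bar>K (x + h) (y + h) - K x y\<bar> \<le> Lam * norm h powr \<sigma> * norm (x - y) powr p"
   if "x \<in> \<Omega>" "y \<in> \<Omega>" "x + h \<in> \<Omega>" "y + h \<in> \<Omega>" "norm h < 1" "x \<noteq> y" for x y h
  proof -
   have "bad (x + h) (y + h) = bad x y" using that by (simp add: bad_def)
   then show ?thesis using hol[OF that(1,2,5,6)] lam by (simp add: K_def)
  qed
  have n1: "AE z in lborel2. fst z - snd z \<notin> Z0" by (rule AE_lborel_pair_diff[OF Z0n Z0m])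
  have "AE z in lborel. z \<notin> uminus -` Z0" using AE_lborel_affine[OF Z0n, of "-1" 0] by simp
  then have n2: "AE z in lborel2. fst z - snd z \<notin> uminus -` Z0"
   by (rule AE_lborel_pair_diff) (use measurable_sets[of uminus borel borel Z0] in simp)
  show "AE z in lborel2. case_prod K z = case_prod k z"
   using n1 n2 W0n AE_lborel_pair_swap[OF W0n W0b]
   by eventually_elim (auto simp: K_def bad_def)
 qed
qed

lemma lebesgue_cong_AE:
 fixes f g :: "'a::euclidean_space => real"
 assumes g: "g \<in> Borel" and e: "AE x in lborel. f x = g x"
 shows "f \<in> borel_measurable lebesgue" and "integral\<^sup>L lebesgue f = integral\<^sup>L lborel g"
  and "integrable lebesgue f \<longleftrightarrow> integrable lborel g"
proof -
 have gl: "g \<in> borel_measurable lebesgue" using g by (intro measurable_completion) simp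
 have e': "AE x in lebesgue. f x = g x" using e by (rule AE_completion)
 show fl: "f \<in> borel_measurable lebesgue"
 proof (rule measurableI)
  fix A :: "real set" assume "A \<in> sets borel"
  then have "g -` A \<inter> space lebesgue \<in> sets lebesgue" by (rule measurable_sets[OF gl])
  then show "f -` A \<inter> space lebesgue \<in> sets lebesgue"
   by (rule completion.in_sets_AE[rotated]) (use e' in \<open>auto elim!: eventually_mono\<close>)
 qed simp
 show "integral\<^sup>L lebesgue f = integral\<^sup>L lborel g"
  using integral_cong_AE[OF fl gl e'] integral_completion[of g lborel] g by simp
 show "integrable lebesgue f \<longleftrightarrow> integrable lborel g"
  using integrable_cong_AE[OF fl gl e'] integrable_completion[of g lborel] g by simp
qed

lemma AE_lborel_pair_both:
 fixes P :: "'a::euclidean_space => bool"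
 assumes P: "AE x in lborel. P x"
 shows "AE z in lborel2. P (fst z) \<and> P (snd z)"
proof -
 obtain N where N: "{x \<in> space lborel. \<not> P x} \<subseteq> N" "emeasure lborel N = 0" "N \<in> sets lborel" using AE_E[OF P] .
 have [measurable]: "N \<in> sets borel" using N(3) by simp
 have n: "AE x in lborel. x \<notin> N" using N by (intro AE_not_in) (simp add: null_sets_def)
 have "AE z in lborel2. fst z \<notin> N \<and> snd z \<notin> N"
 proof (rule lborel_pair.AE_pair_measure)
  show "{z \<in> space lborel2. fst z \<notin> N \<and> snd z \<notin> N} \<in> sets lborel2" by measurable
  show "AE x in lborel. AE y in lborel. fst (x, y) \<notin> N \<and> snd (x, y) \<notin> N"
   using n by eventually_elim (use n in auto)
 qed
 then show ?thesis by eventually_elim (use N(1) in auto)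
qed

text \<open>Ellipticity makes the kernel comparable to the Riesz kernel, so finite energy is the
  seminorm condition of the Sobolev space.\<close>

lemma energy_integrable_iff:
 fixes v :: "real^'n => real" and k :: "real^'n => real^'n => real"
 assumes v: "v \<in> Borel" and k: "case_prod k \<in> borel_measurable borel2" and lam: "0 < lam"
  and kb: "!!x y. x \<noteq> y ==> lam * norm (x - y) powr (- real CARD('n) - 2 * s) \<le> k x y"
   "!!x y. x \<noteq> y ==> k x y \<le> Lam * norm (x - y) powr (- real CARD('n) - 2 * s)"
 shows "integrable lborel2 (\<lambda>(x, y). (v x - v y)\<^sup>2 * k x y) \<longleftrightarrow>
  integrable lborel (\<lambda>(x, y). (v x - v y)\<^sup>2 / norm (x - y) powr (real CARD('n) + 2 * s))" (is "integrable _ ?f \<longleftrightarrow> integrable _ ?g")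
proof -
 note [measurable] = v measurable_case_prod_compose[OF k]
 have leb: "(lborel :: ((real^'n) \<times> (real^'n)) measure) = lborel2" by (simp add: lborel_prod)
 have m: "?f \<in> borel_measurable lborel2" "?g \<in> borel_measurable lborel2" by measurable
 have ge: "(v x - v y)\<^sup>2 / norm (x - y) powr (real CARD('n) + 2 * s) = (v x - v y)\<^sup>2 * norm (x - y) powr (- real CARD('n) - 2 * s)" for x y
  using powr_minus_divide[of "norm (x - y)" "real CARD('n) + 2 * s"] by simp
 have le: "lam * norm (?g z) \<le> norm (?f z)" "norm (?f z) \<le> Lam * norm (?g z)" for z
 proof -
  obtain x y where z: "z = (x, y)" by (cases z)
  have "lam * norm (?g z) \<le> norm (?f z) \<and> norm (?f z) \<le> Lam * norm (?g z)"
  proof (cases "x = y")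
   case False
   let ?p = "norm (x - y) powr (- real CARD('n) - 2 * s)"
   have "0 \<le> lam * ?p" using lam by simp
   then have k0: "0 \<le> k x y" using kb(1)[OF False] by linarith
   have "(v x - v y)\<^sup>2 * (lam * ?p) \<le> (v x - v y)\<^sup>2 * k x y" "(v x - v y)\<^sup>2 * k x y \<le> (v x - v y)\<^sup>2 * (Lam * ?p)"
    using kb[OF False] by (auto intro: mult_left_mono)
   then show ?thesis using k0 unfolding z prod.case ge by (simp add: abs_mult mult_ac)
  qed (simp add: z)
  then show "lam * norm (?g z) \<le> norm (?f z)" "norm (?f z) \<le> Lam * norm (?g z)" by auto
 qed
 show ?thesis unfolding leb
 proof
  assume f: "integrable lborel2 ?f"
  show "integrable lborel2 ?g"
  proof (rule bochner_bound[OF integrable_mult_right[OF f, of "inverse lam"] m(2) AE_I2])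
   fix z
   show "norm (?g z) \<le> norm (inverse lam * ?f z)" using le(1)[of z] lam by (simp add: abs_mult field_simps)
  qed
 next
  assume g: "integrable lborel2 ?g"
  show "integrable lborel2 ?f"
  proof (rule bochner_bound[OF integrable_mult_right[OF g, of Lam] m(1) AE_I2])
   fix z
   have "Lam * norm (?g z) \<le> \<bar>Lam\<bar> * norm (?g z)" by (intro mult_right_mono) auto
   then show "norm (?f z) \<le> norm (Lam * ?g z)" using le(2)[of z] by (simp add: abs_mult)
  qed
 qed
qed

text \<open>A test function from the Sobolev space is Lebesgue measurable and vanishes almost
  everywhere outside \<open>\<Omega>\<close>. It is replaced by a Borel function vanishing there at
  every point, which changes neither the energy nor the right-hand side.\<close>

lemma weak_solution_of_regularized:
 fixes K :: "real^'n => real^'n => ennreal" and k :: "real^'n => real^'n => real" and u \<psi> :: "real^'n => real"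
 assumes k: "case_prod k \<in> borel_measurable borel2" and lam: "0 < lam"
  and kb: "!!x y. x \<noteq> y ==> lam * norm (x - y) powr (- real CARD('n) - 2 * s) \<le> k x y"
   "!!x y. x \<noteq> y ==> k x y \<le> Lam * norm (x - y) powr (- real CARD('n) - 2 * s)"
  and kK: "AE z in lborel2. case_prod k z = enn2real (case_prod K z)"
  and \<Omega>: "\<Omega> \<in> sets borel" "\<Omega> \<subseteq> ball 0 R0"
  and u: "bbd C u" "!!x. x \<notin> \<Omega> ==> u x = 0" "integrable lborel2 (\<lambda>(x, y). (u x - u y)\<^sup>2 * k x y)"
  and \<psi>: "\<psi> \<in> Borel"
  and weak: "!!v. integrable lborel v ==> (!!x. x \<notin> \<Omega> ==> v x = 0) ==>
   integrable lborel2 (\<lambda>(x, y). (v x - v y)\<^sup>2 * k x y) ==> v \<in> Borel ==>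
   (\<integral>(x, y). (u x - u y) * (v x - v y) * k x y \<partial>lborel2) = (LBINT x. \<psi> x * v x)"
 shows "weak_solution s K \<Omega> \<psi> u"
proof -
 have leb: "(lborel :: ((real^'n) \<times> (real^'n)) measure) = lborel2" by (simp add: lborel_prod)
 note um [measurable] = bbd_measurable[OF u(1)]
 note [measurable] = \<psi> measurable_case_prod_compose[OF k]
 have b2: "borel_measurable (borel :: ((real^'n) \<times> (real^'n)) measure) = borel_measurable borel2"
  by (simp only: borel_prod)
 have sob: "integrable lebesgue (\<lambda>(x, y). (v x - v y)\<^sup>2 / norm (x - y) powr (real CARD('n) + 2 * s)) \<longleftrightarrow>
   integrable lborel2 (\<lambda>(x, y). (w x - w y)\<^sup>2 * k x y)"
  if w: "w \<in> Borel" and vw: "AE x in lborel. v x = w x" for v w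
 proof -
  note [measurable] = w
  have m: "(\<lambda>(x, y). (w x - w y)\<^sup>2 / norm (x - y) powr (real CARD('n) + 2 * s)) \<in> Borel"
   unfolding b2 by measurable
  have e: "AE z in lborel. (case z of (x, y) => (v x - v y)\<^sup>2 / norm (x - y) powr (real CARD('n) + 2 * s))
    = (case z of (x, y) => (w x - w y)\<^sup>2 / norm (x - y) powr (real CARD('n) + 2 * s))"
   unfolding leb using AE_lborel_pair_both[OF vw] by eventually_elim (simp add: split_beta)
  show ?thesis unfolding lebesgue_cong_AE(3)[OF m e] by (rule energy_integrable_iff[OF w k lam kb, symmetric])
 qed
 have u2: "integrable lborel (\<lambda>x. (u x)\<^sup>2)"
 proof (rule bochner_bound[OF integrable_mult_right[OF integrable_ball_indicator[of 0 R0], of "C\<^sup>2"] _ AE_I2])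
  fix x
  have "(u x)\<^sup>2 \<le> C\<^sup>2" using bbd_le[OF u(1), of x] by (simp add: abs_le_square_iff[symmetric])
  then show "norm ((u x)\<^sup>2) \<le> norm (C\<^sup>2 * indicator (ball 0 R0) x)" using u(2)[of x] \<Omega>(2) by (cases "x \<in> \<Omega>") auto
 qed measurable
 have "u \<in> sobolev_H0 s \<Omega>" unfolding sobolev_H0_def sobolev_H_def mem_Collect_eq
  using lebesgue_cong_AE(1)[OF um, of u] lebesgue_cong_AE(3)[of "\<lambda>x. (u x)\<^sup>2" "\<lambda>x. (u x)\<^sup>2"] u2 sob[OF um, of u] u(2,3) by simp
 moreover have "energy K u \<eta> = (LINT x:\<Omega>|lebesgue. \<psi> x * \<eta> x)" if "\<eta> \<in> sobolev_H0 s \<Omega>" for \<eta>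
 proof -
  have et: "\<eta> \<in> borel_measurable lebesgue" "integrable lebesgue (\<lambda>x. (\<eta> x)\<^sup>2)" "AE x in lborel. x \<notin> \<Omega> --> \<eta> x = 0"
   "integrable lebesgue (\<lambda>(x, y). (\<eta> x - \<eta> y)\<^sup>2 / norm (x - y) powr (real CARD('n) + 2 * s))"
   using that by (auto simp: sobolev_H0_def sobolev_H_def AE_completion_iff)
  obtain e0 where e0: "e0 \<in> borel_measurable lborel" "AE x in lborel. \<eta> x = e0 x" using completion_ex_borel_measurable_real[OF et(1)] by blast
  define v where "v = (\<lambda>x. indicator \<Omega> x * e0 x)"
  have vm [measurable]: "v \<in> Borel" unfolding v_def using e0(1) \<Omega>(1) by (intro borel_measurable_times borel_measurable_indicator) auto
  have ev: "AE x in lborel. \<eta> x = v x" using e0(2) et(3) by eventually_elim (auto simp: v_def indicator_def)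
  have v0: "v x = 0" if "x \<notin> \<Omega>" for x using that by (simp add: v_def)
  have "AE x in lborel. (\<eta> x)\<^sup>2 = (v x)\<^sup>2" using ev by eventually_elim simp
  then have v2: "integrable lborel (\<lambda>x. (v x)\<^sup>2)" using et(2) lebesgue_cong_AE(3)[of "\<lambda>x. (v x)\<^sup>2"] by simp
  have vi: "integrable lborel v"
  proof (rule bochner_bound[OF bochner_integrable_add[OF v2 integrable_ball_indicator[of 0 R0]] _ AE_I2])
   fix x
   have "0 \<le> (\<bar>v x\<bar> - 1)\<^sup>2" by simp
   then have "\<bar>v x\<bar> \<le> (v x)\<^sup>2 + 1" using zero_le_power2[of "v x"] unfolding power2_diff power2_abs by simp
   then show "norm (v x) \<le> norm ((v x)\<^sup>2 + indicator (ball 0 R0) x)" using v0[of x] \<Omega>(2) by (cases "x \<in> \<Omega>") auto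
  qed simp
  have ven: "integrable lborel2 (\<lambda>(x, y). (v x - v y)\<^sup>2 * k x y)" using sob[OF vm ev] et(4) by simp
  have fm: "(\<lambda>(x, y). (u x - u y) * (v x - v y) * k x y) \<in> Borel" unfolding b2 by measurable
  have "energy K u \<eta> = (\<integral>(x, y). (u x - u y) * (v x - v y) * k x y \<partial>lborel2)"
   unfolding energy_def leb[symmetric]
  proof (rule lebesgue_cong_AE(2))
   show "AE z in lborel. (case z of (x, y) => (u x - u y) * (\<eta> x - \<eta> y) * enn2real (K x y)) = (case z of (x, y) => (u x - u y) * (v x - v y) * k x y)"
    unfolding leb using AE_lborel_pair_both[OF ev] kK by eventually_elim (simp add: split_beta)
  qed (rule fm)
  also have "\<dots> = (LBINT x. \<psi> x * v x)" by (rule weak[OF vi v0 ven vm])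
  also have "\<dots> = (LINT x:\<Omega>|lebesgue. \<psi> x * \<eta> x)" unfolding set_lebesgue_integral_def
  proof (rule lebesgue_cong_AE(2)[symmetric])
   show "AE x in lborel. indicator \<Omega> x *\<^sub>R (\<psi> x * \<eta> x) = \<psi> x * v x"
    using ev by eventually_elim (use v0 in \<open>auto simp: indicator_def\<close>)
  qed measurable
  finally show ?thesis .
 qed
 ultimately show ?thesis by (simp add: weak_solution_def)
qed

section \<open>The Green function\<close>

context holder_kernel
begin

lemmas solves_iff = solves_def[THEN iffD1]
lemmas solves_iff2 = solves_iff[THEN conjunct2, THEN conjunct2, THEN conjunct2, THEN conjunct2]
lemmas solvesD = solves_iff[THEN conjunct1] solves_iff[THEN conjunct2, THEN conjunct1, rule_format]
 solves_iff[THEN conjunct2, THEN conjunct2, THEN conjunct1, rule_format] solves_iff[THEN conjunct2, THEN conjunct2, THEN conjunct2, THEN conjunct1]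
 solves_iff2[THEN conjunct1] solves_iff2[THEN conjunct2, THEN conjunct1, rule_format]
 solves_iff2[THEN conjunct2, THEN conjunct2, rule_format, THEN conjunct1, rule_format]
 solves_iff2[THEN conjunct2, THEN conjunct2, rule_format, THEN conjunct2, rule_format]

lemma solves_integrable: assumes "solves B \<psi> u" shows "integrable lborel u"
proof (rule bochner_bound[OF integrable_mult_right[OF integrable_ball_indicator[of 0 R0]] _ AE_I2])
 fix x :: 'a
 show "norm (u x) \<le> norm (sup_factor * B * indicator (ball 0 R0) x)"
  using bbd_le[OF solvesD(1)[OF assms], of x] solvesD(3)[OF assms, of x] \<Omega>(2) by (cases "x \<in> \<Omega>") (auto intro: order_trans)
qed (use bbd_measurable[OF solvesD(1)[OF assms]] in simp)

text \<open>Each solution is an admissible test function for the other, and the energy form is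
  symmetric.\<close>

lemma solves_symmetric:
 assumes 1: "solves B1 \<psi>1 u1" and 2: "solves B2 \<psi>2 u2"
 shows "(LBINT x. \<psi>1 x * u2 x) = (LBINT x. \<psi>2 x * u1 x)"
proof -
 have "(\<integral>(x, y). (u1 x - u1 y) * (u2 x - u2 y) * K x y \<partial>lborel2) = (LBINT x. \<psi>1 x * u2 x)"
  by (rule solvesD(6)[OF 1 solves_integrable[OF 2] solvesD(3,5)[OF 2]]) (use bbd_measurable[OF solvesD(1)[OF 2]] in auto)
 moreover have "(\<integral>(x, y). (u2 x - u2 y) * (u1 x - u1 y) * K x y \<partial>lborel2) = (LBINT x. \<psi>2 x * u1 x)"
  by (rule solvesD(6)[OF 2 solves_integrable[OF 1] solvesD(3,5)[OF 1]]) (use bbd_measurable[OF solvesD(1)[OF 1]] in auto)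
 ultimately show ?thesis by (simp add: mult.commute)
qed

text \<open>The uniform probability density on a ball, approximating the point mass at
  \<open>a\<close>.\<close>

definition source :: "'a => real => 'a => real" where
 "source a r x = indicator (ball a r) x / (unit_ball_vol DIM('a) * r ^ DIM('a))"

definition source_bound :: "real => real" where "source_bound r = 1 / (unit_ball_vol DIM('a) * r ^ DIM('a))"

lemma source: assumes "0 < r" shows "bbd (source_bound r) (source a r)" "0 \<le> source a r x" "x \<notin> ball a r ==> source a r x = 0"
proof -
 have V: "0 < unit_ball_vol DIM('a) * r ^ DIM('a)" using assms by simp
 show "bbd (source_bound r) (source a r)"
 proof (rule bbdI)
  show "source a r \<in> Borel" unfolding source_def[abs_def] by (intro borel_measurable_divide borel_measurable_indicator) simp_all
  show "\<bar>source a r x\<bar> \<le> source_bound r" for x using V by (auto simp: source_def source_bound_def indicator_def)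
 qed
 show "0 \<le> source a r x" using V by (simp add: source_def)
qed (simp add: source_def)

lemma source_average:
 assumes u: "u \<in> Borel" and r: "0 < r" "0 \<le> \<delta>" and b: "!!x. x \<in> ball a r ==> \<bar>u x - c\<bar> \<le> \<delta>"
 shows "\<bar>(LBINT x. source a r x * u x) - c\<bar> \<le> \<delta>"
 using average_error(2)[OF u r, of a c] b by (simp add: source_def)

end

locale green_setting = holder_kernel n s lam Lam \<sigma> \<gamma> eps tau0 K \<Omega> R0
 for n s lam Lam \<sigma> \<gamma> eps tau0 :: real and K :: "'a::euclidean_space => 'a => real" and \<Omega> R0 +
 fixes G :: "'a => 'a => ennreal"
 assumes G_measurable: "!!y. y \<in> \<Omega> ==> (\<lambda>x. G x y) \<in> borel_measurable (lebesgue_on \<Omega>)"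
  and G_finite_integral: "!!y. y \<in> \<Omega> ==> (\<integral>\<^sup>+x. G x y \<partial>lebesgue_on \<Omega>) < \<infinity>"
  and G_continuous: "continuous_on {(x, y). x \<in> \<Omega> \<and> y \<in> \<Omega> \<and> x \<noteq> y} (\<lambda>(x, y). G x y)"
  and G_represents: "!!B \<psi> u y. bbd B \<psi> ==> (!!x. 0 \<le> \<psi> x) ==> solves B \<psi> u ==> y \<in> \<Omega> ==>
    u y = (LINT x:\<Omega>|lebesgue. enn2real (G x y) * \<psi> x)"
begin

abbreviation g where "g x y \<equiv> enn2real (G x y)"

text \<open>For fixed \<open>y\<close> the function \<open>G x y\<close> is Lebesgue measurable in
  \<open>x\<close> with values in \<open>[0, \<infinity>]\<close>; finiteness of its integral
  provides a real Borel version, for which the representation becomes an integral over the whole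
  space.\<close>

lemma borel_version:
 assumes y: "y \<in> \<Omega>"
 obtains f where "integrable lborel f" "f \<in> Borel" "AE x in lborel. x \<in> \<Omega> --> f x = g x y"
  "AE x in lborel. x \<in> \<Omega> --> G x y \<noteq> \<infinity>"
  "!!B \<psi> u. bbd B \<psi> ==> (!!x. 0 \<le> \<psi> x) ==> solves B \<psi> u ==> (!!x. x \<notin> \<Omega> ==> \<psi> x = 0) ==> u y = (LBINT x. \<psi> x * f x)"
proof -
 note [measurable] = G_measurable[OF y]
 have om: "\<Omega> \<inter> space lebesgue \<in> sets lebesgue" using \<Omega>(1) by simp
 have "integrable (lebesgue_on \<Omega>) (\<lambda>x. g x y)"
 proof (rule integrableI_bounded)
  have "(\<integral>\<^sup>+x. ennreal (norm (g x y)) \<partial>lebesgue_on \<Omega>) \<le> (\<integral>\<^sup>+x. G x y \<partial>lebesgue_on \<Omega>)"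
   by (intro nn_integral_mono) (simp add: ennreal_enn2real_if)
  then show "(\<integral>\<^sup>+x. ennreal (norm (g x y)) \<partial>lebesgue_on \<Omega>) < \<infinity>" using G_finite_integral[OF y] by (rule le_less_trans)
 qed measurable
 then have i: "integrable lebesgue (\<lambda>x. indicator \<Omega> x *\<^sub>R g x y)" unfolding integrable_restrict_space[OF om] .
 then obtain f where f: "f \<in> borel_measurable lborel" "AE x in lborel. indicator \<Omega> x *\<^sub>R g x y = f x"
  using completion_ex_borel_measurable_real[OF borel_measurable_integrable] by blast
 have fm: "f \<in> Borel" using f(1) by simp
 show ?thesis
 proof (rule that[of f])
  show "integrable lborel f" using i lebesgue_cong_AE(3)[OF fm f(2)] by simp
  show "AE x in lborel. x \<in> \<Omega> --> f x = g x y" using f(2) by eventually_elim auto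
  have "AE x in lebesgue_on \<Omega>. G x y \<noteq> \<infinity>" using G_finite_integral[OF y] by (intro nn_integral_PInf_AE) auto
  then show "AE x in lborel. x \<in> \<Omega> --> G x y \<noteq> \<infinity>" unfolding AE_restrict_space_iff[OF om] AE_completion_iff .
  fix B \<psi> u assume \<psi>: "bbd B \<psi>" "!!x. 0 \<le> \<psi> x" "solves B \<psi> u" and z: "!!x. x \<notin> \<Omega> ==> \<psi> x = 0"
  have "u y = (LINT x:\<Omega>|lebesgue. g x y * \<psi> x)" by (rule G_represents[OF \<psi> y])
  also have "\<dots> = (LBINT x. \<psi> x * f x)" unfolding set_lebesgue_integral_def
  proof (rule lebesgue_cong_AE(2))
   show "AE x in lborel. indicator \<Omega> x *\<^sub>R (g x y * \<psi> x) = \<psi> x * f x" using f(2) by eventually_elim (use z in \<open>auto simp: indicator_def\<close>)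
  qed (intro borel_measurable_times bbd_measurable[OF \<psi>(1)] fm)
  finally show "u y = (LBINT x. \<psi> x * f x)" .
 qed (rule fm)
qed

lemma solution_near_green:
 assumes u: "solves (source_bound r) (source a r) u" and r: "0 < r" "ball a r \<subseteq> \<Omega>" and y: "y \<in> \<Omega>"
  and \<delta>: "0 \<le> \<delta>" "!!x. x \<in> ball a r ==> \<bar>g x y - c\<bar> \<le> \<delta>"
 shows "\<bar>u y - c\<bar> \<le> \<delta>"
proof (rule borel_version[OF y])
 fix f assume f: "f \<in> Borel" "AE x in lborel. x \<in> \<Omega> --> f x = g x y"
  and rep: "!!B \<psi> u. bbd B \<psi> ==> (!!x. 0 \<le> \<psi> x) ==> solves B \<psi> u ==> (!!x. x \<notin> \<Omega> ==> \<psi> x = 0) ==> u y = (LBINT x. \<psi> x * f x)"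
 have z: "source a r x = 0" if "x \<notin> \<Omega>" for x by (rule source(3)) (use that r in auto)
 have "u y = (LBINT x. source a r x * f x)" by (rule rep[OF source(1,2)[OF r(1)] u z])
 moreover have "AE x in lborel. x \<in> ball a r --> \<bar>f x - c\<bar> \<le> \<delta>" using f(2) by eventually_elim (use \<delta>(2) r(2) in auto)
 ultimately show ?thesis using average_error(2)[OF f(1) r(1) \<delta>(1)] by (simp add: source_def)
qed

text \<open>A comparison that makes sense before \<open>G\<close> is known to be finite off the
  diagonal, because the lower bound is imposed in the extended half-line.\<close>

lemma solution_ge_green:
 assumes u: "solves (source_bound r) (source a r) u" and r: "0 < r" "ball a r \<subseteq> \<Omega>" and y: "y \<in> \<Omega>"
  and c: "0 \<le> c" "!!x. x \<in> ball a r ==> ennreal c \<le> G x y"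
 shows "c \<le> u y"
proof (rule borel_version[OF y])
 let ?V = "unit_ball_vol DIM('a) * r ^ DIM('a)"
 have V: "0 < ?V" using r by simp
 fix f assume f: "integrable lborel f" "f \<in> Borel" "AE x in lborel. x \<in> \<Omega> --> f x = g x y" "AE x in lborel. x \<in> \<Omega> --> G x y \<noteq> \<infinity>"
  and rep: "!!B \<psi> u. bbd B \<psi> ==> (!!x. 0 \<le> \<psi> x) ==> solves B \<psi> u ==> (!!x. x \<notin> \<Omega> ==> \<psi> x = 0) ==> u y = (LBINT x. \<psi> x * f x)"
 have z: "source a r x = 0" if "x \<notin> \<Omega>" for x by (rule source(3)) (use that r in auto)
 have "u y = (LBINT x. source a r x * f x)" by (rule rep[OF source(1,2)[OF r(1)] u z])
 moreover have "(LBINT x. c * source a r x) \<le> (LBINT x. source a r x * f x)"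
 proof (rule integral_mono_AE)
  have "integrable lborel (source a r)" unfolding source_def[abs_def] by (intro integrable_divide_zero integrable_ball_indicator)
  then show "integrable lborel (\<lambda>x. c * source a r x)" by simp
  show "integrable lborel (\<lambda>x. source a r x * f x)" using bbd_integrable(1)[OF f(1) source(1)[OF r(1)], of a 0] by (simp add: mult.commute)
  show "AE x in lborel. c * source a r x \<le> source a r x * f x" using f(3,4)
  proof eventually_elim
   case (elim x)
   show ?case
   proof (cases "x \<in> ball a r")
    case True
    then have "ennreal c \<le> ennreal (g x y)" using c(2)[OF True] elim r(2) by (simp add: ennreal_enn2real_if subset_eq)
    then have "c \<le> f x" using elim True r(2) c(1) by (auto simp: ennreal_le_iff)
    from mult_right_mono[OF this source(2)[OF r(1)]] show ?thesis by (simp add: mult.commute)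
   qed (simp add: source(3)[OF r(1)])
  qed
 qed
 moreover have "(LBINT x. c * source a r x) = c"
  using integral_ball_indicator[of r a] r(1) less_imp_neq[OF unit_ball_vol_pos[of "real DIM('a)"]] by (simp add: source_def)
 ultimately show ?thesis by (simp only:)
qed

lemma Omega_bounds:
 assumes "y \<in> \<Omega>" "0 < e"
 obtains R where "0 < R" "Lam * R powr \<sigma> \<le> eps" "8 * R < 1" "R \<le> e" "ball y (17 * R) \<subseteq> \<Omega>"
proof -
 obtain d where d: "0 < d" "ball y d \<subseteq> \<Omega>" using \<Omega>(1) assms open_contains_ball by blast
 have L: "0 < Lam" using params by simp
 define R where "R = min (min ((eps / Lam) powr (1 / \<sigma>)) (1 / 16)) (min e (d / 17))"
 have R: "0 < R" using eps L assms d by (simp add: R_def)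
 have "R powr \<sigma> \<le> ((eps / Lam) powr (1 / \<sigma>)) powr \<sigma>" using R sig by (intro powr_mono2) (auto simp: R_def)
 also have "\<dots> = eps / Lam" using sig eps L by (simp add: powr_powr)
 finally have "Lam * R powr \<sigma> \<le> eps" using L by (simp add: field_simps)
 moreover have "8 * R < 1" "R \<le> e" "17 * R \<le> d" by (auto simp: R_def min_def)
 ultimately show ?thesis using that[of R] R d(2) subset_ball[of "17 * R" d y] by auto
qed

lemma solution_exists: "0 < r ==> \<exists>u. solves (source_bound r) (source a r) u"
 by (rule solution) (rule source, assumption, rule source)

text \<open>If the Green function were infinite somewhere, then by Harnack's inequality the solutions with
 concentrating sources would have unbounded mass; by symmetry the mass is the average of the torsion function.\<close>

lemma G_finite:
 assumes x0: "x0 \<in> \<Omega>" and y0: "y0 \<in> \<Omega>" and ne: "x0 \<noteq> y0"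
 shows "G x0 y0 < \<infinity>"
proof (rule ccontr)
 assume "\<not> G x0 y0 < \<infinity>"
 then have inf: "G x0 y0 = \<infinity>" by (metis infinity_ennreal_def top.not_eq_extremum)
 obtain R where R: "0 < R" "Lam * R powr \<sigma> \<le> eps" "8 * R < 1" "R \<le> dist x0 y0 / 3" "ball y0 (17 * R) \<subseteq> \<Omega>"
  using Omega_bounds[OF y0, of "dist x0 y0 / 3"] ne by auto
 define V where "V = unit_ball_vol DIM('a) * (R / 16) ^ DIM('a)"
 have V: "0 < V" using R by (simp add: V_def)
 \<comment> \<open>Chosen so that \<open>N * V\<close> exceeds
   \<open>\<bar>hk\<bar> * \<bar>sup_factor\<bar>\<close>, the upper bound which Harnack's
   inequality and symmetry will give for it.\<close>
 define N where "N = \<bar>hk\<bar> * \<bar>sup_factor\<bar> / V + 1"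
 have N: "0 < N" using V by (simp add: N_def add_nonneg_pos)
 have "continuous_on (\<Omega> - {y0}) (\<lambda>x. G x y0)"
  using continuous_on_compose2[OF G_continuous, of "\<Omega> - {y0}" "\<lambda>x. (x, y0)"] y0 by (force intro!: continuous_intros)
 then have "((\<lambda>x. G x y0) \<longlongrightarrow> G x0 y0) (at x0)"
  using x0 ne \<Omega>(1) by (simp add: continuous_on_eq_continuous_at open_delete isCont_def)
 then have "\<forall>\<^sub>F x in at x0. ennreal N < G x y0" by (rule order_tendstoD(1)) (simp add: inf)
 then obtain r1 where r1: "0 < r1" "!!x. x \<noteq> x0 ==> dist x x0 < r1 ==> ennreal N < G x y0" unfolding eventually_at by auto
 obtain r2 where r2: "0 < r2" "ball x0 r2 \<subseteq> \<Omega>" using \<Omega>(1) x0 open_contains_ball by blast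
 define r where "r = min R (min r1 r2)"
 have r: "0 < r" "r \<le> R" "r \<le> r1" "ball x0 r \<subseteq> \<Omega>" using R r1(1) r2 by (auto simp: r_def)
 obtain u where u: "solves (source_bound r) (source x0 r) u" using solution_exists[OF r(1)] by blast
 have uN: "N \<le> u y0"
 proof (rule solution_ge_green[OF u r(1,4) y0])
  fix x assume "x \<in> ball x0 r"
  then show "ennreal N \<le> G x y0" using r1(2)[of x] r(3) inf by (cases "x = x0") (auto simp: dist_commute less_imp_le)
 qed (use N in simp)
 have har: "u y0 \<le> \<bar>hk\<bar> * u z" if z: "z \<in> ball y0 (R / 16)" for z
 proof -
  have "u y0 \<le> hk * u z"
  proof (rule solvesD(7)[OF u R(1-3)])
   show "ball z (16 * R) \<subseteq> \<Omega>"
   proof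
    fix x assume "x \<in> ball z (16 * R)"
    then have "x \<in> ball y0 (17 * R)" using z R(1) dist_triangle[of y0 x z] by auto
    then show "x \<in> \<Omega>" using R(5) by auto
   qed
   fix x assume x: "x \<in> ball z R"
   show "source x0 r x = 0"
   proof (rule source(3)[OF r(1)], rule notI)
    assume "x \<in> ball x0 r"
    then show False using x z r(2) R(1,4) dist_triangle[of x0 y0 x] dist_triangle[of x y0 z] by (auto simp: dist_commute)
   qed
  qed (use z in \<open>simp add: dist_commute\<close>)
  also have "\<dots> \<le> \<bar>hk\<bar> * u z" using solvesD(2)[OF u, of z] by (intro mult_right_mono) auto
  finally show ?thesis .
 qed
 have om: "\<Omega> \<in> sets borel" using \<Omega>(1) by simp
 have b1: "bbd 1 (indicator \<Omega> :: 'a => real)" using om by (intro bbdI borel_measurable_indicator) (auto simp: indicator_def)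
 obtain \<phi> where \<phi>: "solves 1 (indicator \<Omega>) \<phi>" using solution[OF b1] by auto
 have si: "integrable lborel (source x0 r)" unfolding source_def[abs_def] by (intro integrable_divide_zero integrable_ball_indicator)
 have ui: "integrable lborel (\<lambda>x. indicator \<Omega> x * u x)"
  using bbd_integrable(1)[OF solves_integrable[OF u] b1, of 0] by (simp add: mult.commute)
 have "N * V = (LBINT x. N * indicator (ball y0 (R / 16)) x)"
  using integral_ball_indicator[of "R / 16" y0] R(1) by (simp add: V_def)
 also have "\<dots> \<le> (LBINT x. \<bar>hk\<bar> * (indicator \<Omega> x * u x))"
 proof (rule integral_mono)
  fix x
  show "N * indicator (ball y0 (R / 16)) x \<le> \<bar>hk\<bar> * (indicator \<Omega> x * u x)"
  proof (cases "x \<in> ball y0 (R / 16)")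
   case True
   then have "x \<in> ball y0 (17 * R)" using R(1) by auto
   then have "x \<in> \<Omega>" using R(5) by auto
   then show ?thesis using True uN har[OF True] by simp
  qed (use solvesD(2)[OF u, of x] in simp)
 qed (intro integrable_mult_right ui integrable_ball_indicator)+
 also have "\<dots> = \<bar>hk\<bar> * (LBINT x. source x0 r x * \<phi> x)" using solves_symmetric[OF \<phi> u] by simp
 also have "(LBINT x. source x0 r x * \<phi> x) \<le> \<bar>sup_factor\<bar>"
 proof -
  have "(LBINT x. source x0 r x * \<phi> x) \<le> (LBINT x. sup_factor * source x0 r x)"
  proof (rule integral_mono)
   show "integrable lborel (\<lambda>x. source x0 r x * \<phi> x)" using bbd_integrable(1)[OF si solvesD(1)[OF \<phi>], of 0] by simp
   fix x show "source x0 r x * \<phi> x \<le> sup_factor * source x0 r x"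
    using bbd_le[OF solvesD(1)[OF \<phi>], of x] source(2)[OF r(1), of x0 x] by (subst mult.commute) (auto intro!: mult_right_mono)
  qed (intro integrable_mult_right si)
  also have "\<dots> = sup_factor" using integral_ball_indicator[of r x0] r(1) less_imp_neq[OF unit_ball_vol_pos[of "real DIM('a)"]] by (simp add: source_def)
  finally show ?thesis by simp
 qed
 finally have "N * V \<le> \<bar>hk\<bar> * \<bar>sup_factor\<bar>" by (simp add: mult_left_mono)
 moreover have "N * V = \<bar>hk\<bar> * \<bar>sup_factor\<bar> + V" using V by (simp add: N_def field_simps)
 ultimately show False using V by simp
qed

lemma g_near:
 assumes x0: "x0 \<in> \<Omega>" and y0: "y0 \<in> \<Omega>" and ne: "x0 \<noteq> y0" and e: "0 < e"
 shows "\<exists>r>0. ball x0 r \<subseteq> \<Omega> \<and> ball y0 r \<subseteq> \<Omega> \<and> (\<forall>x\<in>ball x0 r. \<forall>y\<in>ball y0 r. \<bar>g x y - g x0 y0\<bar> \<le> e)"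
proof -
 let ?D = "{(x, y). x \<in> \<Omega> \<and> y \<in> \<Omega> \<and> x \<noteq> y}"
 have "?D = (\<Omega> \<times> \<Omega>) \<inter> {p. fst p \<noteq> snd p}" by auto
 moreover have "open {p :: 'a \<times> 'a. fst p \<noteq> snd p}" by (intro open_Collect_neq continuous_intros)
 ultimately have D: "open ?D" using \<Omega>(1) by (auto intro!: open_Int open_Times)
 have "isCont (\<lambda>(x, y). G x y) (x0, y0)" using G_continuous x0 y0 ne continuous_on_eq_continuous_at[OF D] by blast
 then have "((\<lambda>p. G (fst p) (snd p)) \<longlongrightarrow> G x0 y0) (nhds (x0, y0))"
  using tendsto_at_iff_tendsto_nhds[of "\<lambda>p. G (fst p) (snd p)" "(x0, y0)"] by (simp add: isCont_def split_beta')
 moreover have "G x0 y0 = ennreal (g x0 y0)" using G_finite[OF x0 y0 ne] by simp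
 ultimately have "((\<lambda>p. g (fst p) (snd p)) \<longlongrightarrow> g x0 y0) (nhds (x0, y0))" by (intro tendsto_enn2real) simp_all
 from tendstoD[OF this e] have "\<forall>\<^sub>F p in nhds (x0, y0). dist (g (fst p) (snd p)) (g x0 y0) < e" .
 moreover have "\<forall>\<^sub>F p in nhds (x0, y0). p \<in> ?D" using D x0 y0 ne by (intro eventually_nhds_in_open) auto
 ultimately have "\<forall>\<^sub>F p in nhds (x0, y0). p \<in> ?D \<and> dist (g (fst p) (snd p)) (g x0 y0) < e" by eventually_elim auto
 then obtain S where S: "open S" "(x0, y0) \<in> S" "!!p. p \<in> S ==> p \<in> ?D \<and> dist (g (fst p) (snd p)) (g x0 y0) < e"
  unfolding eventually_nhds by auto
 obtain A B where AB: "open A" "open B" "x0 \<in> A" "y0 \<in> B" "A \<times> B \<subseteq> S" using open_prod_elim[OF S(1,2)] by (metis mem_Sigma_iff)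
 obtain r1 where r1: "0 < r1" "ball x0 r1 \<subseteq> A" using AB open_contains_ball by blast
 obtain r2 where r2: "0 < r2" "ball y0 r2 \<subseteq> B" using AB open_contains_ball by blast
 have *: "x \<in> \<Omega> \<and> y \<in> \<Omega> \<and> \<bar>g x y - g x0 y0\<bar> \<le> e" if "x \<in> ball x0 (min r1 r2)" "y \<in> ball y0 (min r1 r2)" for x y
 proof -
  have "x \<in> A" "y \<in> B" using that r1(2) r2(2) by auto
  then have "(x, y) \<in> S" using AB(5) by auto
  from S(3)[OF this] show ?thesis by (simp add: dist_real_def)
 qed
 show ?thesis
 proof (intro exI[of _ "min r1 r2"] conjI subsetI ballI)
  show "0 < min r1 r2" using r1(1) r2(1) by simp
  then have c: "x0 \<in> ball x0 (min r1 r2)" "y0 \<in> ball y0 (min r1 r2)" by auto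
  show "z \<in> \<Omega>" if "z \<in> ball x0 (min r1 r2)" for z using *[OF that c(2)] by blast
  show "z \<in> \<Omega>" if "z \<in> ball y0 (min r1 r2)" for z using *[OF c(1) that] by blast
 qed (use * in blast)
qed

text \<open>The mean over a ball at \<open>y0\<close> of the solution with source at
  \<open>x0\<close> equals the mean over a ball at \<open>x0\<close> of the solution with source at
  \<open>y0\<close>. As the balls shrink, these means tend to the two values of
  \<open>g\<close>.\<close>

lemma g_symmetric:
 assumes x0: "x0 \<in> \<Omega>" and y0: "y0 \<in> \<Omega>" and ne: "x0 \<noteq> y0"
 shows "g x0 y0 = g y0 x0"
proof -
 have "\<bar>g x0 y0 - g y0 x0\<bar> \<le> 2 * e" if e: "0 < e" for e
 proof -
  obtain r1 where r1: "0 < r1" "ball x0 r1 \<subseteq> \<Omega>" "ball y0 r1 \<subseteq> \<Omega>" "\<forall>x\<in>ball x0 r1. \<forall>y\<in>ball y0 r1. \<bar>g x y - g x0 y0\<bar> \<le> e"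
   using g_near[OF x0 y0 ne e] by (elim exE conjE)
  obtain r2 where r2: "0 < r2" "\<forall>x\<in>ball y0 r2. \<forall>y\<in>ball x0 r2. \<bar>g x y - g y0 x0\<bar> \<le> e"
   using g_near[OF y0 x0 ne[symmetric] e] by (elim exE conjE)
  define r where "r = min r1 r2"
  have r: "0 < r" using r1(1) r2(1) by (simp add: r_def)
  have bb: "ball x0 r \<subseteq> \<Omega>" "ball y0 r \<subseteq> \<Omega>" using r1(2,3) by (auto simp: r_def)
  obtain u1 where u1: "solves (source_bound r) (source x0 r) u1" using solution_exists[OF r] by blast
  obtain u2 where u2: "solves (source_bound r) (source y0 r) u2" using solution_exists[OF r] by blast
  have "\<bar>u1 y - g x0 y0\<bar> \<le> e" if "y \<in> ball y0 r" for y
   by (rule solution_near_green[OF u1 r bb(1)]) (use that bb(2) e r1(4) in \<open>auto simp: r_def\<close>)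
  then have 1: "\<bar>(LBINT x. source y0 r x * u1 x) - g x0 y0\<bar> \<le> e"
   by (intro source_average[OF bbd_measurable[OF solvesD(1)[OF u1]] r]) (use e in auto)
  have "\<bar>u2 y - g y0 x0\<bar> \<le> e" if "y \<in> ball x0 r" for y
   by (rule solution_near_green[OF u2 r bb(2)]) (use that bb(1) e r2(2) in \<open>auto simp: r_def\<close>)
  then have 2: "\<bar>(LBINT x. source x0 r x * u2 x) - g y0 x0\<bar> \<le> e"
   by (intro source_average[OF bbd_measurable[OF solvesD(1)[OF u2]] r]) (use e in auto)
  show ?thesis using 1 2 solves_symmetric[OF u1 u2] by linarith
 qed
 from this[of "\<bar>g x0 y0 - g y0 x0\<bar> / 4"] show ?thesis by (cases "g x0 y0 = g y0 x0") auto
qed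

text \<open>The value \<open>u j y\<close> is a mean of \<open>g x y\<close> over \<open>x\<close>
  near \<open>x0\<close>. Concentrating the source in the first argument thus gives access to
  \<open>G\<close> as a function of the second.\<close>

lemma green_limit:
 assumes x0: "x0 \<in> \<Omega>" and R: "0 < R"
 obtains r u where "!!j::nat. 0 < r j" "!!j. r j \<le> R" "!!j. solves (source_bound (r j)) (source x0 (r j)) (u j)"
  "!!y. y \<in> \<Omega> ==> y \<noteq> x0 ==> (\<lambda>j. u j y) \<longlonglongrightarrow> g x0 y"
proof -
 obtain d where d: "0 < d" "ball x0 d \<subseteq> \<Omega>" using \<Omega>(1) x0 open_contains_ball by blast
 define r where "r = (\<lambda>j. min R d * inverse (real (Suc j)))"
 have m: "0 < min R d" using R d by simp
 have r: "0 < r j" "r j \<le> min R d" for j using m by (auto simp: r_def field_simps simp del: min_less_iff_conj min.bounded_iff)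
 have bb: "ball x0 (r j) \<subseteq> \<Omega>" for j using r[of j] d(2) subset_ball[of "r j" d x0] by auto
 have "\<forall>j. \<exists>u. solves (source_bound (r j)) (source x0 (r j)) u" using solution_exists r by blast
 then obtain u where u: "!!j. solves (source_bound (r j)) (source x0 (r j)) (u j)" by metis
 have r0: "r \<longlonglongrightarrow> 0" unfolding r_def by (intro tendsto_mult_right_zero LIMSEQ_inverse_real_of_nat)
 show ?thesis
 proof (rule that[of r u])
  fix y assume y: "y \<in> \<Omega>" "y \<noteq> x0"
  show "(\<lambda>j. u j y) \<longlonglongrightarrow> g x0 y"
  proof (rule tendstoI)
   fix e :: real assume e: "0 < e"
   then have e2: "0 < e / 2" by simp
   obtain q where q: "0 < q" "\<forall>x\<in>ball x0 q. \<forall>z\<in>ball y q. \<bar>g x z - g x0 y\<bar> \<le> e / 2"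
    using g_near[OF x0 y(1) y(2)[symmetric] e2] by (elim exE conjE)
   show "\<forall>\<^sub>F j in sequentially. dist (u j y) (g x0 y) < e"
    using order_tendstoD(2)[OF r0 q(1)]
   proof eventually_elim
    case (elim j)
    have "\<bar>u j y - g x0 y\<bar> \<le> e / 2" by (rule solution_near_green[OF u r(1) bb y(1)]) (use e q elim in auto)
    then show ?case using e by (simp add: dist_real_def)
   qed
  qed
 qed (use r u in auto)
qed

text \<open>The inequalities persist under pointwise limits. The sources have radius at most
  \<open>R\<close>, so \<open>2 * R \<le> dist x0 y0\<close> keeps them off the ball of radius
  \<open>R\<close> around \<open>y0\<close>.\<close>

lemma green_estimates:
 assumes x0: "x0 \<in> \<Omega>" and R: "0 < R" "Lam * R powr \<sigma> \<le> eps" "8 * R < 1" "ball y0 (16 * R) \<subseteq> \<Omega>" and far: "2 * R \<le> dist x0 y0"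
 shows "dist y0 z < R / 16 ==> g x0 z \<le> hk * g x0 y0"
  and "norm (x - y0) + 2 * norm h \<le> R / 192 ==> \<bar>g x0 (x + 2 *\<^sub>R h) - 2 * g x0 (x + h) + g x0 x\<bar>
    \<le> dk * g x0 y0 * (norm h / R) powr (\<gamma> + \<sigma>)"
proof -
 obtain r u where r: "!!j::nat. 0 < r j" "!!j. r j \<le> R" and u: "!!j. solves (source_bound (r j)) (source x0 (r j)) (u j)"
  and lim: "!!y. y \<in> \<Omega> ==> y \<noteq> x0 ==> (\<lambda>j. u j y) \<longlonglongrightarrow> g x0 y" using green_limit[OF x0 R(1)] by blast
 have z: "source x0 (r j) x = 0" if "x \<in> ball y0 R" for j x
  by (rule source(3)[OF r(1)]) (use that far r(2)[of j] dist_triangle[of x0 y0 x] in \<open>auto simp: dist_commute\<close>)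
 have lim': "(\<lambda>j. u j y) \<longlonglongrightarrow> g x0 y" if "dist y0 y < R" for y
  using that R(1,4) far by (intro lim) (auto simp: subset_eq dist_commute)
 have l0: "(\<lambda>j. u j y0) \<longlonglongrightarrow> g x0 y0" using R by (intro lim') simp
 show "g x0 z \<le> hk * g x0 y0" if "dist y0 z < R / 16"
  by (rule LIMSEQ_le[OF lim' tendsto_mult_left[OF l0]]) (use that R solvesD(7)[OF u R z] in auto)
 show "\<bar>g x0 (x + 2 *\<^sub>R h) - 2 * g x0 (x + h) + g x0 x\<bar> \<le> dk * g x0 y0 * (norm h / R) powr (\<gamma> + \<sigma>)"
  if x: "norm (x - y0) + 2 * norm h \<le> R / 192"
 proof (rule LIMSEQ_le)
  have "dist y0 (x + t *\<^sub>R h) < R" if "0 \<le> t" "t \<le> 2" for t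
  proof -
   have "dist y0 (x + t *\<^sub>R h) \<le> norm (x - y0) + t * norm h"
    using norm_triangle_ineq[of "x - y0" "t *\<^sub>R h"] that by (simp add: dist_norm norm_minus_commute algebra_simps)
   also have "t * norm h \<le> 2 * norm h" using that by (intro mult_right_mono) auto
   finally show ?thesis using x R(1) by simp
  qed
  from lim'[OF this[of 0]] lim'[OF this[of 1]] lim'[OF this[of 2]]
  show "(\<lambda>j. \<bar>u j (x + 2 *\<^sub>R h) - 2 * u j (x + h) + u j x\<bar>) \<longlonglongrightarrow> \<bar>g x0 (x + 2 *\<^sub>R h) - 2 * g x0 (x + h) + g x0 x\<bar>"
   by (intro tendsto_intros) simp_all
  show "(\<lambda>j. dk * u j y0 * (norm h / R) powr (\<gamma> + \<sigma>)) \<longlonglongrightarrow>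
    dk * g x0 y0 * (norm h / R) powr (\<gamma> + \<sigma>)" by (intro tendsto_intros l0)
 qed (use solvesD(8)[OF u R z x] in auto)
qed

end

definition gradient_constant :: "real => real => real => real => real => real => real => real => real" where
 "gradient_constant n s lam Lam \<sigma> \<gamma> eps tau0 = 192 * (\<bar>harnack_constant n s lam Lam \<gamma> tau0\<bar> + 1)
   + \<bar>difference_constant n s lam Lam \<sigma> \<gamma> eps tau0\<bar> / (1 - 2 powr - (\<gamma> + \<sigma> - 1)) * (1 / 192) powr (\<gamma> + \<sigma> - 1)"

text \<open>The estimates concern the second argument with the pole in the first; since
  \<open>G\<close> is symmetric off the diagonal, they yield the gradient in the first argument.
  Harnack's inequality bounds the oscillation that enters the gradient bound.\<close>

lemma (in green_setting) green_gradient: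
 assumes gs: "1 < \<gamma> + \<sigma>" and y: "y \<in> \<Omega>" and R: "0 < R" "Lam * R powr \<sigma> \<le> eps" "8 * R < 1" "ball x (16 * R) \<subseteq> \<Omega>" and far: "2 * R \<le> dist x y"
 shows "\<exists>D. GDERIV (\<lambda>x'. g x' y) x :> D \<and> norm D \<le> gradient_constant n s lam Lam \<sigma> \<gamma> eps tau0 / R * g x y"
proof -
 note est = green_estimates[OF y R far[folded dist_commute[of y]]]
 have x: "x \<in> \<Omega>" "x \<noteq> y" using R far by auto
 define C where "C = \<bar>dk\<bar> * g y x * R powr - (\<gamma> + \<sigma>)"
 have "\<exists>D. GDERIV (g y) x :> D \<and> norm D \<le> (\<bar>hk\<bar> + 1) * g y x / (R / 192) + C / (1 - 2 powr - (\<gamma> + \<sigma> - 1)) * (R / 192) powr (\<gamma> + \<sigma> - 1)"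
 proof (rule gradient_of_second_differences)
  fix z assume "norm (z - x) \<le> R / 192"
  then have "g y z \<le> hk * g y x" using R(1) by (intro est(1)) (simp add: dist_norm norm_minus_commute)
  also have "\<dots> \<le> \<bar>hk\<bar> * g y x" by (intro mult_right_mono) auto
  finally show "\<bar>g y z - g y x\<bar> \<le> (\<bar>hk\<bar> + 1) * g y x"
   using enn2real_nonneg[of "G y z"] enn2real_nonneg[of "G y x"] mult_nonneg_nonneg[OF abs_ge_zero[of hk] enn2real_nonneg[of "G y x"]]
   unfolding distrib_right by linarith
 next
  fix z h :: 'a assume "norm (z - x) + 2 * norm h \<le> R / 192"
  from est(2)[OF this] have "\<bar>g y (z + 2 *\<^sub>R h) - 2 * g y (z + h) + g y z\<bar> \<le> dk * g y x * (norm h / R) powr (\<gamma> + \<sigma>)" .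
  also have "\<dots> \<le> \<bar>dk\<bar> * g y x * (norm h / R) powr (\<gamma> + \<sigma>)" by (intro mult_right_mono) auto
  also have "\<dots> = C * norm h powr (1 + (\<gamma> + \<sigma> - 1))" using R(1) powr_minus_divide[of R "\<gamma> + \<sigma>"] unfolding C_def by (simp add: powr_divide)
  finally show "\<bar>g y (z + 2 *\<^sub>R h) - 2 * g y (z + h) + g y z\<bar> \<le> C * norm h powr (1 + (\<gamma> + \<sigma> - 1))" .
 qed (use gs R in \<open>auto simp: C_def\<close>)
 then obtain D where D: "GDERIV (g y) x :> D"
  "norm D \<le> (\<bar>hk\<bar> + 1) * g y x / (R / 192) + C / (1 - 2 powr - (\<gamma> + \<sigma> - 1)) * (R / 192) powr (\<gamma> + \<sigma> - 1)" by blast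
 have sy: "g x y = g y x" by (rule g_symmetric[OF x(1) y x(2)])
 have "R powr - (\<gamma> + \<sigma>) * (R / 192) powr (\<gamma> + \<sigma> - 1) = (1 / 192) powr (\<gamma> + \<sigma> - 1) / R"
 proof -
  have e1: "(R / 192) powr (\<gamma> + \<sigma> - 1) = R powr (\<gamma> + \<sigma> - 1) * (1 / 192) powr (\<gamma> + \<sigma> - 1)"
   using R(1) by (subst powr_mult[symmetric]) auto
  have e2: "R powr - (\<gamma> + \<sigma>) * R powr (\<gamma> + \<sigma> - 1) = 1 / R"
   using R(1) by (simp add: powr_add[symmetric] powr_minus_divide)
  show ?thesis unfolding e1 mult.assoc[symmetric] e2 by simp
 qed
 moreover have "a * q * P / A * Q = a / A * (P * Q) * q" for a q P A Q :: real by simp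
 ultimately have "C / (1 - 2 powr - (\<gamma> + \<sigma> - 1)) * (R / 192) powr (\<gamma> + \<sigma> - 1)
   = \<bar>dk\<bar> / (1 - 2 powr - (\<gamma> + \<sigma> - 1)) * ((1 / 192) powr (\<gamma> + \<sigma> - 1) / R) * g y x"
  unfolding C_def by presburger
 then have "norm D \<le> gradient_constant n s lam Lam \<sigma> \<gamma> eps tau0 / R * g x y"
  using D(2) unfolding sy gradient_constant_def by (simp add: add_divide_distrib algebra_simps)
 moreover have "GDERIV (\<lambda>x'. g x' y) x :> D" unfolding gderiv_def
 proof (rule has_derivative_transform_within_open[OF D(1)[unfolded gderiv_def]])
  show "open (\<Omega> - {y})" using \<Omega>(1) by (rule open_delete)
  show "g y x' = g x' y" if "x' \<in> \<Omega> - {y}" for x' using that y g_symmetric[of x' y] by auto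
 qed (use x in auto)
 ultimately show ?thesis by blast
qed

section \<open>Choice of the parameters and conclusion\<close>

lemma kernel_params_exist:
 fixes n s lam Lam \<sigma> :: real
 assumes p: "1 / 2 < s" "s < 1" "2 * s < n" "0 < lam" "lam \<le> Lam" and \<sigma>: "0 < \<sigma>"
 obtains \<sigma>' \<gamma> eps tau0 where "kernel_params n s lam Lam \<sigma>' \<gamma> eps tau0" "0 < \<sigma>'" "\<sigma>' \<le> \<sigma>" "1 < \<gamma> + \<sigma>'"
proof -
 \<comment> \<open>With \<open>\<gamma> = 1 - \<sigma>' / 2\<close> the sum
   \<open>\<gamma> + \<sigma>'\<close> exceeds 1 by \<open>\<sigma>' / 2\<close>. The bounds after
   \<open>\<sigma>\<close> guarantee, in this order, \<open>\<sigma>' \<le> \<gamma>\<close>,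
   \<open>2 * s - 1 < \<gamma>\<close> and, by \<open>s > 1 / 2\<close>,
   \<open>\<gamma> + \<sigma>' \<le> 2 * s\<close>. The Hoelder exponent may be lowered as only
   \<open>norm h < 1\<close> occurs.\<close>
 define \<sigma>' where "\<sigma>' = min (min \<sigma> (1 / 2)) (min (2 * (1 - s)) (2 * (2 * s - 1)))"
 have \<sigma>': "0 < \<sigma>'" "\<sigma>' \<le> \<sigma>" "\<sigma>' \<le> 1 / 2" "\<sigma>' \<le> 2 * (1 - s)" "\<sigma>' \<le> 2 * (2 * s - 1)"
  unfolding \<sigma>'_def min_less_iff_conj using p \<sigma> by (auto intro: min.coboundedI1 min.coboundedI2 simp del: right_diff_distrib_numeral)
 define \<gamma> where "\<gamma> = 1 - \<sigma>' / 2"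
 define c1 where "c1 = \<bar>core_constant n s lam \<gamma>\<bar>"
 define c2 where "c2 = \<bar>cutoff_constant n\<bar>"
 define eps where "eps = min (1 / (12 * (c1 + 1))) (1 / (96 * (c1 * c2 + 1)))"
 have c: "0 \<le> c1" "0 \<le> c1 * c2" by (simp_all add: c1_def c2_def)
 then have e: "0 < eps" "eps \<le> 1 / (12 * (c1 + 1))" "eps \<le> 1 / (96 * (c1 * c2 + 1))" by (auto simp: eps_def)
 have e1: "c1 * (6 * eps) \<le> 1 / 2" "c1 * c2 * eps \<le> 1 / 96"
 proof -
  have "(c1 + 1) * eps \<le> 1 / 12" "(c1 * c2 + 1) * eps \<le> 1 / 96" using e c by (auto simp: field_simps)
  then show "c1 * (6 * eps) \<le> 1 / 2" "c1 * c2 * eps \<le> 1 / 96" using e(1) by (auto simp: algebra_simps)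
 qed
 have m: "core_constant n s lam \<gamma> \<le> c1" "core_constant n s lam \<gamma> * cutoff_constant n \<le> c1 * c2"
  unfolding c1_def c2_def abs_mult[symmetric] by auto
 define b where "b = bump_constant n s lam"
 have b: "0 < b" using p by (auto simp: b_def bump_constant_def)
 define tau0 where "tau0 = min (1 / 3) (b powr (1 / (2 * s)))"
 have "tau0 powr (2 * s) \<le> (b powr (1 / (2 * s))) powr (2 * s)" using b p by (intro powr_mono2) (auto simp: tau0_def)
 also have "\<dots> = b" using p b by (simp add: powr_powr)
 finally have t: "0 < tau0" "3 * tau0 \<le> 1" "tau0 powr (2 * s) \<le> bump_constant n s lam" using b by (auto simp: tau0_def b_def)
 have "kernel_params n s lam Lam \<sigma>' \<gamma> eps tau0"
 proof
  have "core_constant n s lam \<gamma> * (6 * eps) \<le> c1 * (6 * eps)" using e m by (intro mult_right_mono) auto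
  then show "core_constant n s lam \<gamma> * (6 * eps) \<le> 1 / 2" using e1 by linarith
  have "core_constant n s lam \<gamma> * cutoff_constant n * eps \<le> c1 * c2 * eps" using e m by (intro mult_right_mono) auto
  then show "2 * core_constant n s lam \<gamma> * (6 * cutoff_constant n * eps) \<le> 1 / 8" using e1(2) by (simp add: mult_ac)
 qed (use p \<sigma>' e t in \<open>auto simp: \<gamma>_def field_simps\<close>)
 then show ?thesis using that[of \<sigma>' \<gamma> eps tau0] \<sigma>' by (simp add: \<gamma>_def)
qed

lemma elliptic_kernel_real:
 fixes K :: "real^'n => real^'n => ennreal"
 assumes K: "elliptic_kernel s lam Lam K" and lam: "0 < lam" "lam \<le> Lam" and xy: "x \<noteq> y"
 shows "lam * norm (x - y) powr (- real CARD('n) - 2 * s) \<le> enn2real (K x y)"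
  and "enn2real (K x y) \<le> Lam * norm (x - y) powr (- real CARD('n) - 2 * s)"
proof -
 let ?p = "norm (x - y) powr (- real CARD('n) - 2 * s)"
 have "inverse (norm (x - y) powr (real CARD('n) + 2 * s)) = ?p" by (simp add: powr_minus[symmetric])
 then have "riesz s x y = ennreal ?p" unfolding riesz_def using xy by (subst inverse_ennreal) auto
 moreover have "ennreal lam * riesz s x y \<le> K x y" "K x y \<le> ennreal Lam * riesz s x y"
  using K unfolding elliptic_kernel_def by blast+
 ultimately have b: "ennreal (lam * ?p) \<le> K x y" "K x y \<le> ennreal (Lam * ?p)" using lam by (simp_all add: ennreal_mult)
 then have f: "K x y < \<infinity>" using ennreal_less_top le_less_trans by (metis infinity_ennreal_def)
 show "lam * ?p \<le> enn2real (K x y)" using enn2real_mono[OF b(1)] f lam by simp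
 show "enn2real (K x y) \<le> Lam * ?p" using enn2real_mono[OF b(2)] lam by simp
qed

text \<open>Passes to the regularized kernel and the lowered Hoelder exponent. The same
  \<open>G\<close> still represents the solutions, because the weak equation sees the kernel only up
  to null sets.\<close>

lemma green_setting_of_green_function:
 fixes K G :: "real^'n => real^'n => ennreal" and \<Omega> A :: "(real^'n) set"
 assumes par: "kernel_params (real CARD('n)) s lam Lam \<sigma>' \<gamma> eps tau0" and \<sigma>: "0 < \<sigma>'" "\<sigma>' \<le> \<sigma>"
  and \<Omega>: "open \<Omega>" "\<Omega> \<subseteq> ball 0 R0" "0 < R0" and A: "\<Omega> \<subseteq> A"
  and K: "elliptic_kernel s lam Lam K" "kernel_holder_on s Lam \<sigma> K A" and G: "green_function s K \<Omega> G"
  and cont: "continuous_on {(x, y). x \<in> \<Omega> \<and> y \<in> \<Omega> \<and> x \<noteq> y} (\<lambda>(x, y). G x y)"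
 shows "\<exists>k. green_setting (real CARD('n)) s lam Lam \<sigma>' \<gamma> eps tau0 k \<Omega> R0 G"
proof -
 interpret par: kernel_params "real CARD('n)" s lam Lam \<sigma>' \<gamma> eps tau0 by (rule par)
 have lam: "0 < lam" "lam \<le> Lam" using par.params by auto
 let ?k = "\<lambda>x y. enn2real (K x y)"
 have km: "case_prod ?k \<in> borel_measurable lebesgue"
 proof -
  have "(\<lambda>z. case z of (x, y) => K x y) \<in> borel_measurable lebesgue" using K(1) by (simp add: elliptic_kernel_def)
  then show ?thesis using borel_measurable_enn2real by (simp add: split_beta')
 qed
 have hol: "\<bar>?k (x + h) (y + h) - ?k x y\<bar> \<le> Lam * norm h powr \<sigma>' * norm (x - y) powr (- real CARD('n) - 2 * s)"
  if "x \<in> \<Omega>" "y \<in> \<Omega>" "norm h < 1" "x \<noteq> y" for x y h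
 proof -
  have "\<bar>?k (x + h) (y + h) - ?k x y\<bar> \<le> Lam * norm h powr \<sigma> * norm (x - y) powr (- real CARD('n) - 2 * s)"
   using K(2)[unfolded kernel_holder_on_def, THEN bspec, THEN bspec, THEN bspec, THEN mp, of x y h] that A by auto
  also have "\<dots> \<le> Lam * norm h powr \<sigma>' * norm (x - y) powr (- real CARD('n) - 2 * s)"
   using that \<sigma> lam by (intro mult_right_mono mult_left_mono powr_mono') auto
  finally show ?thesis .
 qed
 obtain k where k: "case_prod k \<in> borel_measurable borel2" "!!x y. k y x = k x y" "!!x. k x x = 0"
  "!!x y. x \<noteq> y ==> lam * norm (x - y) powr (- real CARD('n) - 2 * s) \<le> k x y"
  "!!x y. x \<noteq> y ==> k x y \<le> Lam * norm (x - y) powr (- real CARD('n) - 2 * s)"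
  "!!x y h. x \<in> \<Omega> ==> y \<in> \<Omega> ==> x + h \<in> \<Omega> ==> y + h \<in> \<Omega> ==> norm h < 1 ==> x \<noteq> y ==>
    \<bar>k (x + h) (y + h) - k x y\<bar> \<le> Lam * norm h powr \<sigma>' * norm (x - y) powr (- real CARD('n) - 2 * s)"
  "AE z in lborel2. case_prod k z = case_prod ?k z"
 proof (rule kernel_regularization[OF km _ _ _ lam \<sigma>(1) \<Omega>(1) hol])
  show "?k y x = ?k x y" for x y
  proof -
   have "K x y = K y x" using K(1) unfolding elliptic_kernel_def by blast
   then show ?thesis by simp
  qed
 qed (use elliptic_kernel_real[OF K(1) lam] in auto)
 have hk: "holder_kernel (real CARD('n)) s lam Lam \<sigma>' \<gamma> eps tau0 k \<Omega> R0"
  by (intro holder_kernel.intro par holder_kernel_axioms.intro k \<Omega>) simp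
 then interpret holder_kernel "real CARD('n)" s lam Lam \<sigma>' \<gamma> eps tau0 k \<Omega> R0 .
 have kK: "AE z in lborel2. case_prod k z = enn2real (case_prod K z)" using k(7) by (simp add: split_beta)
 have "green_setting (real CARD('n)) s lam Lam \<sigma>' \<gamma> eps tau0 k \<Omega> R0 G"
 proof (intro green_setting.intro hk green_setting_axioms.intro cont)
  fix y assume y: "y \<in> \<Omega>"
  show "(\<lambda>x. G x y) \<in> borel_measurable (lebesgue_on \<Omega>)" "(\<integral>\<^sup>+x. G x y \<partial>lebesgue_on \<Omega>) < \<infinity>"
   using G y unfolding green_function_def by blast+
  fix B \<psi> u assume \<psi>: "bbd B \<psi>" "!!x. 0 \<le> \<psi> x" and u: "solves B \<psi> u"
  have "\<psi> \<in> borel_measurable (lebesgue_on \<Omega>)"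
   by (intro measurable_restrict_space1 measurable_completion) (use bbd_measurable[OF \<psi>(1)] in simp)
  then have "\<psi> \<in> Linfty_on \<Omega>" unfolding Linfty_on_def using bbd_le[OF \<psi>(1)] by (auto intro!: exI[of _ B])
  moreover have "weak_solution s K \<Omega> \<psi> u"
   by (rule weak_solution_of_regularized[OF k(1) lam(1) k(4,5) kK _ \<Omega>(2) solvesD(1,3,5)[OF u] bbd_measurable[OF \<psi>(1)] solvesD(6)[OF u]])
    (use \<Omega>(1) in simp_all)
  ultimately show "u y = (LINT x:\<Omega>|lebesgue. enn2real (G x y) * \<psi> x)"
   using G[unfolded green_function_def, THEN conjunct2, THEN conjunct2, THEN conjunct2, THEN bspec, THEN spec, THEN mp, THEN mp, THEN bspec]
    solvesD(4)[OF u] y by (metis (no_types, lifting))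
 qed
 then show ?thesis by blast
qed

lemma ball_infdist_subset: "ball x (infdist x (- \<Omega>)) \<subseteq> \<Omega>"
 using infdist_le[of _ "- \<Omega>" x] by (fastforce simp: not_less[symmetric])

theorem corollary1p2:
  fixes s \<alpha> \<sigma> lam Lam :: real and \<Omega> :: "(real^'n) set"
  assumes "1 / 2 < s" and "s < 1" and "2 * s < real CARD('n)"
    and "0 < \<alpha>" and "\<alpha> < s" and "0 < \<sigma>" and "\<sigma> < s"
    and "0 < lam" and "lam \<le> Lam"
    and "bounded \<Omega>" and "C1_holder_domain \<alpha> \<Omega>"
  shows "\<exists>c>0. \<forall>K A G.
    elliptic_kernel s lam Lam K \<longrightarrow>
    closure \<Omega> \<subseteq> interior A \<longrightarrow>
    kernel_holder_on s Lam \<sigma> K A \<longrightarrow>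
    green_function s K \<Omega> G \<longrightarrow>
    continuous_on {(x, y). x \<in> \<Omega> \<and> y \<in> \<Omega> \<and> x \<noteq> y} (\<lambda>(x, y). G x y) \<longrightarrow>
    (\<forall>x\<in>\<Omega>. \<forall>y\<in>\<Omega>. x \<noteq> y \<longrightarrow>
       G x y < \<infinity> \<and>
       (\<exists>D. GDERIV (\<lambda>x'. enn2real (G x' y)) x :> D \<and>
            norm D \<le> c * max (inverse (norm (x - y))) (inverse (infdist x (- \<Omega>)))
                       * enn2real (G x y)))"
proof -
 have op: "open \<Omega>" using assms(11) by (simp add: C1_holder_domain_def)
 obtain R0 where R0: "0 < R0" "\<Omega> \<subseteq> ball 0 R0" using bounded_subset_ballD[OF assms(10), of 0] by blast
 \<comment> \<open>The parameters are fixed before \<open>K\<close>, \<open>A\<close> and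
   \<open>G\<close> are introduced, which makes the constant uniform in them.\<close>
 obtain \<sigma>' \<gamma> eps tau0 where par: "kernel_params (real CARD('n)) s lam Lam \<sigma>' \<gamma> eps tau0" and \<sigma>': "0 < \<sigma>'" "\<sigma>' \<le> \<sigma>" "1 < \<gamma> + \<sigma>'"
  using kernel_params_exist[OF assms(1-3,8,9,6)] by blast
 interpret par: kernel_params "real CARD('n)" s lam Lam \<sigma>' \<gamma> eps tau0 by (rule par)
 let ?C = "gradient_constant (real CARD('n)) s lam Lam \<sigma>' \<gamma> eps tau0"
 define b where "b = min ((eps / Lam) powr (1 / \<sigma>')) (1 / 16)"
 have Lam: "0 < Lam" using assms(8,9) by simp
 have b: "0 < b" "8 * b < 1" using par.eps(1) Lam by (auto simp: b_def)
 have bL: "Lam * R powr \<sigma>' \<le> eps" if "0 < R" "R \<le> b" for R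
 proof -
  have "R powr \<sigma>' \<le> ((eps / Lam) powr (1 / \<sigma>')) powr \<sigma>'" using that \<sigma>' by (intro powr_mono2) (auto simp: b_def)
  also have "\<dots> = eps / Lam" using \<sigma>' par.eps(1) Lam by (simp add: powr_powr)
  finally show ?thesis using Lam by (simp add: field_simps)
 qed
 \<comment> \<open>Distances inside the bounded domain are at most 2 R0, so that the smallness of the admissible scales costs only a constant factor.\<close>
 define \<rho> where "\<rho> = min (1 / 16) (b / (2 * R0))"
 have \<rho>: "0 < \<rho>" "\<rho> \<le> 1 / 16" "\<rho> * (2 * R0) \<le> b"
 proof -
  have "\<rho> * (2 * R0) \<le> b / (2 * R0) * (2 * R0)" using R0(1) by (intro mult_right_mono) (auto simp: \<rho>_def)
  then show "\<rho> * (2 * R0) \<le> b" using R0(1) by simp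
 qed (use b R0(1) in \<open>auto simp: \<rho>_def\<close>)
 define c where "c = (\<bar>?C\<bar> + 1) / \<rho>"
 show ?thesis
 proof (intro exI[of _ c] conjI allI impI ballI)
  show "0 < c" using \<rho>(1) by (simp add: c_def add_nonneg_pos)
  fix K G :: "real^'n \<Rightarrow> real^'n \<Rightarrow> ennreal" and A :: "(real^'n) set" and x y
  assume K: "elliptic_kernel s lam Lam K" and A: "closure \<Omega> \<subseteq> interior A" and hol: "kernel_holder_on s Lam \<sigma> K A"
   and G: "green_function s K \<Omega> G" and cont: "continuous_on {(x, y). x \<in> \<Omega> \<and> y \<in> \<Omega> \<and> x \<noteq> y} (\<lambda>(x, y). G x y)"
   and x: "x \<in> \<Omega>" and y: "y \<in> \<Omega>" and ne: "x \<noteq> y"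
  have "\<Omega> \<subseteq> A" using A closure_subset interior_subset by blast
  from green_setting_of_green_function[OF par \<sigma>'(1,2) op R0(2,1) this K hol G cont]
  obtain k where gs: "green_setting (real CARD('n)) s lam Lam \<sigma>' \<gamma> eps tau0 k \<Omega> R0 G" by blast
  show "G x y < \<infinity>" by (rule green_setting.G_finite[OF gs x y ne])
  define d where "d = infdist x (- \<Omega>)"
  \<comment> \<open>A point of the complement: \<open>infdist\<close> to the empty set would be 0,
    and the positivity of \<open>d\<close> would fail.\<close>
  obtain w :: "real^'n" where w: "norm w = R0" using vector_choose_size[of R0] R0(1) by auto
  have wO: "w \<in> - \<Omega>" using R0(2) w by auto
  have d: "0 < d" unfolding d_def
   using in_closed_iff_infdist_zero[of "- \<Omega>" x] op x wO infdist_nonneg[of x "- \<Omega>"] by (auto simp: less_le)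
  \<comment> \<open>The estimate is applied at scale \<open>\<rho> * m\<close>; the reciprocal of
    \<open>m\<close> is the maximum in the claim.\<close>
  define m where "m = min (norm (x - y)) d"
  have m: "0 < m" "m \<le> norm (x - y)" "m \<le> d" using d ne by (auto simp: m_def)
  have "m \<le> 2 * R0"
  proof -
   have "norm (x - y) \<le> norm x + norm y" by (rule norm_triangle_ineq4)
   also have "\<dots> \<le> R0 + R0" using R0(2) x y by (intro add_mono) (auto simp: subset_eq less_imp_le)
   finally show ?thesis using m by simp
  qed
  then have "\<rho> * m \<le> \<rho> * (2 * R0)" using \<rho>(1) by (intro mult_left_mono) auto
  then have R: "0 < \<rho> * m" "\<rho> * m \<le> b" "\<rho> * m \<le> m / 16"
   using \<rho>(1,3) m mult_right_mono[OF \<rho>(2), of m] by (simp, linarith, simp)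
  have "\<exists>D. GDERIV (\<lambda>x'. enn2real (G x' y)) x :> D \<and>
    norm D \<le> ?C / (\<rho> * m) * enn2real (G x y)"
  proof (rule green_setting.green_gradient[OF gs \<sigma>'(3) y R(1) bL[OF R(1,2)]])
   show "8 * (\<rho> * m) < 1" using R(2) b(2) by linarith
   show "ball x (16 * (\<rho> * m)) \<subseteq> \<Omega>"
    by (rule order_trans[OF subset_ball ball_infdist_subset]) (use R(3) m(3) in \<open>simp add: d_def[symmetric]\<close>)
   show "2 * (\<rho> * m) \<le> dist x y" unfolding dist_norm using R(3) m(1,2) by linarith
  qed
  then obtain D where D: "GDERIV (\<lambda>x'. enn2real (G x' y)) x :> D"
   "norm D \<le> ?C / (\<rho> * m) * enn2real (G x y)" by blast
  have "?C / (\<rho> * m) \<le> (\<bar>?C\<bar> + 1) / (\<rho> * m)"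
   using R(1) by (intro divide_right_mono) auto
  also have "\<dots> = c * inverse m" by (simp add: c_def field_simps)
  also have "inverse m = max (inverse (norm (x - y))) (inverse d)" using d ne by (auto simp: m_def min_def max_def)
  finally have "?C / (\<rho> * m) \<le> c * max (inverse (norm (x - y))) (inverse d)" .
  from mult_right_mono[OF this enn2real_nonneg[of "G x y"]] D(2)
  have "norm D \<le> c * max (inverse (norm (x - y))) (inverse d) * enn2real (G x y)" by (rule order_trans[rotated])
  then show "\<exists>D. GDERIV (\<lambda>x'. enn2real (G x' y)) x :> D \<and>
    norm D \<le> c * max (inverse (norm (x - y))) (inverse (infdist x (- \<Omega>))) * enn2real (G x y)"
   using D(1) unfolding d_def by blast
 qed
qed

end
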